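(* Let $\kappa>0$, $\lambda\ge0$, $\varepsilon>0$. Assume $f_0,f_1\in H^1(0,1)$ and let $(f,v,z)\in\mathcal A(f_0,f_1)$ be a path minimizing the action $$A_{\kappa,\lambda,\varepsilon}(f,v,z)=\frac12\int_0^1\int_0^1\kappa v^2+\lambda v_x^2+\varepsilon v_{xx}^2+z^2\,dx\,dt$$ over $\mathcal A(f_0,f_1)$. Then $f\in L^\infty((0,1),H^1(0,1))$. Quantitatively, with $b:=\exp\big(\sqrt2\,\|v\|_{L^2((0,1),H^2(0,1))}\big)$, for every $t\in[0,1]$, $$\|\partial_x f(\cdot,t)\|_{L^2(0,1)}\le 6\big(\|f_1\|_{H^1}+\|f_0\|_{H^1}\big)\big(1+b^3+b^5\|v\|_{L^2((0,1),H^2(0,1))}\big)$$ and $$\|f(\cdot,t)\|_{L^2(0,1)}\le b\big(\|f_0\|_{L^2}+\sqrt b\,\|f_0-f_1\|_{L^2}\big).$$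
   Context: Let $\mathcal V=L^2((0,1),H^2(0,1)\cap H^1_0(0,1))$ (time in the outer interval, space in the inner one). For $f_0,f_1\in L^2(0,1)$ the set of admissible paths $\mathcal A(f_0,f_1)$ consists of all triples $(f,v,z)$ of functions of $(x,t)\in(0,1)\times(0,1)$ with $f\in L^2((0,1),L^2(0,1))\cap C([0,1],H^{-1}(0,1))$, $v\in\mathcal V$, $z\in L^2((0,1),L^2(0,1))$, $f(\cdot,0)=f_0$, $f(\cdot,1)=f_1$, and $\partial_t f+\partial_x f\cdot v=z$ weakly, i.e. for every $\phi\in C^\infty([0,1]^2)$, $$-\int_0^1\!\!\int_0^1 f\,\partial_t\phi\,dx\,dt+\int_0^1 f_1(x)\phi(x,1)\,dx-\int_0^1 f_0(x)\phi(x,0)\,dx=\int_0^1\!\!\int_0^1 f\phi\,\partial_x v\,dx\,dt+\int_0^1\!\!\int_0^1 f\,\partial_x\phi\, v\,dx\,dt+\int_0^1\!\!\int_0^1\phi z\,dx\,dt.$$ Here $\|u\|_{H^2}^2=\|u\|_{L^2}^2+\|u_x\|_{L^2}^2+\|u_{xx}\|_{L^2}^2$ and $\|u\|_{H^1}^2=\|u\|_{L^2}^2+\|u_x\|_{L^2}^2$. *)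

theory Defs
  imports "HOL-Analysis.Analysis"
begin

text \<open>
  Elements of Lebesgue and Sobolev spaces are represented by Borel functions, every
  almost-everywhere class having a Borel representative. Functions on the square take the
  pair \<open>(x, t)\<close>: space first, time second.
\<close>

definition unit_ivl :: "real measure" where
  "unit_ivl = restrict_space lborel {0<..<1}"

definition unit_sq :: "(real \<times> real) measure" where
  "unit_sq = unit_ivl \<Otimes>\<^sub>M unit_ivl"

definition L2 :: "'a measure \<Rightarrow> ('a \<Rightarrow> real) set" where
  "L2 M = {u \<in> borel_measurable M. integrable M (\<lambda>x. (u x)\<^sup>2)}"

definition L2_norm :: "(real \<Rightarrow> real) \<Rightarrow> real" where
  "L2_norm u = sqrt (\<integral>x. (u x)\<^sup>2 \<partial>unit_ivl)"

text \<open>Coinduction expresses that directional differentiation can be repeated indefinitely.\<close>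

coinductive smooth :: "('a::euclidean_space \<Rightarrow> real) \<Rightarrow> bool" where
  "\<lbrakk>\<forall>x. f differentiable (at x); \<forall>h. smooth (\<lambda>x. frechet_derivative f (at x) h)\<rbrakk>
    \<Longrightarrow> smooth f"

definition test_functions :: "(real \<Rightarrow> real) set" where
  "test_functions = {\<phi>. smooth \<phi> \<and> closure {x. \<phi> x \<noteq> 0} \<subseteq> {0<..<1}}"

definition weak_deriv :: "(real \<Rightarrow> real) \<Rightarrow> (real \<Rightarrow> real) \<Rightarrow> bool" where
  "weak_deriv u g \<longleftrightarrow> u \<in> L2 unit_ivl \<and> g \<in> L2 unit_ivl \<and>
     (\<forall>\<phi>\<in>test_functions.
        (\<integral>x. u x * deriv \<phi> x \<partial>unit_ivl) = - (\<integral>x. g x * \<phi> x \<partial>unit_ivl))"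

definition H1 :: "(real \<Rightarrow> real) set" where
  "H1 = {u. \<exists>g. weak_deriv u g}"

text \<open>The weak derivative; determined up to null sets when \<open>u \<in> H1\<close>, arbitrary otherwise.\<close>

definition wD :: "(real \<Rightarrow> real) \<Rightarrow> real \<Rightarrow> real" where
  "wD u = (SOME g. weak_deriv u g)"

definition H1_norm :: "(real \<Rightarrow> real) \<Rightarrow> real" where
  "H1_norm u = sqrt ((L2_norm u)\<^sup>2 + (L2_norm (wD u))\<^sup>2)"

definition H2 :: "(real \<Rightarrow> real) set" where
  "H2 = {u \<in> H1. wD u \<in> H1}"

definition H10 :: "(real \<Rightarrow> real) set" where
  "H10 = {u \<in> H1. \<forall>\<delta>>0. \<exists>\<phi>\<in>test_functions. H1_norm (\<lambda>x. u x - \<phi> x) < \<delta>}"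

text \<open>
  The dual of \<open>H10\<close>. Only the values of a functional on \<open>H10\<close> matter; boundedness makes it
  insensitive to the choice of representatives.
\<close>

definition Hm1 :: "((real \<Rightarrow> real) \<Rightarrow> real) set" where
  "Hm1 = {L. (\<forall>u\<in>H10. \<forall>w\<in>H10. \<forall>a b. L (\<lambda>x. a * u x + b * w x) = a * L u + b * L w) \<and>
             (\<exists>C. \<forall>u\<in>H10. \<bar>L u\<bar> \<le> C * H1_norm u)}"

definition Hm1_norm :: "((real \<Rightarrow> real) \<Rightarrow> real) \<Rightarrow> real" where
  "Hm1_norm L = (SUP u\<in>{u \<in> H10. H1_norm u \<le> 1}. \<bar>L u\<bar>)"

definition C_Hm1 :: "(real \<Rightarrow> (real \<Rightarrow> real) \<Rightarrow> real) set" where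
  "C_Hm1 = {F. (\<forall>t\<in>{0..1}. F t \<in> Hm1) \<and>
     (\<forall>t\<in>{0..1}. ((\<lambda>s. Hm1_norm (\<lambda>u. F s u - F t u)) \<longlongrightarrow> 0) (at t within {0..1}))}"

text \<open>The functional \<open>L\<close> is the image of \<open>g\<close> under the embedding of \<open>L\<^sup>2(0,1)\<close> into \<open>H\<^sup>-\<^sup>1(0,1)\<close>.\<close>

definition Hm1_eq :: "((real \<Rightarrow> real) \<Rightarrow> real) \<Rightarrow> (real \<Rightarrow> real) \<Rightarrow> bool" where
  "Hm1_eq L g \<longleftrightarrow> (\<forall>u\<in>H10. L u = (\<integral>x. g x * u x \<partial>unit_ivl))"

text \<open>
  As an element of \<open>L\<^sup>2((0,1)\<^sup>2)\<close>, \<open>f\<close> has no values at individual times. That \<open>f\<close> lies in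
  \<open>C([0,1],H\<^sup>-\<^sup>1)\<close> means that it has a (unique) continuous version \<open>F\<close>, and
  \<open>f(\<cdot>,t)\<close> for an individual \<open>t \<in> [0,1]\<close> denotes \<open>F t\<close>.
\<close>

definition Hm1_version :: "(real \<times> real \<Rightarrow> real) \<Rightarrow> (real \<Rightarrow> (real \<Rightarrow> real) \<Rightarrow> real) \<Rightarrow> bool" where
  "Hm1_version f F \<longleftrightarrow> F \<in> C_Hm1 \<and> (AE t in unit_ivl. Hm1_eq (F t) (\<lambda>x. f (x, t)))"

definition has_dx :: "(real \<times> real \<Rightarrow> real) \<Rightarrow> (real \<times> real \<Rightarrow> real) \<Rightarrow> bool" where
  "has_dx u w \<longleftrightarrow> w \<in> L2 unit_sq \<and>
     (AE t in unit_ivl. weak_deriv (\<lambda>x. u (x, t)) (\<lambda>x. w (x, t)))"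

text \<open>
  The spatial weak derivative, chosen jointly measurable and square integrable in \<open>(x, t)\<close>
  (the choice \<open>\<lambda>(x, t). wD (\<lambda>y. u (y, t)) x\<close> need not be measurable).
\<close>

definition dx :: "(real \<times> real \<Rightarrow> real) \<Rightarrow> real \<times> real \<Rightarrow> real" where
  "dx u = (SOME w. has_dx u w)"

text \<open>
  \<open>L\<^sup>2((0,1), H\<^sup>2(0,1) \<inter> H\<^sup>1\<^sub>0(0,1))\<close>. As these spaces are separable, Bochner
  square integrability amounts to \<open>v\<close>, \<open>v\<^sub>x\<close> and \<open>v\<^sub>x\<^sub>x\<close> having representatives in
  \<open>L\<^sup>2((0,1)\<^sup>2)\<close>.
\<close>

definition L2_H2_H10 :: "(real \<times> real \<Rightarrow> real) set" where
  "L2_H2_H10 = {v \<in> L2 unit_sq. (AE t in unit_ivl. (\<lambda>x. v (x, t)) \<in> H2 \<inter> H10) \<and>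
     (\<exists>w. has_dx v w) \<and> (\<exists>w. has_dx (dx v) w)}"

definition L2_H2_norm :: "(real \<times> real \<Rightarrow> real) \<Rightarrow> real" where
  "L2_H2_norm v = sqrt (\<integral>t. \<integral>x. (v (x, t))\<^sup>2 + (dx v (x, t))\<^sup>2 + (dx (dx v) (x, t))\<^sup>2
     \<partial>unit_ivl \<partial>unit_ivl)"

definition Linf_H1 :: "(real \<times> real \<Rightarrow> real) set" where
  "Linf_H1 = {f \<in> L2 unit_sq. (\<exists>w. has_dx f w) \<and>
     (\<exists>C. AE t in unit_ivl. H1_norm (\<lambda>x. f (x, t)) \<le> C)}"

text \<open>
  Test functions in \<open>C\<^sup>\<infinity>([0,1]\<^sup>2)\<close> are taken to be the restrictions of smooth functions
  on the plane.
\<close>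

definition weak_transport ::
  "(real \<Rightarrow> real) \<Rightarrow> (real \<Rightarrow> real) \<Rightarrow> (real \<times> real \<Rightarrow> real) \<Rightarrow> (real \<times> real \<Rightarrow> real) \<Rightarrow>
   (real \<times> real \<Rightarrow> real) \<Rightarrow> bool" where
  "weak_transport f0 f1 f v z \<longleftrightarrow> (\<forall>\<phi>::real \<times> real \<Rightarrow> real. smooth \<phi> \<longrightarrow>
     - (\<integral>t. \<integral>x. f (x, t) * deriv (\<lambda>s. \<phi> (x, s)) t \<partial>unit_ivl \<partial>unit_ivl)
     + (\<integral>x. f1 x * \<phi> (x, 1) \<partial>unit_ivl) - (\<integral>x. f0 x * \<phi> (x, 0) \<partial>unit_ivl)
     = (\<integral>t. \<integral>x. f (x, t) * \<phi> (x, t) * dx v (x, t) \<partial>unit_ivl \<partial>unit_ivl)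
     + (\<integral>t. \<integral>x. f (x, t) * deriv (\<lambda>y. \<phi> (y, t)) x * v (x, t) \<partial>unit_ivl \<partial>unit_ivl)
     + (\<integral>t. \<integral>x. \<phi> (x, t) * z (x, t) \<partial>unit_ivl \<partial>unit_ivl))"

definition admissible ::
  "(real \<Rightarrow> real) \<Rightarrow> (real \<Rightarrow> real) \<Rightarrow>
   ((real \<times> real \<Rightarrow> real) \<times> (real \<times> real \<Rightarrow> real) \<times> (real \<times> real \<Rightarrow> real)) set" where
  "admissible f0 f1 = {(f, v, z).
     f \<in> L2 unit_sq \<and> v \<in> L2_H2_H10 \<and> z \<in> L2 unit_sq \<and>
     (\<exists>F. Hm1_version f F \<and> Hm1_eq (F 0) f0 \<and> Hm1_eq (F 1) f1) \<and>
     weak_transport f0 f1 f v z}"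

fun action ::
  "real \<Rightarrow> real \<Rightarrow> real \<Rightarrow>
   (real \<times> real \<Rightarrow> real) \<times> (real \<times> real \<Rightarrow> real) \<times> (real \<times> real \<Rightarrow> real) \<Rightarrow> real" where
  "action \<kappa> l \<epsilon> (f, v, z) = 1/2 * (\<integral>t. \<integral>x.
      \<kappa> * (v (x, t))\<^sup>2 + l * (dx v (x, t))\<^sup>2 + \<epsilon> * (dx (dx v) (x, t))\<^sup>2 + (z (x, t))\<^sup>2
      \<partial>unit_ivl \<partial>unit_ivl)"

end

theory Submission
  imports Defs
begin

text \<open>
  For almost every \<open>t\<close> the velocity is Lipschitz in \<open>x\<close> with the square integrable constant
  \<open>l(t) = \<parallel>v\<^sub>x\<^sub>x(\<cdot>,t)\<parallel>\<close> and vanishes at both ends, so it has a flow \<open>\<phi>\<close> of the unit interval with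
  Jacobian \<open>J\<close> between \<open>1/\<beta>\<close> and \<open>\<beta> = exp (\<integral> l)\<close>. Testing with smoothed indicators of the region
  to the left of a trajectory shows that weak solutions satisfy
  \<open>f(\<phi>(x,t),t) = f\<^sub>0(x) + \<integral>\<^sub>0\<^sup>t z(\<phi>(x,s),s) ds\<close>. For fixed \<open>v\<close> the source only has to bring the
  integral along each trajectory to \<open>D(x) = f\<^sub>1(\<phi>(x,1)) - f\<^sub>0(x)\<close>; the unique cheapest choice is
  \<open>z(\<phi>(x,t),t) = D(x) / (W(x,1) J(x,t))\<close> with \<open>W(x,t) = \<integral>\<^sub>0\<^sup>t 1/J(x,s) ds\<close>. Hence a minimizer is
  \<open>f(\<phi>(x,t),t) = f\<^sub>0(x) + D(x) W(x,t) / W(x,1)\<close>, which is continuous and can be differentiated in \<open>x\<close>,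
  the logarithmic derivative of \<open>J\<close> being the integral of \<open>v\<^sub>x\<^sub>x J\<close> along the trajectory. The bound on
  \<open>f\<close> itself uses \<open>\<parallel>z\<parallel> \<le> \<parallel>f\<^sub>0 - f\<^sub>1\<parallel>\<close>, from comparison with the path having \<open>v = 0\<close>.
\<close>

text \<open>Two kinds of roughness shape the argument. In time, \<open>v\<close> is only square
  integrable: trajectories are absolutely continuous, not smooth, and a smooth cutoff cannot follow
  one exactly. The cutoffs therefore follow polynomial curves whose velocities approximate that of
  the trajectory in L^2; the error pairs this difference with \<open>f\<close>, which is in L^2 too.
  In space, the second derivative of \<open>v\<close> is only L^2: \<open>J\<close> has no classical
  x-derivative, and every derivative of a Jacobian is stated through its integral. Sharpening the
  cutoff is harmless although its slope grows like k: it acts only at distance 1/k from the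
  trajectory, where the Lipschitz bound makes the velocity relative to the trajectory of order l/k.
  As for the constants, log \<open>J\<close> varies by at most the integral of \<open>l\<close>
  along a trajectory, so two Jacobians on the same trajectory differ by a factor at most
  \<open>\<beta>\<close>, whatever the two times. Each estimate compares Jacobians only once and so
  costs a single \<open>\<beta>\<close> for squared norms. By Cauchy-Schwarz the integral of
  \<open>l\<close> is at most the norm of \<open>v\<close>, whence
  \<open>\<beta> \<le> b\<close>.\<close>

subsection \<open>Integration over the unit interval\<close>

lemma space_unit_ivl [simp]: "space unit_ivl = {0<..<1}"
  by (simp add: unit_ivl_def)

lemma borel_measurable_unit_ivl [measurable (raw)]:
  "f \<in> measurable borel N \<Longrightarrow> f \<in> measurable unit_ivl N"
  unfolding unit_ivl_def by (rule measurable_restrict_space1) simp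

lemma borel_measurable_unit_sq:
  assumes "f \<in> borel_measurable borel"
  shows "f \<in> borel_measurable (unit_ivl \<Otimes>\<^sub>M unit_ivl)"
proof -
  have "(\<lambda>p. (fst p, snd p)) \<in> measurable (unit_ivl \<Otimes>\<^sub>M unit_ivl) (borel \<Otimes>\<^sub>M borel)"
    by (intro measurable_Pair measurable_compose[OF measurable_snd] measurable_compose[OF measurable_fst]
      borel_measurable_unit_ivl) auto
  from measurable_compose[OF this, of f borel] assms show ?thesis
    by (simp add: borel_prod)
qed

lemma borel_measurable_snd_unit_ivl [measurable (raw)]:
  "f \<in> measurable N (M \<Otimes>\<^sub>M unit_ivl) \<Longrightarrow> (\<lambda>x. snd (f x)) \<in> borel_measurable N"
proof -
  assume f: "f \<in> measurable N (M \<Otimes>\<^sub>M unit_ivl)"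
  have "(\<lambda>x. x) \<in> borel_measurable unit_ivl" by (rule borel_measurable_unit_ivl) simp
  from measurable_compose[OF measurable_compose[OF f measurable_snd] this] show ?thesis .
qed

lemma prob_space_unit_ivl: "emeasure unit_ivl (space unit_ivl) = 1"
  by (simp add: unit_ivl_def emeasure_restrict_space)

interpretation unit_ivl: finite_measure unit_ivl
  by standard (simp add: prob_space_unit_ivl del: space_unit_ivl)

interpretation unit_sq: pair_sigma_finite unit_ivl unit_ivl ..

interpretation unit_sq: finite_measure "unit_ivl \<Otimes>\<^sub>M unit_ivl"
  by (intro finite_measure_pair_measure) unfold_locales

lemma measure_unit_ivl [simp]: "measure unit_ivl {0<..<1} = 1"
  using prob_space_unit_ivl by (simp add: measure_def)

lemma integral_unit_ivl: "(\<integral>x. f x \<partial>unit_ivl) = (LINT x:{0<..<1}|lborel. f x)" for f :: "real \<Rightarrow> real"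
  unfolding unit_ivl_def by (simp add: integral_restrict_space set_lebesgue_integral_def)

lemma integrable_unit_ivl: "integrable unit_ivl f \<longleftrightarrow> set_integrable lborel {0<..<1} f" for f :: "real \<Rightarrow> real"
  unfolding unit_ivl_def by (simp add: integrable_restrict_space set_integrable_def)

lemma AE_unit_ivl: "(AE x in unit_ivl. P x) \<longleftrightarrow> (AE x in lborel. 0 < x \<and> x < 1 \<longrightarrow> P x)"
  unfolding unit_ivl_def by (subst AE_restrict_space_iff) auto

lemma AE_unit_ivlI: "(\<And>x. 0 < x \<Longrightarrow> x < 1 \<Longrightarrow> P x) \<Longrightarrow> AE x in unit_ivl. P x"
  by (simp add: AE_unit_ivl)

lemma AE_unit_ivl_neq: "AE x in unit_ivl. x \<noteq> (c::real)"
  unfolding AE_unit_ivl by (rule AE_mp[OF AE_lborel_singleton[of c]]) auto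

lemma AE_unit_ivl_interior: "AE x in unit_ivl. 0 < x \<and> x < 1"
  by (rule AE_unit_ivlI) auto

text \<open>A nondegenerate interval has positive measure. By this device almost-everywhere
  identities between continuous functions become pointwise ones.\<close>

lemma AE_unit_ivl_dense:
  assumes "AE x in unit_ivl. P x" "a < b" "0 \<le> a" "b \<le> 1"
  obtains x where "a < x" "x < b" "P x"
proof -
  have "\<exists>x\<in>{a<..<b}. P x"
  proof (rule ccontr)
    assume *: "\<not> (\<exists>x\<in>{a<..<b}. P x)"
    have "AE x in lborel. x \<notin> {a<..<b}"
      using assms(1) unfolding AE_unit_ivl by eventually_elim (use * assms in auto)
    then have "emeasure lborel {a<..<b} = 0"
      by (subst (asm) AE_iff_measurable[OF _ refl]) (auto simp: greaterThanLessThan_def greaterThan_def lessThan_def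
         Collect_conj_eq[symmetric] Int_def)
    with \<open>a < b\<close> show False by simp
  qed
  then show ?thesis using that by auto
qed

lemma borel_measurable_integral_unit_ivl [measurable (raw)]:
  fixes f :: "'a \<Rightarrow> real \<Rightarrow> real"
  shows "(\<lambda>p. f (fst p) (snd p)) \<in> borel_measurable (M \<Otimes>\<^sub>M unit_ivl) \<Longrightarrow>
    (\<lambda>x. \<integral>y. f x y \<partial>unit_ivl) \<in> borel_measurable M"
  by (intro unit_ivl.borel_measurable_lebesgue_integral) (simp add: case_prod_beta')

lemma integrable_bounded_unit_ivl:
  fixes f :: "real \<Rightarrow> real"
  assumes "f \<in> borel_measurable unit_ivl" "\<And>x. 0 < x \<Longrightarrow> x < 1 \<Longrightarrow> \<bar>f x\<bar> \<le> B"
  shows "integrable unit_ivl f"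
  by (rule unit_ivl.integrable_const_bound[where B = B]) (use assms in \<open>auto intro!: AE_unit_ivlI\<close>)

lemma integrable_continuous_unit_ivl:
  fixes f :: "real \<Rightarrow> real"
  assumes "continuous_on {0..1} f"
  shows "integrable unit_ivl f"
  unfolding integrable_unit_ivl
  by (rule set_integrable_subset[OF borel_integrable_compact[OF compact_Icc assms, folded set_integrable_def]])
    auto

lemma integral_mono_unit_ivl:
  fixes f g :: "real \<Rightarrow> real"
  assumes "integrable unit_ivl f" "integrable unit_ivl g" "\<And>x. 0 < x \<Longrightarrow> x < 1 \<Longrightarrow> f x \<le> g x"
  shows "(\<integral>x. f x \<partial>unit_ivl) \<le> (\<integral>x. g x \<partial>unit_ivl)"
  by (rule integral_mono) (use assms in auto)

lemma integral_cong_unit_ivl: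
  fixes f g :: "real \<Rightarrow> real"
  assumes "\<And>x. 0 < x \<Longrightarrow> x < 1 \<Longrightarrow> f x = g x"
  shows "(\<integral>x. f x \<partial>unit_ivl) = (\<integral>x. g x \<partial>unit_ivl)"
  by (rule Bochner_Integration.integral_cong) (use assms in auto)

subsection \<open>The Cauchy-Schwarz inequality\<close>

lemma integrable_mult_L2:
  fixes f g :: "'a \<Rightarrow> real"
  assumes [measurable]: "f \<in> borel_measurable M" "g \<in> borel_measurable M"
    and "integrable M (\<lambda>x. (f x)\<^sup>2)" "integrable M (\<lambda>x. (g x)\<^sup>2)"
  shows "integrable M (\<lambda>x. f x * g x)"
proof (rule Bochner_Integration.integrable_bound)
  show "integrable M (\<lambda>x. (f x)\<^sup>2 + (g x)\<^sup>2)" using assms by auto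
  show "AE x in M. norm (f x * g x) \<le> norm ((f x)\<^sup>2 + (g x)\<^sup>2)"
  proof (rule AE_I2)
    fix x
    have "0 \<le> (\<bar>f x\<bar> - \<bar>g x\<bar>)\<^sup>2 " by simp
    then have "2 * (\<bar>f x\<bar> * \<bar>g x\<bar>) \<le> (f x)\<^sup>2 + (g x)\<^sup>2"
      by (simp add: power2_diff)
    moreover have "0 \<le> \<bar>f x\<bar> * \<bar>g x\<bar>" by simp
    ultimately have "\<bar>f x\<bar> * \<bar>g x\<bar> \<le> (f x)\<^sup>2 + (g x)\<^sup>2" by linarith
    then show "norm (f x * g x) \<le> norm ((f x)\<^sup>2 + (g x)\<^sup>2)"
      by (simp add: abs_mult)
  qed
qed auto

lemma Cauchy_Schwarz_integral:
  fixes f g :: "'a \<Rightarrow> real"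
  assumes [measurable]: "f \<in> borel_measurable M" "g \<in> borel_measurable M"
    and f: "integrable M (\<lambda>x. (f x)\<^sup>2)" and g: "integrable M (\<lambda>x. (g x)\<^sup>2)"
  shows "(\<integral>x. f x * g x \<partial>M)\<^sup>2 \<le> (\<integral>x. (f x)\<^sup>2 \<partial>M) * (\<integral>x. (g x)\<^sup>2 \<partial>M)"
proof -
  define A B C where "A = (\<integral>x. (f x)\<^sup>2 \<partial>M)" and "B = (\<integral>x. f x * g x \<partial>M)" and "C = (\<integral>x. (g x)\<^sup>2 \<partial>M)"
  have fg: "integrable M (\<lambda>x. f x * g x)" by (rule integrable_mult_L2) (use f g in auto)
  have A: "0 \<le> A" and C: "0 \<le> C" unfolding A_def C_def by auto
  \<comment> \<open>The integral of \<open>(f - s * g)\<^sup>2\<close> as a quadratic in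
    \<open>s\<close>; the two cases below evaluate it at a suitable \<open>s\<close>.\<close>
  have q: "0 \<le> A - 2 * s * B + s\<^sup>2 * C" for s
  proof -
    have "0 \<le> (\<integral>x. (f x - s * g x)\<^sup>2 \<partial>M)" by simp
    also have "\<dots> = (\<integral>x. (f x)\<^sup>2 - 2 * s * (f x * g x) + s\<^sup>2 * (g x)\<^sup>2 \<partial>M)"
      by (rule Bochner_Integration.integral_cong) (auto simp: power2_diff power_mult_distrib algebra_simps)
    also have "\<dots> = A - 2 * s * B + s\<^sup>2 * C" unfolding A_def B_def C_def
      using f g fg by (subst Bochner_Integration.integral_add Bochner_Integration.integral_diff; simp)+
    finally show ?thesis .
  qed
  show ?thesis
  proof (cases "C = 0")
    case True
    have "B = 0"
    proof (rule ccontr)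
      assume "B \<noteq> 0"
      \<comment> \<open>For \<open>C = 0\<close> the quadratic is affine, and this \<open>s\<close>
        gives it the value -1.\<close>
      then show False using q[of "(A + 1) / (2 * B)"] True by (simp add: field_simps)
    qed
    then show ?thesis using A C by (simp add: A_def[symmetric] B_def[symmetric] C_def[symmetric])
  next
    case False
    then have "C > 0" using C by simp
    \<comment> \<open>\<open>B / C\<close> minimizes the quadratic.\<close>
    then have "0 \<le> (A - 2 * (B / C) * B + (B/C)\<^sup>2 * C) * C" using q[of "B / C"] by simp
    also have "\<dots> = A * C - B\<^sup>2" using False by (simp add: field_simps power2_eq_square)
    finally show ?thesis by (simp add: A_def[symmetric] B_def[symmetric] C_def[symmetric])
  qed
qed

lemma Cauchy_Schwarz_abs_integral:
  fixes f g :: "'a \<Rightarrow> real"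
  assumes [measurable]: "f \<in> borel_measurable M" "g \<in> borel_measurable M"
    and f: "integrable M (\<lambda>x. (f x)\<^sup>2)" and g: "integrable M (\<lambda>x. (g x)\<^sup>2)"
  shows "(\<integral>x. \<bar>f x * g x\<bar> \<partial>M) \<le> sqrt (\<integral>x. (f x)\<^sup>2 \<partial>M) * sqrt (\<integral>x. (g x)\<^sup>2 \<partial>M)"
  using Cauchy_Schwarz_integral[of "\<lambda>x. \<bar>f x\<bar>" M "\<lambda>x. \<bar>g x\<bar>"] f g
  by (simp add: abs_mult real_sqrt_mult[symmetric] real_le_rsqrt)

lemma L2_norm_nonneg [simp]: "0 \<le> L2_norm u"
  unfolding L2_norm_def by simp

lemma L2_norm_power2: "(L2_norm u)\<^sup>2 = (\<integral>x. (u x)\<^sup>2 \<partial>unit_ivl)"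
  unfolding L2_norm_def by simp

lemma L2_unit_ivlD:
  assumes "u \<in> L2 unit_ivl"
  shows "u \<in> borel_measurable unit_ivl" "integrable unit_ivl (\<lambda>x. (u x)\<^sup>2)" "integrable unit_ivl u"
    "(\<integral>x. \<bar>u x\<bar> \<partial>unit_ivl) \<le> L2_norm u"
proof -
  show m [measurable]: "u \<in> borel_measurable unit_ivl" and i: "integrable unit_ivl (\<lambda>x. (u x)\<^sup>2)"
    using assms unfolding L2_def by auto
  show "integrable unit_ivl u"
    using integrable_mult_L2[of u unit_ivl "\<lambda>_. 1"] m i by simp
  show "(\<integral>x. \<bar>u x\<bar> \<partial>unit_ivl) \<le> L2_norm u"
    using Cauchy_Schwarz_abs_integral[of u unit_ivl "\<lambda>_. 1"] m i by (simp add: L2_norm_def)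
qed

lemma L2_norm_cong_AE:
  assumes "AE x in unit_ivl. u x = v x" "u \<in> borel_measurable unit_ivl" "v \<in> borel_measurable unit_ivl"
  shows "L2_norm u = L2_norm v"
  unfolding L2_norm_def
  by (rule arg_cong[where f = sqrt], rule integral_cong_AE)
    (use assms in \<open>auto elim!: eventually_mono\<close>)

subsection \<open>Primitives\<close>

text \<open>The primitive from 0, written with an indicator instead of a variable domain: it is then
  defined for all real \<open>x\<close>, constant to the left of 0 and to the right of 1, and
  dominated convergence and Fubini apply to it directly.\<close>

definition pint :: "(real \<Rightarrow> real) \<Rightarrow> real \<Rightarrow> real" where
  "pint g x = (\<integral>y. indicator {..x} y * g y \<partial>unit_ivl)"

lemma integrable_pint: "integrable unit_ivl g \<Longrightarrow> integrable unit_ivl (\<lambda>y. indicator {..x} y * g y :: real)"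
  by (rule Bochner_Integration.integrable_bound[of _ g])
    (auto simp: indicator_def intro!: borel_measurable_times)

lemma integrable_indicator_unit_ivl:
  assumes "A \<in> sets borel" "integrable unit_ivl g"
  shows "integrable unit_ivl (\<lambda>y. indicator A y * g y :: real)"
  by (rule Bochner_Integration.integrable_bound[of _ g])
    (use assms in \<open>auto simp: indicator_def intro!: borel_measurable_times\<close>)

lemma pint_le_0 [simp]: "x \<le> 0 \<Longrightarrow> pint g x = 0"
  unfolding pint_def by (subst integral_cong_unit_ivl[where g = "\<lambda>_. 0"]) auto

lemma pint_ge_1: "1 \<le> x \<Longrightarrow> pint g x = (\<integral>y. g y \<partial>unit_ivl)"
  unfolding pint_def by (subst integral_cong_unit_ivl[where g = g]) auto

lemma pint_add: "integrable unit_ivl g \<Longrightarrow> integrable unit_ivl h \<Longrightarrow> pint (\<lambda>y. g y + h y) x = pint g x + pint h x"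
  unfolding pint_def by (simp add: distrib_left integrable_pint)

lemma pint_diff: "integrable unit_ivl g \<Longrightarrow> integrable unit_ivl h \<Longrightarrow> pint (\<lambda>y. g y - h y) x = pint g x - pint h x"
  unfolding pint_def by (simp add: right_diff_distrib integrable_pint)

lemma pint_cmult: "pint (\<lambda>y. c * g y) x = c * pint g x"
  unfolding pint_def by (simp add: mult.left_commute)

lemma pint_cong: "(\<And>y. 0 < y \<Longrightarrow> y < 1 \<Longrightarrow> y \<le> x \<Longrightarrow> g y = h y) \<Longrightarrow> pint g x = pint h x"
  unfolding pint_def by (rule integral_cong_unit_ivl) (auto simp: indicator_def)

lemma pint_cong_AE:
  assumes "AE y in unit_ivl. g y = h y" "g \<in> borel_measurable unit_ivl" "h \<in> borel_measurable unit_ivl"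
  shows "pint g x = pint h x"
  unfolding pint_def by (rule integral_cong_AE) (use assms in \<open>auto elim!: eventually_mono\<close>)

lemma pint_diff_points:
  assumes g: "integrable unit_ivl g" and "x \<le> y"
  shows "pint g y - pint g x = (\<integral>s. indicator {x<..y} s * g s \<partial>unit_ivl)"
  unfolding pint_def Bochner_Integration.integral_diff[OF integrable_pint[OF g] integrable_pint[OF g], symmetric]
  by (rule Bochner_Integration.integral_cong) (use \<open>x \<le> y\<close> in \<open>auto simp: indicator_def\<close>)

lemma abs_pint_diff_le:
  assumes h: "integrable unit_ivl h" and g: "integrable unit_ivl g" and "x \<le> y"
    "\<And>s. 0 < s \<Longrightarrow> s < 1 \<Longrightarrow> x < s \<Longrightarrow> s \<le> y \<Longrightarrow> \<bar>g s\<bar> \<le> h s"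
  shows "\<bar>pint g y - pint g x\<bar> \<le> pint h y - pint h x"
proof -
  have "\<bar>pint g y - pint g x\<bar> \<le> (\<integral>s. \<bar>indicator {x<..y} s * g s\<bar> \<partial>unit_ivl)"
    unfolding pint_diff_points[OF g \<open>x \<le> y\<close>] by (rule integral_abs_bound)
  also have "\<dots> \<le> (\<integral>s. indicator {x<..y} s * h s \<partial>unit_ivl)"
  proof (rule integral_mono_unit_ivl)
    show "integrable unit_ivl (\<lambda>s. \<bar>indicator {x<..y} s * g s\<bar>)"
      by (rule integrable_abs, rule integrable_indicator_unit_ivl[OF _ g]) simp
    show "integrable unit_ivl (\<lambda>s. indicator {x<..y} s * h s)"
      by (rule integrable_indicator_unit_ivl[OF _ h]) simp
  qed (use assms in \<open>auto simp: indicator_def\<close>)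
  also have "\<dots> = pint h y - pint h x" using pint_diff_points[OF h \<open>x \<le> y\<close>] by simp
  finally show ?thesis .
qed

lemma pint_mono:
  assumes "integrable unit_ivl h" "\<And>s. 0 < s \<Longrightarrow> s < 1 \<Longrightarrow> 0 \<le> h s" "x \<le> y"
  shows "pint h x \<le> pint h y"
  unfolding pint_def
  by (rule integral_mono_unit_ivl) (use assms in \<open>auto simp: integrable_pint, auto simp: indicator_def\<close>)

lemma abs_pint_le:
  assumes "integrable unit_ivl g"
  shows "\<bar>pint g x\<bar> \<le> (\<integral>y. \<bar>g y\<bar> \<partial>unit_ivl)"
proof -
  have "\<bar>pint g x\<bar> \<le> (\<integral>y. \<bar>indicator {..x} y * g y\<bar> \<partial>unit_ivl)"
    unfolding pint_def by simp
  also have "\<dots> \<le> (\<integral>y. \<bar>g y\<bar> \<partial>unit_ivl)"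
    by (rule integral_mono_unit_ivl) (use assms in \<open>auto simp: integrable_pint, auto simp: indicator_def\<close>)
  finally show ?thesis .
qed

text \<open>The indicator of \<open>{..t}\<close> is continuous in \<open>t\<close> off the null set \<open>s = t\<close>.\<close>

lemma continuous_pint_param:
  fixes G :: "'a::metric_space \<Rightarrow> real \<Rightarrow> real"
  assumes l: "integrable unit_ivl l"
    and m: "\<And>x. x \<in> S \<Longrightarrow> G x \<in> borel_measurable unit_ivl"
    and b: "\<And>x s. x \<in> S \<Longrightarrow> 0 < s \<Longrightarrow> s < 1 \<Longrightarrow> \<bar>G x s\<bar> \<le> l s"
    and c: "\<And>s. 0 < s \<Longrightarrow> s < 1 \<Longrightarrow> continuous_on S (\<lambda>x. G x s)"
  shows "continuous_on (S \<times> UNIV) (\<lambda>(x, t). pint (G x) t)"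
  unfolding continuous_on_sequentially
proof safe
  fix a t and u :: "nat \<Rightarrow> 'a \<times> real"
  assume aS: "a \<in> S" and u: "\<forall>n. u n \<in> S \<times> UNIV" "u \<longlonglongrightarrow> (a, t)"
  have uS: "fst (u n) \<in> S" for n using u(1) by (auto simp: mem_Times_iff)
  have u1: "(\<lambda>n. fst (u n)) \<longlonglongrightarrow> a" and u2: "(\<lambda>n. snd (u n)) \<longlonglongrightarrow> t"
    using tendsto_fst[OF u(2)] tendsto_snd[OF u(2)] by auto
  have "(\<lambda>n. \<integral>y. indicator {..snd (u n)} y * G (fst (u n)) y \<partial>unit_ivl)
      \<longlonglongrightarrow> (\<integral>y. indicator {..t} y * G a y \<partial>unit_ivl)"
  proof (rule integral_dominated_convergence[where w = l])
    show "AE x in unit_ivl. (\<lambda>n. indicator {..snd (u n)} x * G (fst (u n)) x) \<longlonglongrightarrow> indicator {..t} x * G a x"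
      using AE_unit_ivl_neq[of t] AE_unit_ivl_interior
    proof eventually_elim
      case (elim s)
      have "(\<lambda>n. G (fst (u n)) s) \<longlonglongrightarrow> G a s"
        using c[of s] elim uS u1 aS unfolding continuous_on_sequentially by (auto simp: o_def)
      moreover have "(\<lambda>n. indicator {..snd (u n)} s :: real) \<longlonglongrightarrow> indicator {..t} s"
      proof (rule tendsto_eventually)
        show "\<forall>\<^sub>F n in sequentially. indicator {..snd (u n)} s = (indicator {..t} s :: real)"
        proof (cases "s < t")
          case True
          with order_tendstoD(1)[OF u2 True] show ?thesis by (auto elim!: eventually_mono simp: indicator_def)
        next
          case False
          with elim have "t < s" by simp
          from order_tendstoD(2)[OF u2 this] show ?thesis using \<open>t < s\<close> 
            by (auto elim!: eventually_mono simp: indicator_def)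
        qed
      qed
      ultimately show ?case by (rule tendsto_mult[rotated])
    qed
    show "AE x in unit_ivl. norm (indicator {..snd (u n)} x * G (fst (u n)) x) \<le> l x" for n
    proof (rule AE_unit_ivlI)
      fix s :: real assume "0 < s" "s < 1"
      from b[OF uS this, of n] show "norm (indicator {..snd (u n)} s * G (fst (u n)) s) \<le> l s"
        by (auto simp: indicator_def)
    qed
  qed (use l m aS uS in auto)
  then show "((\<lambda>(x, t). pint (G x) t) \<circ> u) \<longlonglongrightarrow> pint (G a) t"
    unfolding pint_def by (simp add: o_def case_prod_beta')
qed

lemma continuous_on_pint:
  assumes "integrable unit_ivl g"
  shows "continuous_on S (pint g)"
proof -
  have "continuous_on (UNIV \<times> UNIV) (\<lambda>(x::real, t). pint (\<lambda>s. g s) t)"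
    by (rule continuous_pint_param[where l = "\<lambda>s. \<bar>g s\<bar>"]) (use assms in auto)
  then have "continuous_on S ((\<lambda>(x::real, t). pint (\<lambda>s. g s) t) \<circ> (\<lambda>t. (0, t)))"
    by (intro continuous_on_compose) (auto intro!: continuous_intros elim: continuous_on_subset)
  then show ?thesis by (simp add: o_def)
qed

lemma borel_measurable_pint_param [measurable (raw)]:
  fixes f :: "'a \<Rightarrow> real \<Rightarrow> real"
  assumes [measurable]: "(\<lambda>p. f (fst p) (snd p)) \<in> borel_measurable (M \<Otimes>\<^sub>M unit_ivl)" "c \<in> borel_measurable M"
  shows "(\<lambda>x. pint (f x) (c x)) \<in> borel_measurable M"
proof -
  have "(\<lambda>p. indicator {..c (fst p)} (snd p) * f (fst p) (snd p)) = 
    (\<lambda>p. (if snd p \<le> c (fst p) then f (fst p) (snd p) else 0))"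
    by (auto simp: indicator_def)
  then show ?thesis unfolding pint_def
    by (intro borel_measurable_integral_unit_ivl) simp
qed

subsection \<open>Absolutely continuous functions\<close>

text \<open>Absolute continuity on [0,1] in integrated form. Carrying the density as a second
  argument avoids statements about classical derivatives at almost every point; the calculus rules
  below are rules for pairs of a function and a density.\<close>

definition ac :: "(real \<Rightarrow> real) \<Rightarrow> (real \<Rightarrow> real) \<Rightarrow> bool" where
  "ac u g \<longleftrightarrow> integrable unit_ivl g \<and> (\<forall>x\<in>{0..1}. u x = u 0 + pint g x)"

lemma acD: "ac u g \<Longrightarrow> integrable unit_ivl g" "ac u g \<Longrightarrow> 0 \<le> x \<Longrightarrow> x \<le> 1 \<Longrightarrow> u x = u 0 + pint g x"
  unfolding ac_def by simp (meson atLeastAtMost_iff)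

lemma acI: "integrable unit_ivl g \<Longrightarrow> (\<And>x. 0 \<le> x \<Longrightarrow> x \<le> 1 \<Longrightarrow> u x = c + pint g x) \<Longrightarrow> ac u g"
  unfolding ac_def by auto

lemma ac_continuous_on: "ac u g \<Longrightarrow> continuous_on {0..1} u"
proof (rule continuous_on_eq[of _ "\<lambda>x. u 0 + pint g x"])
  assume u: "ac u g"
  then show "continuous_on {0..1} (\<lambda>x. u 0 + pint g x)"
    by (intro continuous_intros continuous_on_pint acD(1))
  show "u 0 + pint g x = u x" if "x \<in> {0..1}" for x
    using acD(2)[OF u, of x] that by auto
qed

lemma ac_borel_measurable: "ac u g \<Longrightarrow> u \<in> borel_measurable unit_ivl"
  using ac_continuous_on[THEN integrable_continuous_unit_ivl] by auto

lemma ac_const: "ac (\<lambda>_. c) (\<lambda>_. 0)"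
  by (rule acI[of _ _ c]) (auto simp: pint_def)

lemma ac_add:
  assumes "ac u g" "ac v h"
  shows "ac (\<lambda>x. u x + v x) (\<lambda>x. g x + h x)"
proof (rule acI[of _ _ "u 0 + v 0"])
  show "u x + v x = u 0 + v 0 + pint (\<lambda>x. g x + h x) x" if "0 \<le> x" "x \<le> 1" for x
    unfolding pint_add[OF acD(1)[OF assms(1)] acD(1)[OF assms(2)]]
    using acD(2)[OF assms(1) that] acD(2)[OF assms(2) that] by linarith
qed (use assms in \<open>simp add: acD(1)\<close>)

lemma ac_cmult:
  assumes "ac u g"
  shows "ac (\<lambda>x. c * u x) (\<lambda>x. c * g x)"
proof (rule acI[of _ _ "c * u 0"])
  show "c * u x = c * u 0 + pint (\<lambda>x. c * g x) x" if "0 \<le> x" "x \<le> 1" for x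
    unfolding pint_cmult distrib_left[symmetric] using acD(2)[OF assms that] by (rule arg_cong)
qed (use assms in \<open>simp add: acD(1)\<close>)

lemma ac_diff: "ac u g \<Longrightarrow> ac v h \<Longrightarrow> ac (\<lambda>x. u x - v x) (\<lambda>x. g x - h x)"
  using ac_add[of u g "\<lambda>x. - 1 * v x" "\<lambda>x. - 1 * h x"] ac_cmult[of v h "-1"] by simp

lemma ac_pint: "integrable unit_ivl g \<Longrightarrow> ac (pint g) g"
  by (rule acI[of _ _ 0]) auto

lemma ac_cong: "ac u g \<Longrightarrow> (\<And>x. 0 \<le> x \<Longrightarrow> x \<le> 1 \<Longrightarrow> u x = u' x) \<Longrightarrow>
  (\<And>x. 0 < x \<Longrightarrow> x < 1 \<Longrightarrow> g x = g' x) \<Longrightarrow> ac u' g'"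
proof (rule acI[of _ _ "u 0"])
  assume *: "ac u g" "\<And>x. 0 \<le> x \<Longrightarrow> x \<le> 1 \<Longrightarrow> u x = u' x" "\<And>x. 0 < x \<Longrightarrow> x < 1 \<Longrightarrow> g x = g' x"
  have "integrable unit_ivl g \<longleftrightarrow> integrable unit_ivl g'"
    by (rule Bochner_Integration.integrable_cong) (use * in auto)
  then show "integrable unit_ivl g'" using * acD by auto
  fix x :: real assume x: "0 \<le> x" "x \<le> 1"
  show "u' x = u 0 + pint g' x"
    using *(1,2) acD(2)[OF *(1) x] x pint_cong[of x g g'] *(3) by simp
qed

lemma ac_diff_points:
  "ac u g \<Longrightarrow> 0 \<le> x \<Longrightarrow> x \<le> y \<Longrightarrow> y \<le> 1 \<Longrightarrow> u y - u x = pint g y - pint g x"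
  using acD(2)[of u g x] acD(2)[of u g y] by simp

text \<open>Sum over the intervals of a fine partition.\<close>

lemma const_if_small_increments:
  fixes E M :: "real \<Rightarrow> real"
  assumes *: "\<And>e. e > 0 \<Longrightarrow> \<exists>d>0. \<forall>s t. 0 \<le> s \<longrightarrow> s \<le> t \<longrightarrow> t \<le> 1 \<longrightarrow> t - s < d \<longrightarrow>
      \<bar>E t - E s\<bar> \<le> e * (M t - M s)"
    and T: "0 \<le> T" "T \<le> 1"
  shows "E T = E 0"
proof -
  have bound: "\<bar>E T - E 0\<bar> \<le> e * (M T - M 0)" if e: "e > 0" for e
  proof -
    obtain d where d: "d > 0" "\<And>s t. 0 \<le> s \<Longrightarrow> s \<le> t \<Longrightarrow> t \<le> 1 \<Longrightarrow> t - s < d \<Longrightarrow>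
      \<bar>E t - E s\<bar> \<le> e * (M t - M s)"
      using *[OF e] by blast
    obtain n :: nat where n: "n > 0" "1 / real n < d"
      using real_arch_inverse[of d] d(1) by (auto simp: inverse_eq_divide)
    define p where "p k = real k * T / real n" for k
    have p0: "p 0 = 0" and pn: "p n = T" using n by (auto simp: p_def)
    have mono: "p j \<le> p k" if "j \<le> k" for j k
      unfolding p_def using that T by (intro divide_right_mono mult_right_mono) auto
    have "\<bar>E (p k) - E 0\<bar> \<le> e * (M (p k) - M 0)" if "k \<le> n" for k
      using that
    proof (induction k)
      case 0
      then show ?case by (simp add: p0)
    next
      case (Suc k)
      have "p (Suc k) - p k = T / real n" by (simp add: p_def diff_divide_distrib[symmetric] algebra_simps)
      also have "\<dots> \<le> 1 / real n" using T by (simp add: divide_right_mono)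
      finally have "p (Suc k) - p k < d" using n by simp
      moreover have "0 \<le> p k" using mono[of 0 k] p0 by simp
      moreover have "p (Suc k) \<le> 1" using mono[OF Suc.prems] pn T by simp
      ultimately have "\<bar>E (p (Suc k)) - E (p k)\<bar> \<le> e * (M (p (Suc k)) - M (p k))"
        by (intro d(2)) (auto intro: mono)
      with Suc show ?case by (simp add: algebra_simps)
    qed
    from this[of n] show ?thesis by (simp add: pn)
  qed
  have "\<bar>E T - E 0\<bar> \<le> 0"
  proof (rule field_le_epsilon)
    fix e :: real assume e: "e > 0"
    \<comment> \<open>The 1 in the divisor covers the case that \<open>M T - M 0\<close>
      vanishes.\<close>
    have "\<bar>E T - E 0\<bar> \<le> e / (1 + \<bar>M T - M 0\<bar>) * (M T - M 0)" using e by (intro bound) auto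
    also have "\<dots> \<le> e / (1 + \<bar>M T - M 0\<bar>) * (1 + \<bar>M T - M 0\<bar>)"
      using e by (intro mult_left_mono) auto
    also have "\<dots> = e" by (simp add: field_simps)
    finally show "\<bar>E T - E 0\<bar> \<le> 0 + e" by simp
  qed
  then show ?thesis by simp
qed

text \<open>The mean value theorem with the oscillation of the derivative as error. No order of
  \<open>x\<close> and \<open>y\<close> is prescribed, because they will be values of a curve at two
  successive times.\<close>

lemma MVT_bound_increment:
  fixes G G' :: "real \<Rightarrow> real"
  assumes der: "\<And>x. x \<in> {lo..hi} \<Longrightarrow> (G has_real_derivative G' x) (at x)"
    and x: "x \<in> {lo..hi}" and y: "y \<in> {lo..hi}"
    and near: "\<And>z. min x y \<le> z \<Longrightarrow> z \<le> max x y \<Longrightarrow> \<bar>G' z - c\<bar> \<le> e"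
  shows "\<bar>G y - G x - c * (y - x)\<bar> \<le> e * \<bar>y - x\<bar>"
proof -
  have "\<exists>z. min x y \<le> z \<and> z \<le> max x y \<and> G y - G x = (y - x) * G' z"
  proof (cases x y rule: linorder_cases)
    case less
    have "\<exists>z. x < z \<and> z < y \<and> G y - G x = (y - x) * G' z"
      by (rule MVT2[OF less]) (use der x y in auto)
    then show ?thesis using less by (auto intro: less_imp_le)
  next
    case greater
    have "\<exists>z. y < z \<and> z < x \<and> G x - G y = (x - y) * G' z"
      by (rule MVT2[OF greater]) (use der x y in auto)
    then obtain z where "y < z" "z < x" "G x - G y = (x - y) * G' z" by blast
    then show ?thesis by (intro exI[of _ z]) (auto simp: algebra_simps)
  qed auto
  then obtain z where z: "min x y \<le> z" "z \<le> max x y" "G y - G x = (y - x) * G' z" by blast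
  have "G y - G x - c * (y - x) = (y - x) * (G' z - c)" using z(3) by (simp add: algebra_simps)
  also have "\<bar>\<dots>\<bar> \<le> e * \<bar>y - x\<bar>" using mult_left_mono[OF near[OF z(1,2)], of "\<bar>y - x\<bar>"] by (simp add: abs_mult mult.commute)
  finally show ?thesis .
qed

text \<open>Over a short interval the chain rule holds up to an error of at most \<open>e\<close> times the variation of \<open>a\<close> and \<open>b\<close>.\<close>

lemma ac_chain2:
  fixes G Ga Gb :: "real \<Rightarrow> real \<Rightarrow> real"
  assumes a: "ac a a'" and b: "ac b b'"
    and aA: "\<And>t. 0 \<le> t \<Longrightarrow> t \<le> 1 \<Longrightarrow> a t \<in> {A..A'}" and bB: "\<And>t. 0 \<le> t \<Longrightarrow> t \<le> 1 \<Longrightarrow> b t \<in> {B..B'}"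
    and Ga: "\<And>p q. p \<in> {A..A'} \<Longrightarrow> q \<in> {B..B'} \<Longrightarrow> ((\<lambda>p. G p q) has_real_derivative Ga p q) (at p)"
    and Gb: "\<And>p q. p \<in> {A..A'} \<Longrightarrow> q \<in> {B..B'} \<Longrightarrow> ((\<lambda>q. G p q) has_real_derivative Gb p q) (at q)"
    and c1: "continuous_on ({A..A'} \<times> {B..B'}) (\<lambda>(p, q). Ga p q)"
    and c2: "continuous_on ({A..A'} \<times> {B..B'}) (\<lambda>(p, q). Gb p q)"
  shows "ac (\<lambda>t. G (a t) (b t)) (\<lambda>t. Ga (a t) (b t) * a' t + Gb (a t) (b t) * b' t)"
proof -
  note ca = ac_continuous_on[OF a] and cb = ac_continuous_on[OF b]
  note ia = acD(1)[OF a] and ib = acD(1)[OF b]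
  define k1 k2 where "k1 t = Ga (a t) (b t)" and "k2 t = Gb (a t) (b t)" for t
  have ck1: "continuous_on {0..1} k1"
  proof -
    have "continuous_on {0..1} ((\<lambda>(p, q). Ga p q) \<circ> (\<lambda>t. (a t, b t)))"
      by (intro continuous_on_compose continuous_on_subset[OF c1] continuous_intros ca cb) (use aA bB in auto)
    then show ?thesis by (simp add: o_def k1_def)
  qed
  have ck2: "continuous_on {0..1} k2"
  proof -
    have "continuous_on {0..1} ((\<lambda>(p, q). Gb p q) \<circ> (\<lambda>t. (a t, b t)))"
      by (intro continuous_on_compose continuous_on_subset[OF c2] continuous_intros ca cb) (use aA bB in auto)
    then show ?thesis by (simp add: o_def k2_def)
  qed
  have mult_int: "integrable unit_ivl (\<lambda>t. k t * h t)"
    if k: "continuous_on {0..1} k" and h: "integrable unit_ivl h" for k h :: "real \<Rightarrow> real"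
  proof -
    obtain C where C: "\<And>t. t \<in> {0..1} \<Longrightarrow> \<bar>k t\<bar> \<le> C"
      using compact_imp_bounded[OF compact_continuous_image[OF k compact_Icc]]
      by (fastforce simp: bounded_iff)
    have C0: "0 \<le> C" using C[of 0] by (metis abs_ge_zero atLeastAtMost_iff order_refl order_trans zero_le_one)
    show ?thesis
    proof (rule Bochner_Integration.integrable_bound[of _ "\<lambda>t. C * h t"])
      show "AE x in unit_ivl. norm (k x * h x) \<le> norm (C * h x)"
        by (rule AE_unit_ivlI) (use C C0 in \<open>auto simp: abs_mult intro!: mult_right_mono\<close>)
    qed (use h integrable_continuous_unit_ivl[OF k] in auto)
  qed
  define k where "k t = k1 t * a' t + k2 t * b' t" for t
  have ik: "integrable unit_ivl k" unfolding k_def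
    by (intro Bochner_Integration.integrable_add mult_int ck1 ck2 ia ib)
  define h where "h t = \<bar>a' t\<bar> + \<bar>b' t\<bar>" for t
  have ih: "integrable unit_ivl h" unfolding h_def using ia ib by auto
  \<comment> \<open>The defect of the chain rule. It is constant once its increments over short
    intervals are small compared with those of \<open>2 * pint h\<close>.\<close>
  define E where "E t = G (a t) (b t) - pint k t" for t
  have E: "E T = E 0" if "0 \<le> T" "T \<le> 1" for T
  proof (rule const_if_small_increments[OF _ that, where M = "\<lambda>t. 2 * pint h t"])
    fix e :: real assume e: "e > 0"
    have u1: "uniformly_continuous_on ({A..A'} \<times> {B..B'}) (\<lambda>(p, q). Ga p q)"
      by (intro compact_uniformly_continuous c1 compact_Times compact_Icc)
    have u2: "uniformly_continuous_on ({A..A'} \<times> {B..B'}) (\<lambda>(p, q). Gb p q)"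
      by (intro compact_uniformly_continuous c2 compact_Times compact_Icc)
    have ua: "uniformly_continuous_on {0..1} a" and ub: "uniformly_continuous_on {0..1} b"
      by (intro compact_uniformly_continuous ca cb compact_Icc)+
    obtain d1 where d1: "d1 > 0" "\<And>p q p' q'. p \<in> {A..A'} \<Longrightarrow> q \<in> {B..B'} \<Longrightarrow> p' \<in> {A..A'} \<Longrightarrow> q' \<in> {B..B'} \<Longrightarrow>
        dist (p', q') (p, q) < d1 \<Longrightarrow> \<bar>Ga p' q' - Ga p q\<bar> < e"
      using u1 e unfolding uniformly_continuous_on_def dist_real_def by fast
    obtain d2 where d2: "d2 > 0" "\<And>p q p' q'. p \<in> {A..A'} \<Longrightarrow> q \<in> {B..B'} \<Longrightarrow> p' \<in> {A..A'} \<Longrightarrow> q' \<in> {B..B'} \<Longrightarrow>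
        dist (p', q') (p, q) < d2 \<Longrightarrow> \<bar>Gb p' q' - Gb p q\<bar> < e"
      using u2 e unfolding uniformly_continuous_on_def dist_real_def by fast
    \<comment> \<open>Halved because the distance in the plane is estimated by the sum of the
      distances of the two coordinates.\<close>
    define d where "d = min d1 d2 / 2"
    have d: "d > 0" using d1 d2 by (simp add: d_def)
    obtain da where da: "da > 0" "\<And>s t. s \<in> {0..1} \<Longrightarrow> t \<in> {0..1} \<Longrightarrow> \<bar>t - s\<bar> < da \<Longrightarrow> \<bar>a t - a s\<bar> < d"
      using ua d unfolding uniformly_continuous_on_def dist_real_def by meson
    obtain db where db: "db > 0" "\<And>s t. s \<in> {0..1} \<Longrightarrow> t \<in> {0..1} \<Longrightarrow> \<bar>t - s\<bar> < db \<Longrightarrow> \<bar>b t - b s\<bar> < d"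
      using ub d unfolding uniformly_continuous_on_def dist_real_def by meson
    have near: "dist (p', q') (p, q) < min d1 d2" if "\<bar>p' - p\<bar> < d" "\<bar>q' - q\<bar> < d" for p p' q q' :: real
    proof -
      have "dist (p', q') (p, q) \<le> \<bar>p' - p\<bar> + \<bar>q' - q\<bar>"
        unfolding dist_Pair_Pair dist_real_def by (metis sqrt_sum_squares_le_sum_abs power2_abs)
      with that show ?thesis by (simp add: d_def)
    qed
    show "\<exists>d>0. \<forall>s t. 0 \<le> s \<longrightarrow> s \<le> t \<longrightarrow> t \<le> 1 \<longrightarrow> t - s < d \<longrightarrow>
      \<bar>E t - E s\<bar> \<le> e * (2 * pint h t - 2 * pint h s)"
    proof (intro exI[of _ "min da db"] conjI allI impI)
      show "0 < min da db" using da db by simp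
      fix s t assume st: "0 \<le> s" "s \<le> t" "t \<le> 1" "t - s < min da db"
      have osc: "\<bar>a x - a y\<bar> < d" "\<bar>b x - b y\<bar> < d" if "x \<in> {s..t}" "y \<in> {s..t}" for x y
        using da(2)[of y x] db(2)[of y x] that st by auto
      have av: "\<bar>a t - a s\<bar> \<le> pint h t - pint h s"
        unfolding ac_diff_points[OF a st(1-3)]
        by (rule abs_pint_diff_le) (use ia ih st in \<open>auto simp: h_def\<close>)
      have bv: "\<bar>b t - b s\<bar> \<le> pint h t - pint h s"
        unfolding ac_diff_points[OF b st(1-3)]
        by (rule abs_pint_diff_le) (use ib ih st in \<open>auto simp: h_def\<close>)
      have mid: "min x y \<le> z \<Longrightarrow> z \<le> max x y \<Longrightarrow> \<bar>x - y\<bar> < d \<Longrightarrow> \<bar>z - x\<bar> < d" for x y z :: real by auto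
      have rng: "a s \<in> {A..A'}" "a t \<in> {A..A'}" "b s \<in> {B..B'}" "b t \<in> {B..B'}"
        using aA bB st by auto
      \<comment> \<open>One argument moves at a time: first the first one, with the second already
        at time \<open>t\<close>, then the second one, with the first still at time
        \<open>s\<close>. Both partial derivatives are compared with their values at
        \<open>(a s, b s)\<close>.\<close>
      have 1: "\<bar>G (a t) (b t) - G (a s) (b t) - Ga (a s) (b s) * (a t - a s)\<bar> \<le> e * \<bar>a t - a s\<bar>"
      proof (rule MVT_bound_increment[where lo = A and hi = A' and G = "\<lambda>p. G p (b t)" and G' = "\<lambda>p. Ga p (b t)"])
        fix z assume z: "min (a s) (a t) \<le> z" "z \<le> max (a s) (a t)"
        have "\<bar>z - a s\<bar> < d" by (rule mid[OF z]) (use osc st in auto)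
        then have "dist (z, b t) (a s, b s) < d1" using near[of z "a s" "b t" "b s"] osc st by auto
        then show "\<bar>Ga z (b t) - Ga (a s) (b s)\<bar> \<le> e" using z rng
          by (intro less_imp_le d1(2)) auto
      qed (use rng Ga in auto)
      have 2: "\<bar>G (a s) (b t) - G (a s) (b s) - Gb (a s) (b s) * (b t - b s)\<bar> \<le> e * \<bar>b t - b s\<bar>"
      proof (rule MVT_bound_increment[where lo = B and hi = B' and G = "\<lambda>q. G (a s) q" and G' = "\<lambda>q. Gb (a s) q"])
        fix z assume z: "min (b s) (b t) \<le> z" "z \<le> max (b s) (b t)"
        have "\<bar>z - b s\<bar> < d" by (rule mid[OF z]) (use osc st in auto)
        then have "dist (a s, z) (a s, b s) < d2" using near[of "a s" "a s" z "b s"] d by auto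
        then show "\<bar>Gb (a s) z - Gb (a s) (b s)\<bar> \<le> e" using z rng
          by (intro less_imp_le d2(2)) auto
      qed (use rng Gb in auto)
      \<comment> \<open>The third error comes from freezing the coefficients \<open>k1\<close> and
        \<open>k2\<close> at time \<open>s\<close> inside the integral.\<close>
      have 3: "\<bar>pint (\<lambda>r. (k1 r - k1 s) * a' r + (k2 r - k2 s) * b' r) t -
           pint (\<lambda>r. (k1 r - k1 s) * a' r + (k2 r - k2 s) * b' r) s\<bar> \<le> pint (\<lambda>r. e * h r) t - pint (\<lambda>r. e * h r) s"
      proof (rule abs_pint_diff_le)
        show I: "integrable unit_ivl (\<lambda>r. (k1 r - k1 s) * a' r + (k2 r - k2 s) * b' r)"
          by (intro Bochner_Integration.integrable_add mult_int continuous_intros ck1 ck2 ia ib)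
        fix r assume r: "0 < r" "r < 1" "s < r" "r \<le> t"
        have "dist (a r, b r) (a s, b s) < min d1 d2" using near osc r by auto
        then have "\<bar>k1 r - k1 s\<bar> \<le> e" "\<bar>k2 r - k2 s\<bar> \<le> e" unfolding k1_def k2_def
          using rng aA[of r] bB[of r] r by (auto intro!: less_imp_le d1(2) d2(2))
        then have "\<bar>(k1 r - k1 s) * a' r\<bar> \<le> e * \<bar>a' r\<bar>" "\<bar>(k2 r - k2 s) * b' r\<bar> \<le> e * \<bar>b' r\<bar>"
          by (auto simp: abs_mult intro!: mult_right_mono)
        then show "\<bar>(k1 r - k1 s) * a' r + (k2 r - k2 s) * b' r\<bar> \<le> e * h r"
          unfolding h_def distrib_left by linarith
      qed (use ih st in auto)
      have eq: "pint (\<lambda>r. (k1 r - k1 s) * a' r + (k2 r - k2 s) * b' r) x =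
        pint k x - (k1 s * pint a' x + k2 s * pint b' x)" for x
      proof -
        have "pint (\<lambda>r. (k1 r - k1 s) * a' r + (k2 r - k2 s) * b' r) x =
          pint (\<lambda>r. k r - (k1 s * a' r + k2 s * b' r)) x"
          by (rule pint_cong) (auto simp: k_def algebra_simps)
        also have "\<dots> = pint k x - (k1 s * pint a' x + k2 s * pint b' x)"
          using ik ia ib by (simp add: pint_diff pint_add pint_cmult)
        finally show ?thesis .
      qed
      have 3: "\<bar>pint k t - pint k s - k1 s * (a t - a s) - k2 s * (b t - b s)\<bar> \<le> e * (pint h t - pint h s)"
        using 3 unfolding eq ac_diff_points[OF a st(1-3)] ac_diff_points[OF b st(1-3)] pint_cmult
        by (simp add: algebra_simps)
      have 4: "e * \<bar>a t - a s\<bar> + e * \<bar>b t - b s\<bar> + e * (pint h t - pint h s) \<le> e * (2 * pint h t - 2 * pint h s)"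
      proof -
        have "\<bar>a t - a s\<bar> + \<bar>b t - b s\<bar> \<le> pint h t - pint h s"
        proof -
          have "\<bar>a t - a s\<bar> \<le> pint (\<lambda>r. \<bar>a' r\<bar>) t - pint (\<lambda>r. \<bar>a' r\<bar>) s"
            unfolding ac_diff_points[OF a st(1-3)]
            by (rule abs_pint_diff_le) (use ia st in auto)
          moreover have "\<bar>b t - b s\<bar> \<le> pint (\<lambda>r. \<bar>b' r\<bar>) t - pint (\<lambda>r. \<bar>b' r\<bar>) s"
            unfolding ac_diff_points[OF b st(1-3)]
            by (rule abs_pint_diff_le) (use ib st in auto)
          ultimately show ?thesis using ia ib unfolding h_def by (simp add: pint_add)
        qed
        then have "e * (\<bar>a t - a s\<bar> + \<bar>b t - b s\<bar>) \<le> e * (pint h t - pint h s)"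
          using e by (intro mult_left_mono) auto
        then show ?thesis by (simp add: algebra_simps)
      qed
      have "E t - E s = (G (a t) (b t) - G (a s) (b t) - k1 s * (a t - a s))
         + (G (a s) (b t) - G (a s) (b s) - k2 s * (b t - b s))
         - (pint k t - pint k s - k1 s * (a t - a s) - k2 s * (b t - b s))"
        unfolding E_def by simp
      then show "\<bar>E t - E s\<bar> \<le> e * (2 * pint h t - 2 * pint h s)"
        using 1 2 3 4 unfolding k1_def k2_def by linarith
    qed
  qed
  have "G (a T) (b T) = G (a 0) (b 0) + pint k T" if "0 \<le> T" "T \<le> 1" for T
    using E[OF that] pint_le_0[of 0 k] unfolding E_def by linarith
  then have "ac (\<lambda>t. G (a t) (b t)) k" by (rule acI[OF ik])
  then show ?thesis unfolding k_def k1_def k2_def .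
qed

lemma ac_bounds:
  assumes "ac a a'"
  obtains A A' where "\<And>t. 0 \<le> t \<Longrightarrow> t \<le> 1 \<Longrightarrow> a t \<in> {A..A'}"
proof -
  obtain C where C: "\<And>t. t \<in> {0..1} \<Longrightarrow> \<bar>a t\<bar> \<le> C"
    using compact_imp_bounded[OF compact_continuous_image[OF ac_continuous_on[OF assms] compact_Icc]]
    by (fastforce simp: bounded_iff)
  show ?thesis by (rule that[of "-C" C]) (use C in \<open>auto simp: abs_le_iff minus_le_iff\<close>)
qed

lemma ac_mult:
  assumes a: "ac a a'" and b: "ac b b'"
  shows "ac (\<lambda>t. a t * b t) (\<lambda>t. b t * a' t + a t * b' t)"
proof -
  obtain A A' where A: "\<And>t. 0 \<le> t \<Longrightarrow> t \<le> 1 \<Longrightarrow> a t \<in> {A..A'}" using ac_bounds[OF a] by blast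
  obtain B B' where B: "\<And>t. 0 \<le> t \<Longrightarrow> t \<le> 1 \<Longrightarrow> b t \<in> {B..B'}" using ac_bounds[OF b] by blast
  show ?thesis
    by (rule ac_chain2[OF a b A B, where G = "\<lambda>p q. p * q" and Ga = "\<lambda>p q. q" and Gb = "\<lambda>p q. p"])
      (auto intro!: derivative_eq_intros continuous_intros simp: case_prod_beta')
qed

lemma ac_chain:
  assumes a: "ac a a'" and A: "\<And>t. 0 \<le> t \<Longrightarrow> t \<le> 1 \<Longrightarrow> a t \<in> {A..A'}"
    and G: "\<And>p. p \<in> {A..A'} \<Longrightarrow> (G has_real_derivative G' p) (at p)"
    and c: "continuous_on {A..A'} G'"
  shows "ac (\<lambda>t. G (a t)) (\<lambda>t. G' (a t) * a' t)"
proof -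
  have "ac (\<lambda>t. G (a t)) (\<lambda>t. G' (a t) * a' t + 0 * 0)"
    by (rule ac_chain2[OF a ac_const[of 0] A, where G = "\<lambda>p q. G p" and Ga = "\<lambda>p q. G' p" and Gb = "\<lambda>p q. 0" and B = 0 and B' = 0])
      (use G c in \<open>auto intro!: continuous_intros continuous_on_compose2[OF c] simp: case_prod_beta'\<close>)
  then show ?thesis by simp
qed

lemma ac_exp: "ac a a' \<Longrightarrow> ac (\<lambda>t. exp (a t)) (\<lambda>t. exp (a t) * a' t)"
proof -
  assume a: "ac a a'"
  obtain A A' where A: "\<And>t. 0 \<le> t \<Longrightarrow> t \<le> 1 \<Longrightarrow> a t \<in> {A..A'}" using ac_bounds[OF a] by blast
  show ?thesis by (rule ac_chain[OF a A]) (auto intro!: derivative_eq_intros continuous_intros)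
qed

text \<open>Integrating factor: \<open>d t * exp (- pint a t)\<close> has density zero, hence is
  constant.\<close>

lemma ac_linear_ode:
  assumes d: "ac d (\<lambda>s. a s * d s)" and a: "integrable unit_ivl a" and t: "0 \<le> t" "t \<le> 1"
  shows "d t = d 0 * exp (pint a t)"
proof -
  have "ac (\<lambda>t. - 1 * pint a t) (\<lambda>t. - 1 * a t)" by (intro ac_cmult ac_pint a)
  from ac_mult[OF d ac_exp[OF this]]
  have "ac (\<lambda>t. d t * exp (- 1 * pint a t)) (\<lambda>_. 0)"
    by (rule ac_cong) auto
  from acD(2)[OF this t] have "d t * exp (- pint a t) = d 0"
    using pint_cmult[of 0 "\<lambda>_. 0" t] by simp
  then show ?thesis by (simp add: exp_minus field_simps)
qed

text \<open>The chain rule along the identity curve. The only integral computed from the measure of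
  intervals is that of the constant 1.\<close>

lemma ac_of_continuous_derivative:
  assumes "\<And>x. 0 \<le> x \<Longrightarrow> x \<le> 1 \<Longrightarrow> (u has_real_derivative g x) (at x)" "continuous_on {0..1} g"
  shows "ac u g"
proof -
  have id: "ac (\<lambda>t::real. t) (\<lambda>_. 1)"
  proof (rule acI[of _ _ 0])
    fix x :: real assume x: "0 \<le> x" "x \<le> 1"
    have "pint (\<lambda>_. 1) x = (LINT y:{0<..<1}|lborel. indicator {..x} y * (1::real))"
      unfolding pint_def integral_unit_ivl ..
    also have "\<dots> = (LINT y|lborel. indicator ({0<..<1} \<inter> {..x}) y)"
      unfolding set_lebesgue_integral_def
      by (rule Bochner_Integration.integral_cong) (auto simp: indicator_def)
    also have "\<dots> = measure lborel ({0<..<1} \<inter> {..x})" by simp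
    also have "\<dots> = x"
    proof -
      have "{0<..<1} \<inter> {..x} = (if x = 1 then {0<..<x} else {0<..x})" using x by auto
      then show ?thesis using x by (auto split: if_splits)
    qed
    finally show "x = 0 + pint (\<lambda>_. 1) x" by simp
  qed simp
  have "ac (\<lambda>t. u t) (\<lambda>t. g t * 1)"
    by (rule ac_chain[OF id, where A = 0 and A' = 1]) (use assms in auto)
  then show ?thesis by simp
qed

subsection \<open>Approximation by polynomials\<close>

text \<open>A measurable function is almost everywhere a limit of continuous ones. These are
  truncated to [-M, M], which leaves the limit unchanged, and approximated by Weierstrass up to
  \<open>1 / (real n + 1)\<close>; hence the uniform bound \<open>M + 1\<close>, which serves
  dominated convergence.\<close>

lemma bounded_approx_polynomial:
  fixes k :: "real \<Rightarrow> real"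
  assumes [measurable]: "k \<in> borel_measurable unit_ivl"
    and M: "\<And>x. 0 < x \<Longrightarrow> x < 1 \<Longrightarrow> \<bar>k x\<bar> \<le> M" "0 \<le> M"
  obtains p where "\<And>n. real_polynomial_function (p n)" "\<And>n x. x \<in> {0..1} \<Longrightarrow> \<bar>p n x\<bar> \<le> M + 1"
    "AE x in unit_ivl. (\<lambda>n::nat. p n x) \<longlonglongrightarrow> k x"
proof -
  define k' where "k' x = (if x \<in> {0<..<1} then k x else 0)" for x
  have "k' \<in> borel_measurable lborel" unfolding k'_def
    by (subst borel_measurable_restrict_space_iff[symmetric]; use assms(1) in \<open>simp add: unit_ivl_def\<close>)?
      (use assms(1) in \<open>simp add: unit_ivl_def measurable_restrict_space_iff\<close>)?
  then have "k' \<in> borel_measurable lebesgue" by (rule measurable_completion)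
  from lebesgue_measurable_imp_measurable_on[OF this, of UNIV]
  obtain N g where N: "negligible N" and g: "\<And>n. continuous_on UNIV (g n)"
    and gl: "\<And>x. x \<notin> N \<Longrightarrow> (\<lambda>n::nat. g n x) \<longlonglongrightarrow> k' x"
    unfolding measurable_on_def by auto
  define g' where "g' n x = max (- M) (min M (g n x))" for n x
  have "\<exists>p. real_polynomial_function p \<and> (\<forall>x\<in>{0..1}. \<bar>g' n x - p x\<bar> < 1 / (real n + 1))" for n
  proof -
    have "continuous_on {0..1} (g' n)" unfolding g'_def
      by (intro continuous_intros continuous_on_subset[OF g]) auto
    from Stone_Weierstrass_real_polynomial_function[OF compact_Icc this, of "1 / (real n + 1)"]
    show ?thesis by (metis add_pos_nonneg of_nat_0_le_iff zero_less_divide_1_iff zero_less_one add.commute)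
  qed
  then obtain p where p: "\<And>n. real_polynomial_function (p n)"
    "\<And>n x. x \<in> {0..1} \<Longrightarrow> \<bar>g' n x - p n x\<bar> < 1 / (real n + 1)"
    by metis
  show ?thesis
  proof (rule that[of p])
    show "real_polynomial_function (p n)" for n by (rule p)
    show "\<bar>p n x\<bar> \<le> M + 1" if "x \<in> {0..1}" for n x
    proof -
      have "1 / (real n + 1) \<le> 1" by simp
      moreover have "\<bar>g' n x\<bar> \<le> M" using M(2) by (auto simp: g'_def)
      ultimately show ?thesis using p(2)[OF that, of n] by linarith
    qed
    have "AE x in lebesgue. x \<notin> N" using N by (simp add: negligible_iff_null_sets AE_not_in)
    then have "AE x in lborel. x \<notin> N" by (simp add: AE_completion_iff)
    then show "AE x in unit_ivl. (\<lambda>n. p n x) \<longlonglongrightarrow> k x"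
      unfolding AE_unit_ivl
    proof eventually_elim
      case (elim x)
      show ?case
      proof
        assume x: "0 < x \<and> x < 1"
        have "(\<lambda>n. g' n x) \<longlonglongrightarrow> max (- M) (min M (k' x))" unfolding g'_def
          by (intro tendsto_intros gl elim)
        moreover have "max (- M) (min M (k' x)) = k x"
          using M(1)[of x] x by (auto simp: k'_def abs_le_iff)
        ultimately have 1: "(\<lambda>n. g' n x) \<longlonglongrightarrow> k x" by simp
        have "(\<lambda>n. g' n x - p n x) \<longlonglongrightarrow> 0"
        proof (rule Lim_null_comparison[where g = "\<lambda>n. 1 / (real n + 1)"])
          show "\<forall>\<^sub>F n in sequentially. norm (g' n x - p n x) \<le> 1 / (real n + 1)"
            using p(2)[of x] x by (auto intro!: always_eventually less_imp_le)
          show "(\<lambda>n. 1 / (real n + 1)) \<longlonglongrightarrow> 0"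
            using LIMSEQ_inverse_real_of_nat by (simp add: inverse_eq_divide add.commute)
        qed
        from tendsto_diff[OF 1 this] show "(\<lambda>n. p n x) \<longlonglongrightarrow> k x" by simp
      qed
    qed
  qed
qed

text \<open>Polynomials converging boundedly to the sign of \<open>h\<close> turn orthogonality into
  the vanishing of the integral of its absolute value.\<close>

lemma AE_zero_if_orthogonal_polynomials:
  assumes h: "integrable unit_ivl h"
    and orth: "\<And>p. real_polynomial_function p \<Longrightarrow> (\<integral>x. h x * p x \<partial>unit_ivl) = 0"
  shows "AE x in unit_ivl. h x = (0::real)"
proof -
  have [measurable]: "h \<in> borel_measurable unit_ivl" using h by auto
  obtain p where p: "\<And>n. real_polynomial_function (p n)" "\<And>n x. x \<in> {0..1} \<Longrightarrow> \<bar>p n x\<bar> \<le> 1 + 1"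
    "AE x in unit_ivl. (\<lambda>n::nat. p n x) \<longlonglongrightarrow> sgn (h x)"
    by (rule bounded_approx_polynomial[of "\<lambda>x. sgn (h x)" 1]) (auto simp: abs_sgn_eq)
  have cp: "continuous_on S (p n)" for n S
    using p(1)[of n] by (simp add: continuous_on_polymonial_function real_polynomial_function_eq)
  have "(\<lambda>n. \<integral>x. h x * p n x \<partial>unit_ivl) \<longlonglongrightarrow> (\<integral>x. h x * sgn (h x) \<partial>unit_ivl)"
  proof (rule integral_dominated_convergence[where w = "\<lambda>x. 2 * \<bar>h x\<bar>"])
    show "AE x in unit_ivl. (\<lambda>n. h x * p n x) \<longlonglongrightarrow> h x * sgn (h x)"
      using p(3) by eventually_elim (intro tendsto_intros)
    show "AE x in unit_ivl. norm (h x * p n x) \<le> 2 * \<bar>h x\<bar>" for n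
    proof (rule AE_unit_ivlI)
      fix x :: real assume "0 < x" "x < 1"
      then have "\<bar>p n x\<bar> \<le> 2" using p(2)[of x n] by auto
      from mult_left_mono[OF this, of "\<bar>h x\<bar>"] show "norm (h x * p n x) \<le> 2 * \<bar>h x\<bar>"
        by (simp add: abs_mult mult.commute)
    qed
    show "(\<lambda>x. h x * p n x) \<in> borel_measurable unit_ivl" for n
      using integrable_continuous_unit_ivl[OF cp, of n] by auto
  qed (use h in auto)
  then have "(\<integral>x. h x * sgn (h x) \<partial>unit_ivl) = 0"
    using orth[OF p(1)] by (simp add: LIMSEQ_const_iff)
  then have "(\<integral>x. \<bar>h x\<bar> \<partial>unit_ivl) = 0" by (simp add: abs_sgn[symmetric])
  then have "AE x in unit_ivl. \<bar>h x\<bar> = 0"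
    by (subst (asm) integral_nonneg_eq_0_iff_AE) (use h in auto)
  then show ?thesis by simp
qed

lemma ac_real_polynomial:
  assumes "real_polynomial_function p"
  obtains p' where "real_polynomial_function p'" "\<And>x. (p has_real_derivative p' x) (at x)" "ac p p'"
proof -
  obtain p' where p': "real_polynomial_function p'" "\<And>x. (p has_real_derivative p' x) (at x)"
    using has_real_derivative_polynomial_function[OF assms] by blast
  moreover have "ac p p'"
    by (rule ac_of_continuous_derivative)
      (use p' in \<open>auto simp: continuous_on_polymonial_function real_polynomial_function_eq\<close>)
  ultimately show ?thesis using that by blast
qed

lemma ac_by_parts:
  assumes "ac u g" "ac v h"
  shows "(\<integral>x. v x * g x + u x * h x \<partial>unit_ivl) = u 1 * v 1 - u 0 * v 0"
  using acD(2)[OF ac_mult[OF assms], of 1] by (simp add: pint_ge_1)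

text \<open>After integration by parts, the integral against a polynomial involves \<open>h\<close>
  only through its primitive, so \<open>h\<close> is orthogonal to all polynomials.\<close>

lemma AE_zero_if_pint_zero:
  assumes h: "integrable unit_ivl h" and z: "\<And>x. 0 \<le> x \<Longrightarrow> x \<le> 1 \<Longrightarrow> pint h x = 0"
  shows "AE x in unit_ivl. h x = 0"
proof (rule AE_zero_if_orthogonal_polynomials[OF h])
  fix p :: "real \<Rightarrow> real" assume "real_polynomial_function p"
  then obtain p' where p': "ac p p'" using ac_real_polynomial by blast
  have "(\<integral>x. h x * p x \<partial>unit_ivl) = (\<integral>x. p x * h x + pint h x * p' x \<partial>unit_ivl)"
    by (rule integral_cong_unit_ivl) (simp add: z)
  also have "\<dots> = 0" using ac_by_parts[OF ac_pint[OF h] p'] z by simp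
  finally show "(\<integral>x. h x * p x \<partial>unit_ivl) = 0" .
qed

text \<open>Truncation at height \<open>m\<close> reduces the claim to bounded functions, where
  almost-everywhere bounded convergence implies convergence in L^2. It will provide polynomial
  curves close to a trajectory.\<close>

lemma L2_approx_polynomial:
  assumes k: "k \<in> L2 unit_ivl"
  obtains p where "\<And>n. real_polynomial_function (p n)"
    "(\<lambda>n::nat. \<integral>x. (p n x - k x)\<^sup>2 \<partial>unit_ivl) \<longlonglongrightarrow> 0"
proof -
  note [measurable] = L2_unit_ivlD(1)[OF k]
  note k2 = L2_unit_ivlD(2)[OF k]
  define K where "K m x = max (- real m) (min (real m) (k x))" for m x
  have [measurable]: "K m \<in> borel_measurable unit_ivl" for m unfolding K_def by measurable
  have Kb: "\<bar>K m x\<bar> \<le> real m" for m x by (auto simp: K_def)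
  have Kk: "(K m x - k x)\<^sup>2 \<le> (k x)\<^sup>2" for m x
    by (subst abs_le_square_iff[symmetric]) (auto simp: K_def)
  have "(\<lambda>m. \<integral>x. (K m x - k x)\<^sup>2 \<partial>unit_ivl) \<longlonglongrightarrow> (\<integral>x. 0 \<partial>unit_ivl)"
  proof (rule integral_dominated_convergence[where w = "\<lambda>x. (k x)\<^sup>2"])
    show "AE x in unit_ivl. (\<lambda>m. (K m x - k x)\<^sup>2) \<longlonglongrightarrow> 0"
    proof (rule AE_I2, rule tendsto_eventually)
      fix x
      obtain M :: nat where M: "\<bar>k x\<bar> \<le> real M" using real_arch_simple by blast
      have "K m x = k x" if "M \<le> m" for m
      proof -
        have "real M \<le> real m" using that by simp
        then show ?thesis using M by (auto simp: K_def)
      qed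
      then show "\<forall>\<^sub>F m in sequentially. (K m x - k x)\<^sup>2 = 0"
        by (auto simp: eventually_sequentially)
    qed
  qed (use k2 Kk in auto)
  then have K0: "(\<lambda>m. \<integral>x. (K m x - k x)\<^sup>2 \<partial>unit_ivl) \<longlonglongrightarrow> 0" by simp
  have "\<exists>p. real_polynomial_function p \<and> (\<integral>x. (p x - k x)\<^sup>2 \<partial>unit_ivl) < e" if e: "e > 0" for e
  proof -
    \<comment> \<open>Each of the two errors is kept below \<open>e / 4\<close>, as the inequality
      \<open>sq\<close> below doubles both.\<close>
    from order_tendstoD(2)[OF K0, of "e / 4"] e
    obtain m where m: "(\<integral>x. (K m x - k x)\<^sup>2 \<partial>unit_ivl) < e / 4"
      by (auto simp: eventually_sequentially)
    obtain p where p: "\<And>n. real_polynomial_function (p n)" "\<And>n x. x \<in> {0..1} \<Longrightarrow> \<bar>p n x\<bar> \<le> real m + 1"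
      "AE x in unit_ivl. (\<lambda>n::nat. p n x) \<longlonglongrightarrow> K m x"
      by (rule bounded_approx_polynomial[of "K m" "real m"]) (use Kb in auto)
    have [measurable]: "p n \<in> borel_measurable unit_ivl" for n
      using integrable_continuous_unit_ivl[of "p n"] p(1)[of n]
      by (auto simp: continuous_on_polymonial_function real_polynomial_function_eq)
    have "(\<lambda>n. \<integral>x. (p n x - K m x)\<^sup>2 \<partial>unit_ivl) \<longlonglongrightarrow> (\<integral>x. 0 \<partial>unit_ivl)"
    proof (rule integral_dominated_convergence[where w = "\<lambda>x. (2 * real m + 1)\<^sup>2"])
      show "AE x in unit_ivl. (\<lambda>n. (p n x - K m x)\<^sup>2) \<longlonglongrightarrow> 0"
        using p(3)
      proof eventually_elim
        case (elim x)
        have "(\<lambda>n. (p n x - K m x)\<^sup>2) \<longlonglongrightarrow> (K m x - K m x)\<^sup>2" by (intro tendsto_intros elim)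
        then show ?case by simp
      qed
      show "AE x in unit_ivl. norm ((p n x - K m x)\<^sup>2) \<le> (2 * real m + 1)\<^sup>2" for n
      proof (rule AE_unit_ivlI)
        fix x :: real assume "0 < x" "x < 1"
        then have "\<bar>p n x - K m x\<bar> \<le> \<bar>2 * real m + 1\<bar>" using p(2)[of x n] Kb[of m x] by auto
        then show "norm ((p n x - K m x)\<^sup>2) \<le> (2 * real m + 1)\<^sup>2"
          unfolding abs_le_square_iff by simp
      qed
    qed auto
    from order_tendstoD(2)[OF this, of "e / 4"] e
    obtain n where n: "(\<integral>x. (p n x - K m x)\<^sup>2 \<partial>unit_ivl) < e / 4"
      by (auto simp: eventually_sequentially)
    have i1: "integrable unit_ivl (\<lambda>x. (p n x - K m x)\<^sup>2)"
    proof (rule integrable_bounded_unit_ivl)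
      fix x :: real assume "0 < x" "x < 1"
      then have "\<bar>p n x - K m x\<bar> \<le> \<bar>2 * real m + 1\<bar>" using p(2)[of x n] Kb[of m x] by auto
      then show "\<bar>(p n x - K m x)\<^sup>2\<bar> \<le> (2 * real m + 1)\<^sup>2"
        unfolding abs_le_square_iff by simp
    qed auto
    have i2: "integrable unit_ivl (\<lambda>x. (K m x - k x)\<^sup>2)"
      by (rule Bochner_Integration.integrable_bound[OF k2]) (use Kk in auto)
    have sq: "(x + y)\<^sup>2 \<le> 2 * x\<^sup>2 + 2 * y\<^sup>2" for x y :: real
      using zero_le_power2[of "x - y"] by (simp add: power2_eq_square algebra_simps)
    have bd: "(p n x - k x)\<^sup>2 \<le> 2 * (p n x - K m x)\<^sup>2 + 2 * (K m x - k x)\<^sup>2" for x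
      using sq[of "p n x - K m x" "K m x - k x"] by simp
    have i3: "integrable unit_ivl (\<lambda>x. (p n x - k x)\<^sup>2)"
      by (rule Bochner_Integration.integrable_bound[of _ "\<lambda>x. 2 * (p n x - K m x)\<^sup>2 + 2 * (K m x - k x)\<^sup>2"])
        (use i1 i2 bd in auto)
    have "(\<integral>x. (p n x - k x)\<^sup>2 \<partial>unit_ivl) \<le> (\<integral>x. 2 * (p n x - K m x)\<^sup>2 + 2 * (K m x - k x)\<^sup>2 \<partial>unit_ivl)"
      by (rule integral_mono) (use i1 i2 i3 bd in auto)
    also have "\<dots> = 2 * (\<integral>x. (p n x - K m x)\<^sup>2 \<partial>unit_ivl) + 2 * (\<integral>x. (K m x - k x)\<^sup>2 \<partial>unit_ivl)"
      using i1 i2 by simp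
    also have "\<dots> < e" using m n by linarith
    finally show ?thesis using p(1) by blast
  qed
  then have "\<exists>p. real_polynomial_function p \<and> (\<integral>x. (p x - k x)\<^sup>2 \<partial>unit_ivl) < 1 / (real n + 1)" for n
    by (simp add: add_pos_nonneg)
  then obtain p where p: "\<And>n. real_polynomial_function (p n)"
    "\<And>n. (\<integral>x. (p n x - k x)\<^sup>2 \<partial>unit_ivl) < 1 / (real n + 1)" by metis
  have "(\<lambda>n. \<integral>x. (p n x - k x)\<^sup>2 \<partial>unit_ivl) \<longlonglongrightarrow> 0"
  proof (rule Lim_null_comparison[where g = "\<lambda>n. 1 / (real n + 1)"])
    show "\<forall>\<^sub>F n in sequentially. norm (\<integral>x. (p n x - k x)\<^sup>2 \<partial>unit_ivl) \<le> 1 / (real n + 1)"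
      using p(2) by (auto intro!: always_eventually less_imp_le)
    show "(\<lambda>n. 1 / (real n + 1)) \<longlonglongrightarrow> 0"
      using LIMSEQ_inverse_real_of_nat by (simp add: inverse_eq_divide add.commute)
  qed
  with p(1) that show ?thesis by blast
qed

subsection \<open>Smooth functions\<close>

lemma smoothD:
  assumes "smooth f"
  shows "f differentiable (at x)" "smooth (\<lambda>x. frechet_derivative f (at x) h)"
  using assms by (auto elim: smooth.cases)

lemma smooth_has_derivative: "smooth f \<Longrightarrow> (f has_derivative frechet_derivative f (at x)) (at x)"
  using smoothD(1) frechet_derivative_works by blast

lemma smooth_continuous_on: "smooth f \<Longrightarrow> continuous_on S f"
  by (meson smoothD(1) differentiable_imp_continuous_on differentiable_on_def differentiable_at_withinI)

lemma smooth_real_intro: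
  assumes "\<And>x. (f has_real_derivative g x) (at x)" "\<And>c. smooth (\<lambda>x. c * g x)"
  shows "smooth f"
proof (rule smooth.intros)
  show "\<forall>x. f differentiable (at x)"
    using assms(1) real_differentiable_def by blast
  have "frechet_derivative f (at x) h = h * g x" for x h
    using frechet_derivative_at[OF assms(1)[unfolded has_field_derivative_def]] by (metis mult.commute)
  then show "\<forall>h. smooth (\<lambda>x. frechet_derivative f (at x) h)" using assms(2) by simp
qed

text \<open>On the line, the derivative in direction \<open>h\<close> is \<open>h\<close> times the
  ordinary derivative; this is why the invariant \<open>P\<close> has to hold for all multiples of
  the derivative.\<close>

lemma smooth_real_coinduct:
  assumes "P f"
    and step: "\<And>f. P f \<Longrightarrow> \<exists>g. (\<forall>x. (f has_real_derivative g x) (at x)) \<and> (\<forall>c. P (\<lambda>x. c * g x))"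
  shows "smooth (f :: real \<Rightarrow> real)"
  using \<open>P f\<close>
proof (coinduction arbitrary: f rule: smooth.coinduct)
  case smooth
  obtain g where g: "\<And>x. (f has_real_derivative g x) (at x)" "\<And>c. P (\<lambda>x. c * g x)"
    using step[OF smooth] by blast
  have fd: "frechet_derivative f (at x) h = h * g x" for x h
    using frechet_derivative_at[OF g(1)[unfolded has_field_derivative_def]] by (metis mult.commute)
  have "\<forall>x. f differentiable (at x)" using g(1) real_differentiable_def by blast
  then show ?case using g(2) fd by auto
qed

lemma real_polynomial_function_has_derivative:
  assumes "real_polynomial_function p"
  shows "\<exists>p'. (\<forall>x. (p has_derivative p' x) (at x)) \<and> (\<forall>h. real_polynomial_function (\<lambda>x. p' x h))"
  using assms
proof (induction rule: real_polynomial_function.induct)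
  case (linear f)
  then show ?case
    by (intro exI[of _ "\<lambda>x. f"]) (auto intro: bounded_linear_imp_has_derivative)
next
  case (const c)
  then show ?case by (intro exI[of _ "\<lambda>x h. 0"]) auto
next
  case (add f g)
  then obtain f' g' where *: "\<And>x. (f has_derivative f' x) (at x)" "\<And>h. real_polynomial_function (\<lambda>x. f' x h)"
    "\<And>x. (g has_derivative g' x) (at x)" "\<And>h. real_polynomial_function (\<lambda>x. g' x h)" by blast
  then show ?case
    by (intro exI[of _ "\<lambda>x h. f' x h + g' x h"]) (auto intro!: has_derivative_add)
next
  case (mult f g)
  then obtain f' g' where *: "\<And>x. (f has_derivative f' x) (at x)" "\<And>h. real_polynomial_function (\<lambda>x. f' x h)"
    "\<And>x. (g has_derivative g' x) (at x)" "\<And>h. real_polynomial_function (\<lambda>x. g' x h)" by blast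
  then show ?case using mult(1,2)
    by (intro exI[of _ "\<lambda>x h. f x * g' x h + f' x h * g x"]) (auto intro!: has_derivative_mult real_polynomial_function.intros(3,4) *)
qed

lemma smooth_real_polynomial: "real_polynomial_function p \<Longrightarrow> smooth p"
proof (coinduction arbitrary: p rule: smooth.coinduct)
  case smooth
  then obtain p' where p': "\<And>x. (p has_derivative p' x) (at x)" "\<And>h. real_polynomial_function (\<lambda>x. p' x h)"
    using real_polynomial_function_has_derivative by blast
  have fd: "frechet_derivative p (at x) = p' x" for x
    using frechet_derivative_at[OF p'(1)] by simp
  have "\<forall>x. p differentiable (at x)" using p'(1) differentiable_def by blast
  then show ?case using p'(2) fd by auto
qed

text \<open>A coinduction invariant for \<open>smooth\<close> that contains all cutoffs used as test
  functions. It is closed under directional differentiation because the derivative of a composition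
  with a polynomial is again such a composition times a polynomial.\<close>

inductive smooth_algebra :: "('a::euclidean_space \<Rightarrow> real) \<Rightarrow> bool" where
  comp: "smooth u \<Longrightarrow> real_polynomial_function p \<Longrightarrow> smooth_algebra (\<lambda>x. u (p x :: real))"
| add: "smooth_algebra f \<Longrightarrow> smooth_algebra g \<Longrightarrow> smooth_algebra (\<lambda>x. f x + g x)"
| mult: "smooth_algebra f \<Longrightarrow> smooth_algebra g \<Longrightarrow> smooth_algebra (\<lambda>x. f x * g x)"

lemma smooth_algebra_polynomial: "real_polynomial_function p \<Longrightarrow> smooth_algebra p"
  using comp[of "\<lambda>x. x" p] smooth_real_polynomial[of "\<lambda>x::real. x"] by (auto intro: bounded_linear_ident)

lemma smooth_algebra_has_derivative:
  assumes "smooth_algebra f"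
  shows "\<exists>f'. (\<forall>x. (f has_derivative f' x) (at x)) \<and> (\<forall>h. smooth_algebra (\<lambda>x. f' x h))"
  using assms
proof (induction rule: smooth_algebra.induct)
  case (comp u p)
  obtain p' where p': "\<And>x. (p has_derivative p' x) (at x)" "\<And>h. real_polynomial_function (\<lambda>x. p' x h)"
    using real_polynomial_function_has_derivative[OF comp(2)] by blast
  define u' where "u' x = frechet_derivative u (at x) 1" for x
  have su': "smooth u'" unfolding u'_def by (rule smoothD(2)[OF comp(1)])
  have "(u has_derivative (\<lambda>h. h * u' x)) (at x)" for x
  proof -
    have d: "(u has_derivative frechet_derivative u (at x)) (at x)" by (rule smooth_has_derivative[OF comp(1)])
    have "frechet_derivative u (at x) h = h * u' x" for h
      using linear_cmul[OF has_derivative_linear[OF d], of h 1] by (simp add: u'_def)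
    with d show ?thesis by (metis (no_types, lifting) ext)
  qed
  from has_derivative_compose[OF p'(1) this]
  have "((\<lambda>x. u (p x)) has_derivative (\<lambda>h. p' x h * u' (p x))) (at x)" for x .
  then show ?case
    by (intro exI[of _ "\<lambda>x h. p' x h * u' (p x)"] conjI allI smooth_algebra.mult
        smooth_algebra_polynomial[OF p'(2)] smooth_algebra.comp[OF su' comp(2)])
next
  case (add f g)
  then obtain f' g' where *: "\<And>x. (f has_derivative f' x) (at x)" "\<And>h. smooth_algebra (\<lambda>x. f' x h)"
    "\<And>x. (g has_derivative g' x) (at x)" "\<And>h. smooth_algebra (\<lambda>x. g' x h)" by blast
  then show ?case
    by (intro exI[of _ "\<lambda>x h. f' x h + g' x h"]) (auto intro!: has_derivative_add smooth_algebra.add)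
next
  case (mult f g)
  then obtain f' g' where *: "\<And>x. (f has_derivative f' x) (at x)" "\<And>h. smooth_algebra (\<lambda>x. f' x h)"
    "\<And>x. (g has_derivative g' x) (at x)" "\<And>h. smooth_algebra (\<lambda>x. g' x h)" by blast
  then show ?case using mult(1,2)
    by (intro exI[of _ "\<lambda>x h. f x * g' x h + f' x h * g x"])
      (auto intro!: has_derivative_mult smooth_algebra.add smooth_algebra.mult)
qed

lemma smooth_smooth_algebra: "smooth_algebra f \<Longrightarrow> smooth f"
proof (coinduction arbitrary: f rule: smooth.coinduct)
  case smooth
  then obtain f' where f': "\<And>x. (f has_derivative f' x) (at x)" "\<And>h. smooth_algebra (\<lambda>x. f' x h)"
    using smooth_algebra_has_derivative by blast
  have fd: "frechet_derivative f (at x) = f' x" for x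
    using frechet_derivative_at[OF f'(1)] by simp
  have "\<forall>x. f differentiable (at x)" using f'(1) differentiable_def by blast
  then show ?case using f'(2) fd by auto
qed

lemma smooth_algebra_smooth: "smooth u \<Longrightarrow> smooth_algebra (u :: real \<Rightarrow> real)"
  using comp[of u "\<lambda>x. x"] by (auto intro: bounded_linear_ident)

section \<open>Smooth cutoff functions\<close>

definition exp_recip :: "real \<Rightarrow> real" where
  "exp_recip x = (if x > 0 then exp (- 1 / x) else 0)"

lemma tendsto_poly_recip_exp_recip: "((\<lambda>x. poly q (1 / x) * exp (- 1 / x)) \<longlongrightarrow> (0::real)) (at_right 0)"
proof -
  have "((\<lambda>s. poly q s * exp (- s)) \<longlongrightarrow> (0::real)) at_top"
  proof -
    have "((\<lambda>s. \<Sum>i\<le>degree q. coeff q i * (s ^ i / exp s)) \<longlongrightarrow> (\<Sum>i\<le>degree q. coeff q i * 0)) at_top"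
      by (intro tendsto_intros tendsto_power_div_exp_0)
    then show ?thesis by (simp add: poly_altdef sum_distrib_right exp_minus divide_inverse mult.assoc)
  qed
  from filterlim_compose[OF this filterlim_inverse_at_top_right]
  show ?thesis by (simp add: inverse_eq_divide)
qed

text \<open>The functions \<open>poly q (1 / x) * exp (- 1 / x)\<close>, continued by 0, are closed
  under differentiation: with s = 1/x the polynomial q(s) turns into s^2 (q(s) - q'(s)). At 0 the
  exponential beats every polynomial in 1/x, so all derivatives vanish there.\<close>

lemma smooth_exp_recip: "smooth exp_recip"
proof -
  define E where "E q x = (if x > 0 then poly q (1 / x) * exp (- 1 / x) else 0)" for q and x :: real
  define D where "D q = [:0, 0, 1:] * (q - pderiv q)" for q :: "real poly"
  have der: "(E q has_real_derivative E (D q) x) (at x)" for q x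
  proof (cases x "0::real" rule: linorder_cases)
    case less
    have "((\<lambda>x. 0) has_real_derivative E (D q) x) (at x)" using less by (auto simp: E_def)
    then show ?thesis
      by (rule DERIV_cong_ev[THEN iffD1, OF refl _ refl, rotated])
        (auto simp: E_def eventually_at_topological intro!: exI[of _ "{..<0}"] less
          eventually_nhds[THEN iffD2])
  next
    case greater
    have "((\<lambda>x. poly q (1 / x) * exp (- 1 / x)) has_real_derivative E (D q) x) (at x)"
      using greater by (auto intro!: derivative_eq_intros poly_DERIV[THEN DERIV_chain2] 
        simp: E_def D_def field_simps power2_eq_square)
    then show ?thesis
      by (rule DERIV_cong_ev[THEN iffD1, OF refl _ refl, rotated])
        (use greater in \<open>auto simp: E_def eventually_nhds intro!: exI[of _ "{0<..}"]\<close>)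
  next
    case equal
    have "((\<lambda>y. (E q y - E q 0) / (y - 0)) \<longlongrightarrow> 0) (at 0)"
    proof (rule filterlim_split_at)
      show "((\<lambda>y. (E q y - E q 0) / (y - 0)) \<longlongrightarrow> 0) (at_left 0)"
        by (rule tendsto_eventually) (auto simp: E_def eventually_at_filter)
      \<comment> \<open>Division by \<open>y\<close> in the difference quotient multiplies the
        polynomial in \<open>1 / y\<close> by its variable.\<close>
      have "((\<lambda>x. poly ([:0, 1:] * q) (1 / x) * exp (- 1 / x)) \<longlongrightarrow> 0) (at_right 0)"
        by (rule tendsto_poly_recip_exp_recip)
      then show "((\<lambda>y. (E q y - E q 0) / (y - 0)) \<longlongrightarrow> 0) (at_right 0)"
        by (rule Lim_transform_eventually) (auto simp: E_def eventually_at_filter)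
    qed
    then show ?thesis using equal by (simp add: has_field_derivative_iff E_def)
  qed
  have "smooth (E [:1:])"
  proof (rule smooth_real_coinduct[where P = "\<lambda>f. \<exists>q. f = E q"])
    fix f assume "\<exists>q. f = E q"
    then obtain q where q: "f = E q" by blast
    have "(\<lambda>x. c * E (D q) x) = E (smult c (D q))" for c by (auto simp: E_def fun_eq_iff)
    then show "\<exists>g. (\<forall>x. (f has_real_derivative g x) (at x)) \<and> (\<forall>c. \<exists>q. (\<lambda>x. c * g x) = E q)"
      using der q by blast
  qed blast
  moreover have "E [:1:] = exp_recip" by (auto simp: E_def exp_recip_def fun_eq_iff)
  ultimately show ?thesis by simp
qed

text \<open>For \<open>n \<longlongrightarrow> \<infinity>\<close> these converge boundedly to the indicator of \<open>{a<..<b}\<close>.\<close>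

definition bump :: "nat \<Rightarrow> real \<Rightarrow> real \<Rightarrow> real \<Rightarrow> real" where
  "bump n a b x = exp_recip (real n * (x - a)) * exp_recip (real n * (b - x))"

lemma real_polynomial_affine: "real_polynomial_function (\<lambda>x::real. c * (x - a))"
  by (intro real_polynomial_function.intros(4) real_polynomial_function.intros(2) real_polynomial_function_diff
      real_polynomial_function.intros(1) bounded_linear_ident)

lemma real_polynomial_affine': "real_polynomial_function (\<lambda>x::real. c * (a - x))"
  by (intro real_polynomial_function.intros(4) real_polynomial_function.intros(2) real_polynomial_function_diff
      real_polynomial_function.intros(1) bounded_linear_ident)

lemma smooth_bump: "smooth (bump n a b)"
  unfolding bump_def[abs_def]
  by (rule smooth_smooth_algebra[OF smooth_algebra.mult[OF
      smooth_algebra.comp[OF smooth_exp_recip real_polynomial_affine]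
      smooth_algebra.comp[OF smooth_exp_recip real_polynomial_affine']]])

lemma exp_recip_bounds: "0 \<le> exp_recip x" "exp_recip x \<le> 1"
  by (auto simp: exp_recip_def)

lemma bump_bounds: "0 \<le> bump n a b x" "bump n a b x \<le> 1"
  using exp_recip_bounds by (auto simp: bump_def intro!: mult_le_one)

lemma bump_eq_0: "x \<le> a \<or> b \<le> x \<Longrightarrow> bump n a b x = 0"
  by (auto simp: bump_def exp_recip_def zero_less_mult_iff)

lemma bump_pos: "a < x \<Longrightarrow> x < b \<Longrightarrow> 0 < n \<Longrightarrow> 0 < bump n a b x"
  by (auto simp: bump_def exp_recip_def zero_less_mult_iff)

lemma tendsto_bump: "(\<lambda>n. bump n a b x) \<longlonglongrightarrow> indicator {a<..<b} x"
proof -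
  have e: "(\<lambda>n. exp_recip (real n * y)) \<longlonglongrightarrow> 1" if "y > 0" for y
  proof -
    have "(\<lambda>n. exp (- (inverse y * inverse (real n)))) \<longlonglongrightarrow> exp (- (inverse y * 0))"
      by (intro tendsto_intros lim_inverse_n)
    then have "(\<lambda>n. exp (- (inverse y * inverse (real n)))) \<longlonglongrightarrow> 1" by simp
    then show ?thesis
    proof (rule Lim_transform_eventually)
      show "\<forall>\<^sub>F n in sequentially. exp (- (inverse y * inverse (real n))) = exp_recip (real n * y)"
        using eventually_gt_at_top[of 0]
        by eventually_elim (use that in \<open>auto simp: exp_recip_def field_simps\<close>)
    qed
  qed
  show ?thesis
  proof (cases "a < x \<and> x < b")
    case True
    then show ?thesis using tendsto_mult[OF e[of "x - a"] e[of "b - x"]] by (simp add: bump_def)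
  next
    case False
    then have "bump n a b x = 0" for n by (intro bump_eq_0) auto
    with False show ?thesis by simp
  qed
qed

lemma smooth_primitive:
  assumes "smooth k"
  obtains K where "\<And>x. (K has_real_derivative k x) (at x)" "smooth K" "K 0 = 0"
proof -
  define K where "K x = (LBINT y=0..ereal x. k y)" for x
  have ck: "continuous_on S k" for S using smooth_continuous_on[OF assms] .
  have d: "(K has_real_derivative k x) (at x)" for x
  proof -
    \<comment> \<open>The interval contains 0 and has \<open>x\<close> in its interior, so the
      derivative within it is a full derivative.\<close>
    have "((\<lambda>u. LBINT y=0..ereal u. k y) has_vector_derivative k x) (at x within {-\<bar>x\<bar>-1..\<bar>x\<bar>+1})"
      using interval_integral_FTC2[of "-\<bar>x\<bar>-1" 0 "\<bar>x\<bar>+1" k x] ck by (auto simp: zero_ereal_def)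
    moreover have "at x within {-\<bar>x\<bar>-1..\<bar>x\<bar>+1} = at x" by (intro at_within_Icc_at) auto
    ultimately show ?thesis unfolding K_def by (simp add: has_real_derivative_iff_has_vector_derivative)
  qed
  moreover have "smooth K"
  proof (rule smooth_real_intro[OF d])
    show "smooth (\<lambda>x. c * k x)" for c
      by (rule smooth_smooth_algebra[OF smooth_algebra.mult[OF
          smooth_algebra_polynomial[OF real_polynomial_function.intros(2)] smooth_algebra_smooth[OF assms]]])
  qed
  moreover have "K 0 = 0" by (simp add: K_def zero_ereal_def)
  ultimately show ?thesis using that by blast
qed

subsection \<open>Weak derivatives\<close>

lemma test_functionD:
  assumes "\<phi> \<in> test_functions"
  shows "smooth \<phi>" "\<phi> 0 = 0" "\<phi> 1 = 0" "ac \<phi> (deriv \<phi>)" "(\<phi> has_real_derivative deriv \<phi> x) (at x)"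
    "continuous_on S (deriv \<phi>)"
proof -
  show s: "smooth \<phi>" using assms by (simp add: test_functions_def)
  have "{x. \<phi> x \<noteq> 0} \<subseteq> {0<..<1}"
    using assms closure_subset[of "{x. \<phi> x \<noteq> 0}"] unfolding test_functions_def by blast
  then have "0 \<notin> {x. \<phi> x \<noteq> 0}" "1 \<notin> {x. \<phi> x \<noteq> 0}" by auto
  then show "\<phi> 0 = 0" "\<phi> 1 = 0" by auto
  have d: "(\<phi> has_real_derivative deriv \<phi> x) (at x)" for x
    using smoothD(1)[OF s] by (simp add: DERIV_deriv_iff_real_differentiable)
  then show "(\<phi> has_real_derivative deriv \<phi> x) (at x)" .
  have "deriv \<phi> = (\<lambda>x. frechet_derivative \<phi> (at x) 1)"
    using frechet_derivative_at[OF d[unfolded has_field_derivative_def]] by (metis mult.right_neutral)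
  then show c: "continuous_on S (deriv \<phi>)" for S
    using smooth_continuous_on[OF smoothD(2)[OF s, of 1]] by simp
  show "ac \<phi> (deriv \<phi>)" by (rule ac_of_continuous_derivative[OF d c])
qed

lemma integrable_continuous_mult:
  assumes k: "continuous_on {0..1} k" and h: "integrable unit_ivl (h :: real \<Rightarrow> real)"
  shows "integrable unit_ivl (\<lambda>t. k t * h t)"
proof -
  obtain C where C: "\<And>t. t \<in> {0..1} \<Longrightarrow> \<bar>k t\<bar> \<le> C"
    using compact_imp_bounded[OF compact_continuous_image[OF k compact_Icc]]
    by (fastforce simp: bounded_iff)
  have C0: "0 \<le> C" using C[of 0] by (metis abs_ge_zero atLeastAtMost_iff order_refl order_trans zero_le_one)
  show ?thesis
  proof (rule Bochner_Integration.integrable_bound[of _ "\<lambda>t. C * h t"])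
    show "AE x in unit_ivl. norm (k x * h x) \<le> norm (C * h x)"
      by (rule AE_unit_ivlI) (use C C0 in \<open>auto simp: abs_mult intro!: mult_right_mono\<close>)
  qed (use h integrable_continuous_unit_ivl[OF k] in auto)
qed

text \<open>Integration by parts, with boundary terms killed by the test function. The absolutely
  continuous \<open>U\<close> is kept apart from \<open>u\<close>, which is only one of its
  almost-everywhere representatives.\<close>

lemma ac_imp_weak_deriv:
  assumes a: "ac U g" and g: "g \<in> L2 unit_ivl" and u: "u \<in> borel_measurable unit_ivl"
    and eq: "AE x in unit_ivl. u x = U x"
  shows "weak_deriv u g"
  unfolding weak_deriv_def
proof (intro conjI ballI g)
  note [measurable] = u
  have [measurable]: "U \<in> borel_measurable unit_ivl" by (rule ac_borel_measurable[OF a])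
  have "integrable unit_ivl (\<lambda>x. (U x)\<^sup>2)"
    by (rule integrable_continuous_unit_ivl) (intro continuous_intros ac_continuous_on[OF a])
  then have "integrable unit_ivl (\<lambda>x. (u x)\<^sup>2)"
    by (rule integrable_cong_AE_imp) (use eq in \<open>auto elim!: eventually_mono\<close>)
  then show "u \<in> L2 unit_ivl" using u by (simp add: L2_def)
  fix \<phi> assume "\<phi> \<in> test_functions"
  note \<phi> = test_functionD[OF this]
  have [measurable]: "deriv \<phi> \<in> borel_measurable unit_ivl"
    using integrable_continuous_unit_ivl[OF \<phi>(6)] by auto
  have "(\<integral>x. u x * deriv \<phi> x \<partial>unit_ivl) = (\<integral>x. U x * deriv \<phi> x \<partial>unit_ivl)"
    by (rule integral_cong_AE) (use eq in \<open>auto elim!: eventually_mono\<close>)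
  moreover have "(\<integral>x. \<phi> x * g x + U x * deriv \<phi> x \<partial>unit_ivl) = 0"
    using ac_by_parts[OF a \<phi>(4)] \<phi> by simp
  moreover have "integrable unit_ivl (\<lambda>x. \<phi> x * g x)"
    by (rule integrable_continuous_mult[OF ac_continuous_on[OF \<phi>(4)] acD(1)[OF a]])
  moreover have "integrable unit_ivl (\<lambda>x. U x * deriv \<phi> x)"
    by (rule integrable_continuous_mult[OF ac_continuous_on[OF a] acD(1)[OF \<phi>(4)]])
  ultimately show "(\<integral>x. u x * deriv \<phi> x \<partial>unit_ivl) = - (\<integral>x. g x * \<phi> x \<partial>unit_ivl)"
    by (simp add: mult.commute)
qed

lemma const_if_deriv_zero:
  fixes K :: "real \<Rightarrow> real"
  assumes "\<And>z. min x y < z \<Longrightarrow> z < max x y \<Longrightarrow> k z = 0" "\<And>x. (K has_real_derivative k x) (at x)"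
  shows "K x = K y"
proof -
  have *: "K t = K s" if "s < t" "\<And>z. s < z \<Longrightarrow> z < t \<Longrightarrow> k z = 0" for s t
  proof (rule DERIV_isconst_end[OF that(1)])
    show "continuous_on {s..t} K"
      by (meson DERIV_isCont assms(2) continuous_at_imp_continuous_on)
    show "(K has_real_derivative 0) (at z)" if "s < z" "z < t" for z
      using assms(2)[of z] \<open>\<And>z. s < z \<Longrightarrow> z < t \<Longrightarrow> k z = 0\<close>[OF that] by simp
  qed
  show ?thesis
    using *[of x y] *[of y x] assms(1) by (cases x y rule: linorder_cases) auto
qed

text \<open>Test with a bump corrected to have mean zero (du Bois-Reymond).\<close>

lemma AE_const_if_weak_deriv_zero:
  assumes h: "integrable unit_ivl h"
    and orth: "\<And>\<phi>. \<phi> \<in> test_functions \<Longrightarrow> (\<integral>x. h x * deriv \<phi> x \<partial>unit_ivl) = 0"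
  obtains c where "AE x in unit_ivl. h x = (c::real)"
proof -
  have [measurable]: "h \<in> borel_measurable unit_ivl" using h by auto
  have cb: "continuous_on S (bump n a b)" for n a b S by (rule smooth_continuous_on[OF smooth_bump])
  have ib: "integrable unit_ivl (bump n a b)" for n a b by (rule integrable_continuous_unit_ivl[OF cb])
  have ihb: "integrable unit_ivl (\<lambda>x. h x * bump n a b x)" for n a b
    using integrable_continuous_mult[OF cb h] by (simp add: mult.commute)
  define \<theta> where "\<theta> = bump 1 (1/4) (3/4)"
  have I\<theta>: "(\<integral>x. \<theta> x \<partial>unit_ivl) > 0"
  proof -
    have "(\<integral>x. \<theta> x \<partial>unit_ivl) \<noteq> 0"
    proof
      assume "(\<integral>x. \<theta> x \<partial>unit_ivl) = 0"
      then have "AE x in unit_ivl. \<theta> x = 0"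
        by (subst (asm) integral_nonneg_eq_0_iff_AE) (auto simp: \<theta>_def ib bump_bounds)
      then obtain x where "1/4 < x" "x < 3/4" "\<theta> x = 0" by (rule AE_unit_ivl_dense[of _ "1/4" "3/4"]) auto
      then show False using bump_pos[of "1/4" x "3/4" 1] by (simp add: \<theta>_def)
    qed
    moreover have "0 \<le> (\<integral>x. \<theta> x \<partial>unit_ivl)" by (simp add: \<theta>_def bump_bounds)
    ultimately show ?thesis by simp
  qed
  define c where "c = (\<integral>x. h x * \<theta> x \<partial>unit_ivl) / (\<integral>x. \<theta> x \<partial>unit_ivl)"
  have test: "(\<integral>x. h x * bump n a b x \<partial>unit_ivl) = c * (\<integral>x. bump n a b x \<partial>unit_ivl)"
    if ab: "0 < a" "a < b" "b < 1" for n a b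
  proof -
    define I where "I = (\<integral>x. bump n a b x \<partial>unit_ivl)"
    \<comment> \<open>This multiple of \<open>\<theta>\<close> gives \<open>k\<close> mean zero, so
      that its primitive \<open>K\<close> vanishes on both sides of \<open>{lo..hi}\<close> and is a
      test function with derivative \<open>k\<close>.\<close>
    define d where "d = I / (\<integral>x. \<theta> x \<partial>unit_ivl)"
    define k where "k x = bump n a b x + (- d) * \<theta> x" for x
    have sk: "smooth k" unfolding k_def[abs_def] \<theta>_def
      by (rule smooth_smooth_algebra[OF smooth_algebra.add[OF smooth_algebra_smooth[OF smooth_bump]
         smooth_algebra.mult[OF smooth_algebra_polynomial[OF real_polynomial_function.intros(2)]
           smooth_algebra_smooth[OF smooth_bump]]]])
    obtain K where K: "\<And>x. (K has_real_derivative k x) (at x)" "smooth K" "K 0 = 0"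
      using smooth_primitive[OF sk] by blast
    define lo hi where "lo = min a (1/4)" and "hi = max b (3/4)"
    have k0: "k x = 0" if "x \<le> lo \<or> hi \<le> x" for x
      using that unfolding k_def \<theta>_def lo_def hi_def by (auto simp: bump_eq_0)
    have lh: "0 < lo" "hi < 1" "lo < hi" using ab by (auto simp: lo_def hi_def)
    have "ac K k" by (rule ac_of_continuous_derivative[OF K(1) smooth_continuous_on[OF sk]])
    from acD(2)[OF this, of 1] have "K 1 = (\<integral>x. k x \<partial>unit_ivl)" by (simp add: K(3) pint_ge_1)
    also have "\<dots> = I + (- d) * (\<integral>x. \<theta> x \<partial>unit_ivl)"
      unfolding k_def I_def using ib by (simp add: \<theta>_def)
    also have "\<dots> = 0" using I\<theta> by (simp add: d_def)
    finally have K1: "K 1 = 0" .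
    have K0: "K x = 0" if "x \<le> lo" for x
      by (rule trans[OF const_if_deriv_zero[OF k0 K(1)] K(3)]) (use that lh in auto)
    have K1': "K x = 0" if "hi \<le> x" for x
      by (rule trans[OF const_if_deriv_zero[OF k0 K(1)] K1]) (use that lh in auto)
    have "{x. K x \<noteq> 0} \<subseteq> {lo..hi}"
    proof
      fix x assume "x \<in> {x. K x \<noteq> 0}"
      then show "x \<in> {lo..hi}" using K0[of x] K1'[of x] by (cases "x \<le> lo"; cases "hi \<le> x") auto
    qed
    then have "closure {x. K x \<noteq> 0} \<subseteq> {lo..hi}" by (rule closure_minimal) simp
    then have "K \<in> test_functions" using K(2) lh by (auto simp: test_functions_def)
    from orth[OF this] have "(\<integral>x. h x * k x \<partial>unit_ivl) = 0"
      using DERIV_imp_deriv[OF K(1)] by simp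
    also have "(\<integral>x. h x * k x \<partial>unit_ivl) = (\<integral>x. h x * bump n a b x + (-d) * (h x * \<theta> x) \<partial>unit_ivl)"
      by (rule Bochner_Integration.integral_cong) (auto simp: k_def algebra_simps)
    also have "\<dots> = (\<integral>x. h x * bump n a b x \<partial>unit_ivl) + (-d) * (\<integral>x. h x * \<theta> x \<partial>unit_ivl)"
      using ihb by (simp add: \<theta>_def)
    finally show ?thesis unfolding c_def d_def I_def by simp
  qed
  define h' where "h' x = h x - c" for x
  have h': "integrable unit_ivl h'" unfolding h'_def using h by simp
  \<comment> \<open>As the bumps tend to the indicator of the interval, the primitive of
    \<open>h'\<close> is seen to have no increment between interior points; continuity then covers
    the endpoints.\<close>
  have seg: "pint h' y = pint h' x" if xy: "0 < x" "x < y" "y < 1" for x y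
  proof -
    have "(\<lambda>n. \<integral>s. h' s * bump n x y s \<partial>unit_ivl) \<longlonglongrightarrow> (\<integral>s. h' s * indicator {x<..<y} s \<partial>unit_ivl)"
    proof (rule integral_dominated_convergence[where w = "\<lambda>s. \<bar>h' s\<bar>"])
      show "AE s in unit_ivl. (\<lambda>n. h' s * bump n x y s) \<longlonglongrightarrow> h' s * indicator {x<..<y} s"
        by (intro AE_I2 tendsto_intros tendsto_bump)
      show "AE s in unit_ivl. norm (h' s * bump n x y s) \<le> \<bar>h' s\<bar>" for n
        using mult_left_mono[OF bump_bounds(2)] by (auto simp: abs_mult bump_bounds)
    qed (use h' ib in auto)
    moreover have "(\<integral>s. h' s * bump n x y s \<partial>unit_ivl) = 0" for n
      unfolding h'_def left_diff_distrib
      by (subst Bochner_Integration.integral_diff) (auto simp: ihb ib test[OF xy])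
    ultimately have "(\<integral>s. h' s * indicator {x<..<y} s \<partial>unit_ivl) = 0" by (simp add: LIMSEQ_const_iff)
    also have "(\<integral>s. h' s * indicator {x<..<y} s \<partial>unit_ivl) = (\<integral>s. indicator {x<..y} s * h' s \<partial>unit_ivl)"
    proof (rule integral_cong_AE)
      show "AE s in unit_ivl. h' s * indicator {x<..<y} s = indicator {x<..y} s * h' s"
        using AE_unit_ivl_neq[of y] by eventually_elim (auto simp: indicator_def)
    qed (use h' in auto)
    finally show ?thesis using pint_diff_points[OF h', of x y] xy by simp
  qed
  have cont: "continuous_on {0..1} (pint h')" by (rule continuous_on_pint[OF h'])
  have c: "pint h' x = pint h' (1/2)" if "x \<in> {0..1}" for x
  proof (rule continuous_constant_on_closure[of "{0<..<1}" "pint h'" "pint h' (1/2)"])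
    show "pint h' x = pint h' (1/2)" if "x \<in> {0<..<1}" for x
    proof (cases x "1/2::real" rule: linorder_cases)
      case equal
      show ?thesis unfolding equal ..
    qed (use seg[of x "1/2"] seg[of "1/2" x] that in auto)
  qed (use cont that in auto)
  have "AE x in unit_ivl. h' x = 0"
  proof (rule AE_zero_if_pint_zero[OF h'])
    show "pint h' x = 0" if "0 \<le> x" "x \<le> 1" for x
      using c[of x] c[of 0] that by simp
  qed
  then show ?thesis by (intro that[of c]) (auto simp: h'_def)
qed

text \<open>The difference of \<open>u\<close> and the primitive of \<open>g\<close> has weak
  derivative zero, hence is almost everywhere constant.\<close>

lemma weak_deriv_imp_ac:
  assumes "weak_deriv u g"
  obtains c where "AE x in unit_ivl. u x = c + pint g x" "ac (\<lambda>x. c + pint g x) g"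
proof -
  have u: "u \<in> L2 unit_ivl" and g: "g \<in> L2 unit_ivl" and
    w: "\<And>\<phi>. \<phi> \<in> test_functions \<Longrightarrow> (\<integral>x. u x * deriv \<phi> x \<partial>unit_ivl) = - (\<integral>x. g x * \<phi> x \<partial>unit_ivl)"
    using assms unfolding weak_deriv_def by auto
  note iu = L2_unit_ivlD(3)[OF u] and ig = L2_unit_ivlD(3)[OF g]
  have a: "ac (pint g) g" by (rule ac_pint[OF ig])
  have ip: "integrable unit_ivl (pint g)" by (intro integrable_continuous_unit_ivl continuous_on_pint ig)
  have "integrable unit_ivl (\<lambda>x. u x - pint g x)" using iu ip by simp
  then obtain c where "AE x in unit_ivl. u x - pint g x = c"
  proof (rule AE_const_if_weak_deriv_zero)
    fix \<phi> assume t: "\<phi> \<in> test_functions"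
    note \<phi> = test_functionD[OF t]
    have 1: "(\<integral>x. \<phi> x * g x + pint g x * deriv \<phi> x \<partial>unit_ivl) = 0"
      using ac_by_parts[OF a \<phi>(4)] \<phi> by simp
    have i1: "integrable unit_ivl (\<lambda>x. \<phi> x * g x)"
      by (rule integrable_continuous_mult[OF ac_continuous_on[OF \<phi>(4)] ig])
    have i2: "integrable unit_ivl (\<lambda>x. pint g x * deriv \<phi> x)"
      by (rule integrable_continuous_mult[OF ac_continuous_on[OF a] acD(1)[OF \<phi>(4)]])
    have i3: "integrable unit_ivl (\<lambda>x. u x * deriv \<phi> x)"
      using integrable_continuous_mult[OF \<phi>(6) iu] by (simp add: mult.commute)
    show "(\<integral>x. (u x - pint g x) * deriv \<phi> x \<partial>unit_ivl) = 0"
      unfolding left_diff_distrib using 1 i1 i2 i3 w[OF t] by (simp add: mult.commute)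
  qed
  then have "AE x in unit_ivl. u x = c + pint g x" by eventually_elim auto
  moreover have "ac (\<lambda>x. c + pint g x) g" using ac_add[OF ac_const[of c] a] by simp
  ultimately show ?thesis using that by blast
qed

lemma weak_derivD:
  assumes "weak_deriv u g"
  shows "u \<in> L2 unit_ivl" "g \<in> L2 unit_ivl"
  using assms unfolding weak_deriv_def by auto

text \<open>If the difference were nonzero at \<open>x\<close>, it would be nonzero on a whole
  interval, which meets every set of full measure.\<close>

lemma AE_eq_imp_eq_continuous:
  fixes u v :: "real \<Rightarrow> real"
  assumes "AE x in unit_ivl. u x = v x" "continuous_on {0..1} u" "continuous_on {0..1} v" "x \<in> {0..1}"
  shows "u x = v x"
proof -
  define d where "d x = u x - v x" for x
  have d: "continuous_on {0..1} d" unfolding d_def by (intro continuous_intros assms)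
  have "d x = 0"
  proof (rule ccontr)
    assume ne: "d x \<noteq> 0"
    obtain e where e: "e > 0" "\<And>y. y \<in> {0..1} \<Longrightarrow> dist y x < e \<Longrightarrow> dist (d y) (d x) < \<bar>d x\<bar>"
      using d \<open>x \<in> {0..1}\<close> ne unfolding continuous_on_iff by (metis zero_less_abs_iff)
    have "max 0 (x - e) < min 1 (x + e)" using e(1) assms(4) by auto
    with assms(1) obtain y where y: "max 0 (x - e) < y" "y < min 1 (x + e)" "u y = v y"
      by (rule AE_unit_ivl_dense[of _ "max 0 (x - e)" "min 1 (x + e)"]) auto
    have "dist (d y) (d x) < \<bar>d x\<bar>" using y by (intro e(2)) (auto simp: dist_real_def)
    then show False using y(3) by (simp add: d_def dist_real_def)
  qed
  then show ?thesis by (simp add: d_def)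
qed

text \<open>The two primitives are continuous and agree almost everywhere, hence everywhere, and a
  primitive determines its density up to a null set.\<close>

lemma weak_deriv_unique:
  assumes "weak_deriv u g" "weak_deriv u' g'" "AE x in unit_ivl. u x = u' x"
  shows "AE x in unit_ivl. g x = g' x"
proof -
  obtain c where c: "AE x in unit_ivl. u x = c + pint g x" "ac (\<lambda>x. c + pint g x) g"
    using weak_deriv_imp_ac[OF assms(1)] by blast
  obtain c' where c': "AE x in unit_ivl. u' x = c' + pint g' x" "ac (\<lambda>x. c' + pint g' x) g'"
    using weak_deriv_imp_ac[OF assms(2)] by blast
  note i = acD(1)[OF c(2)] acD(1)[OF c'(2)]
  have "AE x in unit_ivl. c + pint g x = c' + pint g' x"
    using c(1) c'(1) assms(3) by eventually_elim auto
  then have eq: "c + pint g x = c' + pint g' x" if "x \<in> {0..1}" for x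
    using AE_eq_imp_eq_continuous[OF _ ac_continuous_on[OF c(2)] ac_continuous_on[OF c'(2)] that] by blast
  have "AE x in unit_ivl. g x - g' x = 0"
  proof (rule AE_zero_if_pint_zero)
    fix x :: real assume "0 \<le> x" "x \<le> 1"
    then show "pint (\<lambda>x. g x - g' x) x = 0" using eq[of x] eq[of 0] i by (simp add: pint_diff)
  qed (use i in auto)
  then show ?thesis by simp
qed

lemma H1_weak_deriv: "u \<in> H1 \<Longrightarrow> weak_deriv u (wD u)"
  unfolding H1_def wD_def by (auto simp: some_eq_ex)

lemma weak_deriv_H1: "weak_deriv u g \<Longrightarrow> u \<in> H1"
  unfolding H1_def by auto

text \<open>\<open>wD\<close> is an unspecified choice; uniqueness makes its norm computable from
  any weak derivative at hand.\<close>

lemma L2_norm_wD: "weak_deriv u g \<Longrightarrow> L2_norm (wD u) = L2_norm g"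
  using weak_deriv_unique[of u "wD u" u g] weak_derivD[of u g] weak_derivD[of u "wD u"]
    H1_weak_deriv[OF weak_deriv_H1, of u g]
  by (intro L2_norm_cong_AE) (auto dest: L2_unit_ivlD(1))

lemma weak_deriv_diff:
  assumes "weak_deriv u g" "weak_deriv v h"
  shows "weak_deriv (\<lambda>x. u x - v x) (\<lambda>x. g x - h x)"
proof -
  obtain c where c: "AE x in unit_ivl. u x = c + pint g x" "ac (\<lambda>x. c + pint g x) g"
    using weak_deriv_imp_ac[OF assms(1)] by blast
  obtain d where d: "AE x in unit_ivl. v x = d + pint h x" "ac (\<lambda>x. d + pint h x) h"
    using weak_deriv_imp_ac[OF assms(2)] by blast
  note m = weak_derivD[OF assms(1)] weak_derivD[OF assms(2)]
  note [measurable] = m[THEN L2_unit_ivlD(1)]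
  have sq: "(x - y)\<^sup>2 \<le> 2 * x\<^sup>2 + 2 * y\<^sup>2" for x y :: real
    using zero_le_power2[of "x + y"] by (simp add: power2_eq_square algebra_simps)
  have "integrable unit_ivl (\<lambda>x. (g x - h x)\<^sup>2)"
    by (rule Bochner_Integration.integrable_bound[of _ "\<lambda>x. 2 * (g x)\<^sup>2 + 2 * (h x)\<^sup>2"])
      (use m[THEN L2_unit_ivlD(2)] sq in auto)
  then have "(\<lambda>x. g x - h x) \<in> L2 unit_ivl" unfolding L2_def by simp
  then show ?thesis
    by (rule ac_imp_weak_deriv[OF ac_diff[OF c(2) d(2)]]) (use c d in auto)
qed

lemma weak_deriv_test: "\<phi> \<in> test_functions \<Longrightarrow> weak_deriv \<phi> (deriv \<phi>)"
proof (rule ac_imp_weak_deriv)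
  assume "\<phi> \<in> test_functions"
  note \<phi> = test_functionD[OF this]
  show "ac \<phi> (deriv \<phi>)" by (rule \<phi>)
  show "\<phi> \<in> borel_measurable unit_ivl" by (rule ac_borel_measurable[OF \<phi>(4)])
  show "deriv \<phi> \<in> L2 unit_ivl"
    using integrable_continuous_unit_ivl[of "deriv \<phi>"] integrable_continuous_unit_ivl[of "\<lambda>x. (deriv \<phi> x)\<^sup>2"] \<phi>(6)
    by (auto simp: L2_def intro!: continuous_intros)
qed auto

lemma L2_norm_le_H1_norm: "L2_norm u \<le> H1_norm u" "L2_norm (wD u) \<le> H1_norm u"
  unfolding H1_norm_def by auto

lemma L2_continuous: "continuous_on {0..1} u \<Longrightarrow> u \<in> L2 unit_ivl"
  using integrable_continuous_unit_ivl[of u] integrable_continuous_unit_ivl[of "\<lambda>x. (u x)\<^sup>2"]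
  by (auto simp: L2_def intro!: continuous_intros)

text \<open>The Sobolev embedding on the unit interval: average the bound of
  \<open>\<bar>u x\<bar>\<close> by \<open>\<bar>u y\<bar>\<close> plus the total variation over all
  \<open>y\<close>, and estimate the L^1 norms by L^2 norms.\<close>

lemma abs_le_L2_norms:
  assumes a: "ac u g" and g: "g \<in> L2 unit_ivl" and x: "0 \<le> x" "x \<le> 1"
  shows "\<bar>u x\<bar> \<le> L2_norm u + L2_norm g"
proof -
  note u = L2_continuous[OF ac_continuous_on[OF a]]
  have ig: "integrable unit_ivl (\<lambda>y. \<bar>g y\<bar>)" using acD(1)[OF a] by simp
  have "\<bar>u x\<bar> = (\<integral>y. \<bar>u x\<bar> \<partial>unit_ivl)" by simp
  also have "\<dots> \<le> (\<integral>y. \<bar>u y\<bar> + (\<integral>s. \<bar>g s\<bar> \<partial>unit_ivl) \<partial>unit_ivl)"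
  proof (rule integral_mono_unit_ivl)
    fix y :: real assume y: "0 < y" "y < 1"
    have "\<bar>u x - u y\<bar> \<le> (\<integral>s. \<bar>g s\<bar> \<partial>unit_ivl)"
    proof -
      have *: "\<bar>u s - u r\<bar> \<le> (\<integral>s. \<bar>g s\<bar> \<partial>unit_ivl)" if "0 \<le> r" "r \<le> s" "s \<le> 1" for r s
      proof -
        have "\<bar>u s - u r\<bar> \<le> pint (\<lambda>s. \<bar>g s\<bar>) s - pint (\<lambda>s. \<bar>g s\<bar>) r"
          unfolding ac_diff_points[OF a that] by (rule abs_pint_diff_le) (use ig acD(1)[OF a] that in auto)
        also have "\<dots> \<le> (\<integral>s. \<bar>g s\<bar> \<partial>unit_ivl)"
          using abs_pint_le[OF ig, of s] pint_mono[OF ig, of 0 r] that by simp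
        finally show ?thesis .
      qed
      show ?thesis using *[of x y] *[of y x] x y by (cases "x \<le> y") auto
    qed
    then show "\<bar>u x\<bar> \<le> \<bar>u y\<bar> + (\<integral>s. \<bar>g s\<bar> \<partial>unit_ivl)" by linarith
  qed (use L2_unit_ivlD(3)[OF u] in auto)
  also have "\<dots> = (\<integral>y. \<bar>u y\<bar> \<partial>unit_ivl) + (\<integral>s. \<bar>g s\<bar> \<partial>unit_ivl)"
    using L2_unit_ivlD(3)[OF u] by simp
  also have "\<dots> \<le> L2_norm u + L2_norm g" using L2_unit_ivlD(4)[OF u] L2_unit_ivlD(4)[OF g] by simp
  finally show ?thesis .
qed

text \<open>By the Sobolev embedding, boundary values depend continuously on the H^1 norm, and those
  of test functions are zero.\<close>

lemma H10_boundary: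
  assumes u: "u \<in> H10" and w: "weak_deriv u g" and eq: "AE x in unit_ivl. u x = U x" and a: "ac U g"
  shows "U 0 = 0" "U 1 = 0"
proof -
  have small: "\<bar>U x\<bar> \<le> e" if e: "e > 0" and x: "x = 0 \<or> x = 1" for e x
  proof -
    obtain \<phi> where t: "\<phi> \<in> test_functions" and n: "H1_norm (\<lambda>x. u x - \<phi> x) < e / 2"
      using u half_gt_zero[OF e] unfolding H10_def by blast
    note \<phi> = test_functionD[OF t]
    have wd: "weak_deriv (\<lambda>x. u x - \<phi> x) (\<lambda>x. g x - deriv \<phi> x)"
      by (rule weak_deriv_diff[OF w weak_deriv_test[OF t]])
    have ad: "ac (\<lambda>x. U x - \<phi> x) (\<lambda>x. g x - deriv \<phi> x)" by (rule ac_diff[OF a \<phi>(4)])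
    have "L2_norm (\<lambda>x. U x - \<phi> x) = L2_norm (\<lambda>x. u x - \<phi> x)"
      by (rule L2_norm_cong_AE)
        (use eq ac_borel_measurable[OF ad] L2_unit_ivlD(1)[OF weak_derivD(1)[OF wd]] in auto)
    then have "\<bar>U x - \<phi> x\<bar> \<le> L2_norm (\<lambda>x. u x - \<phi> x) + L2_norm (\<lambda>x. g x - deriv \<phi> x)"
      using abs_le_L2_norms[OF ad weak_derivD(2)[OF wd], of x] x by auto
    also have "\<dots> \<le> H1_norm (\<lambda>x. u x - \<phi> x) + H1_norm (\<lambda>x. u x - \<phi> x)"
      using L2_norm_le_H1_norm[of "\<lambda>x. u x - \<phi> x"] L2_norm_wD[OF wd] by simp
    finally show ?thesis using n x \<phi> by auto
  qed
  show "U 0 = 0" "U 1 = 0"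
    using small[of "\<bar>U 0\<bar> / 2" 0] small[of "\<bar>U 1\<bar> / 2" 1] by (auto simp: field_simps)
qed

lemma borel_measurable_compose2:
  fixes F :: "real \<Rightarrow> real \<Rightarrow> real"
  assumes "(\<lambda>p. F (fst p) (snd p)) \<in> borel_measurable borel"
    and [measurable]: "a \<in> borel_measurable M" "b \<in> borel_measurable M"
  shows "(\<lambda>y. F (a y) (b y)) \<in> borel_measurable M"
proof -
  have "(\<lambda>y. (a y, b y)) \<in> measurable M borel" by measurable
  from measurable_compose[OF this assms(1)] show ?thesis by simp
qed

lemma pint_const: "pint (\<lambda>_. c) x = c * max 0 (min 1 x)"
proof -
  have a: "ac (\<lambda>t. c * t) (\<lambda>_. c)"
    by (rule ac_of_continuous_derivative) (auto intro!: derivative_eq_intros)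
  consider "x \<le> 0" | "1 \<le> x" | "0 \<le> x" "x \<le> 1" by linarith
  then show ?thesis
    by cases (use acD(2)[OF a, of x] in \<open>auto simp: pint_ge_1\<close>)
qed

lemma DERIV_pint:
  assumes g: "integrable unit_ivl g" and x: "0 < x" "x < 1" and c: "isCont g x"
  shows "(pint g has_real_derivative g x) (at x)"
  unfolding has_field_derivative_iff
proof (rule tendstoI)
  fix e :: real assume e: "e > 0"
  obtain d where d: "d > 0" "\<And>y. \<bar>y - x\<bar> < d \<Longrightarrow> \<bar>g y - g x\<bar> < e / 2"
    using c half_gt_zero[OF e] unfolding continuous_at_eps_delta dist_real_def by blast
  define d' where "d' = min d (min x (1 - x))"
  have d': "d' > 0" using d x by (simp add: d'_def)
  have B: "\<bar>pint g b - pint g a - g x * (b - a)\<bar> \<le> e / 2 * (b - a)"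
    if "a \<le> b" "\<bar>a - x\<bar> < d'" "\<bar>b - x\<bar> < d'" for a b
  proof -
    have ab: "0 \<le> a" "b \<le> 1" using that by (auto simp: d'_def)
    have "\<bar>pint (\<lambda>s. g s - g x) b - pint (\<lambda>s. g s - g x) a\<bar> \<le> pint (\<lambda>_. e / 2) b - pint (\<lambda>_. e / 2) a"
    proof (rule abs_pint_diff_le)
      fix s assume "a < s" "s \<le> b"
      then have "\<bar>s - x\<bar> < d" using that by (auto simp: d'_def)
      then show "\<bar>g s - g x\<bar> \<le> e / 2" using d(2) by (auto intro: less_imp_le)
    qed (use g that in auto)
    then show ?thesis using g ab \<open>a \<le> b\<close> by (simp add: pint_diff pint_const algebra_simps diff_divide_distrib)
  qed
  show "\<forall>\<^sub>F y in at x. dist ((pint g y - pint g x) / (y - x)) (g x) < e"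
    unfolding eventually_at
  proof (intro exI[of _ d'] conjI d' ballI impI)
    fix y assume y: "y \<noteq> x \<and> dist y x < d'"
    have "\<bar>pint g y - pint g x - g x * (y - x)\<bar> \<le> e / 2 * \<bar>y - x\<bar>"
    proof (cases "x \<le> y")
      case True
      then show ?thesis using B[of x y] y d' by (simp add: dist_real_def)
    next
      case False
      then have "\<bar>pint g x - pint g y - g x * (x - y)\<bar> \<le> e / 2 * (x - y)"
        using B[of y x] y d' by (simp add: dist_real_def)
      moreover have "pint g x - pint g y - g x * (x - y) = - (pint g y - pint g x - g x * (y - x))"
        by (simp add: algebra_simps)
      ultimately show ?thesis using False by (simp only: abs_minus_cancel) simp
    qed
    also have "\<dots> < e * \<bar>y - x\<bar>" using y e by simp
    finally have "\<bar>pint g y - pint g x - g x * (y - x)\<bar> / \<bar>y - x\<bar> < e"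
      using y by (simp add: divide_less_eq)
    then show "dist ((pint g y - pint g x) / (y - x)) (g x) < e"
      using y by (simp add: dist_real_def abs_divide[symmetric] diff_divide_distrib)
  qed
qed

subsection \<open>The flow of a velocity field\<close>

text \<open>
  The field is built from its second space derivative \<open>w\<close>. Subtracting the mean in \<open>vx\<close>
  makes \<open>v\<close> vanish at \<open>1\<close>; since \<open>pint\<close> is constant outside the unit interval, \<open>v\<close> is
  automatically extended by zero.
\<close>

locale velocity =
  fixes w :: "real \<times> real \<Rightarrow> real"
  assumes w_borel [measurable]: "w \<in> borel_measurable borel"
    and w_slice: "\<And>t. integrable unit_ivl (\<lambda>x. (w (x, t))\<^sup>2)"
    and w_square: "integrable unit_ivl (\<lambda>t. \<integral>x. (w (x, t))\<^sup>2 \<partial>unit_ivl)"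
begin

definition l :: "real \<Rightarrow> real" where
  "l t = L2_norm (\<lambda>x. w (x, t))"

definition vx :: "real \<Rightarrow> real \<Rightarrow> real" where
  "vx x t = pint (\<lambda>y. w (y, t)) x - (\<integral>s. pint (\<lambda>y. w (y, t)) s \<partial>unit_ivl)"

definition v :: "real \<Rightarrow> real \<Rightarrow> real" where
  "v x t = pint (\<lambda>y. vx y t) x"

text \<open>The difference quotient of \<open>v\<close>, continued to the diagonal by the
  derivative. With it the difference of two trajectories solves a linear equation.\<close>

definition q :: "real \<Rightarrow> real \<Rightarrow> real \<Rightarrow> real" where
  "q s y z = (if y = z then vx z s else (v y s - v z s) / (y - z))"

lemma w_slice_L2: "(\<lambda>x. w (x, t)) \<in> L2 unit_ivl"
  unfolding L2_def using w_slice by simp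

lemmas integrable_w_slice = L2_unit_ivlD(3)[OF w_slice_L2]

lemma l_nonneg [simp]: "0 \<le> l t"
  by (simp add: l_def)

lemma l_borel [measurable]: "l \<in> borel_measurable borel"
  unfolding l_def[abs_def] L2_norm_def by measurable

lemma l_square: "(l t)\<^sup>2 = (\<integral>x. (w (x, t))\<^sup>2 \<partial>unit_ivl)"
  by (simp add: l_def L2_norm_power2)

lemma l_L2: "l \<in> L2 unit_ivl"
  unfolding L2_def using w_square by (simp add: l_square)

lemmas integrable_l = L2_unit_ivlD(3)[OF l_L2]

lemma vx_borel [measurable (raw)]:
  "a \<in> borel_measurable M \<Longrightarrow> b \<in> borel_measurable M \<Longrightarrow> (\<lambda>y. vx (a y) (b y)) \<in> borel_measurable M"
  by (rule borel_measurable_compose2[of vx]) (unfold vx_def borel_prod[symmetric], measurable)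

lemma v_borel [measurable (raw)]:
  "a \<in> borel_measurable M \<Longrightarrow> b \<in> borel_measurable M \<Longrightarrow> (\<lambda>y. v (a y) (b y)) \<in> borel_measurable M"
  by (rule borel_measurable_compose2[of v]) (unfold v_def borel_prod[symmetric], measurable)

lemma pint_w_diff: "\<bar>pint (\<lambda>y. w (y, t)) x - pint (\<lambda>y. w (y, t)) s\<bar> \<le> l t"
proof -
  have *: "\<bar>pint (\<lambda>y. w (y, t)) x - pint (\<lambda>y. w (y, t)) s\<bar> \<le> l t" if "s \<le> x" for s x
  proof -
    have i: "integrable unit_ivl (\<lambda>y. \<bar>w (y, t)\<bar>)" using integrable_w_slice by simp
    have "\<bar>pint (\<lambda>y. w (y, t)) x - pint (\<lambda>y. w (y, t)) s\<bar> \<le> pint (\<lambda>y. \<bar>w (y, t)\<bar>) x - pint (\<lambda>y. \<bar>w (y, t)\<bar>) s"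
      by (rule abs_pint_diff_le) (use i integrable_w_slice that in auto)
    also have "\<dots> \<le> (\<integral>y. \<bar>w (y, t)\<bar> \<partial>unit_ivl) - 0"
      using abs_pint_le[OF i, of x] pint_mono[OF i, of "min 0 s" s] by (intro diff_mono) auto
    also have "\<dots> \<le> l t" unfolding l_def using L2_unit_ivlD(4)[OF w_slice_L2] by simp
    finally show ?thesis .
  qed
  show ?thesis using *[of x s] *[of s x] by (cases "s \<le> x") auto
qed

lemma integrable_pint_w: "integrable unit_ivl (pint (\<lambda>y. w (y, t)))"
  by (intro integrable_continuous_unit_ivl continuous_on_pint integrable_w_slice)

text \<open>\<open>vx\<close> is the deviation of a primitive of \<open>w\<close> from its mean, so
  it is bounded by the oscillation of this primitive.\<close>

lemma vx_bound: "\<bar>vx x t\<bar> \<le> l t"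
proof -
  have "vx x t = (\<integral>s. pint (\<lambda>y. w (y, t)) x - pint (\<lambda>y. w (y, t)) s \<partial>unit_ivl)"
    unfolding vx_def using integrable_pint_w by simp
  also have "\<bar>\<dots>\<bar> \<le> (\<integral>s. \<bar>pint (\<lambda>y. w (y, t)) x - pint (\<lambda>y. w (y, t)) s\<bar> \<partial>unit_ivl)"
    by (rule integral_abs_bound)
  also have "\<dots> \<le> (\<integral>s. l t \<partial>unit_ivl)"
    by (rule integral_mono_unit_ivl) (use integrable_pint_w pint_w_diff in auto)
  finally show ?thesis by simp
qed

lemma continuous_on_vx: "continuous_on S (\<lambda>x. vx x t)"
  unfolding vx_def by (intro continuous_intros continuous_on_pint integrable_w_slice)

lemma integrable_vx: "integrable unit_ivl (\<lambda>x. vx x t)"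
  by (intro integrable_continuous_unit_ivl continuous_on_vx)

lemma v_le_0 [simp]: "x \<le> 0 \<Longrightarrow> v x t = 0"
  by (simp add: v_def)

lemma v_ge_1 [simp]: "1 \<le> x \<Longrightarrow> v x t = 0"
  unfolding v_def vx_def using integrable_pint_w[of t] by (simp add: pint_ge_1)

lemma v_Lipschitz: "\<bar>v x t - v y t\<bar> \<le> l t * \<bar>x - y\<bar>"
proof -
  have *: "\<bar>v x t - v y t\<bar> \<le> l t * \<bar>x - y\<bar>" if "y \<le> x" for x y
  proof -
    have "\<bar>v x t - v y t\<bar> \<le> pint (\<lambda>_. l t) x - pint (\<lambda>_. l t) y"
      unfolding v_def by (rule abs_pint_diff_le) (use integrable_vx vx_bound that in auto)
    also have "\<dots> = l t * (max 0 (min 1 x) - max 0 (min 1 y))" by (simp add: pint_const algebra_simps)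
    also have "\<dots> \<le> l t * \<bar>x - y\<bar>" by (intro mult_left_mono) auto
    finally show ?thesis .
  qed
  show ?thesis using *[of x y] *[of y x] by (cases "y \<le> x") (auto simp: abs_minus_commute)
qed

lemma v_bound: "\<bar>v x t\<bar> \<le> l t"
proof -
  have "\<bar>v (max 0 (min 1 x)) t - v 0 t\<bar> \<le> l t * \<bar>max 0 (min 1 x) - 0\<bar>" by (rule v_Lipschitz)
  also have "\<dots> \<le> l t * 1" by (intro mult_left_mono) auto
  finally have "\<bar>v (max 0 (min 1 x)) t\<bar> \<le> l t" by simp
  moreover have "v (max 0 (min 1 x)) t = v x t" by (auto simp: max_def min_def)
  ultimately show ?thesis by simp
qed

lemma continuous_on_v: "continuous_on S (\<lambda>x. v x t)"
  unfolding v_def by (intro continuous_on_pint integrable_vx)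

lemma DERIV_v: "0 < x \<Longrightarrow> x < 1 \<Longrightarrow> ((\<lambda>x. v x t) has_real_derivative vx x t) (at x)"
  unfolding v_def[abs_def]
  using DERIV_pint[OF integrable_vx, of x t] continuous_on_vx[of UNIV t]
  by (simp add: continuous_on_eq_continuous_at)

lemma ac_vx: "ac (\<lambda>x. vx x t) (\<lambda>x. w (x, t))"
  unfolding vx_def using ac_diff[OF ac_pint[OF integrable_w_slice] ac_const] by simp

lemma q_bound: "\<bar>q s y z\<bar> \<le> l s"
  using vx_bound[of z s] v_Lipschitz[of y s z] unfolding q_def
  by (auto simp: abs_divide divide_le_eq)

lemma q_mult: "q s y z * (y - z) = v y s - v z s"
  by (simp add: q_def)

lemma q_borel [measurable (raw)]:
  assumes [measurable]: "a \<in> borel_measurable M" "b \<in> borel_measurable M" "c \<in> borel_measurable M"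
  shows "(\<lambda>x. q (a x) (b x) (c x)) \<in> borel_measurable M"
  unfolding q_def by measurable

text \<open>The point \<open>z\<close> is interior because the extension of \<open>v\<close> by zero
  may have a kink at 0 and at 1.\<close>

lemma continuous_on_q:
  assumes z: "0 < z" "z < 1"
  shows "continuous_on UNIV (\<lambda>y. q s y z)"
  unfolding continuous_on_eq_continuous_at[OF open_UNIV]
proof safe
  fix y show "isCont (\<lambda>y. q s y z) y"
  proof (cases "y = z")
    case True
    have "((\<lambda>y. (v y s - v z s) / (y - z)) \<longlongrightarrow> vx z s) (at z)"
      using DERIV_v[OF z, of s] by (simp add: has_field_derivative_iff)
    then have "((\<lambda>y. q s y z) \<longlongrightarrow> vx z s) (at z)"
      by (rule Lim_transform_eventually) (auto simp: eventually_at_filter q_def)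
    then show ?thesis using True by (simp add: isCont_def q_def)
  next
    case False
    have "isCont (\<lambda>y. (v y s - v z s) / (y - z)) y"
      using continuous_on_v[of UNIV s] False
      by (intro continuous_intros) (auto simp: continuous_on_eq_continuous_at)
    moreover have "\<forall>\<^sub>F y in nhds y. (v y s - v z s) / (y - z) = q s y z"
      using False by (auto simp: eventually_nhds q_def intro!: exI[of _ "- {z}"])
    ultimately show ?thesis by (simp add: isCont_cong)
  qed
qed

lemma ac_exp_l: "ac (\<lambda>t. exp (2 * pint l t)) (\<lambda>t. exp (2 * pint l t) * (2 * l t))"
  by (intro ac_exp ac_cmult ac_pint integrable_l)

lemma pint_l_outside: "pint l t = pint l (max 0 (min 1 t))"
  by (auto simp: max_def min_def pint_ge_1)

text \<open>Banach's fixed point theorem for the displacement, in a sup norm with weight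
  \<open>exp (- 2 * L t)\<close>. Since the Lipschitz constant \<open>l\<close> is only integrable
  in time, its primitive \<open>L\<close> takes the place of a multiple of \<open>t\<close>; the
  factor 2 yields the contraction constant 1/2. Solving for all starting points at once, among
  bounded continuous functions on the plane, gives joint continuity for free.\<close>

lemma flow_exists:
  "\<exists>F. continuous_on UNIV (\<lambda>p. F (fst p) (snd p)) \<and> (\<forall>x t. F x t = x + pint (\<lambda>s. v (F x s) s) t)"
proof -
  define L where "L = pint l"
  have cL: "continuous_on S L" for S unfolding L_def by (rule continuous_on_pint[OF integrable_l])
  have [measurable]: "L \<in> borel_measurable borel" by (rule borel_measurable_continuous_onI[OF cL])
  have L0: "0 \<le> L t" for t
    using pint_mono[OF integrable_l, of "min 0 t" t] by (simp add: L_def)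
  \<comment> \<open>\<open>u\<close> stands for the displacement divided by
    \<open>exp (2 * L s)\<close>, so the unweighted norm of \<open>u\<close> is the weighted norm of
    the displacement.\<close>
  define G where "G u x s = v (x + exp (2 * L s) * apply_bcontfun u (x, s)) s"
    for u :: "(real \<times> real) \<Rightarrow>\<^sub>C real" and x s
  have [measurable]: "apply_bcontfun u \<in> borel_measurable borel" for u :: "(real \<times> real) \<Rightarrow>\<^sub>C real"
    by (rule borel_measurable_continuous_onI) auto
  have Gm [measurable]: "G u x \<in> borel_measurable borel" for u x
    unfolding G_def by measurable
  have Gb: "\<bar>G u x s\<bar> \<le> l s" for u x s unfolding G_def by (rule v_bound)
  have Gi: "integrable unit_ivl (G u x)" for u x
    by (rule Bochner_Integration.integrable_bound[OF integrable_l]) (use Gb in auto)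
  have Gc: "continuous_on UNIV (\<lambda>x. G u x s)" for u s
  proof -
    have "continuous_on UNIV (\<lambda>x. x + exp (2 * L s) * apply_bcontfun u (x, s))"
      by (intro continuous_intros continuous_on_compose2[OF continuous_on_apply_bcontfun[of UNIV u]]) auto
    from continuous_on_compose2[OF continuous_on_v[of UNIV s] this] show ?thesis unfolding G_def by simp
  qed
  define T where "T u = Bcontfun (\<lambda>p. exp (- 2 * L (snd p)) * pint (G u (fst p)) (snd p))" for u
  have T: "apply_bcontfun (T u) (x, t) = exp (- 2 * L t) * pint (G u x) t" for u x t
  proof -
    have "(\<lambda>p. exp (- 2 * L (snd p)) * pint (G u (fst p)) (snd p)) \<in> bcontfun"
    proof (rule bcontfun_normI)
      have "continuous_on (UNIV \<times> UNIV) (\<lambda>(x, t). pint (G u x) t)"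
        by (rule continuous_pint_param[OF integrable_l _ Gb Gc]) measurable
      then have "continuous_on UNIV (\<lambda>p. pint (G u (fst p)) (snd p))" by (simp add: case_prod_beta')
      then show "continuous_on UNIV (\<lambda>p. exp (- 2 * L (snd p)) * pint (G u (fst p)) (snd p))"
        by (intro continuous_intros continuous_on_compose2[OF cL[of UNIV]]) auto
      fix p :: "real \<times> real"
      have "\<bar>pint (G u (fst p)) (snd p)\<bar> \<le> (\<integral>s. \<bar>G u (fst p) s\<bar> \<partial>unit_ivl)" by (rule abs_pint_le[OF Gi])
      also have "\<dots> \<le> (\<integral>s. l s \<partial>unit_ivl)"
        by (rule integral_mono) (use Gi integrable_l Gb in auto)
      finally have "\<bar>pint (G u (fst p)) (snd p)\<bar> \<le> (\<integral>s. l s \<partial>unit_ivl)" .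
      moreover have "exp (- 2 * L (snd p)) \<le> 1" using L0 by simp
      ultimately show "norm (exp (- 2 * L (snd p)) * pint (G u (fst p)) (snd p)) \<le> 1 * (\<integral>s. l s \<partial>unit_ivl)"
        unfolding norm_mult by (intro mult_mono) auto
    qed
    then show ?thesis unfolding T_def by (simp add: Bcontfun_inverse)
  qed
  have contr: "dist (T u1) (T u2) \<le> 1 / 2 * dist u1 u2" for u1 u2
  proof (rule dist_bound)
    fix p :: "real \<times> real"
    obtain x t where p: "p = (x, t)" by (cases p)
    define D where "D = dist u1 u2"
    have D0: "0 \<le> D" by (simp add: D_def)
    \<comment> \<open>\<open>pint\<close> does not change outside [0,1], whereas the integral
      identity for \<open>exp (2 * pint l t)\<close> is available only inside.\<close>
    define t' where "t' = max 0 (min 1 t)"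
    have t': "0 \<le> t'" "t' \<le> 1" by (auto simp: t'_def)
    have Lt: "L t = L t'" unfolding L_def t'_def by (rule pint_l_outside)
    have i: "integrable unit_ivl (\<lambda>s. D / 2 * (exp (2 * L s) * (2 * l s)))"
      unfolding L_def by (rule Bochner_Integration.integrable_mult_right[OF acD(1)[OF ac_exp_l]])
    have "\<bar>pint (\<lambda>s. G u1 x s - G u2 x s) t' - pint (\<lambda>s. G u1 x s - G u2 x s) 0\<bar> \<le>
       pint (\<lambda>s. D / 2 * (exp (2 * L s) * (2 * l s))) t' - pint (\<lambda>s. D / 2 * (exp (2 * L s) * (2 * l s))) 0"
    proof (rule abs_pint_diff_le[OF i])
      fix s
      have "\<bar>G u1 x s - G u2 x s\<bar> \<le> l s * \<bar>exp (2 * L s) * (apply_bcontfun u1 (x, s) - apply_bcontfun u2 (x, s))\<bar>"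
        unfolding G_def by (rule order_trans[OF v_Lipschitz]) (simp add: algebra_simps)
      also have "\<dots> \<le> l s * (exp (2 * L s) * D)"
        unfolding abs_mult using dist_bounded[of u1 "(x, s)" u2]
        by (intro mult_left_mono) (auto simp: D_def dist_real_def)
      finally show "\<bar>G u1 x s - G u2 x s\<bar> \<le> D / 2 * (exp (2 * L s) * (2 * l s))" by (simp add: mult_ac)
    qed (use Gi t' in auto)
    also have "\<dots> = D / 2 * (exp (2 * L t') - 1)"
    proof -
      have "exp (2 * L t') = 1 + pint (\<lambda>s. exp (2 * L s) * (2 * l s)) t'"
        using acD(2)[OF ac_exp_l t'] by (simp add: L_def)
      then show ?thesis by (simp only: pint_cmult) simp
    qed
    also have "\<dots> \<le> D / 2 * exp (2 * L t')" using D0 by (simp add: mult_left_mono)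
    finally have "\<bar>pint (\<lambda>s. G u1 x s - G u2 x s) t'\<bar> \<le> D / 2 * exp (2 * L t')" by simp
    moreover have "pint (\<lambda>s. G u1 x s - G u2 x s) t = pint (\<lambda>s. G u1 x s - G u2 x s) t'"
      by (auto simp: t'_def max_def min_def pint_ge_1)
    ultimately have *: "\<bar>pint (G u1 x) t - pint (G u2 x) t\<bar> \<le> D / 2 * exp (2 * L t)"
      using Gi by (simp add: pint_diff Lt)
    have "dist (apply_bcontfun (T u1) p) (apply_bcontfun (T u2) p) = exp (- 2 * L t) * \<bar>pint (G u1 x) t - pint (G u2 x) t\<bar>"
      unfolding p T dist_real_def right_diff_distrib[symmetric] by (simp add: abs_mult)
    also have "\<dots> \<le> exp (- 2 * L t) * (D / 2 * exp (2 * L t))" using * by (intro mult_left_mono) auto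
    also have "\<dots> = 1 / 2 * D" by (simp add: exp_minus)
    finally show "dist (apply_bcontfun (T u1) p) (apply_bcontfun (T u2) p) \<le> 1 / 2 * dist u1 u2" by (simp add: D_def)
  qed
  obtain u where u: "T u = u" using banach_fix_type[of "1/2" T] contr by auto
  define F where "F x t = x + exp (2 * L t) * apply_bcontfun u (x, t)" for x t
  have "F x t = x + pint (\<lambda>s. v (F x s) s) t" for x t
    using arg_cong[OF T[of u x t], of "\<lambda>y. exp (2 * L t) * y"] u
    unfolding F_def G_def by (simp add: exp_minus)
  moreover have "continuous_on UNIV (\<lambda>p. F (fst p) (snd p))"
    unfolding F_def by (intro continuous_intros continuous_on_compose2[OF cL[of UNIV]]) auto
  ultimately show ?thesis by blast
qed

section \<open>Trajectories, their order and their Jacobian\<close>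

definition phi :: "real \<Rightarrow> real \<Rightarrow> real" where
  "phi = (SOME F. continuous_on UNIV (\<lambda>p. F (fst p) (snd p)) \<and> (\<forall>x t. F x t = x + pint (\<lambda>s. v (F x s) s) t))"

lemma continuous_phi: "continuous_on UNIV (\<lambda>p. phi (fst p) (snd p))"
  and phi_eq: "phi x t = x + pint (\<lambda>s. v (phi x s) s) t"
  using someI_ex[OF flow_exists, folded phi_def] by blast+

lemma continuous_on_phi [continuous_intros]:
  assumes "continuous_on S a" "continuous_on S b"
  shows "continuous_on S (\<lambda>y. phi (a y) (b y))"
  using continuous_on_compose2[OF continuous_phi, of S "\<lambda>y. (a y, b y)"] assms
  by (auto intro!: continuous_intros)

lemma phi_borel [measurable (raw)]:
  "a \<in> borel_measurable M \<Longrightarrow> b \<in> borel_measurable M \<Longrightarrow> (\<lambda>y. phi (a y) (b y)) \<in> borel_measurable M"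
  by (rule borel_measurable_compose2[OF borel_measurable_continuous_onI[OF continuous_phi]])

lemma phi_0 [simp]: "phi x 0 = x"
  using phi_eq[of x 0] by simp

lemma integrable_v_along:
  assumes [measurable]: "c \<in> borel_measurable unit_ivl"
  shows "integrable unit_ivl (\<lambda>s. v (c s) s)"
  by (rule Bochner_Integration.integrable_bound[OF integrable_l]) (use v_bound in auto)

lemma integrable_vx_along:
  assumes [measurable]: "c \<in> borel_measurable unit_ivl"
  shows "integrable unit_ivl (\<lambda>s. vx (c s) s)"
  by (rule Bochner_Integration.integrable_bound[OF integrable_l]) (use vx_bound in auto)

lemma ac_phi: "ac (phi x) (\<lambda>s. v (phi x s) s)"
  by (rule acI[OF integrable_v_along phi_eq]) measurable

text \<open>By the choice of \<open>q\<close>, the difference of two solutions solves d' = q d. This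
  one formula yields the fixed endpoints, the strict monotonicity in the starting point and the
  difference quotients of the flow.\<close>

lemma ac_curve_diff:
  assumes c: "ac c (\<lambda>s. v (c s) s)" and t: "0 \<le> t" "t \<le> 1"
  shows "c t - phi x t = (c 0 - x) * exp (pint (\<lambda>s. q s (c s) (phi x s)) t)"
proof -
  have [measurable]: "c \<in> borel_measurable unit_ivl" by (rule ac_borel_measurable[OF c])
  have d: "ac (\<lambda>t. c t - phi x t) (\<lambda>s. q s (c s) (phi x s) * (c s - phi x s))"
    using ac_diff[OF c ac_phi[of x]] by (simp add: q_mult)
  have i: "integrable unit_ivl (\<lambda>s. q s (c s) (phi x s))"
    by (rule Bochner_Integration.integrable_bound[OF integrable_l]) (use q_bound in auto)
  show ?thesis using ac_linear_ode[OF d i t] by simp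
qed

lemma phi_at_0 [simp]: "0 \<le> t \<Longrightarrow> t \<le> 1 \<Longrightarrow> phi 0 t = 0"
  using ac_curve_diff[of "\<lambda>_. 0" t 0] ac_const[of 0] by simp

lemma phi_at_1 [simp]: "0 \<le> t \<Longrightarrow> t \<le> 1 \<Longrightarrow> phi 1 t = 1"
  using ac_curve_diff[of "\<lambda>_. 1" t 1] ac_const[of 1] by simp

lemma phi_strict_mono:
  assumes "0 \<le> t" "t \<le> 1" "x < y"
  shows "phi x t < phi y t"
proof -
  have "0 < (y - x) * exp (pint (\<lambda>s. q s (phi y s) (phi x s)) t)" using assms by simp
  also have "\<dots> = phi y t - phi x t" using ac_curve_diff[OF ac_phi[of y], of t x] assms by simp
  finally show ?thesis by simp
qed

lemma phi_less_iff: "0 \<le> t \<Longrightarrow> t \<le> 1 \<Longrightarrow> phi x t < phi y t \<longleftrightarrow> x < y"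
  using phi_strict_mono[of t x y] phi_strict_mono[of t y x] by (cases x y rule: linorder_cases) auto

lemma phi_le_iff: "0 \<le> t \<Longrightarrow> t \<le> 1 \<Longrightarrow> phi x t \<le> phi y t \<longleftrightarrow> x \<le> y"
  using phi_less_iff[of t y x] by auto

lemma phi_interior: "0 \<le> t \<Longrightarrow> t \<le> 1 \<Longrightarrow> 0 < x \<Longrightarrow> x < 1 \<Longrightarrow> 0 < phi x t \<and> phi x t < 1"
  using phi_strict_mono[of t 0 x] phi_strict_mono[of t x 1] by simp

lemma phi_closed: "0 \<le> t \<Longrightarrow> t \<le> 1 \<Longrightarrow> 0 \<le> x \<Longrightarrow> x \<le> 1 \<Longrightarrow> 0 \<le> phi x t \<and> phi x t \<le> 1"
  using phi_le_iff[of t 0 x] phi_le_iff[of t x 1] by simp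

text \<open>The logarithm of the Jacobian. Liouville's formula serves as the definition;
  \<open>DERIV_phi\<close> shows that its exponential is the derivative of the flow.\<close>

definition lJ :: "real \<Rightarrow> real \<Rightarrow> real" where
  "lJ x t = pint (\<lambda>s. vx (phi x s) s) t"

definition J :: "real \<Rightarrow> real \<Rightarrow> real" where
  "J x t = exp (lJ x t)"

definition \<beta> :: real where
  "\<beta> = exp (\<integral>t. l t \<partial>unit_ivl)"

lemma continuous_lJ: "continuous_on UNIV (\<lambda>p. lJ (fst p) (snd p))"
proof -
  have "continuous_on (UNIV \<times> UNIV) (\<lambda>(x, t). pint (\<lambda>s. vx (phi x s) s) t)"
    by (rule continuous_pint_param[OF integrable_l _ vx_bound])
      (auto intro!: continuous_on_compose2[OF continuous_on_vx[of UNIV]] continuous_intros)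
  then show ?thesis by (simp add: lJ_def case_prod_beta')
qed

lemma continuous_on_lJ [continuous_intros]:
  assumes "continuous_on S a" "continuous_on S b"
  shows "continuous_on S (\<lambda>y. lJ (a y) (b y))"
  using continuous_on_compose2[OF continuous_lJ, of S "\<lambda>y. (a y, b y)"] assms
  by (auto intro!: continuous_intros)

lemma continuous_on_J [continuous_intros]:
  "continuous_on S a \<Longrightarrow> continuous_on S b \<Longrightarrow> continuous_on S (\<lambda>y. J (a y) (b y))"
  unfolding J_def by (intro continuous_intros)

lemma lJ_borel [measurable (raw)]:
  "a \<in> borel_measurable M \<Longrightarrow> b \<in> borel_measurable M \<Longrightarrow> (\<lambda>y. lJ (a y) (b y)) \<in> borel_measurable M"
  by (rule borel_measurable_compose2[OF borel_measurable_continuous_onI[OF continuous_lJ]])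

lemma J_borel [measurable (raw)]:
  "a \<in> borel_measurable M \<Longrightarrow> b \<in> borel_measurable M \<Longrightarrow> (\<lambda>y. J (a y) (b y)) \<in> borel_measurable M"
  unfolding J_def by measurable

lemma J_pos [simp]: "0 < J x t"
  by (simp add: J_def)

lemma J_nonneg [simp]: "0 \<le> J x t"
  using J_pos less_imp_le by blast

lemma J_0 [simp]: "J x 0 = 1"
  by (simp add: J_def lJ_def)

lemma ac_lJ: "ac (lJ x) (\<lambda>s. vx (phi x s) s)"
  unfolding lJ_def[abs_def] by (intro ac_pint integrable_vx_along) measurable

lemma ac_J: "ac (J x) (\<lambda>s. J x s * vx (phi x s) s)"
  unfolding J_def by (rule ac_exp[OF ac_lJ])

lemma \<beta>_ge_1: "1 \<le> \<beta>"
  unfolding \<beta>_def by simp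

text \<open>Between any two times \<open>lJ\<close> changes by at most the integral of
  \<open>l\<close>. Comparing the times directly costs one factor \<open>\<beta>\<close>, where a
  detour through time 0 would cost two.\<close>

lemma J_ratio:
  assumes "0 \<le> s" "s \<le> 1" "0 \<le> t" "t \<le> 1"
  shows "J x t \<le> \<beta> * J x s"
proof -
  have *: "\<bar>lJ x t - lJ x s\<bar> \<le> (\<integral>t. l t \<partial>unit_ivl)" if "s \<le> t" for s t
  proof -
    have "\<bar>lJ x t - lJ x s\<bar> \<le> pint l t - pint l s" unfolding lJ_def
      by (rule abs_pint_diff_le) (use integrable_l integrable_vx_along vx_bound that in auto)
    also have "\<dots> \<le> (\<integral>t. l t \<partial>unit_ivl) - 0"
      using abs_pint_le[OF integrable_l, of t] pint_mono[OF integrable_l, of "min 0 s" s]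
      by (intro diff_mono) auto
    finally show ?thesis by simp
  qed
  have "lJ x t \<le> (\<integral>t. l t \<partial>unit_ivl) + lJ x s"
    using *[of s t] *[of t s] by (cases "s \<le> t") auto
  then show ?thesis unfolding J_def \<beta>_def exp_add[symmetric] by simp
qed

lemma J_bounds: "0 \<le> t \<Longrightarrow> t \<le> 1 \<Longrightarrow> J x t \<le> \<beta>" "0 \<le> t \<Longrightarrow> t \<le> 1 \<Longrightarrow> 1 / \<beta> \<le> J x t"
  using J_ratio[of 0 t x] J_ratio[of t 0 x] \<beta>_ge_1 by (auto simp: divide_le_eq mult.commute)

text \<open>The difference quotients of the flow are exponentials of integrated difference quotients of \<open>v\<close>.\<close>

lemma DERIV_phi:
  assumes x: "0 < x" "x < 1" and t: "0 \<le> t" "t \<le> 1"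
  shows "((\<lambda>x. phi x t) has_real_derivative J x t) (at x)"
proof -
  have "continuous_on (UNIV \<times> UNIV) (\<lambda>(y, t). pint (\<lambda>s. q s (phi y s) (phi x s)) t)"
  proof (rule continuous_pint_param[OF integrable_l _ q_bound])
    fix s :: real assume s: "0 < s" "s < 1"
    then have z: "0 < phi x s" "phi x s < 1" using phi_interior[of s x] x by auto
    show "continuous_on UNIV (\<lambda>y. q s (phi y s) (phi x s))"
      by (rule continuous_on_compose2[OF continuous_on_q[OF z]]) (auto intro!: continuous_intros)
  qed measurable
  from continuous_on_compose2[OF this, of UNIV "\<lambda>y. (y, t)"]
  have "continuous_on UNIV (\<lambda>y. pint (\<lambda>s. q s (phi y s) (phi x s)) t)"
    by (simp add: continuous_on_Pair)
  then have "continuous_on UNIV (\<lambda>y. exp (pint (\<lambda>s. q s (phi y s) (phi x s)) t))"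
    by (intro continuous_intros)
  then have "isCont (\<lambda>y. exp (pint (\<lambda>s. q s (phi y s) (phi x s)) t)) x"
    by (simp add: continuous_on_eq_continuous_at)
  then have "((\<lambda>y. exp (pint (\<lambda>s. q s (phi y s) (phi x s)) t)) \<longlongrightarrow> J x t) (at x)"
    by (simp add: isCont_def q_def J_def lJ_def)
  then have "((\<lambda>y. (phi y t - phi x t) / (y - x)) \<longlongrightarrow> J x t) (at x)"
  proof (rule Lim_transform_eventually)
    show "\<forall>\<^sub>F y in at x. exp (pint (\<lambda>s. q s (phi y s) (phi x s)) t) = (phi y t - phi x t) / (y - x)"
      using ac_curve_diff[OF ac_phi t, of _ x] by (auto simp: eventually_at_filter)
  qed
  then show ?thesis by (simp add: has_field_derivative_iff)
qed

end

subsection \<open>Integration over the unit square\<close>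

lemma space_unit_sq: "space unit_sq = {0<..<1} \<times> {0<..<1}"
  by (simp add: unit_sq_def space_pair_measure)

lemma unit_sq_borel [measurable (raw)]: "f \<in> borel_measurable borel \<Longrightarrow> f \<in> borel_measurable unit_sq"
  unfolding unit_sq_def by (rule borel_measurable_unit_sq)

lemma unit_sqD:
  fixes H :: "real \<times> real \<Rightarrow> real"
  assumes "integrable unit_sq H"
  shows "AE t in unit_ivl. integrable unit_ivl (\<lambda>x. H (x, t))"
    "integrable unit_ivl (\<lambda>t. \<integral>x. H (x, t) \<partial>unit_ivl)"
    "AE x in unit_ivl. integrable unit_ivl (\<lambda>t. H (x, t))"
    "integrable unit_ivl (\<lambda>x. \<integral>t. H (x, t) \<partial>unit_ivl)"
    "(\<integral>t. \<integral>x. H (x, t) \<partial>unit_ivl \<partial>unit_ivl) = (\<integral>x. \<integral>t. H (x, t) \<partial>unit_ivl \<partial>unit_ivl)"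
    "(\<integral>t. \<integral>x. H (x, t) \<partial>unit_ivl \<partial>unit_ivl) = (\<integral>p. H p \<partial>unit_sq)"
proof -
  have i: "integrable (unit_ivl \<Otimes>\<^sub>M unit_ivl) (case_prod (\<lambda>x t. H (x, t)))"
    using assms by (simp add: unit_sq_def)
  show "AE t in unit_ivl. integrable unit_ivl (\<lambda>x. H (x, t))" by (rule unit_sq.AE_integrable_snd[OF i])
  show "integrable unit_ivl (\<lambda>t. \<integral>x. H (x, t) \<partial>unit_ivl)" by (rule unit_sq.integrable_snd[OF i])
  show "AE x in unit_ivl. integrable unit_ivl (\<lambda>t. H (x, t))" by (rule unit_sq.AE_integrable_fst[OF i])
  show "integrable unit_ivl (\<lambda>x. \<integral>t. H (x, t) \<partial>unit_ivl)" by (rule unit_sq.integrable_fst[OF i])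
  show "(\<integral>t. \<integral>x. H (x, t) \<partial>unit_ivl \<partial>unit_ivl) = (\<integral>x. \<integral>t. H (x, t) \<partial>unit_ivl \<partial>unit_ivl)"
    by (rule unit_sq.Fubini_integral[OF i])
  show "(\<integral>t. \<integral>x. H (x, t) \<partial>unit_ivl \<partial>unit_ivl) = (\<integral>p. H p \<partial>unit_sq)"
    using unit_sq.integral_snd[OF i] by (simp add: unit_sq_def)
qed

lemma unit_sqI:
  fixes H :: "real \<times> real \<Rightarrow> real"
  assumes [measurable]: "H \<in> borel_measurable borel"
    and 1: "AE t in unit_ivl. integrable unit_ivl (\<lambda>x. H (x, t))"
    and 2: "integrable unit_ivl (\<lambda>t. \<integral>x. \<bar>H (x, t)\<bar> \<partial>unit_ivl)"
  shows "integrable unit_sq H"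
proof -
  have "(\<lambda>p. (snd p, fst p)) \<in> borel_measurable (unit_ivl \<Otimes>\<^sub>M unit_ivl)"
    by (rule borel_measurable_unit_sq) (simp add: borel_prod[symmetric])
  then have "(\<lambda>p. H (snd p, fst p)) \<in> borel_measurable (unit_ivl \<Otimes>\<^sub>M unit_ivl)"
    by measurable
  then have "integrable (unit_ivl \<Otimes>\<^sub>M unit_ivl) (\<lambda>p. H (snd p, fst p))"
    by (rule unit_sq.Fubini_integrable) (use 1 2 in auto)
  from unit_sq.integrable_product_swap[OF this] show ?thesis
    by (simp add: unit_sq_def)
qed

lemma unit_sq_bound:
  fixes H K :: "real \<times> real \<Rightarrow> real"
  assumes "integrable unit_sq K" "H \<in> borel_measurable borel"
    "\<And>x t. 0 < x \<Longrightarrow> x < 1 \<Longrightarrow> 0 < t \<Longrightarrow> t < 1 \<Longrightarrow> \<bar>H (x, t)\<bar> \<le> K (x, t)"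
  shows "integrable unit_sq H"
proof (rule Bochner_Integration.integrable_bound[OF assms(1)])
  show "AE p in unit_sq. norm (H p) \<le> norm (K p)"
    by (rule AE_I2) (use assms(3) in \<open>force simp: space_unit_sq\<close>)
qed (use assms(2) in measurable)

lemma finite_measure_unit_sq: "finite_measure unit_sq"
  unfolding unit_sq_def by unfold_locales

lemma integrable_unit_sq_const [simp]: "integrable unit_sq (\<lambda>_. c :: real)"
  using finite_measure.integrable_const[OF finite_measure_unit_sq] by blast

lemma integrable_unit_sq_bounded:
  fixes H :: "real \<times> real \<Rightarrow> real"
  assumes "H \<in> borel_measurable borel"
    "\<And>x t. 0 < x \<Longrightarrow> x < 1 \<Longrightarrow> 0 < t \<Longrightarrow> t < 1 \<Longrightarrow> \<bar>H (x, t)\<bar> \<le> C"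
  shows "integrable unit_sq H"
  by (rule unit_sq_bound[of "\<lambda>_. C"]) (use assms in auto)

lemma integrable_unit_sq_snd:
  fixes h :: "real \<Rightarrow> real"
  assumes [measurable]: "h \<in> borel_measurable borel" and "integrable unit_ivl h"
  shows "integrable unit_sq (\<lambda>p. h (snd p) :: real)"
proof (rule unit_sqI)
  show "(\<lambda>p :: real \<times> real. h (snd p)) \<in> borel_measurable borel"
    unfolding borel_prod[symmetric] by measurable
qed (use assms in auto)

text \<open>By Fubini, both sides say that the set of disagreement is null in the square. The form
  of an equation between Borel functions makes this set measurable.\<close>

lemma AE_unit_ivl_swap:
  fixes A B :: "real \<times> real \<Rightarrow> real"
  assumes [measurable]: "A \<in> borel_measurable borel" "B \<in> borel_measurable borel"
  shows "(AE t in unit_ivl. AE x in unit_ivl. A (x, t) = B (x, t)) \<longleftrightarrow>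
    (AE x in unit_ivl. AE t in unit_ivl. A (x, t) = B (x, t))"
proof -
  have [measurable]: "A \<in> borel_measurable (unit_ivl \<Otimes>\<^sub>M unit_ivl)" "B \<in> borel_measurable (unit_ivl \<Otimes>\<^sub>M unit_ivl)"
    by (rule borel_measurable_unit_sq; fact)+
  have "{p \<in> space (unit_ivl \<Otimes>\<^sub>M unit_ivl). A (fst p, snd p) = B (fst p, snd p)} \<in> sets (unit_ivl \<Otimes>\<^sub>M unit_ivl)"
    unfolding prod.collapse by measurable
  from unit_sq.AE_commute[OF this] show ?thesis by simp
qed

lemma AE_unit_sq_iff:
  fixes A B :: "real \<times> real \<Rightarrow> real"
  assumes [measurable]: "A \<in> borel_measurable borel" "B \<in> borel_measurable borel"
  shows "(AE p in unit_sq. A p = B p) \<longleftrightarrow> (AE t in unit_ivl. AE x in unit_ivl. A (x, t) = B (x, t))"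
proof -
  have [measurable]: "A \<in> borel_measurable (unit_ivl \<Otimes>\<^sub>M unit_ivl)" "B \<in> borel_measurable (unit_ivl \<Otimes>\<^sub>M unit_ivl)"
    by (rule borel_measurable_unit_sq; fact)+
  have "{p \<in> space (unit_ivl \<Otimes>\<^sub>M unit_ivl). A (fst p, snd p) = B (fst p, snd p)} \<in> sets (unit_ivl \<Otimes>\<^sub>M unit_ivl)"
    unfolding prod.collapse by measurable
  from unit_sq.AE_pair_iff[OF this] show ?thesis
    unfolding AE_unit_ivl_swap[OF assms] unit_sq_def prod.collapse by (rule sym)
qed

text \<open>Meant for the flow in space, whose derivative is available only at interior starting
  points: \<open>u\<close> minus the primitive of \<open>g\<close> has derivative zero inside and is
  continuous up to the boundary.\<close>

lemma ac_of_interior_derivative: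
  assumes "\<And>x. 0 < x \<Longrightarrow> x < 1 \<Longrightarrow> (u has_real_derivative g x) (at x)"
    and u: "continuous_on {0..1} u" and g: "continuous_on {0..1} g"
  shows "ac u g"
proof (rule acI)
  show ig: "integrable unit_ivl g" by (rule integrable_continuous_unit_ivl[OF g])
  fix x :: real assume x: "0 \<le> x" "x \<le> 1"
  have "u x - pint g x = u 0 - pint g 0" if "0 < x"
  proof (rule DERIV_isconst_end[OF that])
    show "continuous_on {0..x} (\<lambda>x. u x - pint g x)"
      by (intro continuous_intros continuous_on_pint ig continuous_on_subset[OF u]) (use x in auto)
    fix y assume y: "0 < y" "y < x"
    have "isCont g y" using continuous_on_interior[OF g, of y] y x by simp
    from DERIV_pint[OF ig _ _ this] y x assms(1)[of y]
    show "((\<lambda>x. u x - pint g x) has_real_derivative 0) (at y)"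
      by (auto intro!: derivative_eq_intros)
  qed
  then show "u x = u 0 + pint g x" using x by (cases "x = 0") auto
qed

section \<open>The flow as a change of variables, and its inverse\<close>

context velocity
begin

lemma ac_phi_space: "0 \<le> t \<Longrightarrow> t \<le> 1 \<Longrightarrow> ac (\<lambda>x. phi x t) (\<lambda>x. J x t)"
  by (rule ac_of_interior_derivative) (auto intro!: DERIV_phi continuous_intros)

lemma phi_surj:
  assumes "0 \<le> t" "t \<le> 1" "0 \<le> y" "y \<le> 1"
  shows "\<exists>x. 0 \<le> x \<and> x \<le> 1 \<and> phi x t = y"
proof -
  have "continuous_on {0..1} (\<lambda>x. phi x t)" by (intro continuous_intros)
  from IVT'[OF _ _ _ this, of y] show ?thesis using assms by auto
qed

text \<open>It suffices to compare the measures of half-lines. As the flow is increasing, the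
  preimage of a half-line is a half-line, and the integral of \<open>J\<close> over it is an
  increment of the flow.\<close>

lemma distr_phi:
  assumes t: "0 \<le> t" "t \<le> 1"
  shows "distr (density unit_ivl (\<lambda>x. ennreal (J x t))) borel (\<lambda>x. phi x t) = distr unit_ivl borel (\<lambda>x. x)"
    (is "?M = ?N")
proof (rule measure_eqI_lessThan)
  have iJ: "integrable unit_ivl (\<lambda>x. J x t)" using acD(1)[OF ac_phi_space[OF t]] .
  have eM: "emeasure ?M {c<..} = ennreal (\<integral>x. indicator {c<..} (phi x t) * J x t \<partial>unit_ivl)" for c
  proof -
    have "emeasure ?M {c<..} = (\<integral>\<^sup>+x. ennreal (J x t) * indicator ((\<lambda>x. phi x t) -` {c<..} \<inter> space unit_ivl) x \<partial>unit_ivl)"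
      by (subst emeasure_distr) (auto simp: emeasure_density)
    also have "\<dots> = (\<integral>\<^sup>+x. ennreal (indicator {c<..} (phi x t) * J x t) \<partial>unit_ivl)"
      by (rule nn_integral_cong) (auto simp: indicator_def)
    also have "\<dots> = ennreal (\<integral>x. indicator {c<..} (phi x t) * J x t \<partial>unit_ivl)"
      by (rule nn_integral_eq_integral)
        (auto intro!: Bochner_Integration.integrable_bound[OF iJ] simp: indicator_def)
    finally show ?thesis .
  qed
  have eN: "emeasure ?N {c<..} = ennreal (\<integral>x. indicator {c<..} x \<partial>unit_ivl)" for c :: real
  proof -
    have "emeasure ?N {c<..} = (\<integral>\<^sup>+x. indicator ((\<lambda>x. x) -` {c<..} \<inter> space unit_ivl) x \<partial>unit_ivl)"
      by (subst emeasure_distr) (auto intro!: nn_integral_indicator[symmetric])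
    also have "\<dots> = (\<integral>\<^sup>+x. ennreal (indicator {c<..} x) \<partial>unit_ivl)"
      by (rule nn_integral_cong) (auto simp: indicator_def)
    also have "\<dots> = ennreal (\<integral>x. indicator {c<..} x \<partial>unit_ivl)"
      by (rule nn_integral_eq_integral) (auto intro!: integrable_bounded_unit_ivl[where B = 1] simp: indicator_def)
    finally show ?thesis .
  qed
  show "emeasure ?M {c<..} < \<infinity>" for c by (simp add: eM)
  show "emeasure ?M {c<..} = emeasure ?N {c<..}" for c
  proof -
    \<comment> \<open>The threshold is moved into [0,1], where the flow attains it.\<close>
    define c' where "c' = max 0 (min 1 c)"
    obtain a where a: "0 \<le> a" "a \<le> 1" "phi a t = c'"
      using phi_surj[OF t, of c'] by (auto simp: c'_def)
    have "(\<integral>x. indicator {c<..} (phi x t) * J x t \<partial>unit_ivl) = (\<integral>x. J x t - indicator {..a} x * J x t \<partial>unit_ivl)"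
    proof (rule integral_cong_unit_ivl)
      fix x :: real assume x: "0 < x" "x < 1"
      have "c < phi x t \<longleftrightarrow> c' < phi x t"
        using phi_interior[OF t x] by (auto simp: c'_def)
      also have "\<dots> \<longleftrightarrow> a < x" using a phi_less_iff[OF t, of a x] by simp
      finally show "indicator {c<..} (phi x t) * J x t = J x t - indicator {..a} x * J x t"
        by (auto simp: indicator_def)
    qed
    also have "\<dots> = pint (\<lambda>x. J x t) 1 - pint (\<lambda>x. J x t) a"
      unfolding pint_ge_1[OF order_refl] unfolding pint_def
      by (rule Bochner_Integration.integral_diff[OF iJ integrable_pint[OF iJ]])
    also have "\<dots> = phi 1 t - phi a t"
      using acD(2)[OF ac_phi_space[OF t], of 1] acD(2)[OF ac_phi_space[OF t] a(1,2)] by simp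
    also have "\<dots> = pint (\<lambda>_. 1) 1 - pint (\<lambda>_. 1) c'" using a t by (auto simp: pint_const c'_def)
    also have "\<dots> = (\<integral>x. 1 - indicator {..c'} x * 1 \<partial>unit_ivl)"
      unfolding pint_ge_1[OF order_refl] unfolding pint_def
      by (rule Bochner_Integration.integral_diff[symmetric]) (auto intro!: integrable_bounded_unit_ivl[where B = 1] simp: indicator_def)
    also have "\<dots> = (\<integral>x. indicator {c<..} x \<partial>unit_ivl)"
      by (rule integral_cong_unit_ivl) (auto simp: indicator_def c'_def)
    finally show ?thesis unfolding eM eN by simp
  qed
qed auto

lemma
  assumes t: "0 \<le> t" "t \<le> 1" and [measurable]: "h \<in> borel_measurable borel"
  shows integral_phi: "(\<integral>x. h (phi x t) * J x t \<partial>unit_ivl) = (\<integral>y. h y \<partial>unit_ivl :: real)"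
    and integrable_phi: "integrable unit_ivl (\<lambda>x. h (phi x t) * J x t) \<longleftrightarrow> integrable unit_ivl h"
proof -
  have m: "(\<lambda>x. phi x t) \<in> borel_measurable (density unit_ivl (\<lambda>x. ennreal (J x t)))" by simp
  have "(\<integral>y. h y \<partial>unit_ivl) = integral\<^sup>L (distr unit_ivl borel (\<lambda>x. x)) h"
    by (simp add: integral_distr)
  also have "\<dots> = (\<integral>x. h (phi x t) \<partial>(density unit_ivl (\<lambda>x. ennreal (J x t))))"
    unfolding distr_phi[OF t, symmetric] using m by (subst integral_distr) auto
  also have "\<dots> = (\<integral>x. h (phi x t) * J x t \<partial>unit_ivl)"
    by (subst integral_density) (auto simp: mult.commute)
  finally show "(\<integral>x. h (phi x t) * J x t \<partial>unit_ivl) = (\<integral>y. h y \<partial>unit_ivl)" by simp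
  have "integrable unit_ivl h \<longleftrightarrow> integrable (distr unit_ivl borel (\<lambda>x. x)) h"
    by (simp add: integrable_distr_eq)
  also have "\<dots> \<longleftrightarrow> integrable (density unit_ivl (\<lambda>x. ennreal (J x t))) (\<lambda>x. h (phi x t))"
    unfolding distr_phi[OF t, symmetric] using m by (subst integrable_distr_eq) auto
  also have "\<dots> \<longleftrightarrow> integrable unit_ivl (\<lambda>x. h (phi x t) * J x t)"
    by (subst integrable_density) (auto simp: mult.commute)
  finally show "integrable unit_ivl (\<lambda>x. h (phi x t) * J x t) \<longleftrightarrow> integrable unit_ivl h" by simp
qed

text \<open>As the flow preserves order, the substitution turns the indicator of
  \<open>{..phi a t}\<close> into that of \<open>{..a}\<close>. It carries primitives between
  Eulerian and Lagrangian coordinates.\<close>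

lemma pint_phi:
  assumes t: "0 \<le> t" "t \<le> 1" and [measurable]: "h \<in> borel_measurable borel"
  shows "pint (\<lambda>x. h (phi x t) * J x t) a = pint h (phi a t)"
proof -
  have "pint h (phi a t) = (\<integral>x. indicator {..phi a t} (phi x t) * h (phi x t) * J x t \<partial>unit_ivl)"
    unfolding pint_def by (rule integral_phi[OF t, symmetric]) measurable
  also have "\<dots> = pint (\<lambda>x. h (phi x t) * J x t) a"
    unfolding pint_def by (rule Bochner_Integration.integral_cong) (auto simp: indicator_def phi_le_iff[OF t])
  finally show ?thesis by simp
qed

text \<open>The starting point of the trajectory through \<open>y\<close> at time \<open>t\<close>.
  Both arguments are clamped to [0,1] so that the inverse flow is a total function, continuous on
  the whole plane.\<close>

definition X :: "real \<Rightarrow> real \<Rightarrow> real" where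
  "X y t = (SOME x. 0 \<le> x \<and> x \<le> 1 \<and> phi x (max 0 (min 1 t)) = max 0 (min 1 y))"

lemma X_aux: "0 \<le> X y t \<and> X y t \<le> 1 \<and> phi (X y t) (max 0 (min 1 t)) = max 0 (min 1 y)"
  unfolding X_def by (rule someI_ex, rule phi_surj) auto

lemma X_range: "0 \<le> X y t" "X y t \<le> 1"
  using X_aux by auto

lemma phi_X: "0 \<le> t \<Longrightarrow> t \<le> 1 \<Longrightarrow> 0 \<le> y \<Longrightarrow> y \<le> 1 \<Longrightarrow> phi (X y t) t = y"
  using X_aux[of y t] by simp

lemma X_phi:
  assumes "0 \<le> t" "t \<le> 1" "0 \<le> x" "x \<le> 1"
  shows "X (phi x t) t = x"
proof -
  have "phi (X (phi x t) t) t = phi x t" using phi_X[of t "phi x t"] phi_closed assms by auto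
  then show ?thesis using phi_less_iff[OF assms(1,2), of "X (phi x t) t" x] 
      phi_less_iff[OF assms(1,2), of x "X (phi x t) t"] by (metis less_irrefl linorder_neqE)
qed

text \<open>The space-time flow \<open>\<Phi>\<close> is a continuous bijection of the compact
  square onto itself, so its inverse is continuous; clamping extends this to the plane.\<close>

lemma continuous_X: "continuous_on UNIV (\<lambda>p. X (fst p) (snd p))"
proof -
  define \<Phi> where "\<Phi> p = (phi (fst p) (snd p), snd p)" for p
  have c: "continuous_on ({0..1} \<times> {0..1}) \<Phi>" unfolding \<Phi>_def by (intro continuous_intros)
  have "continuous_on (\<Phi> ` ({0..1} \<times> {0..1})) (\<lambda>p. (X (fst p) (snd p), snd p))"
    by (rule continuous_on_inv[OF c]) (auto intro!: compact_Times simp: \<Phi>_def X_phi)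
  moreover have "\<Phi> ` ({0..1} \<times> {0..1}) = {0..1} \<times> {0..1}"
  proof safe
    fix x t :: real assume "x \<in> {0..1}" "t \<in> {0..1}"
    then show "(x, t) \<in> \<Phi> ` ({0..1} \<times> {0..1})"
      using phi_surj[of t x] by (force simp: \<Phi>_def)
  qed (use phi_closed in \<open>auto simp: \<Phi>_def\<close>)
  ultimately have "continuous_on ({0..1} \<times> {0..1}) (\<lambda>p. fst (X (fst p) (snd p), snd p))"
    by (intro continuous_on_fst) simp
  then have *: "continuous_on ({0..1} \<times> {0..1}) (\<lambda>p. X (fst p) (snd p))" by simp
  have "continuous_on UNIV (\<lambda>p :: real \<times> real. (max 0 (min 1 (fst p)), max 0 (min 1 (snd p))))"
    by (intro continuous_intros)
  moreover have "range (\<lambda>p :: real \<times> real. (max 0 (min 1 (fst p)), max 0 (min 1 (snd p)))) \<subseteq> {0..1} \<times> {0..1}"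
    by auto
  ultimately have "continuous_on UNIV (\<lambda>p. X (fst (max 0 (min 1 (fst p)), max 0 (min 1 (snd p))))
      (snd (max 0 (min 1 (fst p)), max 0 (min 1 (snd p)))))"
    by (rule continuous_on_compose2[OF *])
  then have "continuous_on UNIV (\<lambda>p. X (max 0 (min 1 (fst p))) (max 0 (min 1 (snd p))))" by simp
  moreover have "X (max 0 (min 1 y)) (max 0 (min 1 t)) = X y t" for y t by (simp add: X_def)
  ultimately show ?thesis by simp
qed

lemma continuous_on_X [continuous_intros]:
  assumes "continuous_on S a" "continuous_on S b"
  shows "continuous_on S (\<lambda>y. X (a y) (b y))"
  using continuous_on_compose2[OF continuous_X, of S "\<lambda>y. (a y, b y)"] assms
  by (auto intro!: continuous_intros)

lemma X_borel [measurable (raw)]: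
  "a \<in> borel_measurable M \<Longrightarrow> b \<in> borel_measurable M \<Longrightarrow> (\<lambda>y. X (a y) (b y)) \<in> borel_measurable M"
  by (rule borel_measurable_compose2[OF borel_measurable_continuous_onI[OF continuous_X]])

lemma X_at_0 [simp]: "0 \<le> y \<Longrightarrow> y \<le> 1 \<Longrightarrow> X y 0 = y"
  using X_phi[of 0 y] by simp

lemma
  assumes t: "0 \<le> t" "t \<le> 1" and [measurable]: "h \<in> borel_measurable borel"
  shows integral_X: "(\<integral>y. h (X y t) \<partial>unit_ivl) = (\<integral>x. h x * J x t \<partial>unit_ivl :: real)"
    and integrable_X: "integrable unit_ivl (\<lambda>y. h (X y t)) \<longleftrightarrow> integrable unit_ivl (\<lambda>x. h x * J x t)"
proof -
  have 1: "(\<integral>x. h (X (phi x t) t) * J x t \<partial>unit_ivl) = (\<integral>x. h x * J x t \<partial>unit_ivl)"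
    by (rule integral_cong_unit_ivl) (use t X_phi in auto)
  have 2: "integrable unit_ivl (\<lambda>x. h (X (phi x t) t) * J x t) \<longleftrightarrow> integrable unit_ivl (\<lambda>x. h x * J x t)"
    by (rule Bochner_Integration.integrable_cong) (use t X_phi in auto)
  show "(\<integral>y. h (X y t) \<partial>unit_ivl) = (\<integral>x. h x * J x t \<partial>unit_ivl)"
    using integral_phi[OF t, of "\<lambda>y. h (X y t)"] 1 by simp
  show "integrable unit_ivl (\<lambda>y. h (X y t)) \<longleftrightarrow> integrable unit_ivl (\<lambda>x. h x * J x t)"
    using integrable_phi[OF t, of "\<lambda>y. h (X y t)"] 2 by simp
qed

text \<open>The indicator of the set where \<open>g\<close> and \<open>h\<close> differ has integral
  zero after the substitution y = phi x t, hence also before it.\<close>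

lemma AE_X:
  assumes t: "0 \<le> t" "t \<le> 1" and [measurable]: "g \<in> borel_measurable borel" "h \<in> borel_measurable borel"
    and eq: "AE x in unit_ivl. g (phi x t) = (h (phi x t) :: real)"
  shows "AE y in unit_ivl. g y = h y"
proof -
  define d where "d y = (if g y = h y then 0 else 1 :: real)" for y
  have [measurable]: "d \<in> borel_measurable borel" unfolding d_def[abs_def] by measurable
  have "(\<integral>y. d y \<partial>unit_ivl) = (\<integral>x. d (phi x t) * J x t \<partial>unit_ivl)"
    by (rule integral_phi[OF t, symmetric]) measurable
  also have "\<dots> = (\<integral>x. 0 \<partial>unit_ivl)"
    by (rule integral_cong_AE) (use eq in \<open>auto simp: d_def elim!: eventually_mono\<close>)
  finally have "(\<integral>y. d y \<partial>unit_ivl) = 0" by simp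
  moreover have "integrable unit_ivl d" by (rule integrable_bounded_unit_ivl[where B = 1]) (auto simp: d_def)
  ultimately have "AE y in unit_ivl. d y = 0"
    by (subst (asm) integral_nonneg_eq_0_iff_AE) (auto simp: d_def)
  then show ?thesis by eventually_elim (auto simp: d_def split: if_splits)
qed

lemma integrable_w_unit_sq: "integrable unit_sq (\<lambda>p. (w p)\<^sup>2)"
  by (rule unit_sqI) (use w_slice w_square in auto)

lemma integrable_phi_unit_sq:
  assumes [measurable]: "H \<in> borel_measurable borel" and H: "integrable unit_sq H"
  shows "integrable unit_sq (\<lambda>p. H (phi (fst p) (snd p), snd p) * J (fst p) (snd p))"
proof (rule unit_sqI)
  have "(\<lambda>p. H (phi (fst p) (snd p), snd p) * J (fst p) (snd p)) \<in> borel_measurable (borel \<Otimes>\<^sub>M borel)"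
    by measurable
  then show "(\<lambda>p. H (phi (fst p) (snd p), snd p) * J (fst p) (snd p)) \<in> borel_measurable borel"
    unfolding borel_prod .
  show "AE t in unit_ivl. integrable unit_ivl (\<lambda>x. H (phi (fst (x, t)) (snd (x, t)), snd (x, t)) * J (fst (x, t)) (snd (x, t)))"
    using unit_sqD(1)[OF H] AE_unit_ivl_interior
  proof eventually_elim
    case (elim t)
    then show ?case using integrable_phi[of t "\<lambda>y. H (y, t)"] by simp
  qed
  have "integrable unit_ivl (\<lambda>t. \<integral>x. \<bar>H (x, t)\<bar> \<partial>unit_ivl)"
    using unit_sqD(2)[OF integrable_abs[OF H]] by simp
  moreover have "integrable unit_ivl (\<lambda>t. \<integral>x. \<bar>H (x, t)\<bar> \<partial>unit_ivl) \<longleftrightarrow>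
     integrable unit_ivl (\<lambda>t. \<integral>x. \<bar>H (phi (fst (x, t)) (snd (x, t)), snd (x, t)) * J (fst (x, t)) (snd (x, t))\<bar> \<partial>unit_ivl)"
    by (rule Bochner_Integration.integrable_cong) (use integral_phi[of _ "\<lambda>y. \<bar>H (y, _)\<bar>"] in \<open>auto simp: abs_mult\<close>)
  ultimately show "integrable unit_ivl (\<lambda>t. \<integral>x. \<bar>H (phi (fst (x, t)) (snd (x, t)), snd (x, t)) * J (fst (x, t)) (snd (x, t))\<bar> \<partial>unit_ivl)"
    by simp
qed

end

subsection \<open>Lagrangian form of the transport equation\<close>

text \<open>A primitive of a bump on (-1,1), normalized to drop from 1 to 0. With the argument
  scaled by k it tends to the indicator of a half-line, and its derivative lives within distance 1/k
  of the jump.\<close>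

lemma smooth_step:
  obtains \<Theta> \<theta> :: "real \<Rightarrow> real" and C where
    "smooth \<Theta>" "\<And>u. (\<Theta> has_real_derivative \<theta> u) (at u)" "continuous_on UNIV \<theta>"
    "\<And>u. u \<le> -1 \<Longrightarrow> \<Theta> u = 1" "\<And>u. 1 \<le> u \<Longrightarrow> \<Theta> u = 0" "\<And>u. \<bar>\<Theta> u\<bar> \<le> C"
    "\<And>u. \<bar>\<theta> u\<bar> \<le> C" "\<And>u. 1 \<le> \<bar>u\<bar> \<Longrightarrow> \<theta> u = 0"
proof -
  define b where "b = bump 1 (-1) 1"
  have sb: "smooth b" unfolding b_def by (rule smooth_bump)
  obtain K where K: "\<And>x. (K has_real_derivative b x) (at x)" "smooth K" "K 0 = 0"
    using smooth_primitive[OF sb] by blast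
  have b0: "b u = 0" if "1 \<le> \<bar>u\<bar>" for u using that unfolding b_def by (auto intro!: bump_eq_0)
  have Kl: "K u = K (-1)" if "u \<le> -1" for u
    by (rule const_if_deriv_zero[of _ _ b, OF b0 K(1)]) (use that in auto)
  have Kr: "K u = K 1" if "1 \<le> u" for u
    by (rule const_if_deriv_zero[of _ _ b, OF b0 K(1)]) (use that in auto)
  have mono: "K s \<le> K t" if "s \<le> t" for s t
    by (rule DERIV_nonneg_imp_nondecreasing[OF that]) (use K(1) bump_bounds(1) in \<open>unfold b_def, blast\<close>)
  have "K (-1) < K 1"
  proof -
    obtain u where u: "-1 < u" "u < 1" "K 1 - K (-1) = (1 - (-1)) * b u"
      using MVT2[of "-1" 1 K b] K(1) by auto
    then show ?thesis using bump_pos[of "-1" u 1 1] by (simp add: b_def)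
  qed
  define d where "d = K 1 - K (-1)"
  have d: "d > 0" using \<open>K (-1) < K 1\<close> by (simp add: d_def)
  define \<Theta> where "\<Theta> u = K 1 / d + (- 1 / d) * K u" for u
  define \<theta> where "\<theta> u = (- 1 / d) * b u" for u
  show ?thesis
  proof (rule that[of \<Theta> \<theta> "1 + 1 / d"])
    show "smooth \<Theta>" unfolding \<Theta>_def[abs_def]
      by (rule smooth_smooth_algebra[OF smooth_algebra.add[OF smooth_algebra_polynomial[OF real_polynomial_function.intros(2)]
         smooth_algebra.mult[OF smooth_algebra_polynomial[OF real_polynomial_function.intros(2)]
           smooth_algebra_smooth[OF K(2)]]]])
    show "(\<Theta> has_real_derivative \<theta> u) (at u)" for u
      unfolding \<Theta>_def \<theta>_def using K(1)[of u] d by (auto intro!: derivative_eq_intros)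
    show "continuous_on UNIV \<theta>" unfolding \<theta>_def by (intro continuous_intros smooth_continuous_on[OF sb])
    show "\<Theta> u = 1" if "u \<le> -1" for u
      using d Kl[OF that] by (simp add: \<Theta>_def field_simps) (simp add: d_def)
    show "\<Theta> u = 0" if "1 \<le> u" for u
      using Kr[OF that] by (simp add: \<Theta>_def)
    show "\<bar>\<Theta> u\<bar> \<le> 1 + 1 / d" for u
    proof -
      have r1: "K (-1) \<le> K u"
        by (metis Kl mono linear order_refl)
      have r2: "K u \<le> K 1"
        by (metis Kr mono linear order_refl)
      have "\<Theta> u = (K 1 - K u) / d" by (simp add: \<Theta>_def diff_divide_distrib)
      moreover have "0 \<le> (K 1 - K u) / d" using r2 d by simp
      moreover have "(K 1 - K u) / d \<le> 1" using r1 d by (simp add: d_def)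
      moreover have "0 \<le> 1 / d" using d by simp
      ultimately show ?thesis by linarith
    qed
    show "\<bar>\<theta> u\<bar> \<le> 1 + 1 / d" for u
    proof -
      have "\<bar>\<theta> u\<bar> = b u / d" using d bump_bounds[of 1 "-1" 1 u] by (simp add: \<theta>_def b_def)
      also have "\<dots> \<le> 1 / d" using d bump_bounds[of 1 "-1" 1 u] by (simp add: b_def divide_right_mono)
      finally show ?thesis by simp
    qed
    show "\<theta> u = 0" if "1 \<le> \<bar>u\<bar>" for u using b0[OF that] by (simp add: \<theta>_def)
  qed
qed

lemma real_polynomial_snd: "real_polynomial_function p \<Longrightarrow> real_polynomial_function (\<lambda>x::real \<times> real. p (snd x))"
  using real_polynomial_function_compose[OF polynomial_function_bounded_linear[OF bounded_linear_snd], of p]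
  by (simp add: o_def)

lemma real_polynomial_fst: "real_polynomial_function p \<Longrightarrow> real_polynomial_function (\<lambda>x::real \<times> real. p (fst x))"
  using real_polynomial_function_compose[OF polynomial_function_bounded_linear[OF bounded_linear_fst], of p]
  by (simp add: o_def)

lemma continuous_on_real_polynomial: "real_polynomial_function p \<Longrightarrow> continuous_on S p"
  by (simp add: continuous_on_polymonial_function real_polynomial_function_eq)

lemma borel_measurable_real_polynomial:
  "real_polynomial_function p \<Longrightarrow> p \<in> borel_measurable (borel :: 'a::euclidean_space measure)"
  by (rule borel_measurable_continuous_onI[OF continuous_on_real_polynomial])

lemma polynomial_primitive:
  assumes p: "real_polynomial_function (p :: real \<Rightarrow> real)"
  obtains P where "real_polynomial_function P" "\<And>t. (P has_real_derivative p t) (at t)" "P 0 = a"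
proof -
  obtain c n where c: "p = (\<lambda>x. \<Sum>i\<le>n. c i * x ^ i)" using real_polynomial_function_imp_sum[OF p] by blast
  define P where "P x = a + (\<Sum>i\<le>n. c i / (real i + 1) * x ^ (i + 1))" for x
  show ?thesis
  proof (rule that[of P])
    show "(P has_real_derivative p t) (at t)" for t
    proof -
      have monom: "((\<lambda>x. c i / (real i + 1) * x ^ (i + 1)) has_real_derivative c i * t ^ i) (at t)" for i
      proof -
        have "((\<lambda>x. c i / (real i + 1) * x ^ (i + 1)) has_real_derivative
            c i / (real i + 1) * (real (i + 1) * t ^ (i + 1 - Suc 0))) (at t)"
          by (intro DERIV_cmult DERIV_pow)
        moreover have "c i / (real i + 1) * (real (i + 1) * t ^ (i + 1 - Suc 0)) = c i * t ^ i"
        proof -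
          have "real i + 1 \<noteq> 0" by linarith
          then show ?thesis by (simp add: add.commute)
        qed
        ultimately show ?thesis by simp
      qed
      have "((\<lambda>x. \<Sum>i\<le>n. c i / (real i + 1) * x ^ (i + 1)) has_real_derivative p t) (at t)"
        unfolding c by (rule DERIV_sum) (rule monom)
      from DERIV_add[OF DERIV_const this] show ?thesis unfolding P_def by simp
    qed
    show "real_polynomial_function P" unfolding P_def[abs_def]
      by (intro real_polynomial_function.intros(3) real_polynomial_function_sum real_polynomial_function.intros(4) real_polynomial_function.intros(2)
          real_polynomial_function_power real_polynomial_function.intros(1)[OF bounded_linear_ident]) auto
  qed (simp add: P_def)
qed

text \<open>A du Bois-Reymond argument with polynomials that need not vanish at the ends. Constant
  \<open>\<xi>\<close> gives the total balance; then integration by parts shows that the defect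
  \<open>h\<close> is orthogonal to every polynomial, each one being the derivative of some
  \<open>\<xi>\<close>.\<close>

lemma time_primitive:
  assumes M: "integrable unit_ivl M" and N: "integrable unit_ivl N"
    and weak: "\<And>\<xi> \<xi>'. real_polynomial_function \<xi> \<Longrightarrow> real_polynomial_function \<xi>' \<Longrightarrow>
      (\<And>t. (\<xi> has_real_derivative \<xi>' t) (at t)) \<Longrightarrow>
      (\<integral>t. \<xi>' t * M t + \<xi> t * N t \<partial>unit_ivl) = \<xi> 1 * A1 - \<xi> 0 * A0"
  shows "AE t in unit_ivl. M t = A0 + pint N t" "A1 = A0 + (\<integral>t. N t \<partial>unit_ivl)"
proof -
  show A1: "A1 = A0 + (\<integral>t. N t \<partial>unit_ivl)"
    using weak[OF real_polynomial_function.intros(2) real_polynomial_function.intros(2), of 1 0] by simp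
  define h where "h t = M t - A0 - pint N t" for t
  have ip: "integrable unit_ivl (pint N)" by (intro integrable_continuous_unit_ivl continuous_on_pint N)
  have h: "integrable unit_ivl h" unfolding h_def using M ip by simp
  have "AE t in unit_ivl. h t = 0"
  proof (rule AE_zero_if_orthogonal_polynomials[OF h])
    fix p :: "real \<Rightarrow> real" assume p: "real_polynomial_function p"
    obtain \<xi> where \<xi>: "real_polynomial_function \<xi>" "\<And>t. (\<xi> has_real_derivative p t) (at t)"
      using polynomial_primitive[OF p] by metis
    have cp: "continuous_on {0..1} p" "continuous_on {0..1} \<xi>" using p \<xi>(1) by (auto intro: continuous_on_real_polynomial)
    have a\<xi>: "ac \<xi> p" by (rule ac_of_continuous_derivative[OF \<xi>(2) cp(1)])
    have ipM: "integrable unit_ivl (\<lambda>t. p t * M t)" by (rule integrable_continuous_mult[OF cp(1) M])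
    have i\<xi>N: "integrable unit_ivl (\<lambda>t. \<xi> t * N t)" by (rule integrable_continuous_mult[OF cp(2) N])
    have ipN: "integrable unit_ivl (\<lambda>t. p t * pint N t)" by (rule integrable_continuous_mult[OF cp(1) ip])
    have ip1: "integrable unit_ivl p" by (rule integrable_continuous_unit_ivl[OF cp(1)])
    have 1: "(\<integral>t. p t * M t \<partial>unit_ivl) + (\<integral>t. \<xi> t * N t \<partial>unit_ivl) = \<xi> 1 * A1 - \<xi> 0 * A0"
      using weak[OF \<xi>(1) p \<xi>(2)] ipM i\<xi>N by simp
    have 2: "(\<integral>t. \<xi> t * N t \<partial>unit_ivl) + (\<integral>t. p t * pint N t \<partial>unit_ivl) = pint N 1 * \<xi> 1"
      using ac_by_parts[OF ac_pint[OF N] a\<xi>] i\<xi>N ipN by (simp add: mult.commute)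
    have 3: "(\<integral>t. p t \<partial>unit_ivl) = \<xi> 1 - \<xi> 0"
      using acD(2)[OF a\<xi>, of 1] by (simp add: pint_ge_1)
    have "(\<integral>t. h t * p t \<partial>unit_ivl) = (\<integral>t. p t * M t - A0 * p t - p t * pint N t \<partial>unit_ivl)"
      by (rule Bochner_Integration.integral_cong) (auto simp: h_def algebra_simps)
    also have "\<dots> = (\<integral>t. p t * M t \<partial>unit_ivl) - A0 * (\<integral>t. p t \<partial>unit_ivl) - (\<integral>t. p t * pint N t \<partial>unit_ivl)"
      using ipM ip1 ipN by simp
    also have "\<dots> = 0" unfolding 3 using 1 2 A1 by (simp add: pint_ge_1 algebra_simps)
    finally show "(\<integral>t. h t * p t \<partial>unit_ivl) = 0" .
  qed
  then show "AE t in unit_ivl. M t = A0 + pint N t" by eventually_elim (simp add: h_def)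
qed

lemma integrable_bounded_mult:
  fixes g h :: "'a \<Rightarrow> real"
  assumes h: "integrable M h" and [measurable]: "g \<in> borel_measurable M"
    and b: "AE x in M. \<bar>g x\<bar> \<le> C"
  shows "integrable M (\<lambda>x. g x * h x)"
proof (rule Bochner_Integration.integrable_bound[of _ "\<lambda>x. C * h x"])
  show "AE x in M. norm (g x * h x) \<le> norm (C * h x)"
    using b by eventually_elim (auto simp: abs_mult intro!: mult_right_mono)
qed (use h in auto)

lemma AE_unit_sqI: "(\<And>x t. 0 < x \<Longrightarrow> x < 1 \<Longrightarrow> 0 < t \<Longrightarrow> t < 1 \<Longrightarrow> P (x, t)) \<Longrightarrow> AE p in unit_sq. P p"
  by (rule AE_I2) (auto simp: space_unit_sq)

lemma AE_unit_sq_off_graph: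
  fixes c :: "real \<Rightarrow> real"
  assumes [measurable]: "c \<in> borel_measurable borel"
  shows "AE p in unit_sq. fst p \<noteq> c (snd p)"
proof -
  define A where "A p = (if fst p = c (snd p) then 1 else 0 :: real)" for p :: "real \<times> real"
  have [measurable]: "A \<in> borel_measurable borel"
    unfolding A_def[abs_def] borel_prod[symmetric] by measurable
  have "AE t in unit_ivl. AE x in unit_ivl. A (x, t) = 0"
  proof (rule AE_I2)
    fix t show "AE x in unit_ivl. A (x, t) = 0"
      using AE_unit_ivl_neq[of "c t"] by eventually_elim (simp add: A_def)
  qed
  then have "AE p in unit_sq. A p = 0"
    using AE_unit_sq_iff[of A "\<lambda>_. 0"] by simp
  then show ?thesis by eventually_elim (simp add: A_def split: if_splits)
qed

text \<open>The weak equation for Borel representatives, in which the fields \<open>v\<close> and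
  \<open>vx\<close> built from \<open>w\<close> stand for the given velocity and its chosen
  derivative.\<close>

locale transport = velocity +
  fixes f z :: "real \<times> real \<Rightarrow> real" and f0 f1 :: "real \<Rightarrow> real"
  assumes f_borel [measurable]: "f \<in> borel_measurable borel"
    and z_borel [measurable]: "z \<in> borel_measurable borel"
    and f0_borel [measurable]: "f0 \<in> borel_measurable borel"
    and f1_borel [measurable]: "f1 \<in> borel_measurable borel"
    and f_square: "integrable unit_sq (\<lambda>p. (f p)\<^sup>2)"
    and z_square: "integrable unit_sq (\<lambda>p. (z p)\<^sup>2)"
    and f0_int: "integrable unit_ivl f0"
    and f1_int: "integrable unit_ivl f1"
    and weak: "\<And>\<phi> :: real \<times> real \<Rightarrow> real. smooth \<phi> \<Longrightarrow>
      - (\<integral>t. \<integral>x. f (x, t) * deriv (\<lambda>s. \<phi> (x, s)) t \<partial>unit_ivl \<partial>unit_ivl)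
      + (\<integral>x. f1 x * \<phi> (x, 1) \<partial>unit_ivl) - (\<integral>x. f0 x * \<phi> (x, 0) \<partial>unit_ivl)
      = (\<integral>t. \<integral>x. f (x, t) * \<phi> (x, t) * vx x t \<partial>unit_ivl \<partial>unit_ivl)
      + (\<integral>t. \<integral>x. f (x, t) * deriv (\<lambda>y. \<phi> (y, t)) x * v x t \<partial>unit_ivl \<partial>unit_ivl)
      + (\<integral>t. \<integral>x. \<phi> (x, t) * z (x, t) \<partial>unit_ivl \<partial>unit_ivl)"
begin

lemma vx_pair_borel [measurable]: "(\<lambda>p. vx (fst p) (snd p)) \<in> borel_measurable borel"
  unfolding borel_prod[symmetric] by measurable

lemma v_pair_borel [measurable]: "(\<lambda>p. v (fst p) (snd p)) \<in> borel_measurable borel"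
  unfolding borel_prod[symmetric] by measurable

lemma l_snd_borel [measurable]: "(\<lambda>p::real \<times> real. l (snd p)) \<in> borel_measurable borel"
  unfolding borel_prod[symmetric] by measurable

lemma integrable_f: "integrable unit_sq f"
  using integrable_mult_L2[of f unit_sq "\<lambda>_. 1"] f_square by simp

lemma integrable_z: "integrable unit_sq z"
  using integrable_mult_L2[of z unit_sq "\<lambda>_. 1"] z_square by simp

text \<open>The majorant of all terms in which \<open>f\<close> multiplies \<open>v\<close> or
  \<open>vx\<close>; square integrability of \<open>l\<close> in time is matched with that of
  \<open>f\<close>.\<close>

lemma integrable_fl: "integrable unit_sq (\<lambda>p. l (snd p) * f p)"
proof (rule integrable_mult_L2)
  show "integrable unit_sq (\<lambda>p. (l (snd p))\<^sup>2)"
    by (rule integrable_unit_sq_snd[of "\<lambda>t. (l t)\<^sup>2"]) (use L2_unit_ivlD(2)[OF l_L2] in auto)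
qed (use f_square in auto)

lemma integrable_fvx: "integrable unit_sq (\<lambda>p. f p * vx (fst p) (snd p))"
proof (rule unit_sq_bound[OF integrable_abs[OF integrable_fl]])
  fix x t
  show "\<bar>f (x, t) * vx (fst (x, t)) (snd (x, t))\<bar> \<le> \<bar>l (snd (x, t)) * f (x, t)\<bar>"
    using mult_right_mono[OF vx_bound[of x t], of "\<bar>f (x, t)\<bar>"] by (simp add: abs_mult mult.commute)
qed measurable

text \<open>Test with a smoothed indicator of the region to the left of a polynomial curve \<open>c\<close>.\<close>

lemma weak_curve:
  assumes \<Theta>: "smooth \<Theta>" "\<And>u. (\<Theta> has_real_derivative \<theta> u) (at u)" "continuous_on UNIV \<theta>"
      "\<And>u. \<bar>\<Theta> u\<bar> \<le> C" "\<And>u. \<bar>\<theta> u\<bar> \<le> C"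
    and \<xi>: "real_polynomial_function \<xi>" "real_polynomial_function \<xi>'" "\<And>t. (\<xi> has_real_derivative \<xi>' t) (at t)"
    and c: "real_polynomial_function c" "real_polynomial_function c'" "\<And>t. (c has_real_derivative c' t) (at t)"
  shows "(\<integral>p. \<xi>' (snd p) * \<Theta> (k * (fst p - c (snd p))) * f p
        + \<xi> (snd p) * \<Theta> (k * (fst p - c (snd p))) * (f p * vx (fst p) (snd p) + z p)
        + \<xi> (snd p) * (k * \<theta> (k * (fst p - c (snd p)))) * f p * (v (fst p) (snd p) - c' (snd p)) \<partial>unit_sq)
      = \<xi> 1 * (\<integral>x. f1 x * \<Theta> (k * (x - c 1)) \<partial>unit_ivl) - \<xi> 0 * (\<integral>x. f0 x * \<Theta> (k * (x - c 0)) \<partial>unit_ivl)"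
proof -
  define T where "T p = \<Theta> (k * (fst p - c (snd p)))" for p
  define U where "U p = k * \<theta> (k * (fst p - c (snd p)))" for p
  note [measurable] = borel_measurable_real_polynomial[OF \<xi>(1)] borel_measurable_real_polynomial[OF \<xi>(2)]
    borel_measurable_real_polynomial[OF c(1)] borel_measurable_real_polynomial[OF c(2)]
    borel_measurable_continuous_onI[OF smooth_continuous_on[OF \<Theta>(1)]] borel_measurable_continuous_onI[OF \<Theta>(3)]
  have [measurable]: "T \<in> borel_measurable borel" "U \<in> borel_measurable borel"
    unfolding T_def[abs_def] U_def[abs_def] borel_prod[symmetric] by measurable
  have [measurable]: "(\<lambda>p::real \<times> real. \<xi> (snd p)) \<in> borel_measurable borel"
     "(\<lambda>p::real \<times> real. \<xi>' (snd p)) \<in> borel_measurable borel" "(\<lambda>p::real \<times> real. c' (snd p)) \<in> borel_measurable borel"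
    unfolding borel_prod[symmetric] by measurable
  have bd: "\<exists>B\<ge>0. \<forall>t\<in>{0..1}. \<bar>g t\<bar> \<le> B" if "real_polynomial_function g" for g :: "real \<Rightarrow> real"
    using compact_imp_bounded[OF compact_continuous_image[OF continuous_on_real_polynomial[OF that] compact_Icc[of 0 1]]]
    unfolding bounded_iff by (metis abs_ge_zero atLeastAtMost_iff imageI order_refl order_trans real_norm_def zero_le_one)
  obtain B1 where B1: "B1 \<ge> 0" "\<And>t. t \<in> {0..1} \<Longrightarrow> \<bar>\<xi> t\<bar> \<le> B1" using bd[OF \<xi>(1)] by blast
  obtain B2 where B2: "B2 \<ge> 0" "\<And>t. t \<in> {0..1} \<Longrightarrow> \<bar>\<xi>' t\<bar> \<le> B2" using bd[OF \<xi>(2)] by blast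
  obtain B3 where B3: "B3 \<ge> 0" "\<And>t. t \<in> {0..1} \<Longrightarrow> \<bar>c' t\<bar> \<le> B3" using bd[OF c(2)] by blast
  have Tb: "\<bar>T p\<bar> \<le> C" and Ub: "\<bar>U p\<bar> \<le> \<bar>k\<bar> * C" for p
    using \<Theta>(4,5) by (auto simp: T_def U_def abs_mult intro!: mult_left_mono)
  have C0: "0 \<le> C" using Tb[of undefined] by linarith
  have i1: "integrable unit_sq (\<lambda>p. (\<xi>' (snd p) * T p) * f p)"
    by (rule integrable_bounded_mult[OF integrable_f, of _ "B2 * C"])
      (use B2 Tb C0 in \<open>auto intro!: AE_unit_sqI mult_mono simp: abs_mult\<close>)
  have i2: "integrable unit_sq (\<lambda>p. (\<xi> (snd p) * T p) * (f p * vx (fst p) (snd p)))"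
    by (rule integrable_bounded_mult[OF integrable_fvx, of _ "B1 * C"])
      (use B1 Tb C0 in \<open>auto intro!: AE_unit_sqI mult_mono simp: abs_mult\<close>)
  have i3: "integrable unit_sq (\<lambda>p. (\<xi> (snd p) * T p) * z p)"
    by (rule integrable_bounded_mult[OF integrable_z, of _ "B1 * C"])
      (use B1 Tb C0 in \<open>auto intro!: AE_unit_sqI mult_mono simp: abs_mult\<close>)
  have i4: "integrable unit_sq (\<lambda>p. (\<xi> (snd p) * U p * c' (snd p)) * f p)"
    by (rule integrable_bounded_mult[OF integrable_f, of _ "B1 * (\<bar>k\<bar> * C) * B3"])
      (use B1 B3 Ub C0 in \<open>auto intro!: AE_unit_sqI mult_mono mult_nonneg_nonneg simp: abs_mult\<close>)
  have ifv: "integrable unit_sq (\<lambda>p. f p * v (fst p) (snd p))"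
  proof (rule unit_sq_bound[OF integrable_abs[OF integrable_fl]])
    fix x t
    show "\<bar>f (x, t) * v (fst (x, t)) (snd (x, t))\<bar> \<le> \<bar>l (snd (x, t)) * f (x, t)\<bar>"
      using mult_right_mono[OF v_bound[of x t], of "\<bar>f (x, t)\<bar>"] by (simp add: abs_mult mult.commute)
  qed measurable
  have i5: "integrable unit_sq (\<lambda>p. (\<xi> (snd p) * U p) * (f p * v (fst p) (snd p)))"
    by (rule integrable_bounded_mult[OF ifv, of _ "B1 * (\<bar>k\<bar> * C)"])
      (use B1 Ub C0 in \<open>auto intro!: AE_unit_sqI mult_mono simp: abs_mult\<close>)
  define \<phi> where "\<phi> p = \<xi> (snd p) * \<Theta> (k * (fst p - c (snd p)))" for p
  have id: "real_polynomial_function (\<lambda>x::real. x)" by (rule real_polynomial_function.intros(1)[OF bounded_linear_ident])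
  have "smooth \<phi>" unfolding \<phi>_def[abs_def]
    by (rule smooth_smooth_algebra[OF smooth_algebra.mult[OF smooth_algebra_polynomial[OF real_polynomial_snd[OF \<xi>(1)]]
      smooth_algebra.comp[OF \<Theta>(1) real_polynomial_function.intros(4)[OF real_polynomial_function.intros(2)
        real_polynomial_function_diff[OF real_polynomial_fst[OF id] real_polynomial_snd[OF c(1)]]]]]])
  note w = weak[OF this]
  \<comment> \<open>The moving edge of the cutoff contributes the speed \<open>c'\<close>; together
    with the transport term it produces the relative velocity \<open>v - c'\<close>.\<close>
  have dt: "deriv (\<lambda>s. \<phi> (x, s)) t = \<xi>' t * T (x, t) - \<xi> t * U (x, t) * c' t" for x t
    unfolding \<phi>_def T_def U_def
    by (rule DERIV_imp_deriv) (auto intro!: derivative_eq_intros DERIV_chain2[OF \<Theta>(2)] \<xi>(3) c(3))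
  have dx: "deriv (\<lambda>y. \<phi> (y, t)) x = \<xi> t * U (x, t)" for x t
    unfolding \<phi>_def T_def U_def
    by (rule DERIV_imp_deriv) (auto intro!: derivative_eq_intros DERIV_chain2[OF \<Theta>(2)])
  have e1: "(\<integral>t. \<integral>x. f (x, t) * deriv (\<lambda>s. \<phi> (x, s)) t \<partial>unit_ivl \<partial>unit_ivl) =
     (\<integral>p. (\<xi>' (snd p) * T p) * f p \<partial>unit_sq) - (\<integral>p. (\<xi> (snd p) * U p * c' (snd p)) * f p \<partial>unit_sq)"
    unfolding Bochner_Integration.integral_diff[OF i1 i4, symmetric]
      unit_sqD(6)[OF Bochner_Integration.integrable_diff[OF i1 i4], symmetric] dt
    by (simp add: algebra_simps)
  have e2: "(\<integral>t. \<integral>x. f (x, t) * \<phi> (x, t) * vx x t \<partial>unit_ivl \<partial>unit_ivl) =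
     (\<integral>p. (\<xi> (snd p) * T p) * (f p * vx (fst p) (snd p)) \<partial>unit_sq)"
    unfolding unit_sqD(6)[OF i2, symmetric] by (simp add: \<phi>_def T_def mult_ac)
  have e3: "(\<integral>t. \<integral>x. f (x, t) * deriv (\<lambda>y. \<phi> (y, t)) x * v x t \<partial>unit_ivl \<partial>unit_ivl) =
     (\<integral>p. (\<xi> (snd p) * U p) * (f p * v (fst p) (snd p)) \<partial>unit_sq)"
    unfolding unit_sqD(6)[OF i5, symmetric] dx by (simp add: mult_ac)
  have e4: "(\<integral>t. \<integral>x. \<phi> (x, t) * z (x, t) \<partial>unit_ivl \<partial>unit_ivl) = (\<integral>p. (\<xi> (snd p) * T p) * z p \<partial>unit_sq)"
    unfolding unit_sqD(6)[OF i3, symmetric] by (simp add: \<phi>_def T_def mult_ac)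
  have e5: "(\<integral>x. f1 x * \<phi> (x, 1) \<partial>unit_ivl) = \<xi> 1 * (\<integral>x. f1 x * \<Theta> (k * (x - c 1)) \<partial>unit_ivl)"
    by (simp add: \<phi>_def mult.left_commute)
  have e6: "(\<integral>x. f0 x * \<phi> (x, 0) \<partial>unit_ivl) = \<xi> 0 * (\<integral>x. f0 x * \<Theta> (k * (x - c 0)) \<partial>unit_ivl)"
    by (simp add: \<phi>_def mult.left_commute)
  have "(\<integral>p. \<xi>' (snd p) * T p * f p + \<xi> (snd p) * T p * (f p * vx (fst p) (snd p) + z p)
        + \<xi> (snd p) * U p * f p * (v (fst p) (snd p) - c' (snd p)) \<partial>unit_sq)
     = (\<integral>p. ((\<xi>' (snd p) * T p) * f p) + ((\<xi> (snd p) * T p) * (f p * vx (fst p) (snd p))) + ((\<xi> (snd p) * T p) * z p)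
        + ((\<xi> (snd p) * U p) * (f p * v (fst p) (snd p))) - ((\<xi> (snd p) * U p * c' (snd p)) * f p) \<partial>unit_sq)"
    by (rule Bochner_Integration.integral_cong) (auto simp: algebra_simps)
  also have "\<dots> = (\<integral>p. (\<xi>' (snd p) * T p) * f p \<partial>unit_sq) + (\<integral>p. (\<xi> (snd p) * T p) * (f p * vx (fst p) (snd p)) \<partial>unit_sq)
       + (\<integral>p. (\<xi> (snd p) * T p) * z p \<partial>unit_sq) + (\<integral>p. (\<xi> (snd p) * U p) * (f p * v (fst p) (snd p)) \<partial>unit_sq)
       - (\<integral>p. (\<xi> (snd p) * U p * c' (snd p)) * f p \<partial>unit_sq)"
    using i1 i2 i3 i4 i5 by simp
  finally show ?thesis using w unfolding e1 e2 e3 e4 e5 e6 T_def U_def by linarith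
qed

end

lemma real_polynomial_bound:
  fixes g :: "real \<Rightarrow> real"
  assumes "real_polynomial_function g"
  obtains B where "0 \<le> B" "\<And>t. 0 \<le> t \<Longrightarrow> t \<le> 1 \<Longrightarrow> \<bar>g t\<bar> \<le> B"
proof -
  obtain B where B: "\<And>t. t \<in> {0..1} \<Longrightarrow> \<bar>g t\<bar> \<le> B"
    using compact_imp_bounded[OF compact_continuous_image[OF continuous_on_real_polynomial[OF assms] compact_Icc[of 0 1]]]
    by (fastforce simp: bounded_iff)
  show ?thesis by (rule that[of "\<bar>B\<bar>"]) (use B in \<open>force intro: order_trans[OF _ abs_ge_self]\<close>)+
qed

context transport
begin

lemma integrable_fl_abs: "integrable unit_sq (\<lambda>p. l (snd p) * \<bar>f p\<bar>)"
  using integrable_abs[OF integrable_fl] by (simp add: abs_mult)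

lemma phi_curve_L2: "(\<lambda>t. v (phi a t) t) \<in> L2 unit_ivl"
proof -
  have "integrable unit_ivl (\<lambda>t. (v (phi a t) t)\<^sup>2)"
    by (rule Bochner_Integration.integrable_bound[OF L2_unit_ivlD(2)[OF l_L2]])
      (use v_bound in \<open>auto simp: abs_le_square_iff[symmetric]\<close>)
  then show ?thesis by (simp add: L2_def)
qed

text \<open>Trajectories are not smooth, so the velocity \<open>\<kappa>\<close> along one is
  approximated in L^2 by polynomials \<open>p n\<close>. Their primitives \<open>c n\<close>
  starting at \<open>a\<close> converge uniformly to the trajectory, and \<open>weak_curve\<close>
  applies to them.\<close>

lemma weak_flow_curve:
  assumes \<Theta>: "smooth \<Theta>" "\<And>u. (\<Theta> has_real_derivative \<theta> u) (at u)" "continuous_on UNIV \<theta>"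
      "\<And>u. \<bar>\<Theta> u\<bar> \<le> C" "\<And>u. \<bar>\<theta> u\<bar> \<le> C"
    and \<xi>: "real_polynomial_function \<xi>" "real_polynomial_function \<xi>'" "\<And>t. (\<xi> has_real_derivative \<xi>' t) (at t)"
  shows "(\<integral>p. \<xi>' (snd p) * \<Theta> (k * (fst p - phi a (snd p))) * f p
        + \<xi> (snd p) * \<Theta> (k * (fst p - phi a (snd p))) * (f p * vx (fst p) (snd p) + z p)
        + \<xi> (snd p) * (k * \<theta> (k * (fst p - phi a (snd p)))) * f p * (v (fst p) (snd p) - v (phi a (snd p)) (snd p)) \<partial>unit_sq)
      = \<xi> 1 * (\<integral>x. f1 x * \<Theta> (k * (x - phi a 1)) \<partial>unit_ivl) - \<xi> 0 * (\<integral>x. f0 x * \<Theta> (k * (x - a)) \<partial>unit_ivl)"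
proof -
  define \<kappa> where "\<kappa> t = v (phi a t) t" for t
  have \<kappa>L2: "\<kappa> \<in> L2 unit_ivl" unfolding \<kappa>_def using phi_curve_L2 .
  have [measurable]: "\<kappa> \<in> borel_measurable borel" unfolding \<kappa>_def[abs_def] by measurable
  obtain p where p: "\<And>n. real_polynomial_function (p n)" "(\<lambda>n::nat. \<integral>t. (p n t - \<kappa> t)\<^sup>2 \<partial>unit_ivl) \<longlonglongrightarrow> 0"
    using L2_approx_polynomial[OF \<kappa>L2] by blast
  have "\<exists>c. real_polynomial_function c \<and> (\<forall>t. (c has_real_derivative p n t) (at t)) \<and> c 0 = a" for n
    by (rule polynomial_primitive[OF p(1)[of n], of a]) blast
  then obtain c where c: "\<And>n. real_polynomial_function (c n)" "\<And>n t. (c n has_real_derivative p n t) (at t)"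
    "\<And>n. c n 0 = a" by metis
  obtain B1 where B1: "0 \<le> B1" "\<And>t. 0 \<le> t \<Longrightarrow> t \<le> 1 \<Longrightarrow> \<bar>\<xi> t\<bar> \<le> B1" using real_polynomial_bound[OF \<xi>(1)] by blast
  obtain B2 where B2: "0 \<le> B2" "\<And>t. 0 \<le> t \<Longrightarrow> t \<le> 1 \<Longrightarrow> \<bar>\<xi>' t\<bar> \<le> B2" using real_polynomial_bound[OF \<xi>(2)] by blast
  have C0: "0 \<le> C" using \<Theta>(4)[of 0] by linarith
  note [measurable] = borel_measurable_real_polynomial[OF \<xi>(1)] borel_measurable_real_polynomial[OF \<xi>(2)]
    borel_measurable_real_polynomial[OF c(1)] borel_measurable_real_polynomial[OF p(1)]
    borel_measurable_continuous_onI[OF smooth_continuous_on[OF \<Theta>(1)]] borel_measurable_continuous_onI[OF \<Theta>(3)]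
  have pL2: "(\<lambda>t. p n t - \<kappa> t) \<in> L2 unit_ivl" for n
  proof -
    have le: "(p n t - \<kappa> t)\<^sup>2 \<le> 2 * (p n t)\<^sup>2 + 2 * (\<kappa> t)\<^sup>2" for t
      using zero_le_power2[of "p n t + \<kappa> t"] by (simp add: power2_eq_square algebra_simps)
    have i1: "integrable unit_ivl (\<lambda>t. (p n t)\<^sup>2)"
      by (intro integrable_continuous_unit_ivl continuous_intros continuous_on_real_polynomial p(1))
    have i2: "integrable unit_ivl (\<lambda>t. 2 * (p n t)\<^sup>2 + 2 * (\<kappa> t)\<^sup>2)"
      using i1 L2_unit_ivlD(2)[OF \<kappa>L2] by simp
    have "integrable unit_ivl (\<lambda>t. (p n t - \<kappa> t)\<^sup>2)"
    proof (rule Bochner_Integration.integrable_bound[OF i2])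
      show "AE t in unit_ivl. norm ((p n t - \<kappa> t)\<^sup>2) \<le> norm (2 * (p n t)\<^sup>2 + 2 * (\<kappa> t)\<^sup>2)"
        by (rule AE_I2) (simp add: le)
    qed measurable
    then show ?thesis by (simp add: L2_def)
  qed
  have n0: "(\<lambda>n. L2_norm (\<lambda>t. p n t - \<kappa> t)) \<longlonglongrightarrow> 0"
    using tendsto_real_sqrt[OF p(2)] by (simp add: L2_norm_def)
  have cdiff: "\<bar>c n t - phi a t\<bar> \<le> L2_norm (\<lambda>t. p n t - \<kappa> t)" if t: "0 \<le> t" "t \<le> 1" for n t
  proof -
    have "ac (\<lambda>t. c n t - phi a t) (\<lambda>t. p n t - \<kappa> t)" unfolding \<kappa>_def
      by (rule ac_diff[OF ac_of_continuous_derivative[OF c(2) continuous_on_real_polynomial[OF p(1)]] ac_phi])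
    from acD(2)[OF this t] have "c n t - phi a t = pint (\<lambda>t. p n t - \<kappa> t) t" by (simp add: c(3))
    then show ?thesis
      using abs_pint_le[OF L2_unit_ivlD(3)[OF pL2], of n t] L2_unit_ivlD(4)[OF pL2, of n] by simp
  qed
  have clim: "(\<lambda>n. c n t) \<longlonglongrightarrow> phi a t" if "0 \<le> t" "t \<le> 1" for t
  proof -
    have "(\<lambda>n. c n t - phi a t) \<longlonglongrightarrow> 0"
      by (rule Lim_null_comparison[OF _ n0]) (use cdiff[OF that] in auto)
    then show ?thesis by (simp add: LIM_zero_iff)
  qed
  define T where "T n q = \<Theta> (k * (fst q - c n (snd q)))" for n and q :: "real \<times> real"
  define U where "U n q = k * \<theta> (k * (fst q - c n (snd q)))" for n and q :: "real \<times> real"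
  have [measurable]: "T n \<in> borel_measurable borel" "U n \<in> borel_measurable borel" for n
    unfolding T_def[abs_def] U_def[abs_def] borel_prod[symmetric] by measurable
  have [measurable]: "(\<lambda>q::real \<times> real. \<xi> (snd q)) \<in> borel_measurable borel"
     "(\<lambda>q::real \<times> real. \<xi>' (snd q)) \<in> borel_measurable borel" "(\<lambda>q::real \<times> real. \<kappa> (snd q)) \<in> borel_measurable borel"
     "(\<lambda>q::real \<times> real. p n (snd q)) \<in> borel_measurable borel" for n
    unfolding borel_prod[symmetric] by measurable
  have Tb: "\<bar>T n q\<bar> \<le> C" and Ub: "\<bar>U n q\<bar> \<le> \<bar>k\<bar> * C" for n q
    using \<Theta>(4,5) by (auto simp: T_def U_def abs_mult intro!: mult_left_mono)
  \<comment> \<open>The velocity \<open>p n\<close> of the approximating curve is replaced by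
    \<open>\<kappa>\<close> in \<open>M\<close>, which has an integrable majorant independent of
    \<open>n\<close>; the remainder \<open>R\<close> tends to zero by Cauchy-Schwarz.\<close>
  define M where "M n q = \<xi>' (snd q) * T n q * f q + \<xi> (snd q) * T n q * (f q * vx (fst q) (snd q) + z q)
        + \<xi> (snd q) * U n q * f q * (v (fst q) (snd q) - \<kappa> (snd q))" for n q
  define R where "R n q = (\<xi> (snd q) * U n q) * (f q * (\<kappa> (snd q) - p n (snd q)))" for n q
  define D where "D q = B2 * C * \<bar>f q\<bar> + B1 * C * (\<bar>f q * vx (fst q) (snd q)\<bar> + \<bar>z q\<bar>) + B1 * (\<bar>k\<bar> * C) * (2 * (l (snd q) * \<bar>f q\<bar>))" for q
  have iD: "integrable unit_sq D" unfolding D_def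
    using integrable_f integrable_fvx integrable_z integrable_fl_abs by (auto intro!: integrable_abs)
  have MD: "\<bar>M n q\<bar> \<le> D q" if "0 < snd q" "snd q < 1" for n q
  proof -
    have "\<bar>\<xi>' (snd q) * T n q * f q\<bar> \<le> B2 * C * \<bar>f q\<bar>"
      unfolding abs_mult by (intro mult_mono B2 Tb C0 mult_nonneg_nonneg) (use that in auto)
    moreover have "\<bar>\<xi> (snd q) * T n q * (f q * vx (fst q) (snd q) + z q)\<bar> \<le> B1 * C * (\<bar>f q * vx (fst q) (snd q)\<bar> + \<bar>z q\<bar>)"
      unfolding abs_mult[of "\<xi> (snd q) * T n q"] abs_mult[of "\<xi> (snd q)"]
      by (intro mult_mono B1 Tb C0 mult_nonneg_nonneg abs_triangle_ineq) (use that in auto)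
    moreover have "\<bar>\<xi> (snd q) * U n q * f q * (v (fst q) (snd q) - \<kappa> (snd q))\<bar> \<le> B1 * (\<bar>k\<bar> * C) * (2 * (l (snd q) * \<bar>f q\<bar>))"
    proof -
      have "\<bar>v (fst q) (snd q) - \<kappa> (snd q)\<bar> \<le> 2 * l (snd q)"
        using v_bound[of "fst q" "snd q"] v_bound[of "phi a (snd q)" "snd q"] unfolding \<kappa>_def by linarith
      then have 1: "\<bar>f q\<bar> * \<bar>v (fst q) (snd q) - \<kappa> (snd q)\<bar> \<le> 2 * (l (snd q) * \<bar>f q\<bar>)"
        using mult_left_mono[of "\<bar>v (fst q) (snd q) - \<kappa> (snd q)\<bar>" "2 * l (snd q)" "\<bar>f q\<bar>"] by (simp add: mult_ac)
      have 2: "\<bar>\<xi> (snd q)\<bar> * \<bar>U n q\<bar> \<le> B1 * (\<bar>k\<bar> * C)"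
        by (intro mult_mono B1 Ub) (use that in auto)
      have "\<bar>\<xi> (snd q)\<bar> * \<bar>U n q\<bar> * (\<bar>f q\<bar> * \<bar>v (fst q) (snd q) - \<kappa> (snd q)\<bar>) \<le> B1 * (\<bar>k\<bar> * C) * (2 * (l (snd q) * \<bar>f q\<bar>))"
        by (rule mult_mono[OF 2 1]) (use B1 C0 in auto)
      then show ?thesis by (simp add: abs_mult mult.assoc)
    qed
    ultimately show ?thesis unfolding M_def D_def by linarith
  qed
  have [measurable]: "M n \<in> borel_measurable borel" for n unfolding M_def[abs_def] by measurable
  have iM: "integrable unit_sq (M n)" for n
    by (rule unit_sq_bound[OF iD]) (use MD in auto)
  have psq: "integrable unit_sq (\<lambda>q. (\<kappa> (snd q) - p n (snd q))\<^sup>2)" for n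
    by (rule integrable_unit_sq_snd[of "\<lambda>t. (\<kappa> t - p n t)\<^sup>2"])
      (use L2_unit_ivlD(2)[OF pL2, of n] in \<open>auto simp: power2_commute\<close>)
  have ifp: "integrable unit_sq (\<lambda>q. f q * (\<kappa> (snd q) - p n (snd q)))" for n
    by (rule integrable_mult_L2) (use f_square psq in auto)
  have Ab: "AE q in unit_sq. \<bar>\<xi> (snd q) * U n q\<bar> \<le> B1 * (\<bar>k\<bar> * C)" for n
    by (rule AE_unit_sqI) (use B1 Ub C0 in \<open>auto simp: abs_mult intro!: mult_mono\<close>)
  have iR: "integrable unit_sq (R n)" for n unfolding R_def
    by (rule integrable_bounded_mult[OF ifp _ Ab]) measurable
  have Rlim: "(\<lambda>n. \<integral>q. R n q \<partial>unit_sq) \<longlonglongrightarrow> 0"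
  proof (rule Lim_null_comparison)
    show "\<forall>\<^sub>F n in sequentially. norm (\<integral>q. R n q \<partial>unit_sq) \<le>
      B1 * (\<bar>k\<bar> * C) * (sqrt (\<integral>q. (f q)\<^sup>2 \<partial>unit_sq) * L2_norm (\<lambda>t. p n t - \<kappa> t))"
    proof (rule always_eventually, rule allI)
      fix n
      have "norm (\<integral>q. R n q \<partial>unit_sq) \<le> (\<integral>q. \<bar>R n q\<bar> \<partial>unit_sq)" by simp
      also have "\<dots> \<le> (\<integral>q. B1 * (\<bar>k\<bar> * C) * \<bar>f q * (\<kappa> (snd q) - p n (snd q))\<bar> \<partial>unit_sq)"
      proof (rule integral_mono_AE)
        show "AE q in unit_sq. \<bar>R n q\<bar> \<le> B1 * (\<bar>k\<bar> * C) * \<bar>f q * (\<kappa> (snd q) - p n (snd q))\<bar>"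
          using Ab[of n] by eventually_elim (auto simp: R_def abs_mult[of "\<xi> _ * _"] intro!: mult_right_mono)
      qed (use iR ifp in \<open>auto intro!: integrable_abs\<close>)
      also have "\<dots> = B1 * (\<bar>k\<bar> * C) * (\<integral>q. \<bar>f q * (\<kappa> (snd q) - p n (snd q))\<bar> \<partial>unit_sq)" by simp
      also have "\<dots> \<le> B1 * (\<bar>k\<bar> * C) * (sqrt (\<integral>q. (f q)\<^sup>2 \<partial>unit_sq) * sqrt (\<integral>q. (\<kappa> (snd q) - p n (snd q))\<^sup>2 \<partial>unit_sq))"
        by (intro mult_left_mono Cauchy_Schwarz_abs_integral) (use f_square psq B1 C0 in auto)
      also have "(\<integral>q. (\<kappa> (snd q) - p n (snd q))\<^sup>2 \<partial>unit_sq) = (\<integral>t. (p n t - \<kappa> t)\<^sup>2 \<partial>unit_ivl)"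
        unfolding unit_sqD(6)[OF psq, symmetric] by (simp add: power2_commute)
      finally show "norm (\<integral>q. R n q \<partial>unit_sq) \<le>
        B1 * (\<bar>k\<bar> * C) * (sqrt (\<integral>q. (f q)\<^sup>2 \<partial>unit_sq) * L2_norm (\<lambda>t. p n t - \<kappa> t))"
        by (simp add: L2_norm_def)
    qed
    have "(\<lambda>n. B1 * (\<bar>k\<bar> * C) * (sqrt (\<integral>q. (f q)\<^sup>2 \<partial>unit_sq) * L2_norm (\<lambda>t. p n t - \<kappa> t))) \<longlonglongrightarrow>
       B1 * (\<bar>k\<bar> * C) * (sqrt (\<integral>q. (f q)\<^sup>2 \<partial>unit_sq) * 0)" by (intro tendsto_intros n0)
    then show "(\<lambda>n. B1 * (\<bar>k\<bar> * C) * (sqrt (\<integral>q. (f q)\<^sup>2 \<partial>unit_sq) * L2_norm (\<lambda>t. p n t - \<kappa> t))) \<longlonglongrightarrow> 0" by simp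
  qed
  have c\<Theta>: "isCont \<Theta> u" and c\<theta>: "isCont \<theta> u" for u
    using smooth_continuous_on[OF \<Theta>(1), of UNIV] \<Theta>(3) by (auto simp: continuous_on_eq_continuous_at)
  define M' where "M' q = \<xi>' (snd q) * \<Theta> (k * (fst q - phi a (snd q))) * f q
        + \<xi> (snd q) * \<Theta> (k * (fst q - phi a (snd q))) * (f q * vx (fst q) (snd q) + z q)
        + \<xi> (snd q) * (k * \<theta> (k * (fst q - phi a (snd q)))) * f q * (v (fst q) (snd q) - v (phi a (snd q)) (snd q))" for q
  have Mlim: "(\<lambda>n. \<integral>q. M n q \<partial>unit_sq) \<longlonglongrightarrow> (\<integral>q. M' q \<partial>unit_sq)"
  proof (rule integral_dominated_convergence[OF _ _ iD])
    have "(\<lambda>q::real\<times>real. \<Theta> (k * (fst q - phi a (snd q)))) \<in> borel_measurable borel"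
      "(\<lambda>q::real\<times>real. \<theta> (k * (fst q - phi a (snd q)))) \<in> borel_measurable borel"
      "(\<lambda>q::real\<times>real. v (phi a (snd q)) (snd q)) \<in> borel_measurable borel"
      unfolding borel_prod[symmetric] by measurable
    then show "M' \<in> borel_measurable unit_sq" unfolding M'_def[abs_def] by measurable
    show "AE q in unit_sq. (\<lambda>n. M n q) \<longlonglongrightarrow> M' q"
    proof (rule AE_unit_sqI)
      fix x t :: real assume t: "0 < t" "t < 1"
      have "(\<lambda>n. T n (x, t)) \<longlonglongrightarrow> \<Theta> (k * (x - phi a t))" unfolding T_def fst_conv snd_conv
        by (intro isCont_tendsto_compose[OF c\<Theta>] tendsto_intros clim) (use t in auto)
      moreover have "(\<lambda>n. U n (x, t)) \<longlonglongrightarrow> k * \<theta> (k * (x - phi a t))" unfolding U_def fst_conv snd_conv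
        by (intro tendsto_mult tendsto_const isCont_tendsto_compose[OF c\<theta>] tendsto_diff clim) (use t in auto)
      ultimately show "(\<lambda>n. M n (x, t)) \<longlonglongrightarrow> M' (x, t)"
        unfolding M_def M'_def fst_conv snd_conv \<kappa>_def by (intro tendsto_intros)
    qed
    show "AE q in unit_sq. norm (M n q) \<le> D q" for n
      by (rule AE_unit_sqI) (use MD in auto)
  qed simp
  have eq: "(\<integral>q. M n q \<partial>unit_sq) + (\<integral>q. R n q \<partial>unit_sq) =
    \<xi> 1 * (\<integral>x. f1 x * \<Theta> (k * (x - c n 1)) \<partial>unit_ivl) - \<xi> 0 * (\<integral>x. f0 x * \<Theta> (k * (x - a)) \<partial>unit_ivl)" for n
  proof -
    have "(\<integral>q. M n q \<partial>unit_sq) + (\<integral>q. R n q \<partial>unit_sq) = (\<integral>q. M n q + R n q \<partial>unit_sq)"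
      using iM iR by simp
    also have "\<dots> = (\<integral>q. \<xi>' (snd q) * \<Theta> (k * (fst q - c n (snd q))) * f q
        + \<xi> (snd q) * \<Theta> (k * (fst q - c n (snd q))) * (f q * vx (fst q) (snd q) + z q)
        + \<xi> (snd q) * (k * \<theta> (k * (fst q - c n (snd q)))) * f q * (v (fst q) (snd q) - p n (snd q)) \<partial>unit_sq)"
      by (rule Bochner_Integration.integral_cong) (auto simp: M_def R_def T_def U_def algebra_simps)
    also have "\<dots> = \<xi> 1 * (\<integral>x. f1 x * \<Theta> (k * (x - c n 1)) \<partial>unit_ivl) - \<xi> 0 * (\<integral>x. f0 x * \<Theta> (k * (x - c n 0)) \<partial>unit_ivl)"
      by (rule weak_curve[OF \<Theta> \<xi> c(1) p(1) c(2)])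
    finally show ?thesis by (simp add: c(3))
  qed
  have f1lim: "(\<lambda>n. \<integral>x. f1 x * \<Theta> (k * (x - c n 1)) \<partial>unit_ivl) \<longlonglongrightarrow> (\<integral>x. f1 x * \<Theta> (k * (x - phi a 1)) \<partial>unit_ivl)"
  proof (rule integral_dominated_convergence[where w = "\<lambda>x. C * \<bar>f1 x\<bar>"])
    show "AE x in unit_ivl. (\<lambda>n. f1 x * \<Theta> (k * (x - c n 1))) \<longlonglongrightarrow> f1 x * \<Theta> (k * (x - phi a 1))"
      by (intro AE_I2 tendsto_mult tendsto_const isCont_tendsto_compose[OF c\<Theta>] tendsto_diff clim) auto
    show "AE x in unit_ivl. norm (f1 x * \<Theta> (k * (x - c n 1))) \<le> C * \<bar>f1 x\<bar>" for n
      by (rule AE_I2) (simp add: abs_mult mult.commute[of C] mult_left_mono[OF \<Theta>(4)])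
  qed (use f1_int in auto)
  have "(\<lambda>n. (\<integral>q. M n q \<partial>unit_sq) + (\<integral>q. R n q \<partial>unit_sq)) \<longlonglongrightarrow>
     \<xi> 1 * (\<integral>x. f1 x * \<Theta> (k * (x - phi a 1)) \<partial>unit_ivl) - \<xi> 0 * (\<integral>x. f0 x * \<Theta> (k * (x - a)) \<partial>unit_ivl)"
    unfolding eq by (intro tendsto_intros f1lim)
  from LIMSEQ_unique[OF tendsto_add[OF Mlim Rlim] this] show ?thesis by (simp add: M'_def)
qed

text \<open>The smoothed indicators are sharpened, \<open>k\<close> tending to infinity. The term
  with the derivative of the cutoff disappears in the limit, so no flux crosses the
  trajectory.\<close>

lemma weak_flow_region:
  assumes \<xi>: "real_polynomial_function \<xi>" "real_polynomial_function \<xi>'" "\<And>t. (\<xi> has_real_derivative \<xi>' t) (at t)"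
  shows "(\<integral>p. indicator {..phi a (snd p)} (fst p) * (\<xi>' (snd p) * f p + \<xi> (snd p) * (f p * vx (fst p) (snd p) + z p)) \<partial>unit_sq)
      = \<xi> 1 * pint f1 (phi a 1) - \<xi> 0 * pint f0 a"
proof -
  obtain \<Theta> \<theta> :: "real \<Rightarrow> real" and C where \<Theta>:
    "smooth \<Theta>" "\<And>u. (\<Theta> has_real_derivative \<theta> u) (at u)" "continuous_on UNIV \<theta>" "\<And>u. \<bar>\<Theta> u\<bar> \<le> C" "\<And>u. \<bar>\<theta> u\<bar> \<le> C"
    and \<Theta>v: "\<And>u. u \<le> -1 \<Longrightarrow> \<Theta> u = 1" "\<And>u. 1 \<le> u \<Longrightarrow> \<Theta> u = 0" "\<And>u. 1 \<le> \<bar>u\<bar> \<Longrightarrow> \<theta> u = 0"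
    using smooth_step by metis
  have C0: "0 \<le> C" using \<Theta>(4)[of 0] by linarith
  obtain B1 where B1: "0 \<le> B1" "\<And>t. 0 \<le> t \<Longrightarrow> t \<le> 1 \<Longrightarrow> \<bar>\<xi> t\<bar> \<le> B1" using real_polynomial_bound[OF \<xi>(1)] by blast
  obtain B2 where B2: "0 \<le> B2" "\<And>t. 0 \<le> t \<Longrightarrow> t \<le> 1 \<Longrightarrow> \<bar>\<xi>' t\<bar> \<le> B2" using real_polynomial_bound[OF \<xi>(2)] by blast
  note [measurable] = borel_measurable_real_polynomial[OF \<xi>(1)] borel_measurable_real_polynomial[OF \<xi>(2)]
    borel_measurable_continuous_onI[OF smooth_continuous_on[OF \<Theta>(1)]] borel_measurable_continuous_onI[OF \<Theta>(3)]
  have big: "\<exists>N. \<forall>n\<ge>N. 1 \<le> real n * \<bar>y\<bar>" if "y \<noteq> 0" for y :: real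
  proof -
    obtain N :: nat where "1 / \<bar>y\<bar> \<le> real N" using real_arch_simple by blast
    then have "1 \<le> real n * \<bar>y\<bar>" if "N \<le> n" for n
    proof -
      have "1 / \<bar>y\<bar> \<le> real n" using \<open>1 / \<bar>y\<bar> \<le> real N\<close> that by linarith
      then show ?thesis using \<open>y \<noteq> 0\<close> by (simp add: divide_le_eq)
    qed
    then show ?thesis by blast
  qed
  have \<Theta>lim: "(\<lambda>n. \<Theta> (real n * (x - c))) \<longlonglongrightarrow> indicator {..c} x" if "x \<noteq> c" for x c
  proof (rule tendsto_eventually)
    obtain N where N: "\<And>n. n \<ge> N \<Longrightarrow> 1 \<le> real n * \<bar>x - c\<bar>" using big[of "x - c"] \<open>x \<noteq> c\<close> by auto
    have "\<Theta> (real n * (x - c)) = indicator {..c} x" if "n \<ge> N" for n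
    proof (cases "x < c")
      case True
      then have "real n * (x - c) \<le> -1" using N[OF that] by (simp add: abs_if algebra_simps)
      then show ?thesis using \<Theta>v(1) True by simp
    next
      case False
      then have "1 \<le> real n * (x - c)" using N[OF that] \<open>x \<noteq> c\<close> by (simp add: abs_if)
      then show ?thesis using \<Theta>v(2) False \<open>x \<noteq> c\<close> by simp
    qed
    then show "\<forall>\<^sub>F n in sequentially. \<Theta> (real n * (x - c)) = indicator {..c} x"
      unfolding eventually_sequentially by blast
  qed
  have \<theta>lim: "(\<lambda>n. real n * \<theta> (real n * (x - c))) \<longlonglongrightarrow> 0" if "x \<noteq> c" for x c
  proof (rule tendsto_eventually)
    obtain N where N: "\<And>n. n \<ge> N \<Longrightarrow> 1 \<le> real n * \<bar>x - c\<bar>" using big[of "x - c"] \<open>x \<noteq> c\<close> by auto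
    have "\<theta> (real n * (x - c)) = 0" if "n \<ge> N" for n
      by (rule \<Theta>v(3)) (use N[OF that] in \<open>simp add: abs_mult\<close>)
    then show "\<forall>\<^sub>F n in sequentially. real n * \<theta> (real n * (x - c)) = 0"
      unfolding eventually_sequentially by auto
  qed
  \<comment> \<open>Where \<open>\<theta>\<close> does not vanish, \<open>x\<close> is within
    \<open>1 / n\<close> of the trajectory, so the Lipschitz bound on \<open>v\<close> absorbs the
    factor \<open>n\<close>.\<close>
  have \<theta>b: "\<bar>real n * \<theta> (real n * (x - c)) * (v x t - v c t)\<bar> \<le> C * l t" for n x c t
  proof (cases "1 \<le> \<bar>real n * (x - c)\<bar>")
    case True
    then show ?thesis using \<Theta>v(3) C0 by simp
  next
    case False
    have "\<bar>real n * \<theta> (real n * (x - c)) * (v x t - v c t)\<bar> = \<bar>\<theta> (real n * (x - c))\<bar> * (real n * \<bar>v x t - v c t\<bar>)"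
      by (simp add: abs_mult)
    also have "\<dots> \<le> C * (real n * (l t * \<bar>x - c\<bar>))"
      by (intro mult_mono \<Theta>(5) mult_left_mono v_Lipschitz C0) auto
    also have "real n * (l t * \<bar>x - c\<bar>) = l t * \<bar>real n * (x - c)\<bar>" by (simp add: abs_mult)
    also have "C * \<dots> \<le> C * (l t * 1)" using False by (intro mult_left_mono C0) auto
    finally show ?thesis by simp
  qed
  define M where "M n p = \<xi>' (snd p) * \<Theta> (real n * (fst p - phi a (snd p))) * f p
        + \<xi> (snd p) * \<Theta> (real n * (fst p - phi a (snd p))) * (f p * vx (fst p) (snd p) + z p)
        + \<xi> (snd p) * (real n * \<theta> (real n * (fst p - phi a (snd p)))) * f p * (v (fst p) (snd p) - v (phi a (snd p)) (snd p))" for n p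
  define M' where "M' p = indicator {..phi a (snd p)} (fst p) * (\<xi>' (snd p) * f p + \<xi> (snd p) * (f p * vx (fst p) (snd p) + z p))" for p
  define D where "D q = B2 * C * \<bar>f q\<bar> + B1 * C * (\<bar>f q * vx (fst q) (snd q)\<bar> + \<bar>z q\<bar>) + B1 * C * (l (snd q) * \<bar>f q\<bar>)" for q
  have iD: "integrable unit_sq D" unfolding D_def
    using integrable_f integrable_fvx integrable_z integrable_fl_abs by (auto intro!: integrable_abs)
  have [measurable]: "(\<lambda>q::real\<times>real. \<Theta> (real n * (fst q - phi a (snd q)))) \<in> borel_measurable borel"
      "(\<lambda>q::real\<times>real. \<theta> (real n * (fst q - phi a (snd q)))) \<in> borel_measurable borel"
      "(\<lambda>q::real\<times>real. v (phi a (snd q)) (snd q)) \<in> borel_measurable borel"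
      "(\<lambda>q::real\<times>real. \<xi> (snd q)) \<in> borel_measurable borel" "(\<lambda>q::real\<times>real. \<xi>' (snd q)) \<in> borel_measurable borel" for n
    unfolding borel_prod[symmetric] by measurable
  have "(\<lambda>q::real\<times>real. if fst q \<le> phi a (snd q) then 1 else 0 :: real) \<in> borel_measurable borel"
    unfolding borel_prod[symmetric] by measurable
  moreover have "(\<lambda>q::real\<times>real. indicator {..phi a (snd q)} (fst q) :: real) = (\<lambda>q. if fst q \<le> phi a (snd q) then 1 else 0)"
    by (auto simp: indicator_def)
  ultimately have [measurable]: "(\<lambda>q::real\<times>real. indicator {..phi a (snd q)} (fst q) :: real) \<in> borel_measurable borel" by simp
  have Mlim: "(\<lambda>n. \<integral>q. M n q \<partial>unit_sq) \<longlonglongrightarrow> (\<integral>q. M' q \<partial>unit_sq)"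
  proof (rule integral_dominated_convergence[OF _ _ iD])
    show "M' \<in> borel_measurable unit_sq" unfolding M'_def[abs_def] by measurable
    show "M n \<in> borel_measurable unit_sq" for n unfolding M_def[abs_def] by measurable
    have "AE q in unit_sq. fst q \<noteq> phi a (snd q)" by (rule AE_unit_sq_off_graph) measurable
    then show "AE q in unit_sq. (\<lambda>n. M n q) \<longlonglongrightarrow> M' q"
    proof eventually_elim
      case (elim q)
      have "(\<lambda>n. M n q) \<longlonglongrightarrow> \<xi>' (snd q) * indicator {..phi a (snd q)} (fst q) * f q
        + \<xi> (snd q) * indicator {..phi a (snd q)} (fst q) * (f q * vx (fst q) (snd q) + z q)
        + \<xi> (snd q) * 0 * f q * (v (fst q) (snd q) - v (phi a (snd q)) (snd q))"
        unfolding M_def by (intro tendsto_intros \<Theta>lim[OF elim] \<theta>lim[OF elim])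
      then show ?case by (simp add: M'_def algebra_simps)
    qed
    show "AE q in unit_sq. norm (M n q) \<le> D q" for n
    proof (rule AE_unit_sqI)
      fix x t :: real assume t: "0 < t" "t < 1"
      define q where "q = (x, t)"
      have t: "0 \<le> snd q" "snd q \<le> 1" using t by (auto simp: q_def)
      have "\<bar>\<xi>' (snd q) * \<Theta> (real n * (fst q - phi a (snd q))) * f q\<bar> \<le> B2 * C * \<bar>f q\<bar>"
        unfolding abs_mult by (intro mult_mono B2 \<Theta>(4) C0 mult_nonneg_nonneg) (use t in auto)
      moreover have "\<bar>\<xi> (snd q) * \<Theta> (real n * (fst q - phi a (snd q))) * (f q * vx (fst q) (snd q) + z q)\<bar> \<le> B1 * C * (\<bar>f q * vx (fst q) (snd q)\<bar> + \<bar>z q\<bar>)"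
        unfolding abs_mult[of "\<xi> (snd q) * \<Theta> _"] abs_mult[of "\<xi> (snd q)"]
        by (intro mult_mono B1 \<Theta>(4) C0 mult_nonneg_nonneg abs_triangle_ineq) (use t in auto)
      moreover have "\<bar>\<xi> (snd q) * (real n * \<theta> (real n * (fst q - phi a (snd q)))) * f q * (v (fst q) (snd q) - v (phi a (snd q)) (snd q))\<bar> \<le> B1 * C * (l (snd q) * \<bar>f q\<bar>)"
      proof -
        have "\<bar>\<xi> (snd q)\<bar> * \<bar>real n * \<theta> (real n * (fst q - phi a (snd q))) * (v (fst q) (snd q) - v (phi a (snd q)) (snd q))\<bar> * \<bar>f q\<bar>
          \<le> B1 * (C * l (snd q)) * \<bar>f q\<bar>"
          by (intro mult_mono B1 \<theta>b C0 mult_nonneg_nonneg) (use t in auto)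
        then show ?thesis by (simp add: abs_mult mult_ac)
      qed
      ultimately have "\<bar>M n q\<bar> \<le> D q" unfolding M_def D_def by linarith
      then show "norm (M n (x, t)) \<le> D (x, t)" by (simp add: q_def)
    qed
  qed
  have hlim: "(\<lambda>n. \<integral>x. h x * \<Theta> (real n * (x - c)) \<partial>unit_ivl) \<longlonglongrightarrow> pint h c"
    if h: "integrable unit_ivl h" and [measurable]: "h \<in> borel_measurable borel" for h c
  proof -
    have "(\<lambda>n. \<integral>x. h x * \<Theta> (real n * (x - c)) \<partial>unit_ivl) \<longlonglongrightarrow> (\<integral>x. h x * indicator {..c} x \<partial>unit_ivl)"
    proof (rule integral_dominated_convergence[where w = "\<lambda>x. C * \<bar>h x\<bar>"])
      show "AE x in unit_ivl. (\<lambda>n. h x * \<Theta> (real n * (x - c))) \<longlonglongrightarrow> h x * indicator {..c} x"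
        using AE_unit_ivl_neq[of c] by eventually_elim (intro tendsto_intros \<Theta>lim)
      show "AE x in unit_ivl. norm (h x * \<Theta> (real n * (x - c))) \<le> C * \<bar>h x\<bar>" for n
        by (rule AE_I2) (simp add: abs_mult mult.commute[of C] mult_left_mono[OF \<Theta>(4)])
    qed (use h in auto)
    then show ?thesis unfolding pint_def by (simp add: mult.commute)
  qed
  have "(\<integral>q. M n q \<partial>unit_sq) = \<xi> 1 * (\<integral>x. f1 x * \<Theta> (real n * (x - phi a 1)) \<partial>unit_ivl)
      - \<xi> 0 * (\<integral>x. f0 x * \<Theta> (real n * (x - a)) \<partial>unit_ivl)" for n
    unfolding M_def by (rule weak_flow_curve[OF \<Theta> \<xi>])
  moreover have "(\<lambda>n. \<xi> 1 * (\<integral>x. f1 x * \<Theta> (real n * (x - phi a 1)) \<partial>unit_ivl)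
      - \<xi> 0 * (\<integral>x. f0 x * \<Theta> (real n * (x - a)) \<partial>unit_ivl)) \<longlonglongrightarrow> \<xi> 1 * pint f1 (phi a 1) - \<xi> 0 * pint f0 a"
    by (intro tendsto_intros hlim f0_int f1_int f0_borel f1_borel)
  ultimately have "(\<lambda>n. \<integral>q. M n q \<partial>unit_sq) \<longlonglongrightarrow> \<xi> 1 * pint f1 (phi a 1) - \<xi> 0 * pint f0 a" by simp
  from LIMSEQ_unique[OF Mlim this] show ?thesis by (simp add: M'_def)
qed

end

lemma integrable_indicator_fst:
  assumes "integrable unit_sq H"
  shows "integrable unit_sq (\<lambda>p. indicator {..a} (fst p) * H p :: real)"
proof (rule integrable_bounded_mult[OF assms, of _ 1])
  have "(\<lambda>p::real\<times>real. if fst p \<le> a then 1 else 0 :: real) \<in> borel_measurable borel"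
    unfolding borel_prod[symmetric] by measurable
  then have "(\<lambda>p::real\<times>real. if fst p \<le> a then 1 else 0 :: real) \<in> borel_measurable unit_sq" by measurable
  moreover have "(\<lambda>p::real\<times>real. indicator {..a} (fst p) :: real) = (\<lambda>p. if fst p \<le> a then 1 else 0)"
    by (auto simp: indicator_def)
  ultimately show "(\<lambda>p. indicator {..a} (fst p) :: real) \<in> borel_measurable unit_sq" by simp
qed (auto simp: indicator_def)

lemma integrable_indicator_snd:
  assumes "integrable unit_sq H"
  shows "integrable unit_sq (\<lambda>p. indicator {..a} (snd p) * H p :: real)"
proof (rule integrable_bounded_mult[OF assms, of _ 1])
  have "(\<lambda>p::real\<times>real. if snd p \<le> a then 1 else 0 :: real) \<in> borel_measurable borel"
    unfolding borel_prod[symmetric] by measurable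
  then have "(\<lambda>p::real\<times>real. if snd p \<le> a then 1 else 0 :: real) \<in> borel_measurable unit_sq" by measurable
  moreover have "(\<lambda>p::real\<times>real. indicator {..a} (snd p) :: real) = (\<lambda>p. if snd p \<le> a then 1 else 0)"
    by (auto simp: indicator_def)
  ultimately show "(\<lambda>p. indicator {..a} (snd p) :: real) \<in> borel_measurable unit_sq" by simp
qed (auto simp: indicator_def)

lemma integrable_pint_slice: "integrable unit_sq H \<Longrightarrow> integrable unit_ivl (\<lambda>t. pint (\<lambda>x. H (x, t)) a)"
  using unit_sqD(2)[OF integrable_indicator_fst[of H a]] by (simp add: pint_def)

lemma integrable_pint_slice':
  "integrable unit_sq H \<Longrightarrow> integrable unit_ivl (\<lambda>x. pint (\<lambda>s. H (x, s)) t)"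
  using unit_sqD(4)[OF integrable_indicator_snd[of H t]] by (simp add: pint_def)

lemma pint_swap:
  assumes "integrable unit_sq H"
  shows "pint (\<lambda>s. pint (\<lambda>x. H (x, s)) a) t = pint (\<lambda>x. pint (\<lambda>s. H (x, s)) t) a"
  using unit_sqD(5)[OF integrable_indicator_fst[OF integrable_indicator_snd[OF assms, of t], of a]]
  by (simp only: pint_def integral_mult_right_zero[symmetric] mult.left_commute[of "indicator {..t} _"] fst_conv snd_conv)

section \<open>Balance laws in Lagrangian coordinates\<close>

context transport
begin

text \<open>The mass density of \<open>f\<close> per unit of starting points; \<open>Nt\<close>
  below is its rate of change, since the equation in divergence form has the right-hand side f v_x +
  z.\<close>

definition Gt :: "real \<times> real \<Rightarrow> real" where
  "Gt p = f (phi (fst p) (snd p), snd p) * J (fst p) (snd p)"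

definition Nt :: "real \<times> real \<Rightarrow> real" where
  "Nt p = (f (phi (fst p) (snd p), snd p) * vx (phi (fst p) (snd p)) (snd p) + z (phi (fst p) (snd p), snd p))
    * J (fst p) (snd p)"

lemma Gt_borel [measurable]: "Gt \<in> borel_measurable borel"
  unfolding Gt_def[abs_def] borel_prod[symmetric] by measurable

lemma Nt_borel [measurable]: "Nt \<in> borel_measurable borel"
  unfolding Nt_def[abs_def] borel_prod[symmetric] by measurable

lemma integrable_Gt: "integrable unit_sq Gt"
  unfolding Gt_def[abs_def] by (rule integrable_phi_unit_sq[OF f_borel integrable_f])

lemma integrable_source: "integrable unit_sq (\<lambda>p. f p * vx (fst p) (snd p) + z p)"
  using integrable_fvx integrable_z by simp

lemma integrable_Nt: "integrable unit_sq Nt"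
proof -
  have "(\<lambda>p. f p * vx (fst p) (snd p) + z p) \<in> borel_measurable borel" by measurable
  from integrable_phi_unit_sq[OF this integrable_source] show ?thesis
    unfolding Nt_def[abs_def] by simp
qed

text \<open>In Lagrangian coordinates the region to the left of the trajectory from \<open>a\<close>
  is the fixed interval up to \<open>a\<close>. The identity of \<open>weak_flow_region\<close> then
  involves functions of time alone, and \<open>time_primitive\<close> applies.\<close>

lemma mass_balance:
  shows "AE t in unit_ivl. pint (\<lambda>x. Gt (x, t)) a = pint f0 a + pint (\<lambda>s. pint (\<lambda>x. Nt (x, s)) a) t"
    and "pint f1 (phi a 1) = pint f0 a + (\<integral>s. pint (\<lambda>x. Nt (x, s)) a \<partial>unit_ivl)"
proof -
  have weak: "(\<integral>t. \<xi>' t * pint (\<lambda>x. Gt (x, t)) a + \<xi> t * pint (\<lambda>x. Nt (x, t)) a \<partial>unit_ivl)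
      = \<xi> 1 * pint f1 (phi a 1) - \<xi> 0 * pint f0 a"
    if \<xi>: "real_polynomial_function \<xi>" "real_polynomial_function \<xi>'" "\<And>t. (\<xi> has_real_derivative \<xi>' t) (at t)" for \<xi> \<xi>'
  proof -
    obtain B1 where B1: "0 \<le> B1" "\<And>t. 0 \<le> t \<Longrightarrow> t \<le> 1 \<Longrightarrow> \<bar>\<xi> t\<bar> \<le> B1" using real_polynomial_bound[OF \<xi>(1)] by blast
    obtain B2 where B2: "0 \<le> B2" "\<And>t. 0 \<le> t \<Longrightarrow> t \<le> 1 \<Longrightarrow> \<bar>\<xi>' t\<bar> \<le> B2" using real_polynomial_bound[OF \<xi>(2)] by blast
    note [measurable] = borel_measurable_real_polynomial[OF \<xi>(1)] borel_measurable_real_polynomial[OF \<xi>(2)]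
    have [measurable]: "(\<lambda>q::real \<times> real. \<xi> (snd q)) \<in> borel_measurable borel" "(\<lambda>q::real \<times> real. \<xi>' (snd q)) \<in> borel_measurable borel"
      unfolding borel_prod[symmetric] by measurable
    have i1: "integrable unit_sq (\<lambda>p. \<xi>' (snd p) * f p)"
      by (rule integrable_bounded_mult[OF integrable_f, of _ B2]) (use B2 in \<open>auto intro!: AE_unit_sqI\<close>)
    have i2: "integrable unit_sq (\<lambda>p. \<xi> (snd p) * (f p * vx (fst p) (snd p) + z p))"
      by (rule integrable_bounded_mult[OF integrable_source, of _ B1]) (use B1 in \<open>auto intro!: AE_unit_sqI\<close>)
    define H where "H p = \<xi>' (snd p) * f p + \<xi> (snd p) * (f p * vx (fst p) (snd p) + z p)" for p
    have iH: "integrable unit_sq H" unfolding H_def using i1 i2 by simp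
    have ind: "(\<lambda>p::real\<times>real. indicator {..phi a (snd p)} (fst p) :: real) \<in> borel_measurable unit_sq"
    proof -
      have "(\<lambda>q::real\<times>real. if fst q \<le> phi a (snd q) then 1 else 0 :: real) \<in> borel_measurable borel"
        unfolding borel_prod[symmetric] by measurable
      then have "(\<lambda>q::real\<times>real. if fst q \<le> phi a (snd q) then 1 else 0 :: real) \<in> borel_measurable unit_sq" by measurable
      moreover have "(\<lambda>q::real\<times>real. indicator {..phi a (snd q)} (fst q) :: real) = (\<lambda>q. if fst q \<le> phi a (snd q) then 1 else 0)"
        by (auto simp: indicator_def)
      ultimately show ?thesis by simp
    qed
    have iH': "integrable unit_sq (\<lambda>p. indicator {..phi a (snd p)} (fst p) * H p)"
      by (rule integrable_bounded_mult[OF iH ind, of 1]) (auto simp: indicator_def)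
    have "(\<integral>t. \<xi>' t * pint (\<lambda>x. Gt (x, t)) a + \<xi> t * pint (\<lambda>x. Nt (x, t)) a \<partial>unit_ivl)
      = (\<integral>t. \<integral>x. indicator {..phi a (snd (x, t))} (fst (x, t)) * H (x, t) \<partial>unit_ivl \<partial>unit_ivl)"
    proof (rule integral_cong_AE)
      show "(\<lambda>t. \<xi>' t * pint (\<lambda>x. Gt (x, t)) a + \<xi> t * pint (\<lambda>x. Nt (x, t)) a) \<in> borel_measurable unit_ivl"
        using integrable_pint_slice[OF integrable_Gt, of a] integrable_pint_slice[OF integrable_Nt, of a]
        by (intro borel_measurable_add borel_measurable_times) auto
      show "(\<lambda>t. \<integral>x. indicator {..phi a (snd (x, t))} (fst (x, t)) * H (x, t) \<partial>unit_ivl) \<in> borel_measurable unit_ivl"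
        using unit_sqD(2)[OF iH'] by auto
      show "AE t in unit_ivl. \<xi>' t * pint (\<lambda>x. Gt (x, t)) a + \<xi> t * pint (\<lambda>x. Nt (x, t)) a
          = (\<integral>x. indicator {..phi a (snd (x, t))} (fst (x, t)) * H (x, t) \<partial>unit_ivl)"
        using unit_sqD(1)[OF integrable_f] unit_sqD(1)[OF integrable_source] AE_unit_ivl_interior
      proof eventually_elim
        case (elim t)
        have t: "0 \<le> t" "t \<le> 1" using elim by auto
        have "pint (\<lambda>x. Gt (x, t)) a = pint (\<lambda>y. f (y, t)) (phi a t)"
          unfolding Gt_def fst_conv snd_conv by (rule pint_phi[OF t]) measurable
        moreover have "pint (\<lambda>x. Nt (x, t)) a = pint (\<lambda>y. f (y, t) * vx y t + z (y, t)) (phi a t)"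
          unfolding Nt_def fst_conv snd_conv by (rule pint_phi[OF t]) measurable
        moreover have "pint (\<lambda>y. H (y, t)) (phi a t) =
          \<xi>' t * pint (\<lambda>y. f (y, t)) (phi a t) + \<xi> t * pint (\<lambda>y. f (y, t) * vx y t + z (y, t)) (phi a t)"
          unfolding H_def fst_conv snd_conv pint_cmult[symmetric]
          by (rule pint_add) (use elim in auto)
        ultimately show ?case by (simp add: pint_def)
      qed
    qed
    also have "\<dots> = (\<integral>p. indicator {..phi a (snd p)} (fst p) * H p \<partial>unit_sq)" by (rule unit_sqD(6)[OF iH'])
    also have "\<dots> = \<xi> 1 * pint f1 (phi a 1) - \<xi> 0 * pint f0 a"
      unfolding H_def by (rule weak_flow_region[OF \<xi>])
    finally show ?thesis .
  qed
  show "AE t in unit_ivl. pint (\<lambda>x. Gt (x, t)) a = pint f0 a + pint (\<lambda>s. pint (\<lambda>x. Nt (x, s)) a) t"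
    by (rule time_primitive(1)[OF integrable_pint_slice[OF integrable_Gt] integrable_pint_slice[OF integrable_Nt] weak])
  show "pint f1 (phi a 1) = pint f0 a + (\<integral>s. pint (\<lambda>x. Nt (x, s)) a \<partial>unit_ivl)"
    by (rule time_primitive(2)[OF integrable_pint_slice[OF integrable_Gt] integrable_pint_slice[OF integrable_Nt] weak])
qed

lemma AE_slice_Nt: "AE x in unit_ivl. integrable unit_ivl (\<lambda>s. Nt (x, s))"
  by (rule unit_sqD(3)[OF integrable_Nt])

lemma pint_Nt_pair_borel [measurable]: "(\<lambda>p. pint (\<lambda>s. Nt (fst p, s)) (snd p)) \<in> borel_measurable borel"
  unfolding borel_prod[symmetric] by measurable

lemmas integrable_pint_Nt = integrable_pint_slice'[OF integrable_Nt]

text \<open>For fixed \<open>a\<close> the mass balance holds off a null set of times depending on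
  \<open>a\<close>. Fubini puts the times first; for almost every time the balance then holds for
  almost every \<open>a\<close>, by continuity for every \<open>a\<close> in [0,1], and the
  integrand vanishes.\<close>

lemma density_balance:
  "AE t in unit_ivl. AE x in unit_ivl. Gt (x, t) = f0 x + pint (\<lambda>s. Nt (x, s)) t"
  "AE x in unit_ivl. f1 (phi x 1) * J x 1 = f0 x + pint (\<lambda>s. Nt (x, s)) 1"
proof -
  define R where "R p = Gt p - f0 (fst p) - pint (\<lambda>s. Nt (fst p, s)) (snd p)" for p
  have [measurable]: "(\<lambda>p::real\<times>real. f0 (fst p)) \<in> borel_measurable borel"
    unfolding borel_prod[symmetric] by measurable
  have R_borel [measurable]: "R \<in> borel_measurable borel" unfolding R_def[abs_def] by measurable
  have R_a: "pint (\<lambda>x. R (x, t)) a = pint (\<lambda>x. Gt (x, t)) a - pint f0 a - pint (\<lambda>s. pint (\<lambda>x. Nt (x, s)) a) t"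
    if "integrable unit_ivl (\<lambda>x. Gt (x, t))" for t a
    unfolding pint_swap[OF integrable_Nt] R_def fst_conv snd_conv
    using that f0_int integrable_pint_Nt by (simp add: pint_diff)
  have "AE a in unit_ivl. AE t in unit_ivl. pint (\<lambda>x. R (x, t)) a = 0"
  proof (rule AE_I2)
    fix a show "AE t in unit_ivl. pint (\<lambda>x. R (x, t)) a = 0"
      using mass_balance(1)[of a] unit_sqD(1)[OF integrable_Gt] by eventually_elim (simp add: R_a)
  qed
  then have "AE t in unit_ivl. AE a in unit_ivl. pint (\<lambda>x. R (x, t)) a = 0"
    using AE_unit_ivl_swap[of "\<lambda>p. pint (\<lambda>x. R (x, snd p)) (fst p)" "\<lambda>_. 0"]
  proof -
    have "(\<lambda>p::real\<times>real. pint (\<lambda>x. R (x, snd p)) (fst p)) \<in> borel_measurable borel"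
      unfolding borel_prod[symmetric] by measurable
    from AE_unit_ivl_swap[OF this, of "\<lambda>_. 0"] \<open>AE a in unit_ivl. AE t in unit_ivl. pint (\<lambda>x. R (x, t)) a = 0\<close>
    show ?thesis by simp
  qed
  then show "AE t in unit_ivl. AE x in unit_ivl. Gt (x, t) = f0 x + pint (\<lambda>s. Nt (x, s)) t"
    using unit_sqD(1)[OF integrable_Gt]
  proof eventually_elim
    case (elim t)
    have iR: "integrable unit_ivl (\<lambda>x. R (x, t))"
      unfolding R_def fst_conv snd_conv using elim f0_int integrable_pint_Nt by simp
    have "AE x in unit_ivl. R (x, t) = 0"
    proof (rule AE_zero_if_pint_zero[OF iR])
      show "pint (\<lambda>x. R (x, t)) a = 0" if "0 \<le> a" "a \<le> 1" for a
        by (rule AE_eq_imp_eq_continuous[OF elim(1)]) (use that iR in \<open>auto intro: continuous_on_pint\<close>)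
    qed
    then show ?case by eventually_elim (simp add: R_def)
  qed
  \<comment> \<open>At time 1 the mass balance is exact for every \<open>a\<close>, so there is no
    exceptional set to move.\<close>
  define S where "S x = f1 (phi x 1) * J x 1 - f0 x - pint (\<lambda>s. Nt (x, s)) 1" for x
  have i1: "integrable unit_ivl (\<lambda>x. f1 (phi x 1) * J x 1)" using integrable_phi[of 1 f1] f1_int by simp
  have iS: "integrable unit_ivl S" unfolding S_def using i1 f0_int integrable_pint_Nt by simp
  have "AE x in unit_ivl. S x = 0"
  proof (rule AE_zero_if_pint_zero[OF iS])
    fix a
    have "pint S a = pint f1 (phi a 1) - pint f0 a - pint (\<lambda>x. pint (\<lambda>s. Nt (x, s)) 1) a"
      unfolding S_def using i1 f0_int integrable_pint_Nt pint_phi[of 1 f1 a] by (simp add: pint_diff)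
    also have "\<dots> = 0"
      using mass_balance(2)[of a] pint_swap[OF integrable_Nt, of a 1] by (simp add: pint_ge_1)
    finally show "pint S a = 0" .
  qed
  then show "AE x in unit_ivl. f1 (phi x 1) * J x 1 = f0 x + pint (\<lambda>s. Nt (x, s)) 1"
    by eventually_elim (simp add: S_def)
qed

text \<open>Dividing the balance \<open>Q' = vx Q + z J\<close> along a trajectory by \<open>J\<close>, which solves \<open>J' = vx J\<close>.\<close>

lemma Lagrangian:
  "AE t in unit_ivl. AE x in unit_ivl. f (phi x t, t) = f0 x + pint (\<lambda>s. z (phi x s, s)) t"
  "AE x in unit_ivl. f1 (phi x 1) = f0 x + (\<integral>s. z (phi x s, s) \<partial>unit_ivl)"
proof -
  have fst_f0: "(\<lambda>p::real\<times>real. f0 (fst p) + pint (\<lambda>s. Nt (fst p, s)) (snd p)) \<in> borel_measurable borel"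
    unfolding borel_prod[symmetric] by measurable
  have db: "AE x in unit_ivl. AE t in unit_ivl. Gt (x, t) = f0 x + pint (\<lambda>s. Nt (x, s)) t"
    using AE_unit_ivl_swap[OF Gt_borel fst_f0] density_balance(1) by simp
  have main: "AE x in unit_ivl. (AE t in unit_ivl. f (phi x t, t) = f0 x + pint (\<lambda>s. z (phi x s, s)) t)
      \<and> f1 (phi x 1) = f0 x + (\<integral>s. z (phi x s, s) \<partial>unit_ivl)"
    using db density_balance(2) AE_slice_Nt
  proof eventually_elim
    case (elim x)
    \<comment> \<open>The absolutely continuous version of f J along the trajectory, to which the
      product rule applies. The two agree for almost every time, and there the terms with
      \<open>vx\<close> cancel.\<close>
    define Q where "Q t = f0 x + pint (\<lambda>s. Nt (x, s)) t" for t
    have aQ: "ac Q (\<lambda>t. Nt (x, t))" unfolding Q_def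
      using ac_add[OF ac_const[of "f0 x"] ac_pint[OF elim(3)]] by simp
    have "ac (\<lambda>t. - 1 * lJ x t) (\<lambda>t. - 1 * vx (phi x t) t)" by (rule ac_cmult[OF ac_lJ])
    from ac_mult[OF aQ ac_exp[OF this]]
    have a: "ac (\<lambda>t. Q t * exp (- lJ x t)) (\<lambda>t. exp (- lJ x t) * Nt (x, t) + Q t * (exp (- lJ x t) * (- vx (phi x t) t)))"
      by simp
    have eq: "AE t in unit_ivl. exp (- lJ x t) * Nt (x, t) + Q t * (exp (- lJ x t) * (- vx (phi x t) t)) = z (phi x t, t)"
      using elim(1)
    proof eventually_elim
      case (elim t)
      have "Q t = f (phi x t, t) * J x t" using elim unfolding Q_def Gt_def by simp
      then show ?case unfolding Nt_def J_def fst_conv snd_conv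
        by (simp add: algebra_simps exp_minus)
    qed
    have m: "(\<lambda>t. z (phi x t, t)) \<in> borel_measurable unit_ivl" by measurable
    have Qz: "Q t * exp (- lJ x t) = f0 x + pint (\<lambda>s. z (phi x s, s)) t" if t: "0 \<le> t" "t \<le> 1" for t
    proof -
      have "Q 0 * exp (- lJ x 0) = f0 x" by (simp add: Q_def lJ_def)
      moreover have "pint (\<lambda>t. exp (- lJ x t) * Nt (x, t) + Q t * (exp (- lJ x t) * (- vx (phi x t) t))) t =
        pint (\<lambda>s. z (phi x s, s)) t"
        by (rule pint_cong_AE[OF eq _ m]) (use acD(1)[OF a] in auto)
      ultimately show ?thesis using acD(2)[OF a t] by simp
    qed
    have "AE t in unit_ivl. f (phi x t, t) = f0 x + pint (\<lambda>s. z (phi x s, s)) t"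
      using elim(1) AE_unit_ivl_interior
    proof eventually_elim
      case (elim t)
      have "Q t = f (phi x t, t) * J x t" using elim unfolding Q_def Gt_def by simp
      then show ?case using Qz[of t] elim by (simp add: J_def mult.assoc flip: exp_add)
    qed
    moreover have "f1 (phi x 1) = f0 x + (\<integral>s. z (phi x s, s) \<partial>unit_ivl)"
    proof -
      have "Q 1 = f1 (phi x 1) * J x 1" using elim(2) unfolding Q_def by simp
      then show ?thesis using Qz[of 1] by (simp add: J_def pint_ge_1 mult.assoc flip: exp_add)
    qed
    ultimately show ?case by blast
  qed
  then show "AE x in unit_ivl. f1 (phi x 1) = f0 x + (\<integral>s. z (phi x s, s) \<partial>unit_ivl)"
    by eventually_elim blast
  have m1: "(\<lambda>p::real\<times>real. f (phi (fst p) (snd p), snd p)) \<in> borel_measurable borel"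
    and m2: "(\<lambda>p::real\<times>real. f0 (fst p) + pint (\<lambda>s. z (phi (fst p) s, s)) (snd p)) \<in> borel_measurable borel"
    unfolding borel_prod[symmetric] by measurable
  have "AE x in unit_ivl. AE t in unit_ivl. f (phi x t, t) = f0 x + pint (\<lambda>s. z (phi x s, s)) t"
    using main by eventually_elim blast
  then show "AE t in unit_ivl. AE x in unit_ivl. f (phi x t, t) = f0 x + pint (\<lambda>s. z (phi x s, s)) t"
    using AE_unit_ivl_swap[OF m1 m2] by simp
qed

end

subsection \<open>The minimal source for a given velocity field\<close>

lemma smooth_partial:
  fixes \<phi> :: "real \<times> real \<Rightarrow> real"
  assumes s: "smooth \<phi>"
  obtains \<phi>x \<phi>t where
    "\<And>x t. ((\<lambda>y. \<phi> (y, t)) has_real_derivative \<phi>x (x, t)) (at x)"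
    "\<And>x t. ((\<lambda>s. \<phi> (x, s)) has_real_derivative \<phi>t (x, t)) (at t)"
    "continuous_on UNIV \<phi>x" "continuous_on UNIV \<phi>t"
proof -
  define D where "D p = frechet_derivative \<phi> (at p)" for p
  have d: "(\<phi> has_derivative D p) (at p)" for p
    unfolding D_def by (rule smooth_has_derivative[OF s])
  have lin: "D p (c *\<^sub>R h) = c * D p h" for p h c
    using linear_cmul[OF has_derivative_linear[OF d]] by simp
  show ?thesis
  proof (rule that[of "\<lambda>p. D p (1, 0)" "\<lambda>p. D p (0, 1)"])
    fix x t :: real
    have "((\<lambda>y. (y, t)) has_derivative (\<lambda>h. (h, 0))) (at x)"
      by (intro has_derivative_Pair has_derivative_ident has_derivative_const)
    from has_derivative_compose[OF this d]
    have "((\<lambda>y. \<phi> (y, t)) has_derivative (\<lambda>h. D (x, t) (h, 0))) (at x)" .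
    moreover have "(\<lambda>h. D (x, t) (h, 0)) = (*) (D (x, t) (1, 0))"
    proof
      fix h :: real
      have "h *\<^sub>R (1, 0) = (h, 0 :: real)" by simp
      with lin[of "(x, t)" h "(1, 0)"] show "D (x, t) (h, 0) = D (x, t) (1, 0) * h"
        by (simp only: mult.commute)
    qed
    ultimately show "((\<lambda>y. \<phi> (y, t)) has_real_derivative D (x, t) (1, 0)) (at x)"
      unfolding has_field_derivative_def by (simp only:)
    have "((\<lambda>s. (x, s)) has_derivative (\<lambda>h. (0, h))) (at t)"
      by (intro has_derivative_Pair has_derivative_ident has_derivative_const)
    from has_derivative_compose[OF this d]
    have "((\<lambda>s. \<phi> (x, s)) has_derivative (\<lambda>h. D (x, t) (0, h))) (at t)" .
    moreover have "(\<lambda>h. D (x, t) (0, h)) = (*) (D (x, t) (0, 1))"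
    proof
      fix h :: real
      have "h *\<^sub>R (0, 1) = (0 :: real, h)" by simp
      with lin[of "(x, t)" h "(0, 1)"] show "D (x, t) (0, h) = D (x, t) (0, 1) * h"
        by (simp only: mult.commute)
    qed
    ultimately show "((\<lambda>s. \<phi> (x, s)) has_real_derivative D (x, t) (0, 1)) (at t)"
      unfolding has_field_derivative_def by (simp only:)
  qed (auto simp: D_def intro!: smooth_continuous_on smoothD(2)[OF s])
qed

lemma ac_ident: "ac (\<lambda>t. t) (\<lambda>_. 1)"
  by (rule ac_of_continuous_derivative) (auto intro!: derivative_eq_intros)

text \<open>The continuous representatives \<open>g0\<close> and \<open>g1\<close> live on the whole
  line so that their compositions with the flow are continuous; the densities are Borel so that
  their compositions are measurable.\<close>

locale candidate = velocity +
  fixes g0 g1 g0' g1' :: "real \<Rightarrow> real"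
  assumes ac_g0: "ac g0 g0'" and ac_g1: "ac g1 g1'"
    and g0'_borel [measurable]: "g0' \<in> borel_measurable borel"
    and g1'_borel [measurable]: "g1' \<in> borel_measurable borel"
    and g0'_L2: "g0' \<in> L2 unit_ivl" and g1'_L2: "g1' \<in> L2 unit_ivl"
    and continuous_g0: "continuous_on UNIV g0" and continuous_g1: "continuous_on UNIV g1"
begin

lemma J_neq_0: "J x t \<noteq> 0"
  by (simp add: J_def)

definition D :: "real \<Rightarrow> real" where
  "D x = g1 (phi x 1) - g0 x"

definition W :: "real \<Rightarrow> real \<Rightarrow> real" where
  "W x t = pint (\<lambda>s. 1 / J x s) t"

text \<open>
  Among all sources \<open>\<zeta>\<close> along a trajectory with prescribed integral \<open>D\<close>, the one minimizing
  the integral of \<open>\<zeta>\<^sup>2 J\<close> is proportional to \<open>1 / J\<close>.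
\<close>

definition zl :: "real \<Rightarrow> real \<Rightarrow> real" where
  "zl x t = D x / (W x 1 * J x t)"

definition gl :: "real \<Rightarrow> real \<Rightarrow> real" where
  "gl x t = g0 x + D x * (W x t / W x 1)"

definition zh :: "real \<times> real \<Rightarrow> real" where
  "zh p = zl (X (fst p) (snd p)) (snd p)"

definition fh :: "real \<times> real \<Rightarrow> real" where
  "fh p = gl (X (fst p) (snd p)) (snd p)"

lemma g_borel [measurable]: "g0 \<in> borel_measurable borel" "g1 \<in> borel_measurable borel"
  by (rule borel_measurable_continuous_onI[OF continuous_g0], rule borel_measurable_continuous_onI[OF continuous_g1])

lemma continuous_on_D: "continuous_on S a \<Longrightarrow> continuous_on S (\<lambda>y. D (a y))"
  unfolding D_def
  by (intro continuous_intros continuous_on_compose2[OF continuous_g0] continuous_on_compose2[OF continuous_g1]) auto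

lemma \<beta>_pos: "0 < \<beta>"
  using \<beta>_ge_1 by linarith

lemma inverse_J_bounds: "0 \<le> t \<Longrightarrow> t \<le> 1 \<Longrightarrow> 1 / J x t \<le> \<beta>" "0 \<le> t \<Longrightarrow> t \<le> 1 \<Longrightarrow> 1 / \<beta> \<le> 1 / J x t"
  using J_bounds[of t x] \<beta>_pos by (auto simp: divide_le_eq le_divide_eq mult.commute)

lemma integrable_inverse_J: "integrable unit_ivl (\<lambda>s. 1 / J x s)"
  by (intro integrable_continuous_unit_ivl continuous_intros) (auto simp: J_neq_0)

lemma ac_W: "ac (W x) (\<lambda>s. 1 / J x s)"
  unfolding W_def[abs_def] by (rule ac_pint[OF integrable_inverse_J])

lemma continuous_on_W:
  assumes "continuous_on S a" "continuous_on S b"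
  shows "continuous_on S (\<lambda>y. W (a y) (b y))"
proof -
  have "continuous_on (UNIV \<times> UNIV) (\<lambda>(x, t). pint (\<lambda>s. 1 / J x s) t)"
  proof (rule continuous_pint_param[of "\<lambda>_. \<beta>"])
    show "\<bar>1 / J x s\<bar> \<le> \<beta>" if "0 < s" "s < 1" for x s
      using inverse_J_bounds(1)[of s x] that by simp
    show "continuous_on UNIV (\<lambda>x. 1 / J x s)" for s
      by (intro continuous_intros) (auto simp: J_neq_0)
  qed auto
  then have "continuous_on UNIV (\<lambda>p. W (fst p) (snd p))" by (simp add: W_def case_prod_beta')
  from continuous_on_compose2[OF this, of S "\<lambda>y. (a y, b y)"] assms show ?thesis
    by (auto intro!: continuous_on_Pair)
qed

lemma W_1_ge: "1 / \<beta> \<le> W x 1"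
proof -
  have "1 / \<beta> = (\<integral>s. 1 / \<beta> \<partial>unit_ivl)" by simp
  also have "\<dots> \<le> (\<integral>s. 1 / J x s \<partial>unit_ivl)"
    by (rule integral_mono_unit_ivl) (use integrable_inverse_J inverse_J_bounds(2) in auto)
  finally show ?thesis by (simp add: W_def pint_ge_1)
qed

lemma W_1_pos: "0 < W x 1"
proof -
  have "0 < 1 / \<beta>" using \<beta>_pos by simp
  then show ?thesis using W_1_ge[of x] by linarith
qed

lemma W_1_neq_0: "W x 1 \<noteq> 0"
  using W_1_pos[of x] by simp

lemma W_bounds: "0 \<le> W x t" "W x t \<le> W x 1"
proof -
  show "0 \<le> W x t"
    using pint_mono[OF integrable_inverse_J[of x], of "min 0 t" t] by (simp add: W_def less_imp_le)
  have "W x t = W x (min 1 t)" by (auto simp: W_def min_def pint_ge_1)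
  also have "\<dots> \<le> W x 1"
    unfolding W_def by (rule pint_mono[OF integrable_inverse_J]) auto
  finally show "W x t \<le> W x 1" .
qed

lemma W_ratio: "0 \<le> W x t / W x 1" "W x t / W x 1 \<le> 1"
  using W_bounds[of x t] W_1_pos[of x] by auto

lemma continuous_on_zl: "continuous_on S a \<Longrightarrow> continuous_on S b \<Longrightarrow> continuous_on S (\<lambda>y. zl (a y) (b y))"
  unfolding zl_def
  by (intro continuous_intros continuous_on_D continuous_on_W)
    (auto simp: W_1_neq_0 J_neq_0)

lemma continuous_on_gl: "continuous_on S a \<Longrightarrow> continuous_on S b \<Longrightarrow> continuous_on S (\<lambda>y. gl (a y) (b y))"
  unfolding gl_def
  by (intro continuous_intros continuous_on_D continuous_on_W continuous_on_compose2[OF continuous_g0])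
    (auto simp: W_1_neq_0 J_neq_0)

lemma continuous_fh: "continuous_on UNIV fh"
  unfolding fh_def[abs_def] by (intro continuous_on_gl continuous_intros)

lemma continuous_zh: "continuous_on UNIV zh"
  unfolding zh_def[abs_def] by (intro continuous_on_zl continuous_intros)

lemma fh_borel [measurable]: "fh \<in> borel_measurable borel"
  by (rule borel_measurable_continuous_onI[OF continuous_fh])

lemma zh_borel [measurable]: "zh \<in> borel_measurable borel"
  by (rule borel_measurable_continuous_onI[OF continuous_zh])

lemma gl_0 [simp]: "gl x 0 = g0 x"
  by (simp add: gl_def W_def)

lemma gl_1 [simp]: "gl x 1 = g1 (phi x 1)"
  using W_1_pos[of x] by (simp add: gl_def D_def)

lemma ac_gl: "ac (gl x) (zl x)"
proof -
  have "ac (\<lambda>t. g0 x + D x / W x 1 * W x t) (\<lambda>t. 0 + D x / W x 1 * (1 / J x t))"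
    by (intro ac_add ac_const ac_cmult ac_W)
  then show ?thesis by (rule ac_cong) (auto simp: gl_def zl_def)
qed

lemma fh_phi: "0 \<le> t \<Longrightarrow> t \<le> 1 \<Longrightarrow> 0 \<le> x \<Longrightarrow> x \<le> 1 \<Longrightarrow> fh (phi x t, t) = gl x t"
  by (simp add: fh_def X_phi)

lemma zh_phi: "0 \<le> t \<Longrightarrow> t \<le> 1 \<Longrightarrow> 0 \<le> x \<Longrightarrow> x \<le> 1 \<Longrightarrow> zh (phi x t, t) = zl x t"
  by (simp add: zh_def X_phi)

lemma fh_0: "0 \<le> y \<Longrightarrow> y \<le> 1 \<Longrightarrow> fh (y, 0) = g0 y"
  by (simp add: fh_def)

lemma fh_1: "0 \<le> y \<Longrightarrow> y \<le> 1 \<Longrightarrow> fh (y, 1) = g1 y"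
  by (simp add: fh_def phi_X)

lemma bounded_continuous_unit_sq:
  fixes h :: "real \<times> real \<Rightarrow> real"
  assumes "continuous_on UNIV h"
  obtains B where "0 \<le> B" "\<And>x t. 0 \<le> x \<Longrightarrow> x \<le> 1 \<Longrightarrow> 0 \<le> t \<Longrightarrow> t \<le> 1 \<Longrightarrow> \<bar>h (x, t)\<bar> \<le> B"
proof -
  have "compact (h ` ({0..1} \<times> {0..1}))"
    by (intro compact_continuous_image continuous_on_subset[OF assms] compact_Times compact_Icc) auto
  from compact_imp_bounded[OF this]
  obtain B where "\<forall>y\<in>h ` ({0..1} \<times> {0..1}). norm y \<le> B" unfolding bounded_iff by blast
  then have B: "\<bar>h p\<bar> \<le> B" if "p \<in> {0..1} \<times> {0..1}" for p
    using that by fastforce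
  have "\<bar>h (0, 0)\<bar> \<le> B" by (rule B) auto
  then have "0 \<le> B" by linarith
  then show ?thesis by (rule that) (use B in auto)
qed

lemma integrable_continuous_unit_sq:
  fixes h :: "real \<times> real \<Rightarrow> real"
  assumes "continuous_on UNIV h"
  shows "integrable unit_sq h"
proof -
  obtain B where "\<And>x t. 0 \<le> x \<Longrightarrow> x \<le> 1 \<Longrightarrow> 0 \<le> t \<Longrightarrow> t \<le> 1 \<Longrightarrow> \<bar>h (x, t)\<bar> \<le> B"
    using bounded_continuous_unit_sq[OF assms] by blast
  then show ?thesis
    by (intro integrable_unit_sq_bounded[of h B] borel_measurable_continuous_onI[OF assms]) auto
qed

lemma fh_L2: "fh \<in> L2 unit_sq" and zh_L2: "zh \<in> L2 unit_sq"
  unfolding L2_def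
  using integrable_continuous_unit_sq[OF continuous_on_power[OF continuous_fh, of 2]]
    integrable_continuous_unit_sq[OF continuous_on_power[OF continuous_zh, of 2]] by simp_all

text \<open>On each trajectory the product of \<open>gl\<close>, the test function and
  \<open>J\<close> is absolutely continuous. Its total increment in time, integrated over the
  starting points and pulled back to Eulerian coordinates, is the weak equation.\<close>

lemma weak_transport_fh:
  fixes \<phi> :: "real \<times> real \<Rightarrow> real"
  assumes s: "smooth \<phi>"
  shows "- (\<integral>t. \<integral>x. fh (x, t) * deriv (\<lambda>s. \<phi> (x, s)) t \<partial>unit_ivl \<partial>unit_ivl)
      + (\<integral>x. g1 x * \<phi> (x, 1) \<partial>unit_ivl) - (\<integral>x. g0 x * \<phi> (x, 0) \<partial>unit_ivl)
      = (\<integral>t. \<integral>x. fh (x, t) * \<phi> (x, t) * vx x t \<partial>unit_ivl \<partial>unit_ivl)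
      + (\<integral>t. \<integral>x. fh (x, t) * deriv (\<lambda>y. \<phi> (y, t)) x * v x t \<partial>unit_ivl \<partial>unit_ivl)
      + (\<integral>t. \<integral>x. \<phi> (x, t) * zh (x, t) \<partial>unit_ivl \<partial>unit_ivl)"
proof -
  obtain \<phi>x \<phi>t where d: "\<And>x t. ((\<lambda>y. \<phi> (y, t)) has_real_derivative \<phi>x (x, t)) (at x)"
    "\<And>x t. ((\<lambda>s. \<phi> (x, s)) has_real_derivative \<phi>t (x, t)) (at t)"
    and c: "continuous_on UNIV \<phi>x" "continuous_on UNIV \<phi>t"
    using smooth_partial[OF s] by metis
  note c\<phi> = smooth_continuous_on[OF s, of UNIV]
  note [measurable] = borel_measurable_continuous_onI[OF c(1)] borel_measurable_continuous_onI[OF c(2)]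
    borel_measurable_continuous_onI[OF c\<phi>]
  have [measurable]: "(\<lambda>p::real\<times>real. v (fst p) (snd p)) \<in> borel_measurable borel"
    "(\<lambda>p::real\<times>real. vx (fst p) (snd p)) \<in> borel_measurable borel"
    unfolding borel_prod[symmetric] by measurable
  obtain B0 where B0: "0 \<le> B0" "\<And>x t. 0 \<le> x \<Longrightarrow> x \<le> 1 \<Longrightarrow> 0 \<le> t \<Longrightarrow> t \<le> 1 \<Longrightarrow> \<bar>fh (x, t)\<bar> \<le> B0"
    using bounded_continuous_unit_sq[OF continuous_fh] by blast
  obtain B1 where B1: "0 \<le> B1" "\<And>x t. 0 \<le> x \<Longrightarrow> x \<le> 1 \<Longrightarrow> 0 \<le> t \<Longrightarrow> t \<le> 1 \<Longrightarrow> \<bar>\<phi> (x, t)\<bar> \<le> B1"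
    using bounded_continuous_unit_sq[OF c\<phi>] by blast
  obtain B2 where B2: "0 \<le> B2" "\<And>x t. 0 \<le> x \<Longrightarrow> x \<le> 1 \<Longrightarrow> 0 \<le> t \<Longrightarrow> t \<le> 1 \<Longrightarrow> \<bar>\<phi>x (x, t)\<bar> \<le> B2"
    using bounded_continuous_unit_sq[OF c(1)] by blast
  have il: "integrable unit_sq (\<lambda>p. C * l (snd p))" for C
    using integrable_unit_sq_snd[OF l_borel integrable_l] by simp
  have i1: "integrable unit_sq (\<lambda>p. fh p * \<phi>t p)"
    by (rule integrable_continuous_unit_sq) (intro continuous_on_mult continuous_fh c)
  have i2: "integrable unit_sq (\<lambda>p. fh p * \<phi> p * vx (fst p) (snd p))"
    by (rule unit_sq_bound[OF il[of "B0 * B1"]])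
      (use B0 B1 vx_bound in \<open>auto simp: abs_mult intro!: mult_mono\<close>)
  have i3: "integrable unit_sq (\<lambda>p. fh p * \<phi>x p * v (fst p) (snd p))"
    by (rule unit_sq_bound[OF il[of "B0 * B2"]])
      (use B0 B2 v_bound in \<open>auto simp: abs_mult intro!: mult_mono\<close>)
  have i4: "integrable unit_sq (\<lambda>p. \<phi> p * zh p)"
    by (rule integrable_continuous_unit_sq) (intro continuous_on_mult continuous_zh c\<phi>)
  \<comment> \<open>\<open>H\<close> collects all terms that live on the square; its Lagrangian form
    \<open>K\<close> is the time density of that product.\<close>
  define H where "H p = fh p * \<phi>t p + fh p * \<phi> p * vx (fst p) (snd p) + fh p * \<phi>x p * v (fst p) (snd p) + \<phi> p * zh p" for p
  have iH: "integrable unit_sq H" unfolding H_def using i1 i2 i3 i4 by simp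
  have [measurable]: "H \<in> borel_measurable borel" unfolding H_def[abs_def] by measurable
  define K where "K p = H (phi (fst p) (snd p), snd p) * J (fst p) (snd p)" for p
  have iK: "integrable unit_sq K" unfolding K_def by (rule integrable_phi_unit_sq[OF _ iH]) measurable
  have along: "(\<integral>t. K (x, t) \<partial>unit_ivl) = g1 (phi x 1) * \<phi> (phi x 1, 1) * J x 1 - g0 x * \<phi> (x, 0)" if x: "0 < x" "x < 1" for x
  proof -
    have cc: "continuous_on S (\<lambda>(p, q). \<phi>x (p, q))" "continuous_on S (\<lambda>(p, q). \<phi>t (p, q))" for S
      using c by (auto simp: case_prod_beta' intro: continuous_on_subset)
    have A: "ac (\<lambda>t. \<phi> (phi x t, t)) (\<lambda>t. \<phi>x (phi x t, t) * v (phi x t) t + \<phi>t (phi x t, t) * 1)"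
      by (rule ac_chain2[OF ac_phi ac_ident, where G = "\<lambda>p q. \<phi> (p, q)" and Ga = "\<lambda>p q. \<phi>x (p, q)" and Gb = "\<lambda>p q. \<phi>t (p, q)"
            and A = 0 and A' = 1 and B = 0 and B' = 1])
        (use d cc phi_closed x in auto)
    have "ac (\<lambda>t. gl x t * (\<phi> (phi x t, t) * J x t)) (\<lambda>t. K (x, t))"
      by (rule ac_cong[OF ac_mult[OF ac_gl ac_mult[OF A ac_J]]])
        (use x in \<open>auto simp: K_def H_def fh_phi zh_phi algebra_simps\<close>)
    from acD(2)[OF this, of 1] show ?thesis by (simp add: pint_ge_1 algebra_simps)
  qed
  have ia: "integrable unit_ivl (\<lambda>x. g1 (phi x 1) * \<phi> (phi x 1, 1) * J x 1)"
    by (intro integrable_continuous_unit_ivl continuous_intros continuous_on_compose2[OF continuous_g1]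
        continuous_on_compose2[OF c\<phi>]) auto
  have ib: "integrable unit_ivl (\<lambda>x. g0 x * \<phi> (x, 0))"
    by (intro integrable_continuous_unit_ivl continuous_intros continuous_on_compose2[OF continuous_g0]
        continuous_on_compose2[OF c\<phi>]) auto
  have "(\<integral>x. \<integral>t. K (x, t) \<partial>unit_ivl \<partial>unit_ivl) =
     (\<integral>x. g1 (phi x 1) * \<phi> (phi x 1, 1) * J x 1 - g0 x * \<phi> (x, 0) \<partial>unit_ivl)"
    by (rule integral_cong_unit_ivl) (rule along)
  also have "\<dots> = (\<integral>x. g1 (phi x 1) * \<phi> (phi x 1, 1) * J x 1 \<partial>unit_ivl) - (\<integral>x. g0 x * \<phi> (x, 0) \<partial>unit_ivl)"
    using ia ib by simp
  also have "(\<integral>x. g1 (phi x 1) * \<phi> (phi x 1, 1) * J x 1 \<partial>unit_ivl) = (\<integral>x. g1 x * \<phi> (x, 1) \<partial>unit_ivl)"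
    by (rule integral_phi[of 1 "\<lambda>y. g1 y * \<phi> (y, 1)"]) auto
  finally have e1: "(\<integral>x. \<integral>t. K (x, t) \<partial>unit_ivl \<partial>unit_ivl) = (\<integral>x. g1 x * \<phi> (x, 1) \<partial>unit_ivl) - (\<integral>x. g0 x * \<phi> (x, 0) \<partial>unit_ivl)" .
  have "(\<integral>x. \<integral>t. K (x, t) \<partial>unit_ivl \<partial>unit_ivl) = (\<integral>t. \<integral>x. K (x, t) \<partial>unit_ivl \<partial>unit_ivl)"
    by (rule unit_sqD(5)[OF iK, symmetric])
  also have "\<dots> = (\<integral>t. \<integral>x. H (x, t) \<partial>unit_ivl \<partial>unit_ivl)"
  proof (rule integral_cong_unit_ivl)
    fix t :: real assume "0 < t" "t < 1"
    then show "(\<integral>x. K (x, t) \<partial>unit_ivl) = (\<integral>x. H (x, t) \<partial>unit_ivl)"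
      unfolding K_def fst_conv snd_conv by (intro integral_phi) auto
  qed
  also have "\<dots> = (\<integral>p. H p \<partial>unit_sq)" by (rule unit_sqD(6)[OF iH])
  also have "\<dots> = (\<integral>p. fh p * \<phi>t p \<partial>unit_sq) + (\<integral>p. fh p * \<phi> p * vx (fst p) (snd p) \<partial>unit_sq)
      + (\<integral>p. fh p * \<phi>x p * v (fst p) (snd p) \<partial>unit_sq) + (\<integral>p. \<phi> p * zh p \<partial>unit_sq)"
    unfolding H_def using i1 i2 i3 i4 by simp
  finally have e2: "(\<integral>x. \<integral>t. K (x, t) \<partial>unit_ivl \<partial>unit_ivl) = \<dots>" .
  have dd: "deriv (\<lambda>s. \<phi> (x, s)) t = \<phi>t (x, t)" "deriv (\<lambda>y. \<phi> (y, t)) x = \<phi>x (x, t)" for x t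
    using d DERIV_imp_deriv by blast+
  show ?thesis
    using e1 e2 unit_sqD(6)[OF i1] unit_sqD(6)[OF i2] unit_sqD(6)[OF i3] unit_sqD(6)[OF i4]
    unfolding dd by simp
qed

text \<open>Both sources have the same integral \<open>D\<close> along trajectories, hence \<open>z - zh\<close> is orthogonal to \<open>zh\<close>.\<close>

lemma source_orthogonal:
  assumes [measurable]: "z \<in> borel_measurable borel" and z2: "integrable unit_sq (\<lambda>p. (z p)\<^sup>2)"
    and eq: "AE x in unit_ivl. g1 (phi x 1) = g0 x + (\<integral>s. z (phi x s, s) \<partial>unit_ivl)"
  shows "(\<integral>p. zh p * (z p - zh p) \<partial>unit_sq) = 0"
proof -
  have zh2: "integrable unit_sq (\<lambda>p. (zh p)\<^sup>2)" using zh_L2 by (simp add: L2_def)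
  have iz: "integrable unit_sq (\<lambda>p. zh p * z p)" by (rule integrable_mult_L2) (use z2 zh2 in auto)
  have i: "integrable unit_sq (\<lambda>p. zh p * (z p - zh p))"
    using iz zh2 by (simp add: right_diff_distrib power2_eq_square)
  have [measurable]: "(\<lambda>p. zh p * (z p - zh p)) \<in> borel_measurable borel" by measurable
  have iz1: "integrable unit_sq z" using integrable_mult_L2[of z unit_sq "\<lambda>_. 1"] z2 by simp
  define K where "K p = zh (phi (fst p) (snd p), snd p) * (z (phi (fst p) (snd p), snd p) - zh (phi (fst p) (snd p), snd p))
    * J (fst p) (snd p)" for p
  have iK: "integrable unit_sq K" unfolding K_def by (rule integrable_phi_unit_sq[OF _ i]) measurable
  have "(\<integral>p. zh p * (z p - zh p) \<partial>unit_sq) = (\<integral>t. \<integral>x. zh (x, t) * (z (x, t) - zh (x, t)) \<partial>unit_ivl \<partial>unit_ivl)"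
    by (rule unit_sqD(6)[OF i, symmetric])
  also have "\<dots> = (\<integral>t. \<integral>x. K (x, t) \<partial>unit_ivl \<partial>unit_ivl)"
  proof (rule integral_cong_unit_ivl)
    fix t :: real assume "0 < t" "t < 1"
    then show "(\<integral>x. zh (x, t) * (z (x, t) - zh (x, t)) \<partial>unit_ivl) = (\<integral>x. K (x, t) \<partial>unit_ivl)"
      unfolding K_def fst_conv snd_conv
      by (intro integral_phi[symmetric, of t "\<lambda>y. zh (y, t) * (z (y, t) - zh (y, t))"]) auto
  qed
  also have "\<dots> = (\<integral>x. \<integral>t. K (x, t) \<partial>unit_ivl \<partial>unit_ivl)" by (rule unit_sqD(5)[OF iK])
  also have "\<dots> = (\<integral>x. 0 \<partial>unit_ivl)"
  proof (rule integral_cong_AE)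
    show "(\<lambda>x. \<integral>t. K (x, t) \<partial>unit_ivl) \<in> borel_measurable unit_ivl" using unit_sqD(4)[OF iK] by auto
    have iJz: "integrable unit_sq (\<lambda>p. z (phi (fst p) (snd p), snd p) * J (fst p) (snd p))"
      by (rule integrable_phi_unit_sq[OF _ iz1]) measurable
    show "AE x in unit_ivl. (\<integral>t. K (x, t) \<partial>unit_ivl) = 0"
      using eq unit_sqD(3)[OF iJz] AE_unit_ivl_interior
    proof eventually_elim
      case (elim x)
      have x: "0 \<le> x" "x \<le> 1" using elim by auto
      have iz: "integrable unit_ivl (\<lambda>t. z (phi x t, t))"
      proof -
        have "integrable unit_ivl (\<lambda>t. (1 / J x t) * (z (phi x t, t) * J x t))"
          by (rule integrable_continuous_mult) (use elim in \<open>auto intro!: continuous_intros simp: J_neq_0\<close>)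
        then show ?thesis by (simp add: J_neq_0)
      qed
      \<comment> \<open>\<open>zl x t * J x t\<close> does not depend on \<open>t\<close> and leaves
        the integral; what remains is a difference of sources with the same integral
        \<open>D x\<close>.\<close>
      have "(\<integral>t. K (x, t) \<partial>unit_ivl) = (\<integral>t. D x / W x 1 * (z (phi x t, t) - zl x t) \<partial>unit_ivl)"
        by (rule integral_cong_unit_ivl)
          (use x in \<open>auto simp: K_def zh_phi zl_def[of x] J_neq_0\<close>)
      also have "\<dots> = D x / W x 1 * ((\<integral>t. z (phi x t, t) \<partial>unit_ivl) - (\<integral>t. zl x t \<partial>unit_ivl))"
        using iz acD(1)[OF ac_gl] by simp
      also have "(\<integral>t. z (phi x t, t) \<partial>unit_ivl) = D x" using elim by (simp add: D_def)
      also have "(\<integral>t. zl x t \<partial>unit_ivl) = D x"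
        using acD(2)[OF ac_gl, of 1 x] by (simp add: pint_ge_1 D_def)
      finally show ?case by simp
    qed
  qed simp
  finally show ?thesis by simp
qed

end

subsection \<open>Space regularity of the minimizer\<close>

lemma L2_norm_triangle:
  assumes u: "u \<in> L2 unit_ivl" and v: "v \<in> L2 unit_ivl"
  shows "(\<lambda>x. u x + v x) \<in> L2 unit_ivl" "L2_norm (\<lambda>x. u x + v x) \<le> L2_norm u + L2_norm v"
proof -
  note [measurable] = L2_unit_ivlD(1)[OF u] L2_unit_ivlD(1)[OF v]
  note u2 = L2_unit_ivlD(2)[OF u] and v2 = L2_unit_ivlD(2)[OF v]
  have uv: "integrable unit_ivl (\<lambda>x. u x * v x)" by (rule integrable_mult_L2) (use u2 v2 in auto)
  have eq: "(u x + v x)\<^sup>2 = (u x)\<^sup>2 + 2 * (u x * v x) + (v x)\<^sup>2" for x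
    by (simp add: power2_sum)
  have i: "integrable unit_ivl (\<lambda>x. (u x + v x)\<^sup>2)" unfolding eq using u2 v2 uv by simp
  then show "(\<lambda>x. u x + v x) \<in> L2 unit_ivl" by (simp add: L2_def)
  have cs: "(\<integral>x. u x * v x \<partial>unit_ivl) \<le> L2_norm u * L2_norm v"
  proof -
    have "(\<integral>x. u x * v x \<partial>unit_ivl) \<le> (\<integral>x. \<bar>u x * v x\<bar> \<partial>unit_ivl)"
      by (rule integral_mono) (use uv in auto)
    also have "\<dots> \<le> L2_norm u * L2_norm v"
      unfolding L2_norm_def by (rule Cauchy_Schwarz_abs_integral) (use u2 v2 in auto)
    finally show ?thesis .
  qed
  have "(L2_norm (\<lambda>x. u x + v x))\<^sup>2 = (L2_norm u)\<^sup>2 + 2 * (\<integral>x. u x * v x \<partial>unit_ivl) + (L2_norm v)\<^sup>2"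
    unfolding L2_norm_power2 eq using u2 v2 uv by simp
  also have "\<dots> \<le> (L2_norm u + L2_norm v)\<^sup>2" using cs by (simp add: power2_sum)
  finally show "L2_norm (\<lambda>x. u x + v x) \<le> L2_norm u + L2_norm v"
    by (rule power2_le_imp_le) simp
qed

lemma power2_le_if_abs_le: "\<bar>a\<bar> \<le> b \<Longrightarrow> a\<^sup>2 \<le> b\<^sup>2" for a b :: real
  using power_mono[of "\<bar>a\<bar>" b 2] by simp

lemma square_integral_le:
  fixes h :: "real \<Rightarrow> real"
  assumes [measurable]: "h \<in> borel_measurable unit_ivl" and h2: "integrable unit_ivl (\<lambda>s. (h s)\<^sup>2)"
  shows "(\<integral>s. \<bar>h s\<bar> \<partial>unit_ivl)\<^sup>2 \<le> (\<integral>s. (h s)\<^sup>2 \<partial>unit_ivl)"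
  using Cauchy_Schwarz_integral[of "\<lambda>s. \<bar>h s\<bar>" unit_ivl "\<lambda>_. 1"] h2 by simp

lemma AE_unit_sq_fst:
  assumes "AE x in unit_ivl. P x"
  shows "AE p in unit_sq. P (fst p)"
proof -
  \<comment> \<open>The exceptional set itself may fail to be measurable; the indicator of the Borel
    null set \<open>N\<close> turns the claim into an equation between Borel functions.\<close>
  obtain N where N: "{x \<in> space unit_ivl. \<not> P x} \<subseteq> N" "emeasure unit_ivl N = 0" "N \<in> sets unit_ivl"
    using assms by (rule AE_E)
  have "N \<in> sets borel" using N(3) unfolding unit_ivl_def by (auto simp: sets_restrict_space)
  then have [measurable]: "(\<lambda>p::real\<times>real. indicator N (fst p) :: real) \<in> borel_measurable borel"
    unfolding borel_prod[symmetric] by measurable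
  have "AE x in unit_ivl. x \<notin> N" using N by (auto intro: AE_not_in)
  then have "AE x in unit_ivl. AE t in unit_ivl. indicator N (fst (x, t)) = (0 :: real)"
    by eventually_elim simp
  then have "AE p in unit_sq. indicator N (fst p) = (0 :: real)"
    using AE_unit_sq_iff[of "\<lambda>p. indicator N (fst p)" "\<lambda>_. 0"]
      AE_unit_ivl_swap[of "\<lambda>p. indicator N (fst p)" "\<lambda>_. 0"] by simp
  then show ?thesis
    by (rule AE_mp) (rule AE_I2, use N(1) in \<open>auto simp: space_unit_sq indicator_def\<close>)
qed

lemma integrable_unit_sq_fst:
  fixes h :: "real \<Rightarrow> real"
  assumes [measurable]: "h \<in> borel_measurable borel" and "integrable unit_ivl h"
  shows "integrable unit_sq (\<lambda>p. h (fst p))"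
proof (rule unit_sqI)
  show "(\<lambda>p::real\<times>real. h (fst p)) \<in> borel_measurable borel"
    unfolding borel_prod[symmetric] by measurable
qed (use assms in auto)

section \<open>Space derivative of the Jacobian\<close>

context velocity
begin

text \<open>By the chain rule, the space density of \<open>vx (phi x s) s\<close>. Its time integral
  \<open>Kw\<close> is therefore the space density of \<open>lJ\<close>.\<close>

definition Wp :: "real \<times> real \<Rightarrow> real" where
  "Wp p = w (phi (fst p) (snd p), snd p) * J (fst p) (snd p)"

definition Kw :: "real \<Rightarrow> real \<Rightarrow> real" where
  "Kw x t = pint (\<lambda>s. Wp (x, s)) t"

text \<open>A majorant of \<open>Kw x t\<close> for all times at once, off a null set of
  \<open>x\<close> that does not depend on the time.\<close>

definition Kb :: "real \<Rightarrow> real" where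
  "Kb x = (\<integral>s. \<bar>Wp (x, s)\<bar> \<partial>unit_ivl)"

lemma integrable_w: "integrable unit_sq w"
  using integrable_mult_L2[of w unit_sq "\<lambda>_. 1"] integrable_w_unit_sq by simp

lemma Wp_borel [measurable]: "Wp \<in> borel_measurable borel"
  unfolding Wp_def[abs_def] borel_prod[symmetric] by measurable

lemma integrable_Wp: "integrable unit_sq Wp"
  unfolding Wp_def[abs_def] by (rule integrable_phi_unit_sq[OF w_borel integrable_w])

lemma Kw_borel [measurable (raw)]:
  "a \<in> borel_measurable M \<Longrightarrow> b \<in> borel_measurable M \<Longrightarrow> (\<lambda>y. Kw (a y) (b y)) \<in> borel_measurable M"
  by (rule borel_measurable_compose2[of Kw]) (unfold Kw_def borel_prod[symmetric], measurable)

lemma Kb_borel [measurable]: "Kb \<in> borel_measurable borel"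
  unfolding Kb_def[abs_def] by measurable

lemma integrable_Kb: "integrable unit_ivl Kb"
  unfolding Kb_def[abs_def] using unit_sqD(4)[OF integrable_abs[OF integrable_Wp]] by simp

lemma Kb_nonneg [simp]: "0 \<le> Kb x"
  unfolding Kb_def by simp

lemma AE_Kw_bound: "AE x in unit_ivl. \<forall>t. \<bar>Kw x t\<bar> \<le> Kb x"
  using unit_sqD(3)[OF integrable_Wp]
  by eventually_elim (auto simp: Kw_def Kb_def intro: abs_pint_le)

text \<open>The increment of \<open>vx\<close> from 0 to \<open>phi x s\<close> is an integral of
  \<open>w\<close>. Substituting along the flow and exchanging the integrations in time and space
  gives the claim.\<close>

lemma lJ_space:
  assumes x: "0 \<le> x" "x \<le> 1"
  shows "lJ x t = lJ 0 t + pint (\<lambda>y. Kw y t) x"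
proof -
  have vx: "vx (phi x s) s = vx (phi 0 s) s + pint (\<lambda>y. Wp (y, s)) x" if s: "0 < s" "s < 1" for s
  proof -
    have s': "0 \<le> s" "s \<le> 1" using s by auto
    have "vx (phi x s) s = vx 0 s + pint (\<lambda>y. w (y, s)) (phi x s)"
      using acD(2)[OF ac_vx, of "phi x s" s] phi_closed[OF s' x] by simp
    also have "pint (\<lambda>y. w (y, s)) (phi x s) = pint (\<lambda>y. Wp (y, s)) x"
      unfolding Wp_def fst_conv snd_conv by (rule pint_phi[OF s', symmetric]) measurable
    finally show ?thesis using s' by simp
  qed
  have "lJ x t = pint (\<lambda>s. vx (phi 0 s) s + pint (\<lambda>y. Wp (y, s)) x) t"
    unfolding lJ_def by (rule pint_cong) (rule vx)
  also have "\<dots> = lJ 0 t + pint (\<lambda>s. pint (\<lambda>y. Wp (y, s)) x) t"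
    unfolding lJ_def by (rule pint_add) (auto intro!: integrable_vx_along integrable_pint_slice integrable_Wp)
  also have "pint (\<lambda>s. pint (\<lambda>y. Wp (y, s)) x) t = pint (\<lambda>y. Kw y t) x"
    unfolding Kw_def by (rule pint_swap[OF integrable_Wp])
  finally show ?thesis .
qed

lemma ac_lJ_space: "ac (\<lambda>x. lJ x t) (\<lambda>x. Kw x t)"
proof (rule acI)
  show "integrable unit_ivl (\<lambda>x. Kw x t)"
    unfolding Kw_def by (rule integrable_pint_slice'[OF integrable_Wp])
qed (rule lJ_space)

lemma ac_inverse_J_space: "ac (\<lambda>x. 1 / J x t) (\<lambda>x. - Kw x t / J x t)"
  by (rule ac_cong[OF ac_exp[OF ac_cmult[OF ac_lJ_space, of "-1"]]])
    (auto simp: J_def exp_minus divide_inverse)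

text \<open>Cauchy-Schwarz in time bounds \<open>(Kb x)\<^sup>2\<close> by the integral of
  \<open>(Wp (x, s))\<^sup>2 = J x s * H (x, s)\<close>. Since
  \<open>J x s \<le> \<beta> * J x t\<close>, dividing by \<open>J x t\<close> costs one
  \<open>\<beta>\<close>, and the integral of \<open>H\<close> in space is
  \<open>(l s)\<^sup>2\<close> by change of variables.\<close>

lemma Kb_square_integral:
  assumes t: "0 \<le> t" "t \<le> 1"
  obtains V where "V \<in> borel_measurable borel" "integrable unit_ivl V"
    "(\<integral>x. V x \<partial>unit_ivl) = (\<integral>t. (l t)\<^sup>2 \<partial>unit_ivl)" "AE x in unit_ivl. (Kb x)\<^sup>2 / J x t \<le> \<beta> * V x"
proof -
  define H where "H p = (w (phi (fst p) (snd p), snd p))\<^sup>2 * J (fst p) (snd p)" for p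
  have iH: "integrable unit_sq H"
    unfolding H_def by (rule integrable_phi_unit_sq[of "\<lambda>p. (w p)\<^sup>2"]) (use integrable_w_unit_sq in auto)
  have Hm [measurable]: "H \<in> borel_measurable borel"
    unfolding H_def[abs_def] borel_prod[symmetric] by measurable
  define V where "V x = (\<integral>s. H (x, s) \<partial>unit_ivl)" for x
  show ?thesis
  proof (rule that[of V])
    show "V \<in> borel_measurable borel" unfolding V_def[abs_def] by measurable
    show "integrable unit_ivl V" unfolding V_def[abs_def] by (rule unit_sqD(4)[OF iH])
    have "(\<integral>x. V x \<partial>unit_ivl) = (\<integral>s. \<integral>x. H (x, s) \<partial>unit_ivl \<partial>unit_ivl)"
      unfolding V_def by (rule unit_sqD(5)[OF iH, symmetric])
    also have "\<dots> = (\<integral>t. (l t)\<^sup>2 \<partial>unit_ivl)"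
    proof (rule integral_cong_unit_ivl)
      fix s :: real assume "0 < s" "s < 1"
      then show "(\<integral>x. H (x, s) \<partial>unit_ivl) = (l s)\<^sup>2"
        unfolding l_square H_def fst_conv snd_conv by (intro integral_phi[of s "\<lambda>y. (w (y, s))\<^sup>2"]) auto
    qed
    finally show "(\<integral>x. V x \<partial>unit_ivl) = (\<integral>t. (l t)\<^sup>2 \<partial>unit_ivl)" .
    show "AE x in unit_ivl. (Kb x)\<^sup>2 / J x t \<le> \<beta> * V x"
      using unit_sqD(3)[OF iH]
    proof eventually_elim
      case (elim x)
      have le: "(Wp (x, s))\<^sup>2 \<le> J x t * \<beta> * H (x, s)" if "0 < s" "s < 1" for s
      proof -
        have "(Wp (x, s))\<^sup>2 = J x s * H (x, s)"
          by (simp add: Wp_def H_def power2_eq_square)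
        also have "\<dots> \<le> (\<beta> * J x t) * H (x, s)"
          by (intro mult_right_mono J_ratio) (use that t in \<open>auto simp: H_def\<close>)
        finally show ?thesis by (simp add: mult.commute)
      qed
      have iW: "integrable unit_ivl (\<lambda>s. (Wp (x, s))\<^sup>2)"
      proof (rule Bochner_Integration.integrable_bound)
        show "integrable unit_ivl (\<lambda>s. J x t * \<beta> * H (x, s))" using elim by simp
        show "AE s in unit_ivl. norm ((Wp (x, s))\<^sup>2) \<le> norm (J x t * \<beta> * H (x, s))"
          by (rule AE_unit_ivlI) (use le in \<open>force intro: order_trans[OF _ abs_ge_self]\<close>)
      qed measurable
      have "(Kb x)\<^sup>2 \<le> (\<integral>s. (Wp (x, s))\<^sup>2 \<partial>unit_ivl)"
        unfolding Kb_def by (rule square_integral_le) (use iW in auto)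
      also have "\<dots> \<le> (\<integral>s. J x t * \<beta> * H (x, s) \<partial>unit_ivl)"
        by (rule integral_mono_unit_ivl) (use iW elim le in auto)
      also have "\<dots> = J x t * (\<beta> * V x)" by (simp add: V_def)
      finally show ?case by (simp add: divide_le_eq mult.commute)
    qed
  qed
qed

end

section \<open>Space derivative and norms of the candidate\<close>

context candidate
begin

definition Wd :: "real \<Rightarrow> real \<Rightarrow> real" where
  "Wd x t = pint (\<lambda>s. - Kw x s / J x s) t"

lemma KJ_borel [measurable]: "(\<lambda>p. - Kw (fst p) (snd p) / J (fst p) (snd p)) \<in> borel_measurable borel"
  unfolding borel_prod[symmetric] by measurable

lemma integrable_KJ: "integrable unit_sq (\<lambda>p. - Kw (fst p) (snd p) / J (fst p) (snd p))"
proof (rule Bochner_Integration.integrable_bound)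
  show "integrable unit_sq (\<lambda>p. \<beta> * Kb (fst p))"
    using integrable_unit_sq_fst[OF Kb_borel integrable_Kb] by simp
  have "AE p in unit_sq. 0 < snd p \<and> snd p < 1" by (rule AE_unit_sqI) auto
  with AE_unit_sq_fst[OF AE_Kw_bound]
  show "AE p in unit_sq. norm (- Kw (fst p) (snd p) / J (fst p) (snd p)) \<le> norm (\<beta> * Kb (fst p))"
  proof eventually_elim
    case (elim p)
    have "norm (- Kw (fst p) (snd p) / J (fst p) (snd p)) = (1 / J (fst p) (snd p)) * \<bar>Kw (fst p) (snd p)\<bar>"
      by (simp add: abs_divide)
    also have "\<dots> \<le> \<beta> * Kb (fst p)"
      by (rule mult_mono) (use elim inverse_J_bounds(1)[of "snd p" "fst p"] \<beta>_pos in auto)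
    finally show ?case using \<beta>_pos by (simp add: abs_mult)
  qed
qed measurable

text \<open>Differentiation under the time integral takes the form of Fubini: the primitives in
  space and in time are exchanged.\<close>

lemma ac_W_space: "ac (\<lambda>x. W x t) (\<lambda>x. Wd x t)"
proof (rule acI)
  show "integrable unit_ivl (\<lambda>x. Wd x t)"
    unfolding Wd_def using integrable_pint_slice'[OF integrable_KJ, of t] by simp
  fix x :: real assume x: "0 \<le> x" "x \<le> 1"
  have "W x t = pint (\<lambda>s. 1 / J 0 s + pint (\<lambda>y. - Kw y s / J y s) x) t"
    unfolding W_def by (rule pint_cong) (rule acD(2)[OF ac_inverse_J_space x])
  also have "\<dots> = W 0 t + pint (\<lambda>s. pint (\<lambda>y. - Kw y s / J y s) x) t"
    unfolding W_def
    by (rule pint_add[OF integrable_inverse_J]) (use integrable_pint_slice[OF integrable_KJ, of x] in simp)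
  also have "pint (\<lambda>s. pint (\<lambda>y. - Kw y s / J y s) x) t = pint (\<lambda>y. Wd y t) x"
    unfolding Wd_def using pint_swap[OF integrable_KJ, of x t] by simp
  finally show "W x t = W 0 t + pint (\<lambda>x. Wd x t) x" .
qed

lemma Wd_borel [measurable (raw)]:
  "a \<in> borel_measurable M \<Longrightarrow> b \<in> borel_measurable M \<Longrightarrow> (\<lambda>y. Wd (a y) (b y)) \<in> borel_measurable M"
  by (rule borel_measurable_compose2[of Wd]) (unfold Wd_def borel_prod[symmetric], measurable)

lemma W_borel [measurable (raw)]:
  "a \<in> borel_measurable M \<Longrightarrow> b \<in> borel_measurable M \<Longrightarrow> (\<lambda>y. W (a y) (b y)) \<in> borel_measurable M"
  by (rule borel_measurable_compose2[OF borel_measurable_continuous_onI])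
    (auto intro!: continuous_on_W continuous_intros)

text \<open>Bounding \<open>Kw\<close> by \<open>Kb\<close> but keeping the weight
  \<open>1 / J\<close> compares \<open>Wd\<close> with \<open>W\<close> itself, so the quotients by
  \<open>W x 1\<close> below lose no power of \<open>\<beta>\<close>.\<close>

lemma Wd_bound:
  assumes K: "\<forall>t. \<bar>Kw x t\<bar> \<le> Kb x"
  shows "\<bar>Wd x t\<bar> \<le> Kb x * W x t"
proof -
  define t' where "t' = max 0 (min 1 t)"
  have i: "integrable unit_ivl (\<lambda>s. Kb x * (1 / J x s))"
    by (rule Bochner_Integration.integrable_mult_right[OF integrable_inverse_J])
  have le: "\<bar>- Kw x s / J x s\<bar> \<le> Kb x * (1 / J x s)" for s
    using K by (simp add: abs_divide divide_right_mono)
  have i': "integrable unit_ivl (\<lambda>s. - Kw x s / J x s)"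
    by (rule Bochner_Integration.integrable_bound[OF i])
      (use le in \<open>auto intro: order_trans[OF _ abs_ge_self]\<close>)
  have "\<bar>pint (\<lambda>s. - Kw x s / J x s) t' - pint (\<lambda>s. - Kw x s / J x s) 0\<bar> \<le>
     pint (\<lambda>s. Kb x * (1 / J x s)) t' - pint (\<lambda>s. Kb x * (1 / J x s)) 0"
    by (rule abs_pint_diff_le[OF i i']) (use le in \<open>auto simp: t'_def\<close>)
  then have "\<bar>Wd x t'\<bar> \<le> Kb x * W x t'" unfolding pint_cmult Wd_def W_def by simp
  moreover have "Wd x t' = Wd x t" "W x t' = W x t"
    by (auto simp: Wd_def W_def t'_def max_def min_def pint_ge_1)
  ultimately show ?thesis by simp
qed

definition rd :: "real \<Rightarrow> real \<Rightarrow> real" where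
  "rd x t = 1 / W x 1 * Wd x t + (- W x t / (W x 1)\<^sup>2) * Wd x 1"

lemma ac_ratio: "ac (\<lambda>x. W x t / W x 1) (\<lambda>x. rd x t)"
proof -
  obtain A A' where A: "\<And>x. 0 \<le> x \<Longrightarrow> x \<le> 1 \<Longrightarrow> W x t \<in> {A..A'}" using ac_bounds[OF ac_W_space] by blast
  obtain B B' where B: "\<And>x. 0 \<le> x \<Longrightarrow> x \<le> 1 \<Longrightarrow> W x 1 \<in> {B..B'}" using ac_bounds[OF ac_W_space] by blast
  \<comment> \<open>The lower bound \<open>1 / \<beta>\<close> of \<open>W x 1\<close> keeps the
    quotient away from its singularity.\<close>
  have pos: "0 < q" if "q \<in> {1 / \<beta>..B'}" for q
    using that \<beta>_pos by (auto intro: less_le_trans[of 0 "1 / \<beta>"])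
  have nz: "snd x \<noteq> 0" if "x \<in> {A..A'} \<times> {1 / \<beta>..B'}" for x :: "real \<times> real"
    using pos[of "snd x"] that by (auto simp: mem_Times_iff)
  have nz2: "(snd x)\<^sup>2 \<noteq> 0" if "x \<in> {A..A'} \<times> {1 / \<beta>..B'}" for x :: "real \<times> real"
    using nz[OF that] by simp
  show ?thesis unfolding rd_def
  proof (rule ac_chain2[OF ac_W_space ac_W_space A, where G = "\<lambda>p q. p / q" and Ga = "\<lambda>p q. 1 / q" and Gb = "\<lambda>p q. - p / q\<^sup>2"
        and B = "1 / \<beta>" and B' = B'])
    show "W x 1 \<in> {1 / \<beta>..B'}" if "0 \<le> x" "x \<le> 1" for x using B[OF that] W_1_ge by simp
    show "((\<lambda>p. p / q) has_real_derivative 1 / q) (at p)" if "q \<in> {1 / \<beta>..B'}" for p q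
      using pos[OF that] by (auto intro!: derivative_eq_intros)
    show "((\<lambda>q. p / q) has_real_derivative - p / q\<^sup>2) (at q)" if "q \<in> {1 / \<beta>..B'}" for p q
      using pos[OF that] by (auto intro!: derivative_eq_intros simp: power2_eq_square)
    show "continuous_on ({A..A'} \<times> {1 / \<beta>..B'}) (\<lambda>(p, q). 1 / q)"
      unfolding case_prod_beta' by (intro continuous_intros) (rule ballI, rule nz)
    show "continuous_on ({A..A'} \<times> {1 / \<beta>..B'}) (\<lambda>(p, q). - p / q\<^sup>2)"
      unfolding case_prod_beta' by (intro continuous_intros) (rule ballI, rule nz2)
  qed auto
qed

text \<open>Each of the two terms of the quotient rule contributes one \<open>Kb\<close>, because
  \<open>W x t \<le> W x 1\<close>.\<close>

lemma rd_bound: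
  assumes K: "\<forall>t. \<bar>Kw x t\<bar> \<le> Kb x"
  shows "\<bar>rd x t\<bar> \<le> 2 * Kb x"
proof -
  have p: "0 < W x 1" by (rule W_1_pos)
  have "\<bar>1 / W x 1 * Wd x t\<bar> = \<bar>Wd x t\<bar> / W x 1" using p by (simp add: abs_mult)
  also have "\<dots> \<le> Kb x * W x t / W x 1" using Wd_bound[OF K, of t] p by (simp add: divide_right_mono)
  also have "\<dots> = Kb x * (W x t / W x 1)" by simp
  also have "\<dots> \<le> Kb x * 1" using W_ratio[of x t] by (intro mult_left_mono) auto
  finally have 1: "\<bar>1 / W x 1 * Wd x t\<bar> \<le> Kb x" by simp
  have "\<bar>(- W x t / (W x 1)\<^sup>2) * Wd x 1\<bar> = (W x t / W x 1) * (\<bar>Wd x 1\<bar> / W x 1)"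
    using p W_bounds(1)[of x t] by (simp add: abs_mult abs_divide power2_eq_square)
  also have "\<dots> \<le> 1 * Kb x"
    by (rule mult_mono) (use W_ratio[of x t] Wd_bound[OF K, of 1] p in \<open>auto simp: divide_le_eq\<close>)
  finally show ?thesis using 1 unfolding rd_def by linarith
qed

definition Dd :: "real \<Rightarrow> real" where
  "Dd x = g1' (phi x 1) * J x 1 - g0' x"

text \<open>The space density of \<open>gl\<close>, regrouped so that the derivatives of the two
  endpoints appear with weights between 0 and 1 adding up to 1.\<close>

definition gd :: "real \<Rightarrow> real \<Rightarrow> real" where
  "gd x t = g0' x * (1 - W x t / W x 1) + g1' (phi x 1) * J x 1 * (W x t / W x 1) + D x * rd x t"

lemma ac_D: "ac D Dd"
proof -
  have "ac (\<lambda>x. g1 (phi x 1)) (\<lambda>x. g1' (phi x 1) * J x 1)"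
  proof (rule acI)
    show "integrable unit_ivl (\<lambda>x. g1' (phi x 1) * J x 1)"
      using integrable_phi[of 1 g1'] acD(1)[OF ac_g1] by simp
    show "g1 (phi x 1) = g1 0 + pint (\<lambda>x. g1' (phi x 1) * J x 1) x" if "0 \<le> x" "x \<le> 1" for x
      using acD(2)[OF ac_g1, of "phi x 1"] phi_closed[of 1 x] that by (simp add: pint_phi)
  qed
  from ac_diff[OF this ac_g0] show ?thesis by (simp add: D_def[abs_def] Dd_def[abs_def])
qed

lemma ac_gl_space: "ac (\<lambda>x. gl x t) (\<lambda>x. gd x t)"
  by (rule ac_cong[OF ac_add[OF ac_g0 ac_mult[OF ac_D ac_ratio]]])
    (auto simp: gl_def gd_def Dd_def algebra_simps)

lemma D_borel [measurable]: "D \<in> borel_measurable borel"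
  by (rule borel_measurable_continuous_onI) (auto intro!: continuous_on_D)

lemma gd_borel [measurable (raw)]:
  "a \<in> borel_measurable M \<Longrightarrow> b \<in> borel_measurable M \<Longrightarrow> (\<lambda>y. gd (a y) (b y)) \<in> borel_measurable M"
  by (rule borel_measurable_compose2[of gd]) (unfold gd_def rd_def borel_prod[symmetric], measurable)

definition fx :: "real \<times> real \<Rightarrow> real" where
  "fx p = gd (X (fst p) (snd p)) (snd p) / J (X (fst p) (snd p)) (snd p)"

lemma fx_borel [measurable]: "fx \<in> borel_measurable borel"
  unfolding fx_def[abs_def] borel_prod[symmetric] by measurable

text \<open>Along the flow the function is \<open>gl\<close> with density \<open>gd\<close>; the
  substitution y = phi x t divides the density by \<open>J\<close>.\<close>

lemma ac_fh_space:
  assumes t: "0 \<le> t" "t \<le> 1"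
  shows "ac (\<lambda>y. fh (y, t)) (\<lambda>y. fx (y, t))"
proof (rule acI)
  have "integrable unit_ivl (\<lambda>x. gd x t / J x t * J x t)"
    using acD(1)[OF ac_gl_space[of t]] by (simp add: J_neq_0)
  then show "integrable unit_ivl (\<lambda>y. fx (y, t))"
    unfolding fx_def fst_conv snd_conv
    by (subst integrable_X[OF t, of "\<lambda>x. gd x t / J x t"]) auto
  fix y :: real assume y: "0 \<le> y" "y \<le> 1"
  have "fh (y, t) = gl 0 t + pint (\<lambda>x. gd x t) (X y t)"
    unfolding fh_def fst_conv snd_conv using acD(2)[OF ac_gl_space X_range[of y t]] .
  also have "pint (\<lambda>x. gd x t) (X y t) = pint (\<lambda>x. fx (phi x t, t) * J x t) (X y t)"
    by (rule pint_cong) (use t in \<open>simp add: fx_def X_phi J_neq_0\<close>)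
  also have "\<dots> = pint (\<lambda>y. fx (y, t)) (phi (X y t) t)" by (rule pint_phi[OF t]) measurable
  also have "phi (X y t) t = y" by (rule phi_X[OF t y])
  finally show "fh (y, t) = gl 0 t + pint (\<lambda>y. fx (y, t)) y" .
qed

lemma D_bound:
  assumes x: "0 \<le> x" "x \<le> 1"
  shows "\<bar>D x\<bar> \<le> L2_norm g0 + L2_norm g0' + (L2_norm g1 + L2_norm g1')"
  using abs_le_L2_norms[OF ac_g0 g0'_L2 x] abs_le_L2_norms[OF ac_g1 g1'_L2, of "phi x 1"] phi_closed[of 1 x] x
  unfolding D_def by linarith

text \<open>In Lagrangian coordinates the left-hand side is the integral of
  \<open>(gd x t)\<^sup>2 / J x t\<close>. The factor 3 comes from squaring a sum of three terms.
  Each of them costs one \<open>\<beta>\<close>: through \<open>1 / J x t \<le> \<beta>\<close> for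
  the first, \<open>J x 1 \<le> \<beta> * J x t\<close> for the second and
  \<open>Kb_square_integral\<close> for the third; the 4 is the square of the 2 in
  \<open>rd_bound\<close>.\<close>

lemma fx_bound:
  assumes t: "0 \<le> t" "t \<le> 1"
  shows "(\<lambda>y. fx (y, t)) \<in> L2 unit_ivl"
    and "(\<integral>y. (fx (y, t))\<^sup>2 \<partial>unit_ivl) \<le> 3 * \<beta> * ((L2_norm g0')\<^sup>2 + (L2_norm g1')\<^sup>2
      + 4 * (L2_norm g0 + L2_norm g0' + (L2_norm g1 + L2_norm g1'))\<^sup>2 * (\<integral>t. (l t)\<^sup>2 \<partial>unit_ivl))"
proof -
  define S where "S = L2_norm g0 + L2_norm g0' + (L2_norm g1 + L2_norm g1')"
  obtain V where V: "V \<in> borel_measurable borel" "integrable unit_ivl V"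
    "(\<integral>x. V x \<partial>unit_ivl) = (\<integral>t. (l t)\<^sup>2 \<partial>unit_ivl)" "AE x in unit_ivl. (Kb x)\<^sup>2 / J x t \<le> \<beta> * V x"
    using Kb_square_integral[OF t] by blast
  define B where "B x = 3 * \<beta> * ((g0' x)\<^sup>2 + (g1' (phi x 1))\<^sup>2 * J x 1 + 4 * S\<^sup>2 * V x)" for x
  have i0: "integrable unit_ivl (\<lambda>x. (g0' x)\<^sup>2)" using L2_unit_ivlD(2)[OF g0'_L2] .
  have i1: "integrable unit_ivl (\<lambda>x. (g1' (phi x 1))\<^sup>2 * J x 1)"
    using integrable_phi[of 1 "\<lambda>y. (g1' y)\<^sup>2"] L2_unit_ivlD(2)[OF g1'_L2] by simp
  have iB: "integrable unit_ivl B" unfolding B_def using i0 i1 V(2) by simp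
  have le: "AE x in unit_ivl. (gd x t / J x t)\<^sup>2 * J x t \<le> B x"
    using V(4) AE_Kw_bound AE_unit_ivl_interior
  proof eventually_elim
    case (elim x)
    define a b c where "a = g0' x * (1 - W x t / W x 1)" and "b = g1' (phi x 1) * J x 1 * (W x t / W x 1)"
      and "c = D x * rd x t"
    have J: "0 < J x t" by simp
    have sq: "(a + b + c)\<^sup>2 \<le> 3 * (a\<^sup>2 + b\<^sup>2 + c\<^sup>2)"
      using zero_le_power2[of "a - b"] zero_le_power2[of "b - c"] zero_le_power2[of "a - c"]
      by (simp add: power2_eq_square algebra_simps)
    have r: "0 \<le> W x t / W x 1" "W x t / W x 1 \<le> 1" by (rule W_ratio)+
    have a: "a\<^sup>2 / J x t \<le> \<beta> * (g0' x)\<^sup>2"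
    proof -
      have "(1 - W x t / W x 1)\<^sup>2 \<le> 1" using r by (intro power_le_one) auto
      then have "a\<^sup>2 \<le> (g0' x)\<^sup>2 * 1" unfolding a_def power_mult_distrib by (rule mult_left_mono) simp
      then have "a\<^sup>2 * (1 / J x t) \<le> (g0' x)\<^sup>2 * \<beta>"
        using inverse_J_bounds(1)[OF t, of x] by (intro mult_mono) auto
      then show ?thesis by (simp add: mult.commute)
    qed
    have b: "b\<^sup>2 / J x t \<le> \<beta> * ((g1' (phi x 1))\<^sup>2 * J x 1)"
    proof -
      have "(W x t / W x 1)\<^sup>2 \<le> 1" using r by (intro power_le_one) auto
      then have "b\<^sup>2 \<le> (g1' (phi x 1) * J x 1)\<^sup>2 * 1" unfolding b_def power_mult_distrib[of "_ * _"] by (rule mult_left_mono) simp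
      also have "\<dots> = (g1' (phi x 1))\<^sup>2 * J x 1 * J x 1" by (simp add: power2_eq_square)
      also have "\<dots> \<le> (g1' (phi x 1))\<^sup>2 * J x 1 * (\<beta> * J x t)"
        by (rule mult_left_mono) (use J_ratio[of t 1 x] t in auto)
      finally show ?thesis using J by (simp add: divide_le_eq mult_ac)
    qed
    have c: "c\<^sup>2 / J x t \<le> \<beta> * (4 * S\<^sup>2 * V x)"
    proof -
      have "\<bar>c\<bar> \<le> S * (2 * Kb x)" unfolding c_def abs_mult
        by (rule mult_mono) (use D_bound[of x] rd_bound[OF elim(2), of t] elim(3) in \<open>auto simp: S_def\<close>)
      then have "c\<^sup>2 \<le> (S * (2 * Kb x))\<^sup>2" by (intro power2_le_if_abs_le) 
      then have "c\<^sup>2 / J x t \<le> 4 * S\<^sup>2 * ((Kb x)\<^sup>2 / J x t)"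
        using J by (simp add: power_mult_distrib divide_right_mono)
      also have "\<dots> \<le> 4 * S\<^sup>2 * (\<beta> * V x)" by (rule mult_left_mono[OF elim(1)]) simp
      finally show ?thesis by (simp add: mult_ac)
    qed
    have "(gd x t / J x t)\<^sup>2 * J x t = (a + b + c)\<^sup>2 / J x t"
      using J by (simp add: gd_def a_def b_def c_def power_divide power2_eq_square)
    also have "\<dots> \<le> 3 * (a\<^sup>2 + b\<^sup>2 + c\<^sup>2) / J x t" using sq J by (simp add: divide_right_mono)
    also have "\<dots> = 3 * (a\<^sup>2 / J x t + b\<^sup>2 / J x t + c\<^sup>2 / J x t)" by (simp add: add_divide_distrib)
    also have "\<dots> \<le> 3 * (\<beta> * (g0' x)\<^sup>2 + \<beta> * ((g1' (phi x 1))\<^sup>2 * J x 1) + \<beta> * (4 * S\<^sup>2 * V x))"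
      by (intro mult_left_mono add_mono a b c) simp
    also have "\<dots> = B x" by (simp add: B_def algebra_simps)
    finally show ?case .
  qed
  have i: "integrable unit_ivl (\<lambda>x. (gd x t / J x t)\<^sup>2 * J x t)"
    by (rule Bochner_Integration.integrable_bound[OF iB])
      (use le in \<open>auto elim!: eventually_mono intro: order_trans[OF _ abs_ge_self]\<close>)
  have eqs: "(\<integral>y. (fx (y, t))\<^sup>2 \<partial>unit_ivl) = (\<integral>x. (gd x t / J x t)\<^sup>2 * J x t \<partial>unit_ivl)"
    unfolding fx_def fst_conv snd_conv by (rule integral_X[OF t, of "\<lambda>x. (gd x t / J x t)\<^sup>2"]) measurable
  have "integrable unit_ivl (\<lambda>y. (fx (y, t))\<^sup>2)"
    unfolding fx_def fst_conv snd_conv using integrable_X[OF t, of "\<lambda>x. (gd x t / J x t)\<^sup>2"] i by simp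
  then show "(\<lambda>y. fx (y, t)) \<in> L2 unit_ivl" by (simp add: L2_def)
  have "(\<integral>y. (fx (y, t))\<^sup>2 \<partial>unit_ivl) \<le> (\<integral>x. B x \<partial>unit_ivl)"
    unfolding eqs by (rule integral_mono_AE[OF i iB le])
  also have "\<dots> = 3 * \<beta> * ((\<integral>x. (g0' x)\<^sup>2 \<partial>unit_ivl) + (\<integral>x. (g1' (phi x 1))\<^sup>2 * J x 1 \<partial>unit_ivl) + 4 * S\<^sup>2 * (\<integral>x. V x \<partial>unit_ivl))"
    unfolding B_def using i0 i1 V(2) by simp
  also have "(\<integral>x. (g1' (phi x 1))\<^sup>2 * J x 1 \<partial>unit_ivl) = (\<integral>x. (g1' x)\<^sup>2 \<partial>unit_ivl)"
    by (rule integral_phi[of 1 "\<lambda>y. (g1' y)\<^sup>2"]) auto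
  finally show "(\<integral>y. (fx (y, t))\<^sup>2 \<partial>unit_ivl) \<le> 3 * \<beta> * ((L2_norm g0')\<^sup>2 + (L2_norm g1')\<^sup>2
      + 4 * (L2_norm g0 + L2_norm g0' + (L2_norm g1 + L2_norm g1'))\<^sup>2 * (\<integral>t. (l t)\<^sup>2 \<partial>unit_ivl))"
    unfolding V(3) S_def L2_norm_power2 .
qed

lemma fh_slice_weak_deriv:
  assumes t: "0 \<le> t" "t \<le> 1"
  shows "weak_deriv (\<lambda>y. fh (y, t)) (\<lambda>y. fx (y, t))"
  by (rule ac_imp_weak_deriv[OF ac_fh_space[OF t] fx_bound(1)[OF t]]) auto

text \<open>The norm is taken in Lagrangian coordinates with weight \<open>J x t\<close>, and
  \<open>gl\<close> is split into \<open>g0\<close> and the accumulated source. For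
  \<open>g0\<close> the weight is at most \<open>\<beta>\<close>; for the source emitted at time
  \<open>s\<close> it is at most \<open>\<beta> * J x s\<close>, the weight proper to that time.
  Hence a single \<open>sqrt \<beta>\<close> in front.\<close>

lemma fh_slice_norm:
  assumes t: "0 \<le> t" "t \<le> 1"
  shows "L2_norm (\<lambda>y. fh (y, t)) \<le> sqrt \<beta> * (L2_norm g0 + sqrt (\<integral>p. (zh p)\<^sup>2 \<partial>unit_sq))"
proof -
  have m_gl [measurable]: "(\<lambda>x. gl x t) \<in> borel_measurable borel" "(\<lambda>x. pint (zl x) t) \<in> borel_measurable borel"
    "(\<lambda>p::real\<times>real. (zl (fst p) (snd p))\<^sup>2 * J (fst p) (snd p)) \<in> borel_measurable borel"
  proof -
    show "(\<lambda>x. gl x t) \<in> borel_measurable borel"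
      by (rule borel_measurable_continuous_onI) (intro continuous_on_gl continuous_intros)
    have "(\<lambda>x. gl x t - g0 x) \<in> borel_measurable borel"
      by (rule borel_measurable_continuous_onI) (intro continuous_on_gl continuous_intros continuous_g0)
    moreover have "gl x t - g0 x = pint (zl x) (max 0 (min 1 t))" for x
      using acD(2)[OF ac_gl, of t x] t by simp
    ultimately show "(\<lambda>x. pint (zl x) t) \<in> borel_measurable borel" using t by simp
    show "(\<lambda>p::real\<times>real. (zl (fst p) (snd p))\<^sup>2 * J (fst p) (snd p)) \<in> borel_measurable borel"
      by (rule borel_measurable_continuous_onI) (intro continuous_on_zl continuous_intros)
  qed
  define u where "u x = g0 x * sqrt (J x t)" for x
  define I where "I x = pint (zl x) t * sqrt (J x t)" for x
  define H where "H p = (zl (fst p) (snd p))\<^sup>2 * J (fst p) (snd p)" for p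
  have iH: "integrable unit_sq H" unfolding H_def
    by (rule integrable_continuous_unit_sq) (intro continuous_on_zl continuous_intros)
  have HZ: "(\<integral>x. \<integral>s. H (x, s) \<partial>unit_ivl \<partial>unit_ivl) = (\<integral>p. (zh p)\<^sup>2 \<partial>unit_sq)"
  proof -
    have "(\<integral>x. \<integral>s. H (x, s) \<partial>unit_ivl \<partial>unit_ivl) = (\<integral>s. \<integral>x. H (x, s) \<partial>unit_ivl \<partial>unit_ivl)"
      by (rule unit_sqD(5)[OF iH, symmetric])
    also have "\<dots> = (\<integral>s. \<integral>y. (zh (y, s))\<^sup>2 \<partial>unit_ivl \<partial>unit_ivl)"
    proof (rule integral_cong_unit_ivl)
      fix s :: real assume s: "0 < s" "s < 1"
      have "(\<integral>x. H (x, s) \<partial>unit_ivl) = (\<integral>x. (zh (phi x s, s))\<^sup>2 * J x s \<partial>unit_ivl)"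
        by (rule integral_cong_unit_ivl) (use s in \<open>simp add: H_def zh_phi\<close>)
      also have "\<dots> = (\<integral>y. (zh (y, s))\<^sup>2 \<partial>unit_ivl)"
        by (rule integral_phi[of s "\<lambda>y. (zh (y, s))\<^sup>2"]) (use s in auto)
      finally show "(\<integral>x. H (x, s) \<partial>unit_ivl) = (\<integral>y. (zh (y, s))\<^sup>2 \<partial>unit_ivl)" .
    qed
    also have "\<dots> = (\<integral>p. (zh p)\<^sup>2 \<partial>unit_sq)"
      by (rule unit_sqD(6)) (use zh_L2 in \<open>simp add: L2_def\<close>)
    finally show ?thesis .
  qed
  have cu: "continuous_on {0..1} u" unfolding u_def
    by (intro continuous_intros continuous_on_subset[OF continuous_g0]) auto
  have cI: "continuous_on {0..1} I"
  proof -
    have "continuous_on {0..1} (\<lambda>x. (gl x t - g0 x) * sqrt (J x t))"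
      by (intro continuous_intros continuous_on_gl continuous_on_subset[OF continuous_g0]) auto
    then show ?thesis
      by (rule continuous_on_eq) (use acD(2)[OF ac_gl, of t] t in \<open>simp add: I_def\<close>)
  qed
  have eq: "L2_norm (\<lambda>y. fh (y, t)) = L2_norm (\<lambda>x. u x + I x)"
  proof -
    have "(\<integral>y. (fh (y, t))\<^sup>2 \<partial>unit_ivl) = (\<integral>x. (gl x t)\<^sup>2 * J x t \<partial>unit_ivl)"
      unfolding fh_def fst_conv snd_conv by (rule integral_X[OF t, of "\<lambda>x. (gl x t)\<^sup>2"]) measurable
    also have "\<dots> = (\<integral>x. (u x + I x)\<^sup>2 \<partial>unit_ivl)"
    proof (rule Bochner_Integration.integral_cong[OF refl])
      fix x
      have "u x + I x = gl x t * sqrt (J x t)"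
        using acD(2)[OF ac_gl t, of x] by (simp add: u_def I_def algebra_simps)
      then show "(gl x t)\<^sup>2 * J x t = (u x + I x)\<^sup>2" by (simp add: power_mult_distrib)
    qed
    finally show ?thesis by (simp add: L2_norm_def)
  qed
  have nu: "L2_norm u \<le> sqrt \<beta> * L2_norm g0"
  proof -
    have "(\<integral>x. (u x)\<^sup>2 \<partial>unit_ivl) \<le> (\<integral>x. \<beta> * (g0 x)\<^sup>2 \<partial>unit_ivl)"
    proof (rule integral_mono_unit_ivl)
      show "integrable unit_ivl (\<lambda>x. (u x)\<^sup>2)" by (intro integrable_continuous_unit_ivl continuous_intros cu)
      show "integrable unit_ivl (\<lambda>x. \<beta> * (g0 x)\<^sup>2)"
        by (intro integrable_continuous_unit_ivl continuous_intros continuous_on_subset[OF continuous_g0]) auto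
      show "(u x)\<^sup>2 \<le> \<beta> * (g0 x)\<^sup>2" for x
        using mult_left_mono[OF J_bounds(1)[OF t, of x], of "(g0 x)\<^sup>2"]
        by (simp add: u_def power_mult_distrib mult.commute)
    qed
    then show ?thesis unfolding L2_norm_def by (simp add: real_sqrt_mult[symmetric])
  qed
  have nI: "L2_norm I \<le> sqrt \<beta> * sqrt (\<integral>p. (zh p)\<^sup>2 \<partial>unit_sq)"
  proof -
    have "(\<integral>x. (I x)\<^sup>2 \<partial>unit_ivl) \<le> (\<integral>x. \<beta> * (\<integral>s. H (x, s) \<partial>unit_ivl) \<partial>unit_ivl)"
    proof (rule integral_mono_unit_ivl)
      show "integrable unit_ivl (\<lambda>x. (I x)\<^sup>2)" by (intro integrable_continuous_unit_ivl continuous_intros cI)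
      show "integrable unit_ivl (\<lambda>x. \<beta> * (\<integral>s. H (x, s) \<partial>unit_ivl))" using unit_sqD(4)[OF iH] by simp
      fix x
      have czl: "continuous_on {0..1} (zl x)" by (intro continuous_on_zl continuous_intros)
      have i1: "integrable unit_ivl (zl x)" by (rule integrable_continuous_unit_ivl[OF czl])
      have i2: "integrable unit_ivl (\<lambda>s. (zl x s)\<^sup>2)" by (intro integrable_continuous_unit_ivl continuous_intros czl)
      have i3: "integrable unit_ivl (\<lambda>s. H (x, s))" unfolding H_def fst_conv snd_conv
        by (intro integrable_continuous_unit_ivl continuous_intros czl)
      have "\<bar>pint (zl x) t\<bar> \<le> (\<integral>s. \<bar>zl x s\<bar> \<partial>unit_ivl)" by (rule abs_pint_le[OF i1])
      then have "(pint (zl x) t)\<^sup>2 \<le> (\<integral>s. \<bar>zl x s\<bar> \<partial>unit_ivl)\<^sup>2" by (rule power2_le_if_abs_le)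
      also have "\<dots> \<le> (\<integral>s. (zl x s)\<^sup>2 \<partial>unit_ivl)" by (rule square_integral_le) (use i1 i2 in auto)
      finally have "(I x)\<^sup>2 \<le> (\<integral>s. (zl x s)\<^sup>2 \<partial>unit_ivl) * J x t"
        by (simp add: I_def power_mult_distrib mult_right_mono)
      also have "\<dots> = (\<integral>s. (zl x s)\<^sup>2 * J x t \<partial>unit_ivl)" by simp
      also have "\<dots> \<le> (\<integral>s. \<beta> * H (x, s) \<partial>unit_ivl)"
      proof (rule integral_mono_unit_ivl)
        fix s :: real assume "0 < s" "s < 1"
        then have "J x t \<le> \<beta> * J x s" using J_ratio[of s t x] t by simp
        from mult_left_mono[OF this, of "(zl x s)\<^sup>2"]
        show "(zl x s)\<^sup>2 * J x t \<le> \<beta> * H (x, s)" by (simp add: H_def mult_ac)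
      qed (use i2 i3 in auto)
      finally show "(I x)\<^sup>2 \<le> \<beta> * (\<integral>s. H (x, s) \<partial>unit_ivl)" by simp
    qed
    also have "\<dots> = \<beta> * (\<integral>p. (zh p)\<^sup>2 \<partial>unit_sq)" using HZ by simp
    finally show ?thesis unfolding L2_norm_def by (simp add: real_sqrt_mult[symmetric])
  qed
  show ?thesis
    unfolding eq distrib_left using L2_norm_triangle(2)[OF L2_continuous[OF cu] L2_continuous[OF cI]] nu nI by linarith
qed

end

subsection \<open>Borel representatives\<close>

text \<open>Precompose with a measurable retraction of the line to the open interval; 1/2 is an
  arbitrary interior point.\<close>

lemma borel_rep_unit_ivl:
  assumes h: "h \<in> borel_measurable unit_ivl"
  obtains h' where "h' \<in> borel_measurable borel" "\<And>x. 0 < x \<Longrightarrow> x < 1 \<Longrightarrow> h' x = h x"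
proof (rule that)
  have "(\<lambda>x::real. if 0 < x \<and> x < 1 then x else 1/2) \<in> measurable borel unit_ivl"
    unfolding unit_ivl_def by (rule measurable_restrict_space2) auto
  from measurable_compose[OF this h]
  show "(\<lambda>x. h (if 0 < x \<and> x < 1 then x else 1/2)) \<in> borel_measurable borel" .
qed auto

lemma borel_rep_unit_sq:
  assumes h: "h \<in> borel_measurable unit_sq"
  obtains h' where "h' \<in> borel_measurable borel"
    "\<And>x t. 0 < x \<Longrightarrow> x < 1 \<Longrightarrow> 0 < t \<Longrightarrow> t < 1 \<Longrightarrow> h' (x, t) = h (x, t)"
proof (rule that)
  have c: "(\<lambda>x::real. if 0 < x \<and> x < 1 then x else 1/2) \<in> measurable borel unit_ivl"
    unfolding unit_ivl_def by (rule measurable_restrict_space2) auto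
  have "(\<lambda>p::real\<times>real. (if 0 < fst p \<and> fst p < 1 then fst p else 1/2, if 0 < snd p \<and> snd p < 1 then snd p else 1/2))
      \<in> measurable (borel \<Otimes>\<^sub>M borel) unit_sq"
    unfolding unit_sq_def
    by (intro measurable_Pair measurable_compose[OF measurable_fst c] measurable_compose[OF measurable_snd c])
  from measurable_compose[OF this[unfolded borel_prod] h]
  show "(\<lambda>p. h (if 0 < fst p \<and> fst p < 1 then fst p else 1/2, if 0 < snd p \<and> snd p < 1 then snd p else 1/2))
      \<in> borel_measurable borel" .
qed auto

lemma unit_sq_slice:
  assumes "h \<in> borel_measurable unit_sq" "0 < t" "t < 1"
  shows "(\<lambda>x. h (x, t)) \<in> borel_measurable unit_ivl"
  using assms by (intro measurable_compose[OF measurable_Pair2']) (auto simp: unit_sq_def)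

lemma iterated_integral_cong_AE:
  fixes A B :: "real \<times> real \<Rightarrow> real"
  assumes A: "A \<in> borel_measurable unit_sq" and B: "B \<in> borel_measurable unit_sq"
    and eq: "AE t in unit_ivl. AE x in unit_ivl. A (x, t) = B (x, t)"
  shows "(\<integral>t. \<integral>x. A (x, t) \<partial>unit_ivl \<partial>unit_ivl) = (\<integral>t. \<integral>x. B (x, t) \<partial>unit_ivl \<partial>unit_ivl)"
proof (rule integral_cong_AE)
  have m: "(\<lambda>t. \<integral>x. C (x, t) \<partial>unit_ivl) \<in> borel_measurable unit_ivl"
    if "C \<in> borel_measurable unit_sq" for C :: "real \<times> real \<Rightarrow> real"
  proof (rule unit_ivl.borel_measurable_lebesgue_integral)
    show "case_prod (\<lambda>t x. C (x, t)) \<in> borel_measurable (unit_ivl \<Otimes>\<^sub>M unit_ivl)"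
      using measurable_compose[OF measurable_pair_swap' that[unfolded unit_sq_def]]
      by (simp add: case_prod_beta')
  qed
  show "(\<lambda>t. \<integral>x. A (x, t) \<partial>unit_ivl) \<in> borel_measurable unit_ivl" by (rule m[OF A])
  show "(\<lambda>t. \<integral>x. B (x, t) \<partial>unit_ivl) \<in> borel_measurable unit_ivl" by (rule m[OF B])
  show "AE t in unit_ivl. (\<integral>x. A (x, t) \<partial>unit_ivl) = (\<integral>x. B (x, t) \<partial>unit_ivl)"
    using eq AE_unit_ivl_interior
  proof eventually_elim
    case (elim t)
    then show ?case by (intro integral_cong_AE unit_sq_slice A B) auto
  qed
qed

lemma L2_unit_sqD: "h \<in> L2 unit_sq \<Longrightarrow> h \<in> borel_measurable unit_sq" "h \<in> L2 unit_sq \<Longrightarrow> integrable unit_sq (\<lambda>p. (h p)\<^sup>2)"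
  by (auto simp: L2_def)

lemma H1_rep:
  assumes "u \<in> H1"
  obtains g g' where "ac g g'" "g' \<in> borel_measurable borel" "g' \<in> L2 unit_ivl" "continuous_on UNIV g"
    "AE x in unit_ivl. u x = g x" "L2_norm g = L2_norm u" "L2_norm g' = L2_norm (wD u)"
proof -
  note w = H1_weak_deriv[OF assms]
  obtain c where c: "AE x in unit_ivl. u x = c + pint (wD u) x" using weak_deriv_imp_ac[OF w] by blast
  obtain g' where g': "g' \<in> borel_measurable borel" "\<And>x. 0 < x \<Longrightarrow> x < 1 \<Longrightarrow> g' x = wD u x"
    using borel_rep_unit_ivl[OF L2_unit_ivlD(1)[OF weak_derivD(2)[OF w]]] by blast
  have i: "integrable unit_ivl (\<lambda>x. (g' x)\<^sup>2)"
    using L2_unit_ivlD(2)[OF weak_derivD(2)[OF w]] g'(2)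
    by (subst Bochner_Integration.integrable_cong[where g = "\<lambda>x. (wD u x)\<^sup>2"]) auto
  have gL2: "g' \<in> L2 unit_ivl" using i g'(1) by (simp add: L2_def)
  define g where "g x = c + pint g' x" for x
  have p: "pint g' x = pint (wD u) x" for x by (rule pint_cong) (rule g'(2))
  have cg: "continuous_on UNIV g" unfolding g_def
    by (intro continuous_intros continuous_on_pint L2_unit_ivlD(3)[OF gL2])
  have eq: "AE x in unit_ivl. u x = g x" using c by (simp add: g_def p)
  show ?thesis
  proof (rule that[OF _ g'(1) gL2 cg eq])
    show "ac g g'" unfolding g_def using ac_add[OF ac_const ac_pint[OF L2_unit_ivlD(3)[OF gL2]]] by simp
    show "L2_norm g = L2_norm u"
      by (rule L2_norm_cong_AE)
        (use eq borel_measurable_continuous_onI[OF cg] L2_unit_ivlD(1)[OF weak_derivD(1)[OF w]] in \<open>auto elim!: eventually_mono\<close>)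
    show "L2_norm g' = L2_norm (wD u)"
      unfolding L2_norm_def by (rule arg_cong[where f = sqrt], rule integral_cong_unit_ivl) (simp add: g'(2))
  qed
qed

lemma has_dx_dx: "\<exists>w. has_dx u w \<Longrightarrow> has_dx u (dx u)"
  unfolding dx_def by (rule someI_ex[of "has_dx u"])

text \<open>Integrating the second derivative twice recovers \<open>v\<close>, because its zero
  values at both ends determine the two constants of integration. The locale wants a Borel function
  with every time slice square integrable, so the bad slices, a null set of times, are replaced by
  zero.\<close>

lemma velocity_rep:
  assumes v: "v \<in> L2_H2_H10"
  obtains w where "velocity w"
    "AE t in unit_ivl. AE x in unit_ivl. v (x, t) = velocity.v w x t \<and> dx v (x, t) = velocity.vx w x t"
    "(\<integral>t. (velocity.l w t)\<^sup>2 \<partial>unit_ivl) = (\<integral>p. (dx (dx v) p)\<^sup>2 \<partial>unit_sq)"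
proof -
  have h1: "has_dx v (dx v)" and h2: "has_dx (dx v) (dx (dx v))"
    using v by (auto simp: L2_H2_H10_def intro: has_dx_dx)
  have H10: "AE t in unit_ivl. (\<lambda>x. v (x, t)) \<in> H10"
    using v unfolding L2_H2_H10_def by (auto elim!: eventually_mono)
  note dd = h2[unfolded has_dx_def, THEN conjunct1]
  obtain w0 where w0 [measurable]: "w0 \<in> borel_measurable borel"
    and w0_eq: "\<And>x t. 0 < x \<Longrightarrow> x < 1 \<Longrightarrow> 0 < t \<Longrightarrow> t < 1 \<Longrightarrow> w0 (x, t) = dx (dx v) (x, t)"
    using borel_rep_unit_sq[OF L2_unit_sqD(1)[OF dd]] by blast
  have i0: "integrable unit_sq (\<lambda>p. (w0 p)\<^sup>2)"
    by (rule Bochner_Integration.integrable_cong[THEN iffD2, OF refl _ L2_unit_sqD(2)[OF dd]])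
      (use w0_eq in \<open>auto simp: space_unit_sq\<close>)
  \<comment> \<open>The squared slice norm with value in [0, infinity] is Borel in \<open>t\<close>,
    so discarding the slices where it is infinite preserves measurability.\<close>
  define e where "e t = (\<integral>\<^sup>+x. ennreal ((w0 (x, t))\<^sup>2) \<partial>unit_ivl)" for t
  have e_borel [measurable]: "e \<in> borel_measurable borel" unfolding e_def[abs_def] by measurable
  have fin: "integrable unit_ivl (\<lambda>x. (w0 (x, t))\<^sup>2) \<longleftrightarrow> e t < \<infinity>" for t
    unfolding e_def by (simp add: integrable_iff_bounded)
  define w where "w p = (if e (snd p) < \<infinity> then w0 p else 0)" for p
  have w_borel: "w \<in> borel_measurable borel"
  proof -
    have [measurable]: "w0 \<in> borel_measurable (borel \<Otimes>\<^sub>M borel)" by (simp add: borel_prod)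
    have "w \<in> borel_measurable (borel \<Otimes>\<^sub>M borel)" unfolding w_def[abs_def] by measurable
    then show ?thesis by (simp add: borel_prod)
  qed
  have eqw: "AE t in unit_ivl. \<forall>x. w (x, t) = w0 (x, t)"
    using unit_sqD(1)[OF i0] by eventually_elim (simp add: w_def fin)
  have sl: "integrable unit_ivl (\<lambda>x. (w (x, t))\<^sup>2)" for t
    by (cases "e t < \<infinity>") (simp_all add: w_def fin)
  have eqi: "AE t in unit_ivl. (\<integral>x. (w (x, t))\<^sup>2 \<partial>unit_ivl) = (\<integral>x. (w0 (x, t))\<^sup>2 \<partial>unit_ivl)"
    using eqw by eventually_elim simp
  note [measurable] = w_borel
  have mw: "(\<lambda>t. \<integral>x. (w (x, t))\<^sup>2 \<partial>unit_ivl) \<in> borel_measurable unit_ivl" by measurable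
  have sq: "integrable unit_ivl (\<lambda>t. \<integral>x. (w (x, t))\<^sup>2 \<partial>unit_ivl)"
    by (rule integrable_cong_AE_imp[OF unit_sqD(2)[OF i0] mw]) (use eqi in \<open>auto elim!: eventually_mono\<close>)
  have vel: "velocity w" by (rule velocity.intro[OF w_borel sl sq])
  interpret velocity w by (rule vel)
  show ?thesis
  proof (rule that[OF vel])
    have "(\<integral>t. (l t)\<^sup>2 \<partial>unit_ivl) = (\<integral>t. \<integral>x. (w0 (x, t))\<^sup>2 \<partial>unit_ivl \<partial>unit_ivl)"
      unfolding l_square by (rule integral_cong_AE[OF mw _ eqi]) (use unit_sqD(2)[OF i0] in auto)
    also have "\<dots> = (\<integral>p. (w0 p)\<^sup>2 \<partial>unit_sq)" by (rule unit_sqD(6)[OF i0])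
    also have "\<dots> = (\<integral>p. (dx (dx v) p)\<^sup>2 \<partial>unit_sq)"
      by (rule Bochner_Integration.integral_cong) (use w0_eq in \<open>auto simp: space_unit_sq\<close>)
    finally show "(\<integral>t. (velocity.l w t)\<^sup>2 \<partial>unit_ivl) = (\<integral>p. (dx (dx v) p)\<^sup>2 \<partial>unit_sq)" .
    show "AE t in unit_ivl. AE x in unit_ivl. v (x, t) = velocity.v w x t \<and> dx v (x, t) = velocity.vx w x t"
      using h1[unfolded has_dx_def, THEN conjunct2] h2[unfolded has_dx_def, THEN conjunct2] H10 eqw AE_unit_ivl_interior
    proof eventually_elim
      case (elim t)
      have pw: "pint (\<lambda>x. dx (dx v) (x, t)) x = pint (\<lambda>y. w (y, t)) x" for x
        by (rule pint_cong) (use elim w0_eq in auto)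
      obtain c where c: "AE x in unit_ivl. dx v (x, t) = c + pint (\<lambda>y. w (y, t)) x"
        using weak_deriv_imp_ac[OF elim(2)] unfolding pw by blast
      obtain c' where c': "AE x in unit_ivl. v (x, t) = c' + pint (\<lambda>x. dx v (x, t)) x"
         "ac (\<lambda>x. c' + pint (\<lambda>x. dx v (x, t)) x) (\<lambda>x. dx v (x, t))"
        using weak_deriv_imp_ac[OF elim(1)] by blast
      \<comment> \<open>The value at 0 fixes the constant for \<open>v\<close>; the value at 1 then
        forces \<open>dx v\<close> to have mean zero, which fixes the constant
        \<open>c\<close>.\<close>
      have bd: "c' = 0" "c' + (\<integral>x. dx v (x, t) \<partial>unit_ivl) = 0"
        using H10_boundary[OF elim(3,1) c'] by (simp_all add: pint_ge_1)
      note md = L2_unit_ivlD(1)[OF weak_derivD(2)[OF elim(1)]]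
      have mp: "(\<lambda>x. c + pint (\<lambda>y. w (y, t)) x) \<in> borel_measurable unit_ivl"
        using integrable_pint_w[of t] by auto
      have "(\<integral>x. dx v (x, t) \<partial>unit_ivl) = (\<integral>x. c + pint (\<lambda>y. w (y, t)) x \<partial>unit_ivl)"
        by (rule integral_cong_AE[OF md mp c])
      also have "\<dots> = c + (\<integral>x. pint (\<lambda>y. w (y, t)) x \<partial>unit_ivl)"
        using integrable_pint_w[of t] by simp
      finally have "c = - (\<integral>x. pint (\<lambda>y. w (y, t)) x \<partial>unit_ivl)" using bd by simp
      then have e1: "AE x in unit_ivl. dx v (x, t) = vx x t" using c by (simp add: vx_def)
      have pv: "pint (\<lambda>x. dx v (x, t)) x = velocity.v w x t" for x
        unfolding v_def by (rule pint_cong_AE[OF e1 md]) (use integrable_vx in auto)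
      have "AE x in unit_ivl. v (x, t) = velocity.v w x t" using c'(1) unfolding pv bd(1) by simp
      with e1 show ?case by eventually_elim simp
    qed
  qed
qed

subsection \<open>The dual space\<close>

lemma H10_L2: "u \<in> H10 \<Longrightarrow> u \<in> L2 unit_ivl"
  using H1_weak_deriv weak_derivD(1) unfolding H10_def by blast

lemma weak_deriv_zero: "weak_deriv (\<lambda>_. 0) (\<lambda>_. 0)"
  by (rule ac_imp_weak_deriv[OF ac_const[of 0]]) (auto simp: L2_def)

lemma smooth_const: "smooth (\<lambda>_::'a::euclidean_space. c)"
  by (rule smooth_real_polynomial[OF real_polynomial_function.intros(2)])

lemma test_zero: "(\<lambda>_. 0) \<in> test_functions"
  unfolding test_functions_def using smooth_const by simp

lemma H1_norm_eq: "weak_deriv u g \<Longrightarrow> H1_norm u = sqrt ((L2_norm u)\<^sup>2 + (L2_norm g)\<^sup>2)"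
  unfolding H1_norm_def using L2_norm_wD[of u g] by simp

lemma H1_norm_zero: "H1_norm (\<lambda>_. 0) = 0"
  unfolding H1_norm_eq[OF weak_deriv_zero] by (simp add: L2_norm_def)

lemma H10_zero: "(\<lambda>_. 0) \<in> H10"
  unfolding H10_def
  by (intro CollectI conjI allI impI bexI[OF _ test_zero] weak_deriv_H1[OF weak_deriv_zero]) (simp add: H1_norm_zero)

lemma L2_norm_cmult: "L2_norm (\<lambda>x. c * u x) = \<bar>c\<bar> * L2_norm u"
  unfolding L2_norm_def by (simp add: power_mult_distrib real_sqrt_mult)

lemma weak_deriv_cmult:
  assumes "weak_deriv u g"
  shows "weak_deriv (\<lambda>x. c * u x) (\<lambda>x. c * g x)"
proof -
  obtain d where d: "AE x in unit_ivl. u x = d + pint g x" "ac (\<lambda>x. d + pint g x) g"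
    using weak_deriv_imp_ac[OF assms] by blast
  note m = weak_derivD[OF assms]
  show ?thesis
    by (rule ac_imp_weak_deriv[OF ac_cmult[OF d(2)]])
      (use d m[THEN L2_unit_ivlD(1)] m[THEN L2_unit_ivlD(2)] in \<open>auto simp: L2_def power_mult_distrib\<close>)
qed

lemma H1_norm_cmult: "u \<in> H1 \<Longrightarrow> H1_norm (\<lambda>x. c * u x) = \<bar>c\<bar> * H1_norm u"
proof -
  assume "u \<in> H1"
  note w = H1_weak_deriv[OF this]
  have "H1_norm (\<lambda>x. c * u x) = sqrt (c\<^sup>2 * ((L2_norm u)\<^sup>2 + (L2_norm (wD u))\<^sup>2))"
    unfolding H1_norm_eq[OF weak_deriv_cmult[OF w]] L2_norm_cmult by (simp add: power_mult_distrib distrib_left)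
  then show ?thesis by (simp add: H1_norm_def real_sqrt_mult)
qed

lemma test_cmult:
  assumes "\<phi> \<in> test_functions"
  shows "(\<lambda>x. c * \<phi> x) \<in> test_functions"
proof -
  have s: "smooth \<phi>" and c: "closure {x. \<phi> x \<noteq> 0} \<subseteq> {0<..<1}" using assms by (auto simp: test_functions_def)
  have "smooth (\<lambda>x. c * \<phi> x)"
    by (rule smooth_smooth_algebra[OF smooth_algebra.mult[OF
          smooth_algebra_polynomial[OF real_polynomial_function.intros(2)] smooth_algebra_smooth[OF s]]])
  moreover have "closure {x. c * \<phi> x \<noteq> 0} \<subseteq> closure {x. \<phi> x \<noteq> 0}" by (rule closure_mono) auto
  ultimately show ?thesis using c by (auto simp: test_functions_def)
qed

lemma H10_cmult:
  assumes u: "u \<in> H10"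
  shows "(\<lambda>x. c * u x) \<in> H10"
  unfolding H10_def
proof (intro CollectI conjI allI impI)
  have u1: "u \<in> H1" using u by (simp add: H10_def)
  then show "(\<lambda>x. c * u x) \<in> H1" using weak_deriv_H1[OF weak_deriv_cmult[OF H1_weak_deriv]] by blast
  fix \<delta> :: real assume d: "\<delta> > 0"
  \<comment> \<open>The added 1 handles \<open>c = 0\<close> and makes the final inequality
    strict.\<close>
  then have "\<delta> / (\<bar>c\<bar> + 1) > 0" by simp
  then obtain \<phi> where t: "\<phi> \<in> test_functions" and n: "H1_norm (\<lambda>x. u x - \<phi> x) < \<delta> / (\<bar>c\<bar> + 1)"
    using u unfolding H10_def by blast
  have ud: "(\<lambda>x. u x - \<phi> x) \<in> H1"
    by (rule weak_deriv_H1[OF weak_deriv_diff[OF H1_weak_deriv[OF u1] weak_deriv_test[OF t]]])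
  have "H1_norm (\<lambda>x. c * u x - c * \<phi> x) = \<bar>c\<bar> * H1_norm (\<lambda>x. u x - \<phi> x)"
    using H1_norm_cmult[OF ud, of c] by (simp add: right_diff_distrib)
  also have "\<dots> \<le> \<bar>c\<bar> * (\<delta> / (\<bar>c\<bar> + 1))" using n by (intro mult_left_mono) auto
  also have "\<dots> < \<delta>" using d by (simp add: field_simps)
  finally show "\<exists>\<phi>\<in>test_functions. H1_norm (\<lambda>x. c * u x - \<phi> x) < \<delta>"
    by (intro bexI[OF _ test_cmult[OF t]])
qed

lemma H1_norm_nonneg: "0 \<le> H1_norm u"
  by (simp add: H1_norm_def)

text \<open>Scale \<open>u\<close> into the unit ball. Dividing by \<open>1 + H1_norm u\<close>
  instead of \<open>H1_norm u\<close> treats functions of norm zero as well. Boundedness of both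
  functionals makes the supremum over the reals meaningful.\<close>

lemma Hm1_diff_bound:
  assumes F: "F \<in> Hm1" and G: "G \<in> Hm1" and u: "u \<in> H10"
  shows "\<bar>F u - G u\<bar> \<le> (1 + H1_norm u) * Hm1_norm (\<lambda>u. F u - G u)"
proof -
  obtain C where C: "\<And>u. u \<in> H10 \<Longrightarrow> \<bar>F u\<bar> \<le> C * H1_norm u" using F unfolding Hm1_def by blast
  obtain C' where C': "\<And>u. u \<in> H10 \<Longrightarrow> \<bar>G u\<bar> \<le> C' * H1_norm u" using G unfolding Hm1_def by blast
  have hom: "L (\<lambda>x. c * u x) = c * L u" if "L \<in> Hm1" for L c
  proof -
    have "L (\<lambda>x. c * u x + 0 * u x) = c * L u + 0 * L u" using that u unfolding Hm1_def by blast
    then show ?thesis by simp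
  qed
  define c where "c = 1 / (1 + H1_norm u)"
  have pos: "0 < 1 + H1_norm u" using H1_norm_nonneg[of u] by linarith
  have c: "0 < c" using pos by (simp add: c_def)
  have u1: "u \<in> H1" using u by (simp add: H10_def)
  have mem: "(\<lambda>x. c * u x) \<in> {u \<in> H10. H1_norm u \<le> 1}"
  proof -
    have "H1_norm (\<lambda>x. c * u x) \<le> 1" unfolding H1_norm_cmult[OF u1] using pos by (simp add: c_def divide_le_eq)
    then show ?thesis using H10_cmult[OF u, of c] by blast
  qed
  have bdd: "bdd_above ((\<lambda>u. \<bar>F u - G u\<bar>) ` {u \<in> H10. H1_norm u \<le> 1})"
  proof (rule bdd_aboveI2)
    fix u assume "u \<in> {u \<in> H10. H1_norm u \<le> 1}"
    then have u: "u \<in> H10" "H1_norm u \<le> 1" by auto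
    have "\<bar>F u - G u\<bar> \<le> C * H1_norm u + C' * H1_norm u" using C[OF u(1)] C'[OF u(1)] by linarith
    also have "\<dots> \<le> \<bar>C\<bar> * 1 + \<bar>C'\<bar> * 1"
      using u(2) H1_norm_nonneg[of u] by (intro add_mono mult_mono) auto
    finally show "\<bar>F u - G u\<bar> \<le> \<bar>C\<bar> * 1 + \<bar>C'\<bar> * 1" .
  qed
  have "\<bar>F (\<lambda>x. c * u x) - G (\<lambda>x. c * u x)\<bar> \<le> Hm1_norm (\<lambda>u. F u - G u)"
    unfolding Hm1_norm_def by (rule cSUP_upper[OF mem bdd])
  then have "c * \<bar>F u - G u\<bar> \<le> Hm1_norm (\<lambda>u. F u - G u)"
    using c by (simp add: hom[OF F] hom[OF G] right_diff_distrib[symmetric] abs_mult)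
  then show ?thesis using pos by (simp add: c_def divide_le_eq mult.commute)
qed

lemma Hm1_continuous_pairing:
  assumes F: "F \<in> C_Hm1" and u: "u \<in> H10"
  shows "continuous_on {0..1} (\<lambda>t. F t u)"
  unfolding continuous_on_def
proof
  fix t :: real assume t: "t \<in> {0..1}"
  have m: "\<And>s. s \<in> {0..1} \<Longrightarrow> F s \<in> Hm1" and
    lim: "((\<lambda>s. Hm1_norm (\<lambda>u. F s u - F t u)) \<longlongrightarrow> 0) (at t within {0..1})"
    using F t by (auto simp: C_Hm1_def)
  have "((\<lambda>s. F s u - F t u) \<longlongrightarrow> 0) (at t within {0..1})"
  proof (rule Lim_null_comparison)
    show "\<forall>\<^sub>F s in at t within {0..1}. norm (F s u - F t u) \<le> (1 + H1_norm u) * Hm1_norm (\<lambda>u. F s u - F t u)"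
      unfolding eventually_at_filter
      by (rule always_eventually) (use Hm1_diff_bound[OF m m[OF t] u] in auto)
    show "((\<lambda>s. (1 + H1_norm u) * Hm1_norm (\<lambda>u. F s u - F t u)) \<longlongrightarrow> 0) (at t within {0..1})"
      using tendsto_mult_left[OF lim, of "1 + H1_norm u"] by simp
  qed
  then show "((\<lambda>t. F t u) \<longlongrightarrow> F t u) (at t within {0..1})" by (simp add: LIM_zero_iff)
qed

lemma abs_pairing_le:
  assumes h: "h \<in> L2 unit_ivl" and u: "u \<in> H10"
  shows "\<bar>\<integral>x. h x * u x \<partial>unit_ivl\<bar> \<le> L2_norm h * H1_norm u"
proof -
  note uL = H10_L2[OF u]
  have "\<bar>\<integral>x. h x * u x \<partial>unit_ivl\<bar> \<le> (\<integral>x. \<bar>h x * u x\<bar> \<partial>unit_ivl)" by simp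
  also have "\<dots> \<le> L2_norm h * L2_norm u" unfolding L2_norm_def
    by (rule Cauchy_Schwarz_abs_integral) (use L2_unit_ivlD[OF h] L2_unit_ivlD[OF uL] in auto)
  also have "\<dots> \<le> L2_norm h * H1_norm u" by (intro mult_left_mono L2_norm_le_H1_norm) simp
  finally show ?thesis .
qed

text \<open>By uniform continuity on the square, the slices of \<open>h\<close> depend continuously
  on time in L^2, and the L^2 norm dominates the dual norm.\<close>

lemma Hm1_version_continuous:
  fixes h :: "real \<times> real \<Rightarrow> real"
  assumes c: "continuous_on UNIV h"
  shows "Hm1_version h (\<lambda>t u. \<integral>x. h (x, t) * u x \<partial>unit_ivl)"
proof -
  have cs: "continuous_on S (\<lambda>x. h (x, t))" for t S
    by (rule continuous_on_compose2[OF c]) (auto intro!: continuous_intros)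
  have hL: "(\<lambda>x. h (x, t)) \<in> L2 unit_ivl" for t by (rule L2_continuous[OF cs])
  have dL: "(\<lambda>x. h (x, s) - h (x, t)) \<in> L2 unit_ivl" for s t
    by (rule L2_continuous) (intro continuous_intros cs)
  have ip: "integrable unit_ivl (\<lambda>x. h (x, t) * u x)" if "u \<in> H10" for t u
    by (rule integrable_mult_L2) (use L2_unit_ivlD[OF hL[of t]] L2_unit_ivlD[OF H10_L2[OF that]] in auto)
  have mem: "(\<lambda>u. \<integral>x. h (x, t) * u x \<partial>unit_ivl) \<in> Hm1" for t
    unfolding Hm1_def
  proof (intro CollectI conjI ballI allI)
    fix u v :: "real \<Rightarrow> real" and a b :: real assume u: "u \<in> H10" and v: "v \<in> H10"
    have "(\<integral>x. h (x, t) * (a * u x + b * v x) \<partial>unit_ivl) = (\<integral>x. a * (h (x, t) * u x) + b * (h (x, t) * v x) \<partial>unit_ivl)"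
      by (rule Bochner_Integration.integral_cong) (auto simp: algebra_simps)
    also have "\<dots> = a * (\<integral>x. h (x, t) * u x \<partial>unit_ivl) + b * (\<integral>x. h (x, t) * v x \<partial>unit_ivl)"
      using ip[OF u] ip[OF v] by simp
    finally show "(\<integral>x. h (x, t) * (a * u x + b * v x) \<partial>unit_ivl)
        = a * (\<integral>x. h (x, t) * u x \<partial>unit_ivl) + b * (\<integral>x. h (x, t) * v x \<partial>unit_ivl)" .
  next
    show "\<exists>C. \<forall>u\<in>H10. \<bar>\<integral>x. h (x, t) * u x \<partial>unit_ivl\<bar> \<le> C * H1_norm u"
      using abs_pairing_le[OF hL] by blast
  qed
  have nb: "\<bar>Hm1_norm (\<lambda>u. (\<integral>x. h (x, s) * u x \<partial>unit_ivl) - (\<integral>x. h (x, t) * u x \<partial>unit_ivl))\<bar>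
      \<le> L2_norm (\<lambda>x. h (x, s) - h (x, t))" for s t
  proof -
    have b: "\<bar>(\<integral>x. h (x, s) * u x \<partial>unit_ivl) - (\<integral>x. h (x, t) * u x \<partial>unit_ivl)\<bar> \<le> L2_norm (\<lambda>x. h (x, s) - h (x, t))"
      if u: "u \<in> {u \<in> H10. H1_norm u \<le> 1}" for u
    proof -
      have "(\<integral>x. h (x, s) * u x \<partial>unit_ivl) - (\<integral>x. h (x, t) * u x \<partial>unit_ivl) = (\<integral>x. (h (x, s) - h (x, t)) * u x \<partial>unit_ivl)"
        using ip[of u s] ip[of u t] u by (simp add: left_diff_distrib)
      also have "\<bar>\<dots>\<bar> \<le> L2_norm (\<lambda>x. h (x, s) - h (x, t)) * H1_norm u"
        by (rule abs_pairing_le[OF dL]) (use u in auto)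
      also have "\<dots> \<le> L2_norm (\<lambda>x. h (x, s) - h (x, t)) * 1" using u by (intro mult_left_mono) auto
      finally show ?thesis by simp
    qed
    \<comment> \<open>The zero function makes the set under the supremum nonempty and supplies the
      lower bound 0.\<close>
    have z: "(\<lambda>_. 0) \<in> {u \<in> H10. H1_norm u \<le> 1}" using H10_zero H1_norm_zero by simp
    have "0 \<le> Hm1_norm (\<lambda>u. (\<integral>x. h (x, s) * u x \<partial>unit_ivl) - (\<integral>x. h (x, t) * u x \<partial>unit_ivl))"
      unfolding Hm1_norm_def
      by (rule cSUP_upper2[OF _ z]) (use b in \<open>auto intro!: bdd_aboveI2\<close>)
    moreover have "Hm1_norm (\<lambda>u. (\<integral>x. h (x, s) * u x \<partial>unit_ivl) - (\<integral>x. h (x, t) * u x \<partial>unit_ivl)) \<le> L2_norm (\<lambda>x. h (x, s) - h (x, t))"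
      unfolding Hm1_norm_def by (rule cSUP_least) (use z b in auto)
    ultimately show ?thesis by simp
  qed
  have lim: "((\<lambda>s. L2_norm (\<lambda>x. h (x, s) - h (x, t))) \<longlongrightarrow> 0) (at t within {0..1})" if t: "t \<in> {0..1}" for t
  proof (rule tendstoI)
    fix e :: real assume e: "e > 0"
    have "uniformly_continuous_on ({0..1} \<times> {0..1}) h"
      by (intro compact_uniformly_continuous continuous_on_subset[OF c] compact_Times compact_Icc) auto
    then obtain d where d: "d > 0" "\<And>p q. p \<in> {0..1} \<times> {0..1} \<Longrightarrow> q \<in> {0..1} \<times> {0..1} \<Longrightarrow> dist q p < d \<Longrightarrow> dist (h q) (h p) < e / 2"
      using half_gt_zero[OF e] unfolding uniformly_continuous_on_def by metis
    have "L2_norm (\<lambda>x. h (x, s) - h (x, t)) < e" if s: "s \<in> {0..1}" "dist s t < d" for s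
    proof -
      have "(\<integral>x. (h (x, s) - h (x, t))\<^sup>2 \<partial>unit_ivl) \<le> (\<integral>x. (e / 2)\<^sup>2 \<partial>unit_ivl)"
      proof (rule integral_mono_unit_ivl)
        fix x :: real assume "0 < x" "x < 1"
        then have "dist (h (x, s)) (h (x, t)) < e / 2"
          using s t by (intro d(2)) (auto simp: dist_Pair_Pair)
        then show "(h (x, s) - h (x, t))\<^sup>2 \<le> (e / 2)\<^sup>2"
          by (intro power2_le_if_abs_le) (simp add: dist_real_def)
      qed (use L2_unit_ivlD(2)[OF dL] in auto)
      then have "(L2_norm (\<lambda>x. h (x, s) - h (x, t)))\<^sup>2 \<le> (e / 2)\<^sup>2" unfolding L2_norm_power2 by simp
      then have "L2_norm (\<lambda>x. h (x, s) - h (x, t)) \<le> e / 2" by (rule power2_le_imp_le) (use e in simp)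
      then show ?thesis using e by simp
    qed
    then show "\<forall>\<^sub>F s in at t within {0..1}. dist (L2_norm (\<lambda>x. h (x, s) - h (x, t))) 0 < e"
      unfolding eventually_at using d(1) by (auto simp: dist_real_def)
  qed
  show ?thesis unfolding Hm1_version_def C_Hm1_def
  proof (intro conjI CollectI ballI mem)
    fix t :: real assume "t \<in> {0..1}"
    from lim[OF this]
    show "((\<lambda>s. Hm1_norm (\<lambda>u. (\<integral>x. h (x, s) * u x \<partial>unit_ivl) - (\<integral>x. h (x, t) * u x \<partial>unit_ivl))) \<longlongrightarrow> 0) (at t within {0..1})"
      by (rule Lim_null_comparison[rotated]) (use nb in auto)
  qed (simp add: Hm1_eq_def)
qed

text \<open>For a fixed \<open>u\<close> both pairings are continuous in time and agree almost
  everywhere, hence at every time. This identifies \<open>f\<close> at each individual time with a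
  slice of the continuous function \<open>h\<close>.\<close>

lemma Hm1_version_unique:
  fixes h :: "real \<times> real \<Rightarrow> real"
  assumes F: "Hm1_version f F" and c: "continuous_on UNIV h"
    and eq: "AE t in unit_ivl. AE x in unit_ivl. f (x, t) = h (x, t)"
    and f: "f \<in> borel_measurable unit_sq" and t: "t \<in> {0..1}"
  shows "Hm1_eq (F t) (\<lambda>x. h (x, t))"
  unfolding Hm1_eq_def
proof
  fix u assume u: "u \<in> H10"
  have FC: "F \<in> C_Hm1" and FA: "AE t in unit_ivl. Hm1_eq (F t) (\<lambda>x. f (x, t))"
    using F by (auto simp: Hm1_version_def)
  have hC: "(\<lambda>t u. \<integral>x. h (x, t) * u x \<partial>unit_ivl) \<in> C_Hm1"
    using Hm1_version_continuous[OF c] by (simp add: Hm1_version_def)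
  have "AE t in unit_ivl. F t u = (\<integral>x. h (x, t) * u x \<partial>unit_ivl)"
    using FA eq AE_unit_ivl_interior
  proof eventually_elim
    case (elim t)
    have "F t u = (\<integral>x. f (x, t) * u x \<partial>unit_ivl)" using elim(1) u by (simp add: Hm1_eq_def)
    also have "\<dots> = (\<integral>x. h (x, t) * u x \<partial>unit_ivl)"
    proof (rule integral_cong_AE)
      have "(\<lambda>x. h (x, t)) \<in> borel_measurable unit_ivl"
        by (intro borel_measurable_unit_ivl borel_measurable_continuous_onI continuous_on_compose2[OF c])
          (auto intro!: continuous_intros)
      then show "(\<lambda>x. h (x, t) * u x) \<in> borel_measurable unit_ivl" using L2_unit_ivlD(1)[OF H10_L2[OF u]] by simp
      show "(\<lambda>x. f (x, t) * u x) \<in> borel_measurable unit_ivl"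
        using unit_sq_slice[OF f] elim(3) L2_unit_ivlD(1)[OF H10_L2[OF u]] by simp
      show "AE x in unit_ivl. f (x, t) * u x = h (x, t) * u x" using elim(2) by eventually_elim simp
    qed
    finally show ?case .
  qed
  then show "F t u = (\<integral>x. h (x, t) * u x \<partial>unit_ivl)"
    by (rule AE_eq_imp_eq_continuous[OF _ Hm1_continuous_pairing[OF FC u] Hm1_continuous_pairing[OF hC u] t])
qed

subsection \<open>Admissibility and minimality\<close>

lemma L2_H2_H10_D:
  assumes "v \<in> L2_H2_H10"
  shows "v \<in> L2 unit_sq" "dx v \<in> L2 unit_sq" "dx (dx v) \<in> L2 unit_sq"
    "has_dx v (dx v)" "has_dx (dx v) (dx (dx v))"
proof -
  show "v \<in> L2 unit_sq" "has_dx v (dx v)" "has_dx (dx v) (dx (dx v))"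
    using assms by (auto simp: L2_H2_H10_def intro: has_dx_dx)
  then show "dx v \<in> L2 unit_sq" "dx (dx v) \<in> L2 unit_sq" by (auto simp: has_dx_def)
qed

lemma Hm1_eq_cong_AE:
  assumes "AE x in unit_ivl. g x = h x" "g \<in> borel_measurable unit_ivl" "h \<in> borel_measurable unit_ivl"
  shows "Hm1_eq L g \<longleftrightarrow> Hm1_eq L h"
proof -
  have "(\<integral>x. g x * u x \<partial>unit_ivl) = (\<integral>x. h x * u x \<partial>unit_ivl)" if "u \<in> H10" for u
    by (rule integral_cong_AE)
      (use assms L2_unit_ivlD(1)[OF H10_L2[OF that]] in \<open>auto elim!: eventually_mono\<close>)
  then show ?thesis by (simp add: Hm1_eq_def)
qed

text \<open>\<open>dx v\<close> is an unspecified choice that agrees with \<open>vx\<close> only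
  almost everywhere; hence the passage through iterated integrals of almost everywhere equal
  functions.\<close>

lemma weak_transport_rep:
  fixes \<phi> :: "real \<times> real \<Rightarrow> real"
  assumes vel: "velocity w" and s: "smooth \<phi>"
    and f: "f \<in> borel_measurable unit_sq" and v: "v \<in> L2_H2_H10"
    and eq: "AE t in unit_ivl. AE x in unit_ivl. v (x, t) = velocity.v w x t \<and> dx v (x, t) = velocity.vx w x t"
  shows "(\<integral>t. \<integral>x. f (x, t) * \<phi> (x, t) * dx v (x, t) \<partial>unit_ivl \<partial>unit_ivl)
      = (\<integral>t. \<integral>x. f (x, t) * \<phi> (x, t) * velocity.vx w x t \<partial>unit_ivl \<partial>unit_ivl)"
    "(\<integral>t. \<integral>x. f (x, t) * deriv (\<lambda>y. \<phi> (y, t)) x * v (x, t) \<partial>unit_ivl \<partial>unit_ivl)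
      = (\<integral>t. \<integral>x. f (x, t) * deriv (\<lambda>y. \<phi> (y, t)) x * velocity.v w x t \<partial>unit_ivl \<partial>unit_ivl)"
proof -
  interpret velocity w by (rule vel)
  obtain \<phi>x \<phi>t where d: "\<And>x t. ((\<lambda>y. \<phi> (y, t)) has_real_derivative \<phi>x (x, t)) (at x)"
    and c: "continuous_on UNIV \<phi>x" using smooth_partial[OF s] by metis
  have dd: "deriv (\<lambda>y. \<phi> (y, t)) x = \<phi>x (x, t)" for x t using d DERIV_imp_deriv by blast
  note [measurable] = f L2_unit_sqD(1)[OF L2_H2_H10_D(1)[OF v]] L2_unit_sqD(1)[OF L2_H2_H10_D(2)[OF v]]
  have [measurable]: "\<phi> \<in> borel_measurable unit_sq" "\<phi>x \<in> borel_measurable unit_sq"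
    by (intro unit_sq_borel borel_measurable_continuous_onI smooth_continuous_on[OF s] c)+
  have mv: "(\<lambda>p::real\<times>real. velocity.v w (fst p) (snd p)) \<in> borel_measurable borel"
    and mvx: "(\<lambda>p::real\<times>real. vx (fst p) (snd p)) \<in> borel_measurable borel"
    unfolding borel_prod[symmetric] by measurable
  have [measurable]: "(\<lambda>p. velocity.v w (fst p) (snd p)) \<in> borel_measurable unit_sq"
    "(\<lambda>p. vx (fst p) (snd p)) \<in> borel_measurable unit_sq"
    by (intro unit_sq_borel mv mvx)+
  have "AE t in unit_ivl. AE x in unit_ivl. f (x, t) * \<phi> (x, t) * dx v (x, t) = f (x, t) * \<phi> (x, t) * vx x t"
    using eq by eventually_elim (erule eventually_mono, simp)
  then show "(\<integral>t. \<integral>x. f (x, t) * \<phi> (x, t) * dx v (x, t) \<partial>unit_ivl \<partial>unit_ivl)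
      = (\<integral>t. \<integral>x. f (x, t) * \<phi> (x, t) * vx x t \<partial>unit_ivl \<partial>unit_ivl)"
    using iterated_integral_cong_AE[of "\<lambda>p. f p * \<phi> p * dx v p" "\<lambda>p. f p * \<phi> p * vx (fst p) (snd p)"]
    unfolding fst_conv snd_conv by simp
  have "AE t in unit_ivl. AE x in unit_ivl. f (x, t) * \<phi>x (x, t) * v (x, t) = f (x, t) * \<phi>x (x, t) * velocity.v w x t"
    using eq by eventually_elim (erule eventually_mono, simp)
  then show "(\<integral>t. \<integral>x. f (x, t) * deriv (\<lambda>y. \<phi> (y, t)) x * v (x, t) \<partial>unit_ivl \<partial>unit_ivl)
      = (\<integral>t. \<integral>x. f (x, t) * deriv (\<lambda>y. \<phi> (y, t)) x * velocity.v w x t \<partial>unit_ivl \<partial>unit_ivl)"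
    using iterated_integral_cong_AE[of "\<lambda>p. f p * \<phi>x p * v p" "\<lambda>p. f p * \<phi>x p * velocity.v w (fst p) (snd p)"]
    unfolding fst_conv snd_conv dd by simp
qed

lemma candidate_admissible:
  assumes cand: "candidate w g0 g1 g0' g1'" and v: "v \<in> L2_H2_H10"
    and eq: "AE t in unit_ivl. AE x in unit_ivl. v (x, t) = velocity.v w x t \<and> dx v (x, t) = velocity.vx w x t"
    and f0: "AE x in unit_ivl. f0 x = g0 x" "f0 \<in> borel_measurable unit_ivl"
    and f1: "AE x in unit_ivl. f1 x = g1 x" "f1 \<in> borel_measurable unit_ivl"
  shows "(candidate.fh w g0 g1, v, candidate.zh w g0 g1) \<in> admissible f0 f1"
proof -
  interpret candidate w g0 g1 g0' g1' by (rule cand)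
  define F where "F t u = (\<integral>x. fh (x, t) * u x \<partial>unit_ivl)" for t u
  have ver: "Hm1_version fh F"
    unfolding F_def[abs_def] by (rule Hm1_version_continuous[OF continuous_fh])
  have F0: "Hm1_eq (F 0) f0"
  proof -
    have "Hm1_eq (F 0) (\<lambda>x. fh (x, 0))" by (simp add: Hm1_eq_def F_def)
    moreover have "AE x in unit_ivl. fh (x, 0) = f0 x"
      using f0(1) AE_unit_ivl_interior by eventually_elim (simp add: fh_0)
    ultimately show ?thesis using Hm1_eq_cong_AE[of "\<lambda>x. fh (x, 0)" f0 "F 0"] f0(2) by simp
  qed
  have F1: "Hm1_eq (F 1) f1"
  proof -
    have "Hm1_eq (F 1) (\<lambda>x. fh (x, 1))" by (simp add: Hm1_eq_def F_def)
    moreover have "AE x in unit_ivl. fh (x, 1) = f1 x"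
      using f1(1) AE_unit_ivl_interior by eventually_elim (simp add: fh_1)
    ultimately show ?thesis using Hm1_eq_cong_AE[of "\<lambda>x. fh (x, 1)" f1 "F 1"] f1(2) by simp
  qed
  have wt: "weak_transport f0 f1 fh v zh"
    unfolding weak_transport_def
  proof (intro allI impI)
    fix \<phi> :: "real \<times> real \<Rightarrow> real" assume s: "smooth \<phi>"
    have m: "(\<lambda>x. \<phi> (x, t)) \<in> borel_measurable unit_ivl" for t
      by (intro borel_measurable_unit_ivl borel_measurable_continuous_onI
          continuous_on_compose2[OF smooth_continuous_on[OF s, of UNIV]]) (auto intro!: continuous_intros)
    have e0: "(\<integral>x. f0 x * \<phi> (x, 0) \<partial>unit_ivl) = (\<integral>x. g0 x * \<phi> (x, 0) \<partial>unit_ivl)"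
      by (rule integral_cong_AE) (use f0 m in \<open>auto elim!: eventually_mono\<close>)
    have e1: "(\<integral>x. f1 x * \<phi> (x, 1) \<partial>unit_ivl) = (\<integral>x. g1 x * \<phi> (x, 1) \<partial>unit_ivl)"
      by (rule integral_cong_AE) (use f1 m in \<open>auto elim!: eventually_mono\<close>)
    show "- (\<integral>t. \<integral>x. fh (x, t) * deriv (\<lambda>s. \<phi> (x, s)) t \<partial>unit_ivl \<partial>unit_ivl)
      + (\<integral>x. f1 x * \<phi> (x, 1) \<partial>unit_ivl) - (\<integral>x. f0 x * \<phi> (x, 0) \<partial>unit_ivl)
      = (\<integral>t. \<integral>x. fh (x, t) * \<phi> (x, t) * dx v (x, t) \<partial>unit_ivl \<partial>unit_ivl)
      + (\<integral>t. \<integral>x. fh (x, t) * deriv (\<lambda>y. \<phi> (y, t)) x * v (x, t) \<partial>unit_ivl \<partial>unit_ivl)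
      + (\<integral>t. \<integral>x. \<phi> (x, t) * zh (x, t) \<partial>unit_ivl \<partial>unit_ivl)"
      unfolding e0 e1 weak_transport_rep[OF velocity_axioms s L2_unit_sqD(1)[OF fh_L2] v eq]
      by (rule weak_transport_fh[OF s])
  qed
  show ?thesis unfolding admissible_def using fh_L2 zh_L2 v ver F0 F1 wt by blast
qed

text \<open>The share of the action, without the factor 1/2, that cancels between paths with the
  same velocity.\<close>

definition kinetic :: "real \<Rightarrow> real \<Rightarrow> real \<Rightarrow> (real \<times> real \<Rightarrow> real) \<Rightarrow> real" where
  "kinetic \<kappa> l \<epsilon> v = (\<integral>p. \<kappa> * (v p)\<^sup>2 + l * (dx v p)\<^sup>2 + \<epsilon> * (dx (dx v) p)\<^sup>2 \<partial>unit_sq)"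

lemma action_split:
  assumes v: "v \<in> L2_H2_H10" and z: "z \<in> L2 unit_sq"
  shows "action \<kappa> l \<epsilon> (f, v, z) = 1/2 * (kinetic \<kappa> l \<epsilon> v + (\<integral>p. (z p)\<^sup>2 \<partial>unit_sq))"
proof -
  note i = L2_H2_H10_D(1,2,3)[OF v, THEN L2_unit_sqD(2)] L2_unit_sqD(2)[OF z]
  have iK: "integrable unit_sq (\<lambda>p. \<kappa> * (v p)\<^sup>2 + l * (dx v p)\<^sup>2 + \<epsilon> * (dx (dx v) p)\<^sup>2)" using i by simp
  have iA: "integrable unit_sq (\<lambda>p. \<kappa> * (v p)\<^sup>2 + l * (dx v p)\<^sup>2 + \<epsilon> * (dx (dx v) p)\<^sup>2 + (z p)\<^sup>2)" using i by simp
  show ?thesis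
    unfolding action.simps unit_sqD(6)[OF iA] Bochner_Integration.integral_add[OF iK i(4)] kinetic_def ..
qed

lemma kinetic_nonneg: "0 \<le> \<kappa> \<Longrightarrow> 0 \<le> l \<Longrightarrow> 0 \<le> \<epsilon> \<Longrightarrow> 0 \<le> kinetic \<kappa> l \<epsilon> v"
  unfolding kinetic_def by (intro Bochner_Integration.integral_nonneg) auto

section \<open>The comparison path with zero velocity\<close>

lemma velocity_zero: "velocity (\<lambda>_. 0)"
  by unfold_locales auto

lemma has_dx_zero: "has_dx (\<lambda>_. 0) (\<lambda>_. 0)"
  unfolding has_dx_def using weak_deriv_zero by (auto simp: L2_def)

lemma dx_AE_zero:
  assumes u: "AE t in unit_ivl. AE x in unit_ivl. u (x, t) = 0" and w: "has_dx u w"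
  shows "AE t in unit_ivl. AE x in unit_ivl. w (x, t) = 0"
  using u w[unfolded has_dx_def, THEN conjunct2]
  by eventually_elim (rule weak_deriv_unique[OF _ weak_deriv_zero])

text \<open>As \<open>dx\<close> and \<open>wD\<close> are unspecified choices, the derivatives of
  the zero function are zero only almost everywhere, and at each order the weak derivative has to be
  identified anew.\<close>

lemma zero_L2_H2_H10: "(\<lambda>_. 0) \<in> L2_H2_H10"
  and dx_zero: "AE t in unit_ivl. AE x in unit_ivl. dx (\<lambda>_. 0) (x, t) = 0"
  and kinetic_zero: "kinetic \<kappa> l \<epsilon> (\<lambda>_. 0) = 0"
proof -
  have d: "has_dx (\<lambda>_. 0) (dx (\<lambda>_. 0))" using has_dx_zero by (intro has_dx_dx) blast
  show dz: "AE t in unit_ivl. AE x in unit_ivl. dx (\<lambda>_. 0) (x, t) = 0"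
    by (rule dx_AE_zero[OF _ d]) simp
  have "has_dx (dx (\<lambda>_. 0)) (\<lambda>_. 0)"
    unfolding has_dx_def
  proof
    show "AE t in unit_ivl. weak_deriv (\<lambda>x. dx (\<lambda>_. 0) (x, t)) (\<lambda>x. 0)"
      using dz d[unfolded has_dx_def, THEN conjunct2]
    proof eventually_elim
      case (elim t)
      show ?case
        by (rule ac_imp_weak_deriv[OF ac_const[of 0]])
          (use elim L2_unit_ivlD(1)[OF weak_derivD(2)[OF elim(2)]] in \<open>auto simp: L2_def\<close>)
    qed
  qed (auto simp: L2_def)
  then have dd: "has_dx (dx (\<lambda>_. 0)) (dx (dx (\<lambda>_. 0)))" and ex: "\<exists>w. has_dx (dx (\<lambda>_. 0)) w"
    by (auto intro: has_dx_dx)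
  have "(\<lambda>_. 0) \<in> H2"
    unfolding H2_def
  proof (intro CollectI conjI)
    show h: "(\<lambda>_. 0) \<in> H1" by (rule weak_deriv_H1[OF weak_deriv_zero])
    note wd = H1_weak_deriv[OF h]
    have "weak_deriv (wD (\<lambda>_. 0)) (\<lambda>_. 0)"
      by (rule ac_imp_weak_deriv[OF ac_const[of 0]])
        (use weak_deriv_unique[OF wd weak_deriv_zero] L2_unit_ivlD(1)[OF weak_derivD(2)[OF wd]] in \<open>auto simp: L2_def\<close>)
    then show "wD (\<lambda>_. 0) \<in> H1" by (rule weak_deriv_H1)
  qed
  then show mem: "(\<lambda>_. 0) \<in> L2_H2_H10"
    unfolding L2_H2_H10_def using H10_zero d ex by (auto simp: L2_def)
  have ddz: "AE t in unit_ivl. AE x in unit_ivl. dx (dx (\<lambda>_. 0)) (x, t) = 0" by (rule dx_AE_zero[OF dz dd])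
  note i = L2_H2_H10_D(1,2,3)[OF mem, THEN L2_unit_sqD(2)]
  have iK: "integrable unit_sq (\<lambda>p. \<kappa> * 0\<^sup>2 + l * (dx (\<lambda>_. 0) p)\<^sup>2 + \<epsilon> * (dx (dx (\<lambda>_. 0)) p)\<^sup>2)" using i by simp
  have "kinetic \<kappa> l \<epsilon> (\<lambda>_. 0) = (\<integral>t. \<integral>x. \<kappa> * 0\<^sup>2 + l * (dx (\<lambda>_. 0) (x, t))\<^sup>2 + \<epsilon> * (dx (dx (\<lambda>_. 0)) (x, t))\<^sup>2 \<partial>unit_ivl \<partial>unit_ivl)"
    unfolding kinetic_def by (rule unit_sqD(6)[OF iK, symmetric])
  also have "\<dots> = (\<integral>t. \<integral>x. 0 \<partial>unit_ivl \<partial>unit_ivl)"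
  proof (rule iterated_integral_cong_AE[of "\<lambda>p. \<kappa> * 0\<^sup>2 + l * (dx (\<lambda>_. 0) p)\<^sup>2 + \<epsilon> * (dx (dx (\<lambda>_. 0)) p)\<^sup>2" "\<lambda>_. 0"])
    show "AE t in unit_ivl. AE x in unit_ivl.
      \<kappa> * 0\<^sup>2 + l * (dx (\<lambda>_. 0) (x, t))\<^sup>2 + \<epsilon> * (dx (dx (\<lambda>_. 0)) (x, t))\<^sup>2 = 0"
      using dz ddz
    proof eventually_elim
      case (elim t)
      then show ?case by eventually_elim simp
    qed
  qed (use iK in auto)
  finally show "kinetic \<kappa> l \<epsilon> (\<lambda>_. 0) = 0" by simp
qed

text \<open>With zero velocity the flow is the identity and \<open>J\<close> is 1, so the candidate
  interpolates linearly between its endpoints and its source is their difference at all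
  times.\<close>

lemma candidate_zero:
  assumes cand: "candidate (\<lambda>_. 0) g0 g1 g0' g1'"
  shows "velocity.v (\<lambda>_. 0) x t = 0" "velocity.vx (\<lambda>_. 0) x t = 0"
    "(\<integral>p. (candidate.zh (\<lambda>_. 0) g0 g1 p)\<^sup>2 \<partial>unit_sq) = (L2_norm (\<lambda>x. g0 x - g1 x))\<^sup>2"
proof -
  interpret candidate "\<lambda>_. 0" g0 g1 g0' g1' by (rule cand)
  show vx0: "vx x t = 0" for x t using pint_cmult[of 0 "\<lambda>_. 0"] by (simp add: vx_def)
  show v0: "v x t = 0" for x t using pint_cmult[of 0 "\<lambda>_. 0" x] by (simp add: v_def vx0)
  have phi: "phi x t = x" for x t using phi_eq[of x t] pint_cmult[of 0 "\<lambda>_. 0" t] by (simp add: v0)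
  have J1: "J x t = 1" for x t using pint_cmult[of 0 "\<lambda>_. 0" t] by (simp add: J_def lJ_def vx0)
  have W1: "W x 1 = 1" for x by (simp add: W_def J1 pint_const)
  have zl: "zl x t = g1 x - g0 x" for x t by (simp add: zl_def D_def phi J1 W1)
  have "(\<integral>p. (zh p)\<^sup>2 \<partial>unit_sq) = (\<integral>t. \<integral>x. (zh (x, t))\<^sup>2 \<partial>unit_ivl \<partial>unit_ivl)"
    by (rule unit_sqD(6)[symmetric]) (rule L2_unit_sqD(2)[OF zh_L2])
  also have "\<dots> = (\<integral>t. (L2_norm (\<lambda>x. g0 x - g1 x))\<^sup>2 \<partial>unit_ivl)"
  proof (rule integral_cong_unit_ivl)
    fix t :: real assume t: "0 < t" "t < 1"
    show "(\<integral>x. (zh (x, t))\<^sup>2 \<partial>unit_ivl) = (L2_norm (\<lambda>x. g0 x - g1 x))\<^sup>2"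
      unfolding L2_norm_power2
    proof (rule integral_cong_unit_ivl)
      fix x :: real assume x: "0 < x" "x < 1"
      have "X x t = x" using X_phi[of t x] t x by (simp add: phi)
      then show "(zh (x, t))\<^sup>2 = (g0 x - g1 x)\<^sup>2" by (simp add: zh_def zl power2_commute)
    qed
  qed
  finally show "(\<integral>p. (zh p)\<^sup>2 \<partial>unit_sq) = (L2_norm (\<lambda>x. g0 x - g1 x))\<^sup>2" by simp
qed

text \<open>As \<open>z - zh\<close> is orthogonal to \<open>zh\<close>, minimality forces \<open>z = zh\<close>.\<close>

lemma minimizer_eq_candidate:
  assumes cand: "candidate w g0 g1 g0' g1'" and v: "v \<in> L2_H2_H10"
    and eq: "AE t in unit_ivl. AE x in unit_ivl. v (x, t) = velocity.v w x t \<and> dx v (x, t) = velocity.vx w x t"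
    and f0: "AE x in unit_ivl. f0 x = g0 x" "f0 \<in> borel_measurable unit_ivl"
    and f1: "AE x in unit_ivl. f1 x = g1 x" "f1 \<in> borel_measurable unit_ivl"
    and adm: "(f, v, z) \<in> admissible f0 f1"
    and min: "\<forall>p\<in>admissible f0 f1. action \<kappa> l \<epsilon> (f, v, z) \<le> action \<kappa> l \<epsilon> p"
  shows "AE t in unit_ivl. AE x in unit_ivl. f (x, t) = candidate.fh w g0 g1 (x, t)"
    "(\<integral>p. (candidate.zh w g0 g1 p)\<^sup>2 \<partial>unit_sq) \<le> (\<integral>p. (z p)\<^sup>2 \<partial>unit_sq)"
proof -
  interpret candidate w g0 g1 g0' g1' by (rule cand)
  have f: "f \<in> L2 unit_sq" and z: "z \<in> L2 unit_sq" and wt: "weak_transport f0 f1 f v z"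
    using adm by (auto simp: admissible_def)
  obtain f' where f' [measurable]: "f' \<in> borel_measurable borel"
    and f'_eq: "\<And>x t. 0 < x \<Longrightarrow> x < 1 \<Longrightarrow> 0 < t \<Longrightarrow> t < 1 \<Longrightarrow> f' (x, t) = f (x, t)"
    using borel_rep_unit_sq[OF L2_unit_sqD(1)[OF f]] by blast
  obtain z' where z' [measurable]: "z' \<in> borel_measurable borel"
    and z'_eq: "\<And>x t. 0 < x \<Longrightarrow> x < 1 \<Longrightarrow> 0 < t \<Longrightarrow> t < 1 \<Longrightarrow> z' (x, t) = z (x, t)"
    using borel_rep_unit_sq[OF L2_unit_sqD(1)[OF z]] by blast
  have f'2: "integrable unit_sq (\<lambda>p. (f' p)\<^sup>2)"
    by (rule Bochner_Integration.integrable_cong[THEN iffD2, OF refl _ L2_unit_sqD(2)[OF f]])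
      (use f'_eq in \<open>auto simp: space_unit_sq\<close>)
  have z'2: "integrable unit_sq (\<lambda>p. (z' p)\<^sup>2)"
    by (rule Bochner_Integration.integrable_cong[THEN iffD2, OF refl _ L2_unit_sqD(2)[OF z]])
      (use z'_eq in \<open>auto simp: space_unit_sq\<close>)
  have zz': "(\<integral>p. (z p)\<^sup>2 \<partial>unit_sq) = (\<integral>p. (z' p)\<^sup>2 \<partial>unit_sq)"
    by (rule Bochner_Integration.integral_cong) (use z'_eq in \<open>auto simp: space_unit_sq\<close>)
  interpret T: transport w f' z' g0 g1
  proof (unfold_locales)
    show "integrable unit_ivl g0" "integrable unit_ivl g1"
      by (rule integrable_continuous_unit_ivl[OF ac_continuous_on], rule ac_g0 ac_g1)+
    fix \<phi> :: "real \<times> real \<Rightarrow> real" assume s: "smooth \<phi>"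
    have m: "(\<lambda>x. \<phi> (x, t)) \<in> borel_measurable unit_ivl" for t
      by (intro borel_measurable_unit_ivl borel_measurable_continuous_onI
          continuous_on_compose2[OF smooth_continuous_on[OF s, of UNIV]]) (auto intro!: continuous_intros)
    have e0: "(\<integral>x. g0 x * \<phi> (x, 0) \<partial>unit_ivl) = (\<integral>x. f0 x * \<phi> (x, 0) \<partial>unit_ivl)"
      by (rule integral_cong_AE) (use f0 m in \<open>auto elim!: eventually_mono\<close>)
    have e1: "(\<integral>x. g1 x * \<phi> (x, 1) \<partial>unit_ivl) = (\<integral>x. f1 x * \<phi> (x, 1) \<partial>unit_ivl)"
      by (rule integral_cong_AE) (use f1 m in \<open>auto elim!: eventually_mono\<close>)
    have f'_cong: "(\<integral>t. \<integral>x. f' (x, t) * A x t \<partial>unit_ivl \<partial>unit_ivl) = (\<integral>t. \<integral>x. f (x, t) * A x t \<partial>unit_ivl \<partial>unit_ivl)" for A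
      by (intro integral_cong_unit_ivl) (simp add: f'_eq)
    have z'_cong: "(\<integral>t. \<integral>x. \<phi> (x, t) * z' (x, t) \<partial>unit_ivl \<partial>unit_ivl) = (\<integral>t. \<integral>x. \<phi> (x, t) * z (x, t) \<partial>unit_ivl \<partial>unit_ivl)"
      by (intro integral_cong_unit_ivl) (simp add: z'_eq)
    note rep = weak_transport_rep[OF velocity_axioms s L2_unit_sqD(1)[OF f] v eq]
    show "- (\<integral>t. \<integral>x. f' (x, t) * deriv (\<lambda>s. \<phi> (x, s)) t \<partial>unit_ivl \<partial>unit_ivl)
      + (\<integral>x. g1 x * \<phi> (x, 1) \<partial>unit_ivl) - (\<integral>x. g0 x * \<phi> (x, 0) \<partial>unit_ivl)
      = (\<integral>t. \<integral>x. f' (x, t) * \<phi> (x, t) * vx x t \<partial>unit_ivl \<partial>unit_ivl)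
      + (\<integral>t. \<integral>x. f' (x, t) * deriv (\<lambda>y. \<phi> (y, t)) x * velocity.v w x t \<partial>unit_ivl \<partial>unit_ivl)
      + (\<integral>t. \<integral>x. \<phi> (x, t) * z' (x, t) \<partial>unit_ivl \<partial>unit_ivl)"
      unfolding e0 e1 mult.assoc f'_cong z'_cong
      using wt[unfolded weak_transport_def, rule_format, OF s] rep by (simp add: mult.assoc)
  qed (use f'2 z'2 in auto)
  note L = T.Lagrangian
  have orth: "(\<integral>p. zh p * (z' p - zh p) \<partial>unit_sq) = 0"
    by (rule source_orthogonal[OF z' z'2 L(2)])
  have zh2: "integrable unit_sq (\<lambda>p. (zh p)\<^sup>2)" by (rule L2_unit_sqD(2)[OF zh_L2])
  have izz: "integrable unit_sq (\<lambda>p. zh p * z' p)" by (rule integrable_mult_L2) (use z'2 zh2 in auto)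
  \<comment> \<open>Expanded so that the last term is the orthogonal one; integrated, this is
    Pythagoras.\<close>
  have sq: "(z' p - zh p)\<^sup>2 = (z' p)\<^sup>2 - (zh p)\<^sup>2 - 2 * (zh p * (z' p - zh p))" for p
    by (simp add: power2_eq_square algebra_simps)
  have io: "integrable unit_sq (\<lambda>p. zh p * (z' p - zh p))"
    using izz zh2 by (simp add: right_diff_distrib power2_eq_square)
  have id: "integrable unit_sq (\<lambda>p. (z' p - zh p)\<^sup>2)" unfolding sq using z'2 zh2 io by simp
  have pyth: "(\<integral>p. (z' p - zh p)\<^sup>2 \<partial>unit_sq) = (\<integral>p. (z' p)\<^sup>2 \<partial>unit_sq) - (\<integral>p. (zh p)\<^sup>2 \<partial>unit_sq)"
    unfolding sq using z'2 zh2 io orth by simp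
  have nn: "0 \<le> (\<integral>p. (z' p - zh p)\<^sup>2 \<partial>unit_sq)" by simp
  show "(\<integral>p. (zh p)\<^sup>2 \<partial>unit_sq) \<le> (\<integral>p. (z p)\<^sup>2 \<partial>unit_sq)" using pyth nn zz' by linarith
  have "(fh, v, zh) \<in> admissible f0 f1"
    by (rule candidate_admissible[OF cand v eq f0 f1])
  \<comment> \<open>Both paths have the same velocity, so the action compares only the
    sources.\<close>
  from min[rule_format, OF this] have "(\<integral>p. (z p)\<^sup>2 \<partial>unit_sq) \<le> (\<integral>p. (zh p)\<^sup>2 \<partial>unit_sq)"
    unfolding action_split[OF v z] action_split[OF v zh_L2] by simp
  then have "(\<integral>p. (z' p - zh p)\<^sup>2 \<partial>unit_sq) = 0" using pyth nn zz' by linarith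
  then have "AE p in unit_sq. (z' p - zh p)\<^sup>2 = 0"
    by (subst (asm) integral_nonneg_eq_0_iff_AE) (use id in auto)
  then have "AE p in unit_sq. z' p = zh p" by eventually_elim simp
  then have zt: "AE t in unit_ivl. AE x in unit_ivl. z' (x, t) = zh (x, t)"
    using AE_unit_sq_iff[OF z' zh_borel] by simp
  \<comment> \<open>Null sets pull back to null sets along the flow, because the weight
    \<open>J\<close> in the change of variables is positive.\<close>
  have "AE t in unit_ivl. AE x in unit_ivl. z' (phi x t, t) = zh (phi x t, t)"
    using zt AE_unit_ivl_interior
  proof eventually_elim
    case (elim t)
    have t: "0 \<le> t" "t \<le> 1" using elim by auto
    define d where "d y = (if z' (y, t) = zh (y, t) then 0 else 1 :: real)" for y
    have [measurable]: "d \<in> borel_measurable borel" unfolding d_def[abs_def] by measurable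
    have id: "integrable unit_ivl d" by (rule integrable_bounded_unit_ivl[where B = 1]) (auto simp: d_def)
    have "(\<integral>x. d (phi x t) * J x t \<partial>unit_ivl) = (\<integral>y. d y \<partial>unit_ivl)" by (rule integral_phi[OF t]) measurable
    also have "\<dots> = (\<integral>y. 0 \<partial>unit_ivl)"
      by (rule integral_cong_AE) (use elim(1) in \<open>auto simp: d_def elim!: eventually_mono\<close>)
    finally have "(\<integral>x. d (phi x t) * J x t \<partial>unit_ivl) = 0" by simp
    moreover have "integrable unit_ivl (\<lambda>x. d (phi x t) * J x t)" using integrable_phi[OF t, of d] id by simp
    ultimately have "AE x in unit_ivl. d (phi x t) * J x t = 0"
      by (subst (asm) integral_nonneg_eq_0_iff_AE) (auto simp: d_def)
    then show ?case by eventually_elim (auto simp: d_def J_neq_0 split: if_splits)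
  qed
  moreover have m1: "(\<lambda>p::real\<times>real. z' (phi (fst p) (snd p), snd p)) \<in> borel_measurable borel"
    and m2: "(\<lambda>p::real\<times>real. zh (phi (fst p) (snd p), snd p)) \<in> borel_measurable borel"
    unfolding borel_prod[symmetric] by measurable
  ultimately have zx: "AE x in unit_ivl. AE t in unit_ivl. z' (phi x t, t) = zh (phi x t, t)"
    using AE_unit_ivl_swap[OF m1 m2] by simp
  have gl: "AE x in unit_ivl. \<forall>t\<in>{0..1}. g0 x + pint (\<lambda>s. z' (phi x s, s)) t = gl x t"
    using zx AE_unit_ivl_interior
  proof eventually_elim
    case (elim x)
    have x: "0 \<le> x" "x \<le> 1" using elim by auto
    have zl: "AE s in unit_ivl. z' (phi x s, s) = zl x s"
      using elim(1) AE_unit_ivl_interior by eventually_elim (use x in \<open>simp add: zh_phi\<close>)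
    have "pint (\<lambda>s. z' (phi x s, s)) t = pint (zl x) t" for t
      by (rule pint_cong_AE[OF zl]) (use acD(1)[OF ac_gl] in auto)
    then show ?case using acD(2)[OF ac_gl, of _ x] by auto
  qed
  have m3: "(\<lambda>p::real\<times>real. f' (phi (fst p) (snd p), snd p)) \<in> borel_measurable borel"
    and m4: "(\<lambda>p::real\<times>real. g0 (fst p) + pint (\<lambda>s. z' (phi (fst p) s, s)) (snd p)) \<in> borel_measurable borel"
    and m5: "(\<lambda>p::real\<times>real. fh (phi (fst p) (snd p), snd p)) \<in> borel_measurable borel"
    unfolding borel_prod[symmetric] by measurable
  have "AE x in unit_ivl. AE t in unit_ivl. f' (phi x t, t) = g0 x + pint (\<lambda>s. z' (phi x s, s)) t"
    using L(1) AE_unit_ivl_swap[OF m3 m4] by simp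
  then have "AE x in unit_ivl. AE t in unit_ivl. f' (phi x t, t) = fh (phi x t, t)"
    using gl AE_unit_ivl_interior
  proof eventually_elim
    case (elim x)
    show ?case using elim(1) AE_unit_ivl_interior
      by eventually_elim (use elim(2,3) in \<open>simp add: fh_phi\<close>)
  qed
  then have "AE t in unit_ivl. AE x in unit_ivl. f' (phi x t, t) = fh (phi x t, t)"
    using AE_unit_ivl_swap[OF m3 m5] by simp
  then show "AE t in unit_ivl. AE x in unit_ivl. f (x, t) = fh (x, t)"
    using AE_unit_ivl_interior
  proof eventually_elim
    case (elim t)
    have "AE y in unit_ivl. f' (y, t) = fh (y, t)"
      by (rule AE_X[of t "\<lambda>y. f' (y, t)" "\<lambda>y. fh (y, t)"]) (use elim in auto)
    then show ?case using AE_unit_ivl_interior by eventually_elim (use elim(2) f'_eq in auto)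
  qed
qed

text \<open>With h the sum of the two H^1 norms, the squared derivatives add up to at most h^2, and
  n + a \<le> sqrt 2 k for k^2 = n^2 + a^2 bounds the squared sum of all four norms by 2 h^2. This
  leads to the bound 6 h b (1 + N), and b (1 + N) \<le> 1 + b^3 + b^5 N because b \<ge> 1.\<close>

lemma gradient_bound:
  fixes \<beta> b m N n0 a0 n1 a1 h0 h1 X :: real
  assumes h0: "h0\<^sup>2 = n0\<^sup>2 + a0\<^sup>2" "0 \<le> h0" "0 \<le> n0" "0 \<le> a0"
    and h1: "h1\<^sup>2 = n1\<^sup>2 + a1\<^sup>2" "0 \<le> h1" "0 \<le> n1" "0 \<le> a1"
    and m: "m \<le> N\<^sup>2" "0 \<le> m" "0 \<le> N" and \<beta>: "1 \<le> \<beta>" "\<beta> \<le> b"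
    and X: "X \<le> 3 * \<beta> * (a0\<^sup>2 + a1\<^sup>2 + 4 * (n0 + a0 + (n1 + a1))\<^sup>2 * m)"
  shows "sqrt X \<le> 6 * (h1 + h0) * (1 + b^3 + b^5 * N)"
proof -
  define h where "h = h1 + h0"
  have b: "1 \<le> b" using \<beta> by linarith
  have h: "0 \<le> h" using h0 h1 by (simp add: h_def)
  have hs: "h1\<^sup>2 + h0\<^sup>2 \<le> h\<^sup>2" using h0 h1 by (simp add: h_def power2_sum)
  have aa: "a0\<^sup>2 + a1\<^sup>2 \<le> h\<^sup>2" using hs h0(1) h1(1) zero_le_power2[of n0] zero_le_power2[of n1] by linarith
  have s2: "n + a \<le> sqrt 2 * k" if "k\<^sup>2 = n\<^sup>2 + a\<^sup>2" "0 \<le> k" for n a k :: real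
  proof (rule power2_le_imp_le)
    show "(n + a)\<^sup>2 \<le> (sqrt 2 * k)\<^sup>2"
      using that zero_le_power2[of "n - a"] by (simp add: power_mult_distrib power2_sum power2_diff)
  qed (use that in auto)
  have "n0 + a0 + (n1 + a1) \<le> sqrt 2 * h" using s2[OF h0(1,2)] s2[OF h1(1,2)] by (simp add: h_def distrib_left)
  then have "(n0 + a0 + (n1 + a1))\<^sup>2 \<le> (sqrt 2 * h)\<^sup>2" using h0 h1 by (intro power_mono) auto
  then have S: "(n0 + a0 + (n1 + a1))\<^sup>2 \<le> 2 * h\<^sup>2" by (simp add: power_mult_distrib)
  have "(n0 + a0 + (n1 + a1))\<^sup>2 * m \<le> 2 * h\<^sup>2 * N\<^sup>2" using S m by (intro mult_mono) auto
  then have "a0\<^sup>2 + a1\<^sup>2 + 4 * (n0 + a0 + (n1 + a1))\<^sup>2 * m \<le> h\<^sup>2 + 8 * (h\<^sup>2 * N\<^sup>2)" using aa by linarith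
  \<comment> \<open>The 12 is chosen for 3 * 12 = 6^2; likewise \<open>\<beta>\<close> is raised to
    \<open>b\<^sup>2\<close> below, so that the right-hand side becomes a perfect square.\<close>
  also have "\<dots> \<le> 12 * (h\<^sup>2 * (1 + N)\<^sup>2)"
    using mult_nonneg_nonneg[of "h\<^sup>2" N] m by (simp add: power2_sum algebra_simps)
  finally have "a0\<^sup>2 + a1\<^sup>2 + 4 * (n0 + a0 + (n1 + a1))\<^sup>2 * m \<le> 12 * (h\<^sup>2 * (1 + N)\<^sup>2)" .
  then have "3 * \<beta> * (a0\<^sup>2 + a1\<^sup>2 + 4 * (n0 + a0 + (n1 + a1))\<^sup>2 * m) \<le> 3 * b\<^sup>2 * (12 * (h\<^sup>2 * (1 + N)\<^sup>2))"
  proof (intro mult_mono)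
    show "\<beta> \<le> b\<^sup>2" using \<beta> b self_le_power[of b 2] by simp
  qed (use m \<beta> in auto)
  also have "\<dots> = (6 * h * (b * (1 + N)))\<^sup>2" unfolding power_mult_distrib by simp
  finally have "X \<le> (6 * h * (b * (1 + N)))\<^sup>2" using X by linarith
  then have "sqrt X \<le> 6 * h * (b * (1 + N))" using h b m by (intro real_le_lsqrt) auto
  also have "b * (1 + N) \<le> 1 + b^3 + b^5 * N"
  proof -
    have "b \<le> b^3" "b * N \<le> b^5 * N" using b m by (auto intro!: self_le_power mult_right_mono)
    then show ?thesis by (simp add: distrib_left)
  qed
  finally show ?thesis using h by (simp add: h_def mult_left_mono)
qed

lemma L2_H2_norm_power2:
  assumes v: "v \<in> L2_H2_H10"
  shows "(\<integral>p. (dx (dx v) p)\<^sup>2 \<partial>unit_sq) \<le> (L2_H2_norm v)\<^sup>2"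
proof -
  note i = L2_H2_H10_D(1,2,3)[OF v, THEN L2_unit_sqD(2)]
  have ii: "integrable unit_sq (\<lambda>p. (v p)\<^sup>2 + (dx v p)\<^sup>2 + (dx (dx v) p)\<^sup>2)" using i by simp
  have "(\<integral>p. (dx (dx v) p)\<^sup>2 \<partial>unit_sq) \<le> (\<integral>p. (v p)\<^sup>2 + (dx v p)\<^sup>2 + (dx (dx v) p)\<^sup>2 \<partial>unit_sq)"
    by (rule integral_mono[OF i(3) ii]) simp
  also have "\<dots> = (L2_H2_norm v)\<^sup>2"
  proof -
    have "0 \<le> (\<integral>p. (v p)\<^sup>2 + (dx v p)\<^sup>2 + (dx (dx v) p)\<^sup>2 \<partial>unit_sq)" by simp
    then show ?thesis unfolding L2_H2_norm_def unit_sqD(6)[OF ii] by (rule real_sqrt_pow2[symmetric])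
  qed
  finally show ?thesis .
qed

lemma minimizer_source_bound:
  assumes pos: "\<kappa> \<ge> 0" "l \<ge> 0" "\<epsilon> \<ge> 0"
    and f0: "f0 \<in> H1" and f1: "f1 \<in> H1"
    and adm: "(f, v, z) \<in> admissible f0 f1"
    and min: "\<forall>p\<in>admissible f0 f1. action \<kappa> l \<epsilon> (f, v, z) \<le> action \<kappa> l \<epsilon> p"
  shows "(\<integral>p. (z p)\<^sup>2 \<partial>unit_sq) \<le> (L2_norm (\<lambda>x. f0 x - f1 x))\<^sup>2"
proof -
  have v: "v \<in> L2_H2_H10" and z: "z \<in> L2 unit_sq" using adm by (auto simp: admissible_def)
  have m0: "f0 \<in> borel_measurable unit_ivl" and m1: "f1 \<in> borel_measurable unit_ivl"
    using f0 f1 H1_weak_deriv weak_derivD(1) L2_unit_ivlD(1) by blast+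
  obtain g0 g0' where g0: "ac g0 g0'" "g0' \<in> borel_measurable borel" "g0' \<in> L2 unit_ivl" "continuous_on UNIV g0"
    "AE x in unit_ivl. f0 x = g0 x" using H1_rep[OF f0] by blast
  obtain g1 g1' where g1: "ac g1 g1'" "g1' \<in> borel_measurable borel" "g1' \<in> L2 unit_ivl" "continuous_on UNIV g1"
    "AE x in unit_ivl. f1 x = g1 x" using H1_rep[OF f1] by blast
  have cand: "candidate (\<lambda>_. 0) g0 g1 g0' g1'"
    by (intro candidate.intro candidate_axioms.intro velocity_zero g0 g1)
  note zero = candidate_zero[OF cand]
  let ?f = "candidate.fh (\<lambda>_. 0) g0 g1" and ?z = "candidate.zh (\<lambda>_. 0) g0 g1"
  have "(?f, \<lambda>_. 0, ?z) \<in> admissible f0 f1"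
  proof (rule candidate_admissible[OF cand zero_L2_H2_H10 _ g0(5) m0 g1(5) m1])
    show "AE t in unit_ivl. AE x in unit_ivl. 0 = velocity.v (\<lambda>_. 0) x t \<and> dx (\<lambda>_. 0) (x, t) = velocity.vx (\<lambda>_. 0) x t"
      using dx_zero by (simp add: zero)
  qed
  from min[rule_format, OF this]
  have "kinetic \<kappa> l \<epsilon> v + (\<integral>p. (z p)\<^sup>2 \<partial>unit_sq) \<le> (\<integral>p. (?z p)\<^sup>2 \<partial>unit_sq)"
    unfolding action_split[OF v z] action_split[OF zero_L2_H2_H10 candidate.zh_L2[OF cand]] kinetic_zero by simp
  then have "(\<integral>p. (z p)\<^sup>2 \<partial>unit_sq) \<le> (L2_norm (\<lambda>x. g0 x - g1 x))\<^sup>2"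
    using kinetic_nonneg[OF pos, of v] zero(3) by linarith
  also have "L2_norm (\<lambda>x. g0 x - g1 x) = L2_norm (\<lambda>x. f0 x - f1 x)"
    by (rule L2_norm_cong_AE)
      (use g0(5) g1(5) m0 m1 g0(4)[THEN borel_measurable_continuous_onI] g1(4)[THEN borel_measurable_continuous_onI] in auto)
  finally show ?thesis .
qed

theorem proposition3p1:
  fixes \<kappa> l \<epsilon> b :: real
    and f0 f1 :: "real \<Rightarrow> real"
    and f v z :: "real \<times> real \<Rightarrow> real"
    and F :: "real \<Rightarrow> (real \<Rightarrow> real) \<Rightarrow> real"
  assumes "\<kappa> > 0" and "l \<ge> 0" and "\<epsilon> > 0"
    and "f0 \<in> H1" and "f1 \<in> H1"
    and "(f, v, z) \<in> admissible f0 f1"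
    and "\<forall>p\<in>admissible f0 f1. action \<kappa> l \<epsilon> (f, v, z) \<le> action \<kappa> l \<epsilon> p"
    and "Hm1_version f F"
    and "b = exp (sqrt 2 * L2_H2_norm v)"
  shows "f \<in> Linf_H1 \<and>
    (\<forall>t\<in>{0..1}. \<exists>g\<in>H1. Hm1_eq (F t) g \<and>
       L2_norm (wD g) \<le> 6 * (H1_norm f1 + H1_norm f0) * (1 + b^3 + b^5 * L2_H2_norm v) \<and>
       L2_norm g \<le> b * (L2_norm f0 + sqrt b * L2_norm (\<lambda>x. f0 x - f1 x)))"
proof -
  note f0 = \<open>f0 \<in> H1\<close> and f1 = \<open>f1 \<in> H1\<close> and adm = \<open>(f, v, z) \<in> admissible f0 f1\<close>
    and min = \<open>\<forall>p\<in>admissible f0 f1. action \<kappa> l \<epsilon> (f, v, z) \<le> action \<kappa> l \<epsilon> p\<close>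
    and b = \<open>b = exp (sqrt 2 * L2_H2_norm v)\<close>
  have f: "f \<in> L2 unit_sq" and v: "v \<in> L2_H2_H10" using adm by (auto simp: admissible_def)
  have m0: "f0 \<in> borel_measurable unit_ivl" and m1: "f1 \<in> borel_measurable unit_ivl"
    using f0 f1 H1_weak_deriv weak_derivD(1) L2_unit_ivlD(1) by blast+
  obtain g0 g0' where g0: "ac g0 g0'" "g0' \<in> borel_measurable borel" "g0' \<in> L2 unit_ivl" "continuous_on UNIV g0"
    "AE x in unit_ivl. f0 x = g0 x" and n0: "L2_norm g0 = L2_norm f0" "L2_norm g0' = L2_norm (wD f0)"
    using H1_rep[OF f0] by blast
  obtain g1 g1' where g1: "ac g1 g1'" "g1' \<in> borel_measurable borel" "g1' \<in> L2 unit_ivl" "continuous_on UNIV g1"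
    "AE x in unit_ivl. f1 x = g1 x" and n1: "L2_norm g1 = L2_norm f1" "L2_norm g1' = L2_norm (wD f1)"
    using H1_rep[OF f1] by blast
  obtain w where w: "velocity w"
    "AE t in unit_ivl. AE x in unit_ivl. v (x, t) = velocity.v w x t \<and> dx v (x, t) = velocity.vx w x t"
    "(\<integral>t. (velocity.l w t)\<^sup>2 \<partial>unit_ivl) = (\<integral>p. (dx (dx v) p)\<^sup>2 \<partial>unit_sq)"
    using velocity_rep[OF v] by blast
  have cand: "candidate w g0 g1 g0' g1'"
    by (intro candidate.intro candidate_axioms.intro w g0 g1)
  interpret candidate w g0 g1 g0' g1' by (rule cand)
  define N where "N = L2_H2_norm v"
  define d where "d = L2_norm (\<lambda>x. f0 x - f1 x)"
  note mc = minimizer_eq_candidate[OF cand v w(2) g0(5) m0 g1(5) m1 adm min]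
  have N: "0 \<le> N"
    unfolding N_def L2_H2_norm_def by (intro real_sqrt_ge_zero Bochner_Integration.integral_nonneg) simp
  have l2: "(\<integral>t. (velocity.l w t)\<^sup>2 \<partial>unit_ivl) \<le> N\<^sup>2"
    using L2_H2_norm_power2[OF v] w(3) by (simp add: N_def)
  have "(\<integral>t. velocity.l w t \<partial>unit_ivl) \<le> N"
  proof -
    have "(\<integral>t. velocity.l w t \<partial>unit_ivl) \<le> (\<integral>t. \<bar>velocity.l w t\<bar> \<partial>unit_ivl)"
      by (rule integral_mono) (use integrable_l in auto)
    also have "\<dots> \<le> L2_norm (velocity.l w)" by (rule L2_unit_ivlD(4)[OF l_L2])
    also have "\<dots> \<le> N" unfolding L2_norm_def using l2 N by (rule real_le_lsqrt[rotated])
    finally show ?thesis .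
  qed
  \<comment> \<open>The integral of \<open>l\<close> is at most \<open>N\<close>, which is below the
    exponent of \<open>b\<close>.\<close>
  also have "N \<le> sqrt 2 * N" using N by (simp add: mult_le_cancel_right1)
  finally have \<beta>b: "\<beta> \<le> b" unfolding \<beta>_def b N_def by simp
  have b1: "1 \<le> b" using \<beta>_ge_1 \<beta>b by linarith
  have d: "0 \<le> d" by (simp add: d_def)
  have zd: "sqrt (\<integral>p. (zh p)\<^sup>2 \<partial>unit_sq) \<le> d"
    using mc(2) minimizer_source_bound[OF _ _ _ f0 f1 adm min] assms(1-3) d
    by (intro real_le_lsqrt) (auto simp: d_def)
  define G where "G = 6 * (H1_norm f1 + H1_norm f0) * (1 + b^3 + b^5 * N)"
  define M where "M = b * (L2_norm f0 + sqrt b * d)"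
  have grad: "L2_norm (\<lambda>y. fx (y, t)) \<le> G" if t: "0 \<le> t" "t \<le> 1" for t
    unfolding G_def L2_norm_def
  proof (rule gradient_bound)
    show "(H1_norm f0)\<^sup>2 = (L2_norm f0)\<^sup>2 + (L2_norm (wD f0))\<^sup>2" "(H1_norm f1)\<^sup>2 = (L2_norm f1)\<^sup>2 + (L2_norm (wD f1))\<^sup>2"
      by (simp_all add: H1_norm_def)
    show "(\<integral>x. (fx (x, t))\<^sup>2 \<partial>unit_ivl) \<le> 3 * \<beta> * ((L2_norm (wD f0))\<^sup>2 + (L2_norm (wD f1))\<^sup>2
      + 4 * (L2_norm f0 + L2_norm (wD f0) + (L2_norm f1 + L2_norm (wD f1)))\<^sup>2 * (\<integral>t. (velocity.l w t)\<^sup>2 \<partial>unit_ivl))"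
      using fx_bound(2)[OF t] unfolding n0 n1 .
  qed (use l2 N \<beta>b \<beta>_ge_1 H1_norm_nonneg in auto)
  have size: "L2_norm (\<lambda>y. fh (y, t)) \<le> M" if t: "0 \<le> t" "t \<le> 1" for t
  proof -
    have "L2_norm (\<lambda>y. fh (y, t)) \<le> sqrt \<beta> * (L2_norm f0 + sqrt (\<integral>p. (zh p)\<^sup>2 \<partial>unit_sq))"
      using fh_slice_norm[OF t] unfolding n0 .
    \<comment> \<open>Here \<open>\<beta> \<le> b \<le> b\<^sup>2\<close> gives
      \<open>sqrt \<beta> \<le> b\<close>, and \<open>sqrt b\<close> is at least 1.\<close>
    also have "\<dots> \<le> b * (L2_norm f0 + sqrt b * d)"
    proof (intro mult_mono add_left_mono)
      show "sqrt \<beta> \<le> b" using \<beta>b b1 self_le_power[of b 2] by (intro real_le_lsqrt) auto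
      have "1 * d \<le> sqrt b * d" using b1 d by (intro mult_right_mono) auto
      then show "sqrt (\<integral>p. (zh p)\<^sup>2 \<partial>unit_sq) \<le> sqrt b * d" using zd by linarith
    qed (use b1 in auto)
    finally show ?thesis by (simp add: M_def)
  qed
  have "f \<in> Linf_H1"
  proof -
    have wd: "AE t in unit_ivl. weak_deriv (\<lambda>x. f (x, t)) (\<lambda>x. fx (x, t))"
      using mc(1) AE_unit_ivl_interior
    proof eventually_elim
      case (elim t)
      then have t: "0 \<le> t" "t \<le> 1" by auto
      show ?case
        by (rule ac_imp_weak_deriv[OF ac_fh_space[OF t] fx_bound(1)[OF t] unit_sq_slice[OF L2_unit_sqD(1)[OF f]]])
          (use elim in auto)
    qed
    have "integrable unit_sq (\<lambda>p. (fx p)\<^sup>2)"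
    proof (rule unit_sqI)
      show "integrable unit_ivl (\<lambda>t. \<integral>x. \<bar>(fx (x, t))\<^sup>2\<bar> \<partial>unit_ivl)"
      proof (rule integrable_bounded_unit_ivl[where B = "G\<^sup>2"])
        fix t :: real assume "0 < t" "t < 1"
        then show "\<bar>\<integral>x. \<bar>(fx (x, t))\<^sup>2\<bar> \<partial>unit_ivl\<bar> \<le> G\<^sup>2"
          using power_mono[OF grad, of t 2] by (simp add: L2_norm_power2)
      qed measurable
      show "AE t in unit_ivl. integrable unit_ivl (\<lambda>x. (fx (x, t))\<^sup>2)"
        using AE_unit_ivl_interior by eventually_elim (rule L2_unit_ivlD(2)[OF fx_bound(1)], auto)
    qed measurable
    then have "fx \<in> L2 unit_sq" by (simp add: L2_def unit_sq_borel)
    then have dx: "has_dx f fx" using wd by (simp add: has_dx_def)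
    have "AE t in unit_ivl. H1_norm (\<lambda>x. f (x, t)) \<le> sqrt (M\<^sup>2 + G\<^sup>2)"
      using wd mc(1) AE_unit_ivl_interior
    proof eventually_elim
      case (elim t)
      then have t: "0 \<le> t" "t \<le> 1" by auto
      have "L2_norm (\<lambda>x. f (x, t)) = L2_norm (\<lambda>x. fh (x, t))"
        by (rule L2_norm_cong_AE[OF elim(2)]) (use elim unit_sq_slice[OF L2_unit_sqD(1)[OF f]] in auto)
      then show ?case
        unfolding H1_norm_eq[OF elim(1)] using size[OF t] grad[OF t] by (auto intro!: add_mono power_mono)
    qed
    then show ?thesis using f dx by (auto simp: Linf_H1_def)
  qed
  \<comment> \<open>The witness is the slice of \<open>fh\<close> at time \<open>t\<close>: being
    jointly continuous, \<open>fh\<close> represents \<open>F t\<close> at every single time, not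
    only at almost every one.\<close>
  moreover have "\<exists>g\<in>H1. Hm1_eq (F t) g \<and> L2_norm (wD g) \<le> G \<and> L2_norm g \<le> M" if "t \<in> {0..1}" for t
  proof -
    have t: "0 \<le> t" "t \<le> 1" using that by auto
    note wd = fh_slice_weak_deriv[OF t]
    show ?thesis
      using weak_deriv_H1[OF wd] L2_norm_wD[OF wd] grad[OF t] size[OF t]
        Hm1_version_unique[OF \<open>Hm1_version f F\<close> continuous_fh mc(1) L2_unit_sqD(1)[OF f] that] by auto
  qed
  ultimately show ?thesis by (simp add: G_def M_def N_def d_def)
qed

end
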